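(* Let $k$ be a field, $K$ a flag complex with vertex set $\{1,\ldots,m\}$, $A_1,\ldots,A_m$ connected Hopf algebras over $k$, and $A'=\underline{A}^K\square_{\underline{A}^{\Delta}}k$. Suppose that $A_i$ is of finite type, $i=1,\ldots,m$. For the Euler–Poincaré series we have $$\frac{1}{P(A';t)}=1+\sum_{I\subset\{1,\ldots,m\},\ I\neq\emptyset}\ \sum_{n=1}^{\infty}(-1)^n\dim\widetilde{H}_{n-1}(K_I;k)\prod_{i\in I}P(J(A_i);t)$$ and $$P(\underline{A}^K;t)=P(A';t)\prod_{i=1}^mP(A_i;t).$$
   Context: An abstract simplicial complex $K$ on $\{1,\ldots,m\}$ is a collection of subsets (simplices) closed under subsets, containing $\emptyset$ and all singletons; it is flag if every $\sigma\subset\{1,\ldots,m\}$ with $\{i,j\}\in K$ for all $i,j\in\sigma$ is a simplex of $K$. $K_I=\{\sigma\in K\mid\sigma\subset I\}$ is the full subcomplex on $I$; $\widetilde{H}_*$ is reduced simplicial homology. Connected Hopf algebras over $k$ are non-negatively graded Hopf algebras $A$ with $A_0=k$; $J(A)=\ker(A\to k)$. The polyhedral product $\underline{A}^K$ is the colimit, in connected Hopf algebras over $k$, of $\sigma\mapsto\bigotimes_{i\in\sigma}A_i$ ($\emptyset\mapsto k$) over the poset of simplices of $K$; as an algebra it is the free product of the $A_i$ modulo $a_ia_j=(-1)^{|a_i||a_j|}a_ja_i$ for homogeneous $a_i\in A_i,a_j\in A_j$, $\{i,j\}\in K$. $\Delta$ is the simplex on $\{1,\dots,m\}$, $\underline{A}^{\Delta}=\otimes_{i=1}^mA_i$,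 and $p\colon\underline{A}^K\to\underline{A}^{\Delta}$ is the epimorphism induced by $K\subset\Delta$. The cotensor product $A'=\underline{A}^K\square_{\underline{A}^{\Delta}}k$ consists of those $a\in\underline{A}^K$ with $(\mathrm{id}\otimes p)(\Delta a)=a\otimes1$, $\Delta$ here denoting the comultiplication. A graded vector space $V=\oplus_{n\ge0}V_n$ is of finite type if each $\dim V_n$ is finite, and then $P(V;t)=\sum_{n\ge0}(\dim V_n)t^n$. *)

theory Defs
  imports
    Complex_Main
    "HOL-Library.Function_Algebras"
    "HOL-Computational_Algebra.Formal_Power_Series"
begin

section \<open>Linear algebra\<close>

text \<open>
  Vector spaces are subspaces of an ambient additive group type with a scalar multiplication
  satisfying \<^locale>\<open>vector_space\<close>. On function types into the field both operations are
  pointwise.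
\<close>

definition fscale :: "'k::times \<Rightarrow> ('x \<Rightarrow> 'k) \<Rightarrow> 'x \<Rightarrow> 'k" where
  "fscale c f = (\<lambda>x. c * f x)"

definition linear_on ::
  "('k \<Rightarrow> 'b \<Rightarrow> 'b) \<Rightarrow> ('k \<Rightarrow> 'c \<Rightarrow> 'c) \<Rightarrow> 'b::plus set \<Rightarrow> ('b \<Rightarrow> 'c::plus) \<Rightarrow> bool" where
  "linear_on s1 s2 V f \<longleftrightarrow>
     (\<forall>x\<in>V. \<forall>y\<in>V. f (x + y) = f x + f y) \<and> (\<forall>c. \<forall>x\<in>V. f (s1 c x) = s2 c (f x))"

text \<open>
  The linear map on the span of the \<^term>\<open>e x\<close>, \<^term>\<open>x \<in> X\<close>, that sends every \<^term>\<open>e x\<close> to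
  \<^term>\<open>h x\<close>. It is meaningful if every linear relation between the \<^term>\<open>e x\<close> also holds
  between the \<^term>\<open>h x\<close>.
\<close>

definition lin_ext ::
  "('k \<Rightarrow> 'b \<Rightarrow> 'b) \<Rightarrow> ('k \<Rightarrow> 'c \<Rightarrow> 'c) \<Rightarrow> 'x set \<Rightarrow> ('x \<Rightarrow> 'b::comm_monoid_add) \<Rightarrow>
   ('x \<Rightarrow> 'c::comm_monoid_add) \<Rightarrow> 'b \<Rightarrow> 'c" where
  "lin_ext s1 s2 X e h t =
     (THE y. \<exists>xs. set xs \<subseteq> UNIV \<times> X \<and>
        t = (\<Sum>(c, x)\<leftarrow>xs. s1 c (e x)) \<and> y = (\<Sum>(c, x)\<leftarrow>xs. s2 c (h x)))"

text \<open>
  The class of \<^term>\<open>v\<close> modulo a subspace \<^term>\<open>U\<close>, represented by its values under the linear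
  functionals that vanish on \<^term>\<open>U\<close>. This is a linear map with kernel \<^term>\<open>U\<close>
  (lemmas \<open>quot_class_linear\<close> and \<open>quot_class_eq_iff\<close> below), so the image of a subspace
  \<^term>\<open>Z\<close> containing \<^term>\<open>U\<close> is the quotient of \<^term>\<open>Z\<close> by \<^term>\<open>U\<close>.
\<close>

definition quot_class ::
  "('k::field \<Rightarrow> 'b \<Rightarrow> 'b) \<Rightarrow> 'b set \<Rightarrow> 'b::ab_group_add \<Rightarrow> ('b \<Rightarrow> 'k) \<Rightarrow> 'k" where
  "quot_class s U v =
     (\<lambda>f. if Vector_Spaces.linear s (*) f \<and> (\<forall>u\<in>U. f u = 0) then f v else 0)"

text \<open>
  Over a field, the canonical map from a tensor product to the multilinear forms on the dual
  spaces is injective. Tensor products are taken to be its image: the pure tensor of \<^term>\<open>v\<close> and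
  \<^term>\<open>w\<close> is the form sending \<^term>\<open>(f, g)\<close> to \<^term>\<open>f v * g w\<close>, and the tensor product of two
  subspaces is the span of their pure tensors. The universal property is lemma
  \<open>tensor_universal\<close>, and \<open>mtensor_universal\<close> for finitely many factors.
\<close>

type_synonym ('k, 'a, 'b) tensor = "('a \<Rightarrow> 'k) \<times> ('b \<Rightarrow> 'k) \<Rightarrow> 'k"

definition tensor ::
  "('k::field \<Rightarrow> 'a \<Rightarrow> 'a) \<Rightarrow> ('k \<Rightarrow> 'b \<Rightarrow> 'b) \<Rightarrow> 'a::ab_group_add \<Rightarrow> 'b::ab_group_add \<Rightarrow>
   ('k, 'a, 'b) tensor" where
  "tensor s1 s2 v w =
     (\<lambda>(f, g). if Vector_Spaces.linear s1 (*) f \<and> Vector_Spaces.linear s2 (*) g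
       then f v * g w else 0)"

type_synonym ('k, 'a) mtensor = "(nat \<Rightarrow> 'a \<Rightarrow> 'k) \<Rightarrow> 'k"

definition mtensor ::
  "(nat \<Rightarrow> 'k::field \<Rightarrow> 'a \<Rightarrow> 'a) \<Rightarrow> nat set \<Rightarrow> (nat \<Rightarrow> 'a::ab_group_add) \<Rightarrow> ('k, 'a) mtensor"
  where
  "mtensor s \<sigma> a =
     (\<lambda>f. if \<forall>i\<in>\<sigma>. Vector_Spaces.linear (s i) (*) (f i) then \<Prod>i\<in>\<sigma>. f i (a i) else 0)"

lemma vector_space_fscale: "vector_space (fscale :: 'k::field \<Rightarrow> ('x \<Rightarrow> 'k) \<Rightarrow> 'x \<Rightarrow> 'k)"
  by unfold_locales (auto simp: fscale_def fun_eq_iff algebra_simps)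

lemma vector_space_times: "vector_space ((*) :: 'k::field \<Rightarrow> 'k \<Rightarrow> 'k)"
  by unfold_locales (auto simp: algebra_simps)

lemma vs_linear_add: "Vector_Spaces.linear s1 s2 f \<Longrightarrow> f (x + y) = f x + f y"
  by (simp add: Vector_Spaces.linear_def module_hom_def module_hom_axioms_def)

lemma vs_linear_scale: "Vector_Spaces.linear s1 s2 f \<Longrightarrow> f (s1 c x) = s2 c (f x)"
  by (simp add: Vector_Spaces.linear_def module_hom_def module_hom_axioms_def)

lemma vs_linear_0: "Vector_Spaces.linear s1 s2 f \<Longrightarrow> f 0 = 0"
  by (meson Vector_Spaces.linear_def module_hom.zero)

lemma quot_class_linear:
  assumes "vector_space s"
  shows "Vector_Spaces.linear s fscale (quot_class s U)"
proof -
  have "module s" "module (fscale :: 'a \<Rightarrow> (('b \<Rightarrow> 'a) \<Rightarrow> 'a) \<Rightarrow> _)"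
    using assms vector_space_fscale by (auto simp: module_iff_vector_space)
  moreover have "quot_class s U (x + y) = quot_class s U x + quot_class s U y" for x y
    by (rule ext) (simp add: quot_class_def vs_linear_add[of s "(*)"])
  moreover have "quot_class s U (s c x) = fscale c (quot_class s U x)" for c x
    by (rule ext) (simp add: quot_class_def fscale_def vs_linear_scale[of s "(*)"])
  ultimately show ?thesis
    using assms vector_space_fscale
    unfolding Vector_Spaces.linear_def module_hom_def module_hom_axioms_def by blast
qed

lemma functional_separates:
  fixes s :: "'k::field \<Rightarrow> 'b::ab_group_add \<Rightarrow> 'b"
  assumes s: "vector_space s" and U: "module.subspace s U" and v: "v \<notin> U"
  obtains f where "Vector_Spaces.linear s (*) f" "\<And>u. u \<in> U \<Longrightarrow> f u = 0" "f v = 1"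
proof -
  interpret vector_space s by fact
  interpret vector_space_pair s "(*) :: 'k \<Rightarrow> 'k \<Rightarrow> 'k"
    using s vector_space_times by (simp add: vector_space_pair_def)
  obtain B where B: "B \<subseteq> U" "independent B" "U \<subseteq> span B"
    using maximal_independent_subset by blast
  have "span B = U" using B U by (simp add: span_minimal subset_antisym)
  then have vB: "v \<notin> span B" using v by simp
  then have ind: "independent (insert v B)" using B by (simp add: independent_insert)
  obtain f where f: "Vector_Spaces.linear s (*) f" "\<forall>x\<in>insert v B. f x = (if x = v then 1 else 0)"
    using linear_independent_extend[OF ind, of "\<lambda>x. if x = v then 1 else 0"] by auto
  have "v \<notin> B" using vB span_base by blast
  have "f u = 0" if "u \<in> U" for u
  proof -
    have "u \<in> span B" using that B by auto
    then show ?thesis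
    proof (induct rule: span_induct_alt)
      case base then show ?case using f vs_linear_0 by blast
    next
      case (step c x y)
      have "f x = 0" using f step \<open>v \<notin> B\<close> by auto
      then show ?case using step by (simp add: vs_linear_add[OF f(1)] vs_linear_scale[OF f(1)])
    qed
  qed
  then show thesis using that f by auto
qed

lemma quot_class_eq_iff:
  assumes "vector_space s" "module.subspace s U"
  shows "quot_class s U x = quot_class s U y \<longleftrightarrow> x - y \<in> U"
proof
  assume eq: "quot_class s U x = quot_class s U y"
  show "x - y \<in> U"
  proof (rule ccontr)
    assume "x - y \<notin> U"
    then obtain f where f: "Vector_Spaces.linear s (*) f" "\<And>u. u \<in> U \<Longrightarrow> f u = 0" "f (x - y) = 1"
      using functional_separates assms by metis
    have "f x = f y" using fun_cong[OF eq, of f] f by (auto simp: quot_class_def)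
    moreover have "f x = f (x - y) + f y" using vs_linear_add[OF f(1), of "x - y" y] by simp
    ultimately show False using f by simp
  qed
next
  assume U: "x - y \<in> U"
  have "f x = f y" if "Vector_Spaces.linear s (*) f" "\<forall>u\<in>U. f u = 0" for f
    using vs_linear_add[OF that(1), of "x - y" y] U that(2) by simp
  then show "quot_class s U x = quot_class s U y"
    by (auto simp: quot_class_def fun_eq_iff)
qed

lemma lin_ext_linear:
  fixes s1 :: "'k::field \<Rightarrow> 'b::ab_group_add \<Rightarrow> 'b" and s2 :: "'k \<Rightarrow> 'c::ab_group_add \<Rightarrow> 'c"
  assumes s1: "vector_space s1" and s2: "vector_space s2"
    and rel: "\<And>xs. set xs \<subseteq> UNIV \<times> X \<Longrightarrow> (\<Sum>(c, x)\<leftarrow>xs. s1 c (e x)) = 0 \<Longrightarrow>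
      (\<Sum>(c, x)\<leftarrow>xs. s2 c (h x)) = 0"
  shows "linear_on s1 s2 (module.span s1 (e ` X)) (lin_ext s1 s2 X e h)"
    and "\<And>x. x \<in> X \<Longrightarrow> lin_ext s1 s2 X e h (e x) = h x"
proof -
  interpret s1: vector_space s1 by fact
  interpret s2: vector_space s2 by fact
  define S where "S g xs = (\<Sum>(c, x)\<leftarrow>xs. s1 c (g x))" for g :: "'a \<Rightarrow> 'b" and xs
  define T where "T g xs = (\<Sum>(c, x)\<leftarrow>xs. s2 c (g x))" for g :: "'a \<Rightarrow> 'c" and xs
  define sc where "sc d xs = map (\<lambda>(c, x). (d * c, x :: 'a)) xs" for d :: 'k and xs
  have app: "S g (xs @ ys) = S g xs + S g ys" "T g' (xs @ ys) = T g' xs + T g' ys" for g g' xs ys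
    by (simp_all add: S_def T_def)
  have sc: "S g (sc d xs) = s1 d (S g xs)" "T g' (sc d xs) = s2 d (T g' xs)" for g g' d xs
    by (induction xs) (auto simp: S_def T_def sc_def s1.scale_right_distrib s2.scale_right_distrib)
  have sc_set: "set xs \<subseteq> UNIV \<times> X \<Longrightarrow> set (sc d xs) \<subseteq> UNIV \<times> X" for d xs
    by (force simp: sc_def)
  have val: "lin_ext s1 s2 X e h (S e xs) = T h xs" if xs: "set xs \<subseteq> UNIV \<times> X" for xs
    unfolding lin_ext_def
  proof (rule the_equality)
    show "\<exists>xsa. set xsa \<subseteq> UNIV \<times> X \<and> S e xs = (\<Sum>(c, x)\<leftarrow>xsa. s1 c (e x)) \<and>
        T h xs = (\<Sum>(c, x)\<leftarrow>xsa. s2 c (h x))"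
      using xs by (auto simp: S_def T_def)
  next
    fix y assume "\<exists>ys. set ys \<subseteq> UNIV \<times> X \<and> S e xs = (\<Sum>(c, x)\<leftarrow>ys. s1 c (e x)) \<and>
        y = (\<Sum>(c, x)\<leftarrow>ys. s2 c (h x))"
    then obtain ys where ys: "set ys \<subseteq> UNIV \<times> X" "S e xs = S e ys" "y = T h ys"
      by (auto simp: S_def T_def)
    have "S e (xs @ sc (-1) ys) = 0" using ys by (simp add: app sc)
    moreover have "set (xs @ sc (-1) ys) \<subseteq> UNIV \<times> X" using xs sc_set[OF ys(1)] by simp
    ultimately have "T h (xs @ sc (-1) ys) = 0" using rel unfolding S_def T_def by blast
    then show "y = T h xs" using ys by (simp add: app sc)
  qed
  have span: "\<exists>xs. set xs \<subseteq> UNIV \<times> X \<and> t = S e xs" if "t \<in> s1.span (e ` X)" for t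
    using that
  proof (induct rule: s1.span_induct_alt)
    case base
    have "set [] \<subseteq> UNIV \<times> X \<and> 0 = S e []" by (simp add: S_def)
    then show ?case by blast
  next
    case (step c z y)
    then obtain x xs where "x \<in> X" "z = e x" "set xs \<subseteq> UNIV \<times> X" "y = S e xs" by auto
    then have "set ((c, x) # xs) \<subseteq> UNIV \<times> X \<and> s1 c z + y = S e ((c, x) # xs)"
      by (simp add: S_def)
    then show ?case by blast
  qed
  show "linear_on s1 s2 (s1.span (e ` X)) (lin_ext s1 s2 X e h)"
    unfolding linear_on_def
  proof (intro conjI ballI allI)
    fix t u assume "t \<in> s1.span (e ` X)" "u \<in> s1.span (e ` X)"
    then obtain xs ys where *: "set xs \<subseteq> UNIV \<times> X" "t = S e xs" "set ys \<subseteq> UNIV \<times> X" "u = S e ys"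
      using span by metis
    then have "lin_ext s1 s2 X e h (S e (xs @ ys)) = T h (xs @ ys)" by (intro val) simp
    then show "lin_ext s1 s2 X e h (t + u) = lin_ext s1 s2 X e h t + lin_ext s1 s2 X e h u"
      using * by (simp add: app val)
  next
    fix d t assume "t \<in> s1.span (e ` X)"
    then obtain xs where *: "set xs \<subseteq> UNIV \<times> X" "t = S e xs" using span by metis
    then show "lin_ext s1 s2 X e h (s1 d t) = s2 d (lin_ext s1 s2 X e h t)"
      using val[OF sc_set[OF *(1)], of d] by (simp add: sc val)
  qed
  show "lin_ext s1 s2 X e h (e x) = h x" if "x \<in> X" for x
    using val[of "[(1, x)]"] that by (simp add: S_def T_def)
qed

lemma linear_on_sum_list:
  assumes "module.subspace s V" "vector_space s" "vector_space s'" "linear_on s s' V f"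
    and "\<And>x. x \<in> set xs \<Longrightarrow> g x \<in> V"
  shows "(\<Sum>x\<leftarrow>xs. s (c x) (g x)) \<in> V \<and> f (\<Sum>x\<leftarrow>xs. s (c x) (g x)) = (\<Sum>x\<leftarrow>xs. s' (c x) (f (g x)))"
  using assms(5)
proof (induction xs)
  case Nil
  interpret vector_space s by fact
  interpret s': vector_space s' by fact
  have 0: "0 \<in> V" using assms(1) by (rule subspace_0)
  have "f (s 0 0) = s' 0 (f 0)" using assms(4) 0 by (auto simp only: linear_on_def)
  then show ?case using 0 by simp
next
  case (Cons x xs)
  interpret vector_space s by fact
  have "s (c x) (g x) \<in> V" "f (s (c x) (g x)) = s' (c x) (f (g x))"
    using Cons.prems assms(1,4) subspace_scale by (auto simp: linear_on_def)
  then show ?case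
    using Cons assms(1,4) subspace_add by (auto simp: linear_on_def)
qed

lemma functional_sum_list:
  assumes "Vector_Spaces.linear s (*) f"
  shows "f (\<Sum>x\<leftarrow>xs. s (c x) (g x)) = (\<Sum>x\<leftarrow>xs. c x * f (g x))"
  by (induction xs) (auto simp: vs_linear_0[OF assms] vs_linear_add[OF assms] vs_linear_scale[OF assms])

lemma fscale_sum_list_apply:
  "(\<Sum>x\<leftarrow>xs. fscale (c x) (t x)) y = (\<Sum>x\<leftarrow>xs. c x * t x y)"
  by (induction xs) (auto simp: fscale_def)

lemma sum_list_zero_if_functionals:
  fixes s :: "'k::field \<Rightarrow> 'b::ab_group_add \<Rightarrow> 'b"
  assumes "vector_space s"
    and "\<And>f. Vector_Spaces.linear s (*) f \<Longrightarrow> (\<Sum>x\<leftarrow>xs. c x * f (g x)) = 0"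
  shows "(\<Sum>x\<leftarrow>xs. s (c x) (g x)) = 0"
proof (rule ccontr)
  interpret vector_space s by fact
  assume "(\<Sum>x\<leftarrow>xs. s (c x) (g x)) \<noteq> 0"
  then obtain f where f: "Vector_Spaces.linear s (*) f" "f (\<Sum>x\<leftarrow>xs. s (c x) (g x)) = 1"
    using functional_separates[OF assms(1), of "{0}"] subspace_single_0 by blast
  then show False using assms(2)[OF f(1)] functional_sum_list[OF f(1), of c g xs] by simp
qed

text \<open>Coordinates on a subspace, extended to functionals on the ambient space.\<close>

lemma subspace_coordinates:
  fixes s :: "'k::field \<Rightarrow> 'b::ab_group_add \<Rightarrow> 'b"
  assumes s: "vector_space s" and V: "module.subspace s V" and F: "finite F" "F \<subseteq> V"
  obtains B g where "finite B" "B \<subseteq> V" "\<And>b. Vector_Spaces.linear s (*) (g b)"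
    "\<And>v. v \<in> F \<Longrightarrow> v = (\<Sum>b\<in>B. s (g b v) b)"
proof -
  interpret vector_space s by fact
  interpret vector_space_pair s "(*) :: 'k \<Rightarrow> 'k \<Rightarrow> 'k"
    using s vector_space_times by (simp add: vector_space_pair_def)
  obtain B where B: "B \<subseteq> F" "independent B" "F \<subseteq> span B"
    using maximal_independent_subset by blast
  have fin: "finite B" using B F finite_subset by blast
  have "\<exists>f. Vector_Spaces.linear s (*) f \<and> (\<forall>x\<in>B. f x = (if x = b then 1 else 0))" for b
    using linear_independent_extend[OF B(2), of "\<lambda>x. if x = b then 1 else 0"] by auto
  then obtain g where g: "\<And>b. Vector_Spaces.linear s (*) (g b)"
    "\<And>b x. x \<in> B \<Longrightarrow> g b x = (if x = b then 1 else 0)" by metis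
  have "v = (\<Sum>b\<in>B. s (g b v) b)" if "v \<in> F" for v
  proof -
    have "v \<in> span B" using that B by auto
    then show ?thesis
    proof (induct rule: span_induct_alt)
      case base then show ?case by (simp add: vs_linear_0[OF g(1)])
    next
      case (step c x y)
      have "(\<Sum>b\<in>B. s (g b x) b) = (\<Sum>b\<in>B. if b = x then b else 0)"
        using step by (intro sum.cong) (auto simp: g(2))
      also have "\<dots> = x" using step fin by simp
      finally have x: "(\<Sum>b\<in>B. s (g b x) b) = x" .
      have "(\<Sum>b\<in>B. s (g b (s c x + y)) b) = s c (\<Sum>b\<in>B. s (g b x) b) + (\<Sum>b\<in>B. s (g b y) b)"
        by (simp add: vs_linear_add[OF g(1)] vs_linear_scale[OF g(1)] scale_left_distrib
          sum.distrib scale_sum_right)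
      then show ?case using x step by simp
    qed
  qed
  moreover have "B \<subseteq> V" using B F by auto
  ultimately show thesis using that fin g(1) by blast
qed

lemma sum_list_sum_swap: "(\<Sum>x\<leftarrow>xs. \<Sum>b\<in>B. k x b) = (\<Sum>b\<in>B. \<Sum>x\<leftarrow>xs. k x b :: 'c::comm_monoid_add)"
  by (induction xs) (auto simp: sum.distrib)

lemma linear_on_sum:
  assumes "module.subspace s V" "vector_space s" "vector_space s'" "linear_on s s' V f"
    "finite B" "B \<subseteq> V"
  shows "f (\<Sum>b\<in>B. s (c b) b) = (\<Sum>b\<in>B. s' (c b) (f b))"
proof -
  obtain xs where "set xs = B" "distinct xs" using finite_distinct_list[OF assms(5)] by blast
  then show ?thesis
    using linear_on_sum_list[OF assms(1-4), of xs "\<lambda>x. x" c] assms(6)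
    by (auto simp: sum_list_distinct_conv_sum_set)
qed

lemma mtensor_relation:
  fixes s :: "nat \<Rightarrow> 'k::field \<Rightarrow> 'a::ab_group_add \<Rightarrow> 'a"
    and s3 :: "'k \<Rightarrow> 'c::ab_group_add \<Rightarrow> 'c"
  assumes "finite \<sigma>" and s3: "vector_space s3"
    and "\<And>i. i \<in> \<sigma> \<Longrightarrow> vector_space (s i) \<and> module.subspace (s i) (V i)"
    and "\<And>i a. i \<in> \<sigma> \<Longrightarrow> (\<forall>j\<in>\<sigma>. a j \<in> V j) \<Longrightarrow> linear_on (s i) s3 (V i) (\<lambda>x. h (a(i := x)))"
    and "\<And>a b. (\<forall>i\<in>\<sigma>. a i = b i) \<Longrightarrow> h a = h b"
    and "\<And>x. x \<in> set xs \<Longrightarrow> \<forall>i\<in>\<sigma>. a x i \<in> V i"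
    and "(\<Sum>x\<leftarrow>xs. fscale (c x) (mtensor s \<sigma> (a x))) = 0"
  shows "(\<Sum>x\<leftarrow>xs. s3 (c x) (h (a x))) = 0"
  using assms(1,3-7)
proof (induction \<sigma> arbitrary: h c rule: finite_induct)
  case empty
  interpret vector_space s3 by fact
  have "h b = h (\<lambda>_. 0)" for b by (rule empty.prems) simp
  then have "(\<Sum>x\<leftarrow>xs. s3 (c x) (h (a x))) = s3 (\<Sum>x\<leftarrow>xs. c x) (h (\<lambda>_. 0))"
    by (induction xs) (auto simp: scale_left_distrib)
  moreover have "(\<Sum>x\<leftarrow>xs. c x) = 0"
    using fun_cong[OF empty.prems(5), of "\<lambda>_ _. 0"]
    by (simp add: fscale_sum_list_apply mtensor_def)
  ultimately show ?case by simp
next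
  case (insert i \<sigma>)
  interpret vector_space s3 by fact
  have si: "vector_space (s i)" "module.subspace (s i) (V i)" using insert.prems(1) by auto
  obtain B g where B: "finite B" "B \<subseteq> V i" "\<And>b. Vector_Spaces.linear (s i) (*) (g b)"
    "\<And>v. v \<in> (\<lambda>x. a x i) ` set xs \<Longrightarrow> v = (\<Sum>b\<in>B. s i (g b v) b)"
  proof (rule subspace_coordinates[OF si, of "(\<lambda>x. a x i) ` set xs"])
    show "(\<lambda>x. a x i) ` set xs \<subseteq> V i" using insert.prems(4) by auto
  qed (use that in auto)
  have "(\<Sum>x\<leftarrow>xs. s3 (c x * g b (a x i)) (h ((a x)(i := b)))) = 0" if b: "b \<in> B" for b
  proof (rule insert.IH)
    show "vector_space (s j) \<and> module.subspace (s j) (V j)" if "j \<in> \<sigma>" for j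
      using that insert.prems by auto
    show "linear_on (s j) s3 (V j) (\<lambda>x. h ((a'(j := x))(i := b)))"
      if "j \<in> \<sigma>" "\<forall>j\<in>\<sigma>. a' j \<in> V j" for j a'
    proof -
      have "j \<noteq> i" using that insert.hyps by auto
      then have "(a'(j := x))(i := b) = (a'(i := b))(j := x)" for x by auto
      moreover have "\<forall>k\<in>insert i \<sigma>. (a'(i := b)) k \<in> V k" using that b B(2) by auto
      ultimately show ?thesis
        using insert.prems(2)[OF insertI2[OF that(1)], of "a'(i := b)"] by (simp only:)
    qed
    show "h (a'(i := b)) = h (b'(i := b))" if "\<forall>i\<in>\<sigma>. a' i = b' i" for a' b'
      using that by (intro insert.prems(3)) auto
    show "\<forall>i\<in>\<sigma>. a x i \<in> V i" if "x \<in> set xs" for x using insert.prems(4) that by auto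
    show "(\<Sum>x\<leftarrow>xs. fscale (c x * g b (a x i)) (mtensor s \<sigma> (a x))) = 0"
    proof
      fix f
      show "(\<Sum>x\<leftarrow>xs. fscale (c x * g b (a x i)) (mtensor s \<sigma> (a x))) f = 0 f"
      proof (cases "\<forall>j\<in>\<sigma>. Vector_Spaces.linear (s j) (*) (f j)")
        case True
        have eq: "mtensor s (insert i \<sigma>) (a x) (f(i := g b)) = g b (a x i) * mtensor s \<sigma> (a x) f" for x
        proof -
          have "(\<Prod>j\<in>\<sigma>. (f(i := g b)) j (a x j)) = (\<Prod>j\<in>\<sigma>. f j (a x j))"
            using insert.hyps by (intro prod.cong) auto
          moreover have "\<forall>j\<in>insert i \<sigma>. Vector_Spaces.linear (s j) (*) ((f(i := g b)) j)"
            using True B(3) by auto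
          ultimately show ?thesis using True insert.hyps unfolding mtensor_def by simp
        qed
        show ?thesis
          using fun_cong[OF insert.prems(5), of "f(i := g b)"]
          by (simp add: fscale_sum_list_apply eq mult.assoc del: fun_upd_apply)
      next
        case False
        then have "mtensor s \<sigma> (a x) f = 0" for x by (auto simp: mtensor_def)
        then show ?thesis by (simp add: fscale_sum_list_apply)
      qed
    qed
  qed
  then have "(\<Sum>b\<in>B. \<Sum>x\<leftarrow>xs. s3 (c x * g b (a x i)) (h ((a x)(i := b)))) = 0" by simp
  moreover have "h (a x) = (\<Sum>b\<in>B. s3 (g b (a x i)) (h ((a x)(i := b))))" if x: "x \<in> set xs" for x
  proof -
    have "linear_on (s i) s3 (V i) (\<lambda>y. h ((a x)(i := y)))"
      by (rule insert.prems(2)[OF insertI1 insert.prems(4)[OF x]])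
    from linear_on_sum[OF si(2,1) s3 this B(1,2), of "\<lambda>b. g b (a x i)"]
    show ?thesis using B(4)[of "a x i"] x by simp
  qed
  then have "(\<Sum>x\<leftarrow>xs. s3 (c x) (h (a x))) =
      (\<Sum>x\<leftarrow>xs. \<Sum>b\<in>B. s3 (c x * g b (a x i)) (h ((a x)(i := b))))"
    by (intro arg_cong[where f = sum_list] map_cong) (auto simp: scale_sum_right)
  ultimately show ?case by (simp add: sum_list_sum_swap)
qed

lemma tensor_relation:
  fixes s1 :: "'k::field \<Rightarrow> 'a::ab_group_add \<Rightarrow> 'a" and s2 :: "'k \<Rightarrow> 'b::ab_group_add \<Rightarrow> 'b"
    and s3 :: "'k \<Rightarrow> 'c::ab_group_add \<Rightarrow> 'c"
  assumes s: "vector_space s1" "vector_space s2" "vector_space s3"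
    and V: "module.subspace s1 V" "module.subspace s2 W"
    and h: "\<And>v. v \<in> V \<Longrightarrow> linear_on s2 s3 W (h v)"
      "\<And>w. w \<in> W \<Longrightarrow> linear_on s1 s3 V (\<lambda>v. h v w)"
    and xs: "\<And>x. x \<in> set xs \<Longrightarrow> v x \<in> V \<and> w x \<in> W"
    and rel: "(\<Sum>x\<leftarrow>xs. fscale (c x) (tensor s1 s2 (v x) (w x))) = 0"
  shows "(\<Sum>x\<leftarrow>xs. s3 (c x) (h (v x) (w x))) = 0"
proof -
  interpret vector_space s3 by fact
  interpret s1: vector_space s1 by fact
  obtain B g where B: "finite B" "B \<subseteq> W" "\<And>b. Vector_Spaces.linear s2 (*) (g b)"
    "\<And>y. y \<in> w ` set xs \<Longrightarrow> y = (\<Sum>b\<in>B. s2 (g b y) b)"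
  proof (rule subspace_coordinates[OF s(2) V(2), of "w ` set xs"])
    show "w ` set xs \<subseteq> W" using xs by auto
  qed (use that in auto)
  have "(\<Sum>x\<leftarrow>xs. s3 (c x * g b (w x)) (h (v x) b)) = 0" if "b \<in> B" for b
  proof -
    have "(\<Sum>x\<leftarrow>xs. s1 (c x * g b (w x)) (v x)) = 0"
    proof (rule sum_list_zero_if_functionals[OF s(1)])
      fix f assume f: "Vector_Spaces.linear s1 (*) f"
      show "(\<Sum>x\<leftarrow>xs. c x * g b (w x) * f (v x)) = 0"
        using fun_cong[OF rel, of "(f, g b)"] f B(3)
        by (simp add: fscale_sum_list_apply tensor_def mult_ac)
    qed
    moreover have "h 0 b = 0"
    proof -
      have "h (s1 0 0) b = s3 0 (h 0 b)"
        using h(2)[of b] that B(2) s1.subspace_0[OF V(1)] by (auto simp only: linear_on_def)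
      then show ?thesis by simp
    qed
    ultimately show ?thesis
      using linear_on_sum_list[OF V(1) s(1,3) h(2), of b xs v "\<lambda>x. c x * g b (w x)"] xs that B(2)
      by auto
  qed
  then have "(\<Sum>b\<in>B. \<Sum>x\<leftarrow>xs. s3 (c x * g b (w x)) (h (v x) b)) = 0" by simp
  moreover have "h (v x) (w x) = (\<Sum>b\<in>B. s3 (g b (w x)) (h (v x) b))" if x: "x \<in> set xs" for x
    using linear_on_sum[OF V(2) s(2,3) h(1) B(1,2), of "v x" "\<lambda>b. g b (w x)"] xs[OF x] B(4)[of "w x"] x
    by simp
  then have "(\<Sum>x\<leftarrow>xs. s3 (c x) (h (v x) (w x))) =
      (\<Sum>x\<leftarrow>xs. \<Sum>b\<in>B. s3 (c x * g b (w x)) (h (v x) b))"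
    by (intro arg_cong[where f = sum_list] map_cong) (auto simp: scale_sum_right)
  ultimately show ?thesis by (simp add: sum_list_sum_swap)
qed

lemma tensor_bilinear:
  "linear_on s1 fscale UNIV (\<lambda>v. tensor s1 s2 v w)"
  "linear_on s2 fscale UNIV (\<lambda>w. tensor s1 s2 v w)"
  by (simp_all add: linear_on_def tensor_def fscale_def fun_eq_iff algebra_simps
    vs_linear_add[of s1 "(*)"] vs_linear_scale[of s1 "(*)"]
    vs_linear_add[of s2 "(*)"] vs_linear_scale[of s2 "(*)"])

lemma mtensor_multilinear:
  assumes "finite \<sigma>" "i \<in> \<sigma>"
  shows "linear_on (s i) fscale UNIV (\<lambda>x. mtensor s \<sigma> (a(i := x)))"
proof -
  have "mtensor s \<sigma> (a(i := x)) = (\<lambda>f. if \<forall>j\<in>\<sigma>. Vector_Spaces.linear (s j) (*) (f j)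
      then f i x * (\<Prod>j\<in>\<sigma> - {i}. f j (a j)) else 0)" for x
    using assms by (auto simp: mtensor_def fun_eq_iff prod.remove[of \<sigma> i])
  then show ?thesis
    using assms(2)
    by (simp add: linear_on_def fscale_def fun_eq_iff algebra_simps
      vs_linear_add[of "s i" "(*)"] vs_linear_scale[of "s i" "(*)"])
qed

lemma tensor_universal:
  fixes s1 :: "'k::field \<Rightarrow> 'a::ab_group_add \<Rightarrow> 'a" and s2 :: "'k \<Rightarrow> 'b::ab_group_add \<Rightarrow> 'b"
    and s3 :: "'k \<Rightarrow> 'c::ab_group_add \<Rightarrow> 'c"
  assumes "vector_space s1" "vector_space s2" "vector_space s3"
    and "module.subspace s1 V" "module.subspace s2 W"
    and "\<And>v. v \<in> V \<Longrightarrow> linear_on s2 s3 W (h v)"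
      "\<And>w. w \<in> W \<Longrightarrow> linear_on s1 s3 V (\<lambda>v. h v w)"
  defines "e \<equiv> \<lambda>(v, w). tensor s1 s2 v w"
    and "H \<equiv> lin_ext fscale s3 (V \<times> W) (\<lambda>(v, w). tensor s1 s2 v w) (\<lambda>(v, w). h v w)"
  shows "linear_on fscale s3 (module.span fscale (e ` (V \<times> W))) H"
    and "\<And>v w. v \<in> V \<Longrightarrow> w \<in> W \<Longrightarrow> H (tensor s1 s2 v w) = h v w"
proof -
  have rel: "(\<Sum>(c, x)\<leftarrow>xs. s3 c ((\<lambda>(v, w). h v w) x)) = 0"
    if "set xs \<subseteq> UNIV \<times> (V \<times> W)" "(\<Sum>(c, x)\<leftarrow>xs. fscale c ((\<lambda>(v, w). tensor s1 s2 v w) x)) = 0" for xs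
    using tensor_relation[OF assms(1-7), of xs "\<lambda>(c, v, w). v" "\<lambda>(c, v, w). w" "\<lambda>(c, v, w). c"] that
    by (force simp: case_prod_unfold)
  show "linear_on fscale s3 (module.span fscale (e ` (V \<times> W))) H"
    unfolding e_def H_def by (rule lin_ext_linear(1)[OF vector_space_fscale assms(3) rel])
  show "H (tensor s1 s2 v w) = h v w" if "v \<in> V" "w \<in> W" for v w
    using lin_ext_linear(2)[OF vector_space_fscale assms(3), where x = "(v, w)" and X = "V \<times> W"
        and e = "\<lambda>(v, w). tensor s1 s2 v w" and h = "\<lambda>(v, w). h v w", OF rel] that
    by (simp add: H_def)
qed

lemma mtensor_universal:
  fixes s :: "nat \<Rightarrow> 'k::field \<Rightarrow> 'a::ab_group_add \<Rightarrow> 'a"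
    and s3 :: "'k \<Rightarrow> 'c::ab_group_add \<Rightarrow> 'c"
  assumes "finite \<sigma>" "vector_space s3"
    and "\<And>i. i \<in> \<sigma> \<Longrightarrow> vector_space (s i) \<and> module.subspace (s i) (V i)"
    and "\<And>i a. i \<in> \<sigma> \<Longrightarrow> (\<forall>j\<in>\<sigma>. a j \<in> V j) \<Longrightarrow> linear_on (s i) s3 (V i) (\<lambda>x. h (a(i := x)))"
    and "\<And>a b. (\<forall>i\<in>\<sigma>. a i = b i) \<Longrightarrow> h a = h b"
  defines "X \<equiv> {a. \<forall>i\<in>\<sigma>. a i \<in> V i}"
  defines "H \<equiv> lin_ext fscale s3 X (mtensor s \<sigma>) h"
  shows "linear_on fscale s3 (module.span fscale (mtensor s \<sigma> ` X)) H"
    and "\<And>a. a \<in> X \<Longrightarrow> H (mtensor s \<sigma> a) = h a"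
proof -
  have rel: "(\<Sum>(c, x)\<leftarrow>xs. s3 c (h x)) = 0"
    if "set xs \<subseteq> UNIV \<times> X" "(\<Sum>(c, x)\<leftarrow>xs. fscale c (mtensor s \<sigma> x)) = 0" for xs
  proof -
    have mem: "\<forall>i\<in>\<sigma>. snd y i \<in> V i" if "y \<in> set xs" for y
      using \<open>set xs \<subseteq> UNIV \<times> X\<close> that by (cases y) (auto simp: X_def)
    have zero: "(\<Sum>y\<leftarrow>xs. fscale (fst y) (mtensor s \<sigma> (snd y))) = 0"
      using that(2) unfolding case_prod_unfold .
    have "(\<Sum>y\<leftarrow>xs. s3 (fst y) (h (snd y))) = 0"
      by (rule mtensor_relation[where s = s and V = V and h = h and a = snd and c = fst])
        (fact assms mem zero)+
    then show ?thesis unfolding case_prod_unfold .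
  qed
  show "linear_on fscale s3 (module.span fscale (mtensor s \<sigma> ` X)) H"
    unfolding H_def by (rule lin_ext_linear(1)[OF vector_space_fscale assms(2) rel])
  show "H (mtensor s \<sigma> a) = h a" if "a \<in> X" for a
    unfolding H_def by (rule lin_ext_linear(2)[OF vector_space_fscale assms(2) rel that])
qed


section \<open>Graded vector spaces\<close>

definition graded_space :: "('k::field \<Rightarrow> 'a \<Rightarrow> 'a) \<Rightarrow> (nat \<Rightarrow> 'a::ab_group_add set) \<Rightarrow> bool" where
  "graded_space s V \<longleftrightarrow>
     vector_space s \<and> (\<forall>n. module.subspace s (V n)) \<and>
     (\<forall>N v. (\<forall>n\<le>N. v n \<in> V n) \<and> (\<Sum>n\<le>N. v n) = 0 \<longrightarrow> (\<forall>n\<le>N. v n = 0))"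

definition finite_type :: "('k::field \<Rightarrow> 'a \<Rightarrow> 'a) \<Rightarrow> (nat \<Rightarrow> 'a::ab_group_add set) \<Rightarrow> bool" where
  "finite_type s V \<longleftrightarrow> (\<forall>n. \<exists>B. finite B \<and> V n \<subseteq> module.span s B)"

definition poincare_series ::
  "('k::field \<Rightarrow> 'a \<Rightarrow> 'a) \<Rightarrow> (nat \<Rightarrow> 'a::ab_group_add set) \<Rightarrow> rat fps" where
  "poincare_series s V = Abs_fps (\<lambda>n. of_nat (vector_space.dim s (V n)))"


section \<open>Connected Hopf algebras\<close>

text \<open>
  The algebra is \<^term>\<open>hcarrier A\<close>, the sum of the subspaces \<^term>\<open>gr A n\<close>; the values of the
  operations outside it are irrelevant.
\<close>

record ('k, 'a) hopf =
  scl :: "'k \<Rightarrow> 'a \<Rightarrow> 'a"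
  gr :: "nat \<Rightarrow> 'a set"
  mult :: "'a \<Rightarrow> 'a \<Rightarrow> 'a"
  unit :: "'a"
  comult :: "'a \<Rightarrow> ('k, 'a, 'a) tensor"
  counit :: "'a \<Rightarrow> 'k"

definition hcarrier :: "('k::field, 'a::ab_group_add) hopf \<Rightarrow> 'a set" where
  "hcarrier A = module.span (scl A) (\<Union>n. gr A n)"

definition homog :: "('k, 'a) hopf \<Rightarrow> (nat \<times> 'a) set" where
  "homog A = {(n, a). a \<in> gr A n}"

definition ten ::
  "('k::field, 'a::ab_group_add) hopf \<Rightarrow> ('k, 'b::ab_group_add) hopf \<Rightarrow> 'a \<Rightarrow> 'b \<Rightarrow>
   ('k, 'a, 'b) tensor" where
  "ten A B = tensor (scl A) (scl B)"

text \<open>The product \<open>(a \<otimes> b)(c \<otimes> d) = (-1)^(|b||c|) ac \<otimes> bd\<close> on the tensor square.\<close>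

definition tensor_mult ::
  "('k::field, 'a::ab_group_add) hopf \<Rightarrow> ('k, 'a, 'a) tensor \<Rightarrow> ('k, 'a, 'a) tensor \<Rightarrow>
   ('k, 'a, 'a) tensor" where
  "tensor_mult A t u =
     lin_ext fscale fscale (homog A \<times> homog A) (\<lambda>((_, a), (_, b)). ten A A a b)
       (\<lambda>((_, a), (q, b)).
          lin_ext fscale fscale (homog A \<times> homog A) (\<lambda>((_, c), (_, d)). ten A A c d)
            (\<lambda>((r, c), (_, d)). fscale ((-1) ^ (q * r)) (ten A A (mult A a c) (mult A b d))) u) t"

text \<open>\<open>f \<otimes> g\<close> on the tensor product of the subspaces \<^term>\<open>V\<close> and \<^term>\<open>W\<close>.\<close>

definition tensor_map ::
  "('k::field \<Rightarrow> 'a \<Rightarrow> 'a) \<Rightarrow> ('k \<Rightarrow> 'b \<Rightarrow> 'b) \<Rightarrow> ('k \<Rightarrow> 'c \<Rightarrow> 'c) \<Rightarrow> ('k \<Rightarrow> 'd \<Rightarrow> 'd) \<Rightarrow>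
   'a::ab_group_add set \<Rightarrow> 'b::ab_group_add set \<Rightarrow>
   ('a \<Rightarrow> 'c::ab_group_add) \<Rightarrow> ('b \<Rightarrow> 'd::ab_group_add) \<Rightarrow>
   ('k, 'a, 'b) tensor \<Rightarrow> ('k, 'c, 'd) tensor" where
  "tensor_map s1 s2 s3 s4 V W f g =
     lin_ext fscale fscale (V \<times> W) (\<lambda>(v, w). tensor s1 s2 v w) (\<lambda>(v, w). tensor s3 s4 (f v) (g w))"

definition graded_algebra :: "('k::field, 'a::ab_group_add) hopf \<Rightarrow> bool" where
  "graded_algebra A \<longleftrightarrow>
     graded_space (scl A) (gr A) \<and>
     (\<forall>i j. \<forall>a\<in>gr A i. \<forall>b\<in>gr A j. mult A a b \<in> gr A (i + j)) \<and>
     (\<forall>a\<in>hcarrier A. linear_on (scl A) (scl A) (hcarrier A) (mult A a)) \<and>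
     (\<forall>b\<in>hcarrier A. linear_on (scl A) (scl A) (hcarrier A) (\<lambda>a. mult A a b)) \<and>
     (\<forall>a\<in>hcarrier A. \<forall>b\<in>hcarrier A. \<forall>c\<in>hcarrier A.
        mult A (mult A a b) c = mult A a (mult A b c)) \<and>
     unit A \<in> gr A 0 \<and>
     (\<forall>a\<in>hcarrier A. mult A (unit A) a = a \<and> mult A a (unit A) = a)"

definition graded_coalgebra :: "('k::field, 'a::ab_group_add) hopf \<Rightarrow> bool" where
  "graded_coalgebra A \<longleftrightarrow>
     (let s = scl A; C = hcarrier A in
      graded_space s (gr A) \<and>
      linear_on s fscale C (comult A) \<and>
      linear_on s (*) C (counit A) \<and>
      (\<forall>n. \<forall>a\<in>gr A n.
         comult A a \<in> module.span fscale {ten A A b c |i j b c. i + j = n \<and> b \<in> gr A i \<and> c \<in> gr A j}) \<and>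
      (\<forall>n>0. \<forall>a\<in>gr A n. counit A a = 0) \<and>
      (\<forall>a\<in>C.
         lin_ext fscale fscale (C \<times> C \<times> C)
           (\<lambda>(x, y, z). tensor fscale s (ten A A x y) z) (\<lambda>(x, y, z). tensor s fscale x (ten A A y z))
           (tensor_map s s fscale s C C (comult A) id (comult A a)) =
         tensor_map s s s fscale C C id (comult A) (comult A a)) \<and>
      (\<forall>a\<in>C.
         lin_ext fscale s (C \<times> C) (\<lambda>(x, y). ten A A x y) (\<lambda>(x, y). s (counit A x) y) (comult A a) = a \<and>
         lin_ext fscale s (C \<times> C) (\<lambda>(x, y). ten A A x y) (\<lambda>(x, y). s (counit A y) x) (comult A a) = a))"

text \<open>
  Hopf algebras are graded in the sense of Milnor and Moore. There is no antipode among the data: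
  as the degree-zero part is the ground field, it exists, is unique, and is preserved by all
  morphisms.
\<close>

definition connected_hopf :: "('k::field, 'a::ab_group_add) hopf \<Rightarrow> bool" where
  "connected_hopf A \<longleftrightarrow>
     graded_algebra A \<and> graded_coalgebra A \<and>
     comult A (unit A) = ten A A (unit A) (unit A) \<and>
     (\<forall>a\<in>hcarrier A. \<forall>b\<in>hcarrier A.
        comult A (mult A a b) = tensor_mult A (comult A a) (comult A b)) \<and>
     counit A (unit A) = 1 \<and>
     (\<forall>a\<in>hcarrier A. \<forall>b\<in>hcarrier A. counit A (mult A a b) = counit A a * counit A b) \<and>
     gr A 0 = range (\<lambda>c. scl A c (unit A))"

definition hopf_hom ::
  "('k::field, 'a::ab_group_add) hopf \<Rightarrow> ('k, 'b::ab_group_add) hopf \<Rightarrow> ('a \<Rightarrow> 'b) \<Rightarrow> bool" where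
  "hopf_hom A B f \<longleftrightarrow>
     linear_on (scl A) (scl B) (hcarrier A) f \<and>
     (\<forall>n. f ` gr A n \<subseteq> gr B n) \<and>
     f (unit A) = unit B \<and>
     (\<forall>a\<in>hcarrier A. \<forall>b\<in>hcarrier A. f (mult A a b) = mult B (f a) (f b)) \<and>
     (\<forall>a\<in>hcarrier A. counit B (f a) = counit A a) \<and>
     (\<forall>a\<in>hcarrier A. comult B (f a) =
        tensor_map (scl A) (scl A) (scl B) (scl B) (hcarrier A) (hcarrier A) f f (comult A a))"

definition aug_ideal :: "('k::zero, 'a) hopf \<Rightarrow> nat \<Rightarrow> 'a set" where
  "aug_ideal A n = {a \<in> gr A n. counit A a = 0}"


section \<open>Tensor products of Hopf algebras over a finite set of indices\<close>

definition homog_family :: "(nat \<Rightarrow> ('k, 'a) hopf) \<Rightarrow> nat set \<Rightarrow> ((nat \<Rightarrow> nat) \<times> (nat \<Rightarrow> 'a)) set" where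
  "homog_family A \<sigma> = {(d, a). \<forall>i\<in>\<sigma>. a i \<in> gr (A i) (d i)}"

text \<open>
  The Koszul sign for moving \<open>x\<^sub>i\<close> past \<open>y\<^sub>j\<close> for all \<open>j < i\<close>, where \<open>x\<^sub>i\<close> and \<open>y\<^sub>j\<close> have degrees
  \<^term>\<open>d i\<close> and \<^term>\<open>e j\<close>. The product needs it for the passage from
  \<open>x\<^sub>1 x\<^sub>2 \<dots> y\<^sub>1 y\<^sub>2 \<dots>\<close> to \<open>x\<^sub>1 y\<^sub>1 x\<^sub>2 y\<^sub>2 \<dots>\<close>, the coproduct for the reverse passage.
\<close>

definition koszul_sign :: "nat set \<Rightarrow> (nat \<Rightarrow> nat) \<Rightarrow> (nat \<Rightarrow> nat) \<Rightarrow> 'k::field" where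
  "koszul_sign \<sigma> d e = (-1) ^ (\<Sum>i\<in>\<sigma>. \<Sum>j\<in>{j\<in>\<sigma>. j < i}. d i * e j)"

definition mten ::
  "(nat \<Rightarrow> ('k::field, 'a::ab_group_add) hopf) \<Rightarrow> nat set \<Rightarrow> (nat \<Rightarrow> 'a) \<Rightarrow> ('k, 'a) mtensor" where
  "mten A = mtensor (\<lambda>i. scl (A i))"

definition mten_mult ::
  "(nat \<Rightarrow> ('k::field, 'a::ab_group_add) hopf) \<Rightarrow> nat set \<Rightarrow>
   ('k, 'a) mtensor \<Rightarrow> ('k, 'a) mtensor \<Rightarrow> ('k, 'a) mtensor" where
  "mten_mult A \<sigma> t u =
     lin_ext fscale fscale (homog_family A \<sigma>) (\<lambda>(d, a). mten A \<sigma> a)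
       (\<lambda>(d, a). lin_ext fscale fscale (homog_family A \<sigma>) (\<lambda>(e, b). mten A \<sigma> b)
          (\<lambda>(e, b). fscale (koszul_sign \<sigma> d e) (mten A \<sigma> (\<lambda>i. mult (A i) (a i) (b i)))) u) t"

text \<open>\<open>(a\<^sub>1 \<otimes> b\<^sub>1) \<otimes> \<dots> \<otimes> (a\<^sub>r \<otimes> b\<^sub>r) \<mapsto> \<plusminus> (a\<^sub>1 \<otimes> \<dots> \<otimes> a\<^sub>r) \<otimes> (b\<^sub>1 \<otimes> \<dots> \<otimes> b\<^sub>r)\<close>\<close>

definition shuffle ::
  "(nat \<Rightarrow> ('k::field, 'a::ab_group_add) hopf) \<Rightarrow> nat set \<Rightarrow>
   ('k, ('k, 'a, 'a) tensor) mtensor \<Rightarrow> ('k, ('k, 'a) mtensor, ('k, 'a) mtensor) tensor" where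
  "shuffle A \<sigma> =
     lin_ext fscale fscale (homog_family A \<sigma> \<times> homog_family A \<sigma>)
       (\<lambda>((d, a), (e, b)). mtensor (\<lambda>_. fscale) \<sigma> (\<lambda>i. ten (A i) (A i) (a i) (b i)))
       (\<lambda>((d, a), (e, b)).
          fscale (koszul_sign \<sigma> d e) (tensor fscale fscale (mten A \<sigma> a) (mten A \<sigma> b)))"

definition hopf_tensor ::
  "(nat \<Rightarrow> ('k::field, 'a::ab_group_add) hopf) \<Rightarrow> nat set \<Rightarrow> ('k, ('k, 'a) mtensor) hopf" where
  "hopf_tensor A \<sigma> =
     \<lparr>scl = fscale,
      gr = (\<lambda>n. module.span fscale {mten A \<sigma> a |d a. (d, a) \<in> homog_family A \<sigma> \<and> (\<Sum>i\<in>\<sigma>. d i) = n}),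
      mult = mten_mult A \<sigma>,
      unit = mten A \<sigma> (\<lambda>i. unit (A i)),
      comult = lin_ext fscale fscale (homog_family A \<sigma>) (\<lambda>(d, a). mten A \<sigma> a)
        (\<lambda>(d, a). shuffle A \<sigma> (mtensor (\<lambda>_. fscale) \<sigma> (\<lambda>i. comult (A i) (a i)))),
      counit = lin_ext fscale (*) (homog_family A \<sigma>) (\<lambda>(d, a). mten A \<sigma> a)
        (\<lambda>(d, a). \<Prod>i\<in>\<sigma>. counit (A i) (a i))\<rparr>"

text \<open>The inclusion for \<^term>\<open>\<sigma> \<subseteq> \<tau>\<close>, putting the unit at the indices outside \<^term>\<open>\<sigma>\<close>.\<close>

definition hopf_incl ::
  "(nat \<Rightarrow> ('k::field, 'a::ab_group_add) hopf) \<Rightarrow> nat set \<Rightarrow> nat set \<Rightarrow>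
   ('k, 'a) mtensor \<Rightarrow> ('k, 'a) mtensor" where
  "hopf_incl A \<sigma> \<tau> =
     lin_ext fscale fscale (homog_family A \<sigma>) (\<lambda>(d, a). mten A \<sigma> a)
       (\<lambda>(d, a). mten A \<tau> (\<lambda>i. if i \<in> \<sigma> then a i else unit (A i)))"


section \<open>Simplicial complexes and reduced homology\<close>

definition simplicial_complex :: "nat \<Rightarrow> nat set set \<Rightarrow> bool" where
  "simplicial_complex m K \<longleftrightarrow>
     K \<subseteq> Pow {1..m} \<and> (\<forall>\<sigma>\<in>K. \<forall>\<tau>. \<tau> \<subseteq> \<sigma> \<longrightarrow> \<tau> \<in> K) \<and> {} \<in> K \<and> (\<forall>i\<in>{1..m}. {i} \<in> K)"

definition flag_complex :: "nat \<Rightarrow> nat set set \<Rightarrow> bool" where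
  "flag_complex m K \<longleftrightarrow>
     simplicial_complex m K \<and>
     (\<forall>\<sigma>. \<sigma> \<subseteq> {1..m} \<and> (\<forall>i\<in>\<sigma>. \<forall>j\<in>\<sigma>. {i, j} \<in> K) \<longrightarrow> \<sigma> \<in> K)"

definition full_subcomplex :: "nat set set \<Rightarrow> nat set \<Rightarrow> nat set set" where
  "full_subcomplex K I = {\<sigma> \<in> K. \<sigma> \<subseteq> I}"

text \<open>
  Chains are coefficient functions; a simplex with \<^term>\<open>q + 1\<close> vertices has dimension \<^term>\<open>q\<close>.
  As the empty simplex belongs to \<^term>\<open>K\<close>, the boundary on vertices is the augmentation, and the
  homology below is reduced.
\<close>

definition chains :: "nat set set \<Rightarrow> nat \<Rightarrow> (nat set \<Rightarrow> 'k::field) set" where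
  "chains K q = {c. \<forall>\<sigma>. c \<sigma> \<noteq> 0 \<longrightarrow> \<sigma> \<in> K \<and> card \<sigma> = q + 1}"

definition boundary :: "nat set set \<Rightarrow> (nat set \<Rightarrow> 'k::field) \<Rightarrow> nat set \<Rightarrow> 'k" where
  "boundary K c =
     (\<lambda>\<tau>. \<Sum>\<sigma>\<in>K. \<Sum>i\<in>\<sigma>. if \<sigma> - {i} = \<tau> then (-1) ^ card {j\<in>\<sigma>. j < i} * c \<sigma> else 0)"

definition reduced_homology ::
  "nat set set \<Rightarrow> nat \<Rightarrow> (((nat set \<Rightarrow> 'k::field) \<Rightarrow> 'k) \<Rightarrow> 'k) set" where
  "reduced_homology K q =
     quot_class fscale (boundary K ` chains K (q + 1)) ` {c \<in> chains K q. boundary K c = 0}"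

definition reduced_homology_dim :: "'k::field itself \<Rightarrow> nat set set \<Rightarrow> nat \<Rightarrow> nat" where
  "reduced_homology_dim _ K q =
     vector_space.dim fscale (reduced_homology K q :: (((nat set \<Rightarrow> 'k) \<Rightarrow> 'k) \<Rightarrow> 'k) set)"


section \<open>Polyhedral products and cotensor products\<close>

definition polyhedral_cocone ::
  "nat set set \<Rightarrow> (nat \<Rightarrow> ('k::field, 'a::ab_group_add) hopf) \<Rightarrow> ('k, 'h::ab_group_add) hopf \<Rightarrow>
   (nat set \<Rightarrow> ('k, 'a) mtensor \<Rightarrow> 'h) \<Rightarrow> bool" where
  "polyhedral_cocone K A B \<psi> \<longleftrightarrow>
     (\<forall>\<sigma>\<in>K. hopf_hom (hopf_tensor A \<sigma>) B (\<psi> \<sigma>)) \<and>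
     (\<forall>\<sigma>\<in>K. \<forall>\<tau>\<in>K. \<sigma> \<subseteq> \<tau> \<longrightarrow>
        (\<forall>x\<in>hcarrier (hopf_tensor A \<sigma>). \<psi> \<tau> (hopf_incl A \<sigma> \<tau> x) = \<psi> \<sigma> x))"

text \<open>
  HOL does not allow quantification over types within a formula, so the colimit is formed among
  the connected Hopf algebras with elements in the following fixed type. This is no restriction:
  a connected Hopf algebra that receives a cocone and is generated by its images is spanned by
  products of words of elements of the \<^term>\<open>A i\<close>, hence is isomorphic to one on a subspace of
  this type. In particular the type contains a copy of the colimit over all connected Hopf
  algebras.
\<close>

type_synonym ('k, 'a) word_space = "(nat \<times> 'a) list \<Rightarrow> 'k"

definition is_polyhedral_product ::
  "nat set set \<Rightarrow> (nat \<Rightarrow> ('k::field, 'a::ab_group_add) hopf) \<Rightarrow>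
   ('k, ('k, 'a) word_space) hopf \<Rightarrow>
   (nat set \<Rightarrow> ('k, 'a) mtensor \<Rightarrow> ('k, 'a) word_space) \<Rightarrow> bool" where
  "is_polyhedral_product K A H \<phi> \<longleftrightarrow>
     connected_hopf H \<and> polyhedral_cocone K A H \<phi> \<and>
     (\<forall>(B :: ('k, ('k, 'a) word_space) hopf) \<psi>.
        connected_hopf B \<and> polyhedral_cocone K A B \<psi> \<longrightarrow>
        (\<exists>u. hopf_hom H B u \<and> (\<forall>\<sigma>\<in>K. \<forall>x\<in>hcarrier (hopf_tensor A \<sigma>). u (\<phi> \<sigma> x) = \<psi> \<sigma> x) \<and>
           (\<forall>v. hopf_hom H B v \<and>
              (\<forall>\<sigma>\<in>K. \<forall>x\<in>hcarrier (hopf_tensor A \<sigma>). v (\<phi> \<sigma> x) = \<psi> \<sigma> x) \<longrightarrow>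
              (\<forall>h\<in>hcarrier H. v h = u h))))"

text \<open>The map induced on polyhedral products by the inclusion of \<^term>\<open>K\<close> into the full simplex.\<close>

definition is_induced_projection ::
  "nat \<Rightarrow> nat set set \<Rightarrow> (nat \<Rightarrow> ('k::field, 'a::ab_group_add) hopf) \<Rightarrow> ('k, 'h::ab_group_add) hopf \<Rightarrow>
   (nat set \<Rightarrow> ('k, 'a) mtensor \<Rightarrow> 'h) \<Rightarrow> ('h \<Rightarrow> ('k, 'a) mtensor) \<Rightarrow> bool" where
  "is_induced_projection m K A H \<phi> p \<longleftrightarrow>
     hopf_hom H (hopf_tensor A {1..m}) p \<and>
     (\<forall>\<sigma>\<in>K. \<forall>x\<in>hcarrier (hopf_tensor A \<sigma>). p (\<phi> \<sigma> x) = hopf_incl A \<sigma> {1..m} x)"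

definition cotensor ::
  "('k::field, 'h::ab_group_add) hopf \<Rightarrow> ('k, 'd::ab_group_add) hopf \<Rightarrow> ('h \<Rightarrow> 'd) \<Rightarrow> 'h set" where
  "cotensor H D p =
     {a \<in> hcarrier H.
        tensor_map (scl H) (scl H) (scl H) (scl D) (hcarrier H) (hcarrier H) id p (comult H a) =
        ten H D a (unit D)}"

definition cotensor_gr ::
  "('k::field, 'h::ab_group_add) hopf \<Rightarrow> ('k, 'd::ab_group_add) hopf \<Rightarrow> ('h \<Rightarrow> 'd) \<Rightarrow> nat \<Rightarrow> 'h set"
  where
  "cotensor_gr H D p n = cotensor H D p \<inter> gr H n"

end

theory Submission
  imports Defs "HOL-Library.Multiset"
begin

text \<open>
  The polyhedral product is a graph product: \<open>K\<close> enters only through its edges, and as \<open>K\<close> is flag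
  its simplices are the cliques. Choose in every \<open>A i\<close> a homogeneous basis that contains the unit.
  The graph product has a basis of reduced traces, that is, of words in the other basis elements, up
  to exchanging adjacent letters whose indices form an edge, in which no two letters with the same
  index can be brought next to each other. Linear independence needs no study of rewriting. Each
  \<open>A i\<close> acts on the free vector space on the reduced traces by multiplication into the initial letter
  with index \<open>i\<close>, and these actions satisfy the defining relations (\<open>L_mult\<close>, \<open>L_commute\<close>).
  Conversely the reduced traces act on everything on which the \<open>A i\<close> act subject to the relations.
  This makes the free vector space an algebra with the universal property of the graph product
  (\<open>alg_hom_M0_exists\<close>, \<open>alg_hom_M0_eqI\<close>), which provides the comultiplication and the counit and
  reduces the Hopf algebra axioms to those of the \<open>A i\<close> (\<open>connected_hopf_M\<close>). The result contains
  the tensor products over the simplices (\<open>psi_inj\<close>, \<open>hopf_hom_psi\<close>), and it is their colimit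
  (\<open>polyhedral_product_iso\<close>).

  For the second formula let \<open>q\<close> be a surjection of connected Hopf algebras from \<open>H\<close> onto \<open>E\<close>. As in
  the theorem of Milnor and Moore, \<open>H\<close> is a free left module over the cotensor product, with basis any
  lift of a homogeneous basis of \<open>E\<close>. To see this, let \<open>Tb b h\<close> be the coefficient of the basis
  element \<open>b\<close> in the coaction \<open>(id \<otimes> q) (\<Delta> h)\<close>. The cotensor product consists of the elements whose
  coefficients vanish for all \<open>b \<noteq> 1\<close> (\<open>cotensor_iff\<close>), the maps \<open>Tb b\<close> are linear over it (\<open>Tb_mult\<close>),
  and the coefficients of highest degree lie in it (\<open>Tb_Tb\<close>). Splitting off these coefficients
  expands every element uniquely (\<open>span_products\<close>, \<open>dim_products\<close>).

  For the first formula let \<open>J i\<close> be the series of the augmentation ideal of \<open>A i\<close>, so that \<open>A i\<close>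
  has the series \<open>1 + J i\<close>, and let \<open>G\<close> be the series that counts the reduced traces. The indices of
  the initial letters of a trace form a simplex. The traces for which this simplex contains \<open>\<sigma>\<close> have
  the series \<open>G * (\<Prod>i\<in>\<sigma>. J i / (1 + J i))\<close> (\<open>gfs_Tsub\<close>). Only the empty trace has no initial letter,
  so the alternating sum of these series over all \<open>\<sigma>\<close> in \<open>K\<close> is \<open>1\<close> (\<open>alternating_gfs\<close>). Multiplied by
  all \<open>1 + J i\<close> and expanded, this says that \<open>\<Prod>i. 1 + J i\<close> is the product of \<open>G\<close> with the sum over
  all sets \<open>I\<close> of vertices of \<open>(\<Sum>\<sigma>\<in>K\<^sub>I. (-1) ^ card \<sigma>) * (\<Prod>i\<in>I. J i)\<close> (\<open>poincare_M_eq\<close>). By the second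
  formula the left hand side is \<open>G\<close> divided by the series of the cotensor product, so the sum over \<open>I\<close>
  is the reciprocal of that series. Its inner sums are, up to sign, reduced Euler characteristics, and
  hence alternating sums of dimensions of reduced homology (\<open>euler_characteristic\<close>).
\<close>



section \<open>Linear maps on subspaces\<close>

lemma vs_module: "vector_space s \<Longrightarrow> module s"
  by (simp add: module_iff_vector_space)

lemma linear_on_add: "linear_on s1 s2 V f \<Longrightarrow> x \<in> V \<Longrightarrow> y \<in> V \<Longrightarrow> f (x + y) = f x + f y"
  by (simp add: linear_on_def)

lemma linear_on_scale: "linear_on s1 s2 V f \<Longrightarrow> x \<in> V \<Longrightarrow> f (s1 c x) = s2 c (f x)"
  by (simp add: linear_on_def)

lemma linear_on_zero:
  assumes "linear_on s1 s2 V f" "vector_space s1" "vector_space s2" "0 \<in> V"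
  shows "f 0 = 0"
proof -
  interpret a: vector_space s1 by fact
  interpret b: vector_space s2 by fact
  show ?thesis using linear_on_scale[OF assms(1,4), of 0] by simp
qed

lemma linear_on_diff:
  fixes f :: "'a::ab_group_add \<Rightarrow> 'b::ab_group_add"
  assumes "linear_on s1 s2 V f" "vector_space s1" "vector_space s2" "module.subspace s1 V"
    "x \<in> V" "y \<in> V"
  shows "f (x - y) = f x - f y"
proof -
  interpret a: vector_space s1 by fact
  interpret b: vector_space s2 by fact
  have "f (x + s1 (-1) y) = f x + s2 (-1) (f y)"
    using assms(1) a.subspace_scale[OF assms(4,6)] assms(5,6) by (simp only: linear_on_def)
  then show ?thesis by simp
qed

lemma linear_on_subset: "linear_on s1 s2 V f \<Longrightarrow> W \<subseteq> V \<Longrightarrow> linear_on s1 s2 W f"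
  by (auto simp: linear_on_def subset_iff)

lemma linear_on_cong:
  assumes "linear_on s1 s2 V f" "\<And>x. x \<in> V \<Longrightarrow> g x = f x" "vector_space s1" "module.subspace s1 V"
  shows "linear_on s1 s2 V g"
proof -
  interpret vector_space s1 by fact
  have "x + y \<in> V" "s1 c x \<in> V" if "x \<in> V" "y \<in> V" for x y c
    using that subspace_add[OF assms(4)] subspace_scale[OF assms(4)] by auto
  then show ?thesis using assms(1,2) by (auto simp: linear_on_def)
qed

lemma linear_on_comp:
  assumes "linear_on s1 s2 V f" "linear_on s2 s3 W g" "f ` V \<subseteq> W"
  shows "linear_on s1 s3 V (\<lambda>x. g (f x))"
  using assms by (auto simp: linear_on_def image_subset_iff)

lemma linear_on_ident: "linear_on s s V (\<lambda>x. x)" "linear_on s s V id"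
  by (simp_all add: linear_on_def)

lemma linear_on_scale_map:
  assumes "vector_space s" shows "linear_on s s V (s c)"
proof -
  interpret vector_space s by fact
  show ?thesis by (simp add: linear_on_def scale_right_distrib mult.commute)
qed

lemma linear_on_null: "vector_space s2 \<Longrightarrow> linear_on s1 s2 V (\<lambda>x. 0)"
  by (simp add: linear_on_def module.scale_zero_right[OF vs_module])

lemma linear_on_plus:
  assumes "linear_on s1 s2 V f" "linear_on s1 s2 V g" "vector_space s2"
  shows "linear_on s1 s2 V (\<lambda>x. f x + (g x :: 'b::ab_group_add))"
proof -
  interpret vector_space s2 by fact
  show ?thesis using assms by (simp add: linear_on_def scale_right_distrib algebra_simps)
qed

lemma linear_on_scaled:
  assumes "linear_on s1 s2 V f" "vector_space s2"
  shows "linear_on s1 s2 V (\<lambda>x. s2 c (f x))"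
  using linear_on_comp[OF assms(1) linear_on_scale_map[OF assms(2)]] by blast

lemma linear_on_sum_maps:
  assumes "\<And>i. i \<in> I \<Longrightarrow> linear_on s1 s2 V (f i)" "vector_space s2"
  shows "linear_on s1 s2 V (\<lambda>x. \<Sum>i\<in>I. f i x :: 'b::ab_group_add)"
  using assms(1)
proof (induction I rule: infinite_finite_induct)
  case (insert i I) then show ?case using assms(2) by (simp add: linear_on_plus)
qed (use assms(2) linear_on_null in auto)

lemma linear_on_eq_on_span:
  assumes f: "linear_on s1 s2 (module.span s1 S) f" and g: "linear_on s1 s2 (module.span s1 S) g"
    and s: "vector_space s1" "vector_space s2" and eq: "\<And>x. x \<in> S \<Longrightarrow> f x = g x"
    and x: "x \<in> module.span s1 S"
  shows "f x = g x"
proof -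
  interpret vector_space s1 by fact
  have "x \<in> span S \<and> f x = g x" using x
  proof (induct rule: span_induct_alt)
    case base then show ?case using linear_on_zero[OF f s] linear_on_zero[OF g s] span_zero by simp
  next
    case (step c x y)
    then have "x \<in> span S" using span_base by blast
    then show ?case using step eq f g span_scale span_add by (simp add: linear_on_def)
  qed
  then show ?thesis ..
qed

lemma linear_on_image_span:
  assumes f: "linear_on s1 s2 (module.span s1 S) f" and s: "vector_space s1" "vector_space s2"
    and im: "\<And>x. x \<in> S \<Longrightarrow> f x \<in> W" and W: "module.subspace s2 W"
    and x: "x \<in> module.span s1 S"
  shows "f x \<in> W"
proof -
  interpret vector_space s1 by fact
  interpret b: vector_space s2 by fact
  have "x \<in> span S \<and> f x \<in> W" using x
  proof (induct rule: span_induct_alt)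
    case base then show ?case using linear_on_zero[OF f s] span_zero b.subspace_0[OF W] by simp
  next
    case (step c x y)
    then have "x \<in> span S" using span_base by blast
    then show ?case
      using step im f span_scale span_add b.subspace_add[OF W] b.subspace_scale[OF W]
      by (simp add: linear_on_def)
  qed
  then show ?thesis ..
qed

lemma linear_on_into_preimage:
  assumes "linear_on s1 s2 V f" "vector_space s1" "vector_space s2" "module.subspace s1 V"
    "module.subspace s2 W"
  shows "module.subspace s1 {x \<in> V. f x \<in> W}"
proof -
  interpret a: vector_space s1 by fact
  interpret b: vector_space s2 by fact
  have "f 0 = 0" using linear_on_zero[OF assms(1-3)] a.subspace_0[OF assms(4)] by blast
  then show ?thesis
    using assms a.subspace_0 a.subspace_add a.subspace_scale b.subspace_0 b.subspace_add b.subspace_scale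
    unfolding a.subspace_def by (auto simp: linear_on_def)
qed

lemma linear_on_image_subspace:
  assumes "linear_on s1 s2 V f" "vector_space s1" "vector_space s2" "module.subspace s1 V"
  shows "module.subspace s2 (f ` V)"
proof -
  interpret a: vector_space s1 by fact
  interpret b: vector_space s2 by fact
  have z: "f 0 = 0" "0 \<in> V" using linear_on_zero[OF assms(1-3)] a.subspace_0[OF assms(4)] by blast+
  show ?thesis unfolding b.subspace_def
  proof (intro conjI ballI allI)
    show "0 \<in> f ` V" using z by force
  next
    fix x y assume "x \<in> f ` V" "y \<in> f ` V"
    then obtain u v where "u \<in> V" "v \<in> V" "x = f u" "y = f v" by auto
    moreover then have "x + y = f (u + v)" "u + v \<in> V"
      using assms a.subspace_add by (auto simp: linear_on_def)
    ultimately show "x + y \<in> f ` V" by blast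
  next
    fix c x assume "x \<in> f ` V"
    then obtain u where "u \<in> V" "x = f u" by auto
    moreover then have "s2 c x = f (s1 c u)" "s1 c u \<in> V"
      using assms a.subspace_scale by (auto simp: linear_on_def)
    ultimately show "s2 c x \<in> f ` V" by blast
  qed
qed

lemma linear_on_inv_into:
  assumes "linear_on s1 s2 V f" "inj_on f V" "vector_space s1" "module.subspace s1 V"
  shows "linear_on s2 s1 (f ` V) (the_inv_into V f)"
proof -
  interpret a: vector_space s1 by fact
  have "the_inv_into V f (f u) = u" if "u \<in> V" for u using assms(2) that by (simp add: the_inv_into_f_f)
  moreover have "f u + f v = f (u + v)" "u + v \<in> V" "s2 c (f u) = f (s1 c u)" "s1 c u \<in> V"
    if "u \<in> V" "v \<in> V" for u v c
    using assms a.subspace_add a.subspace_scale that by (auto simp: linear_on_def)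
  ultimately show ?thesis unfolding linear_on_def by auto
qed

lemma linear_on_from_span_image:
  assumes "linear_on s1 s2 (module.span s1 S) f" "vector_space s1" "vector_space s2"
  shows "f ` module.span s1 S = module.span s2 (f ` S)"
proof -
  interpret a: vector_space s1 by fact
  interpret b: vector_space s2 by fact
  have "f x \<in> b.span (f ` S)" if "x \<in> a.span S" for x
    by (rule linear_on_image_span[OF assms _ _ that]) (auto intro: b.span_base)
  moreover have "b.subspace (f ` a.span S)"
    by (rule linear_on_image_subspace[OF assms]) simp
  then have "b.span (f ` S) \<subseteq> f ` a.span S"
    by (rule b.span_minimal[rotated]) (auto intro: a.span_base)
  ultimately show ?thesis by blast
qed

text \<open>To compute a \<^const>\<open>lin_ext\<close> it suffices to exhibit some linear map with the prescribed
  values: its existence also proves that the prescribed values are consistent.\<close>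

lemma lin_ext_eqI:
  fixes s1 :: "'k::field \<Rightarrow> 'b::ab_group_add \<Rightarrow> 'b" and s2 :: "'k \<Rightarrow> 'c::ab_group_add \<Rightarrow> 'c"
  assumes s: "vector_space s1" "vector_space s2"
    and G: "linear_on s1 s2 (module.span s1 (e ` X)) G"
    and eq: "\<And>x. x \<in> X \<Longrightarrow> G (e x) = h x"
    and t: "t \<in> module.span s1 (e ` X)"
  shows "lin_ext s1 s2 X e h t = G t"
proof -
  interpret a: vector_space s1 by fact
  interpret b: vector_space s2 by fact
  have rel: "(\<Sum>(c, x)\<leftarrow>xs. s2 c (h x)) = 0"
    if xs: "set xs \<subseteq> UNIV \<times> X" and z: "(\<Sum>(c, x)\<leftarrow>xs. s1 c (e x)) = 0" for xs
  proof -
    have "snd y \<in> X" if "y \<in> set xs" for y using xs that by (cases y) auto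
    then have "(\<Sum>y\<leftarrow>xs. s1 (fst y) (e (snd y))) \<in> a.span (e ` X) \<and>
      G (\<Sum>y\<leftarrow>xs. s1 (fst y) (e (snd y))) = (\<Sum>y\<leftarrow>xs. s2 (fst y) (G (e (snd y))))"
      by (intro linear_on_sum_list[OF _ s G]) (auto intro: a.span_base)
    moreover have "(\<Sum>y\<leftarrow>xs. s2 (fst y) (G (e (snd y)))) = (\<Sum>y\<leftarrow>xs. s2 (fst y) (h (snd y)))"
      using \<open>\<And>y. y \<in> set xs \<Longrightarrow> snd y \<in> X\<close> eq by (intro arg_cong[where f = sum_list] map_cong) auto
    moreover have "G 0 = 0" using linear_on_zero[OF G s] a.span_zero by blast
    ultimately show ?thesis using z by (simp add: case_prod_unfold)
  qed
  note L = lin_ext_linear[where X = X and e = e and h = h, OF s rel]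
  show ?thesis
    by (rule linear_on_eq_on_span[OF L(1) G s _ t]) (auto simp: L(2) eq)
qed


section \<open>Tensor products of two subspaces\<close>

definition tspan ::
  "('k::field \<Rightarrow> 'a \<Rightarrow> 'a) \<Rightarrow> ('k \<Rightarrow> 'b \<Rightarrow> 'b) \<Rightarrow> 'a::ab_group_add set \<Rightarrow> 'b::ab_group_add set \<Rightarrow>
   ('k, 'a, 'b) tensor set" where
  "tspan s1 s2 V W = module.span fscale ((\<lambda>(v, w). tensor s1 s2 v w) ` (V \<times> W))"

interpretation fs: vector_space "fscale :: 'k::field \<Rightarrow> ('x \<Rightarrow> 'k) \<Rightarrow> 'x \<Rightarrow> 'k"
  by (rule vector_space_fscale)

lemma tspan_base: "v \<in> V \<Longrightarrow> w \<in> W \<Longrightarrow> tensor s1 s2 v w \<in> tspan s1 s2 V W"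
  unfolding tspan_def by (rule fs.span_base) auto

lemma subspace_tspan: "module.subspace fscale (tspan s1 s2 V W)"
  by (simp add: tspan_def)

lemma tensor_lin1: "linear_on s1 fscale V (\<lambda>v. tensor s1 s2 v w)"
  and tensor_lin2: "linear_on s2 fscale W (\<lambda>w. tensor s1 s2 v w)"
  by (auto intro: linear_on_subset[OF tensor_bilinear(1)] linear_on_subset[OF tensor_bilinear(2)])

lemma tspan_span:
  assumes s: "vector_space s1" "vector_space s2"
  shows "tspan s1 s2 (module.span s1 S) (module.span s2 S') =
    module.span fscale ((\<lambda>(v, w). tensor s1 s2 v w) ` (S \<times> S'))" (is "?L = ?R")
proof
  interpret a: vector_space s1 by fact
  interpret b: vector_space s2 by fact
  have 1: "tensor s1 s2 v w \<in> ?R" if "v \<in> a.span S" "w \<in> S'" for v w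
    by (rule linear_on_image_span[OF tensor_lin1 s(1) vector_space_fscale _ _ that(1)])
      (use that in \<open>auto intro: fs.span_base\<close>)
  have "tensor s1 s2 v w \<in> ?R" if "v \<in> a.span S" "w \<in> b.span S'" for v w
    by (rule linear_on_image_span[OF tensor_lin2 s(2) vector_space_fscale _ _ that(2)])
      (use 1 that in auto)
  then show "?L \<subseteq> ?R" unfolding tspan_def by (intro fs.span_minimal) auto
  show "?R \<subseteq> ?L" unfolding tspan_def
    by (intro fs.span_mono) (auto intro: a.span_base b.span_base)
qed

lemma tensor_lift:
  fixes s3 :: "'k::field \<Rightarrow> 'c::ab_group_add \<Rightarrow> 'c"
  assumes "vector_space s1" "vector_space s2" "vector_space s3"
    and "module.subspace s1 V" "module.subspace s2 W"
    and "\<And>v. v \<in> V \<Longrightarrow> linear_on s2 s3 W (h v)"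
      "\<And>w. w \<in> W \<Longrightarrow> linear_on s1 s3 V (\<lambda>v. h v w)"
  obtains H where "linear_on fscale s3 (tspan s1 s2 V W) H"
    "\<And>v w. v \<in> V \<Longrightarrow> w \<in> W \<Longrightarrow> H (tensor s1 s2 v w) = h v w"
  using tensor_universal[OF assms] unfolding tspan_def by blast

lemma tensor_map_linear:
  assumes s: "vector_space s1" "vector_space s2" "vector_space s3" "vector_space s4"
    and V: "module.subspace s1 V" "module.subspace s2 W"
    and f: "linear_on s1 s3 V f" and g: "linear_on s2 s4 W g"
  shows "linear_on fscale fscale (tspan s1 s2 V W) (tensor_map s1 s2 s3 s4 V W f g)"
    and "\<And>v w. v \<in> V \<Longrightarrow> w \<in> W \<Longrightarrow>
      tensor_map s1 s2 s3 s4 V W f g (tensor s1 s2 v w) = tensor s3 s4 (f v) (g w)"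
proof -
  have 1: "linear_on s2 fscale W (\<lambda>w. tensor s3 s4 (f v) (g w))" for v
    by (rule linear_on_comp[OF g tensor_lin2[where W = UNIV]]) auto
  have 2: "linear_on s1 fscale V (\<lambda>v. tensor s3 s4 (f v) (g w))" for w
    by (rule linear_on_comp[OF f tensor_lin1[where V = UNIV]]) auto
  note * = tensor_universal[where h = "\<lambda>v w. tensor s3 s4 (f v) (g w)",
      OF s(1,2) vector_space_fscale V 1 2]
  show "linear_on fscale fscale (tspan s1 s2 V W) (tensor_map s1 s2 s3 s4 V W f g)"
    using *(1) unfolding tspan_def tensor_map_def by simp
  show "tensor_map s1 s2 s3 s4 V W f g (tensor s1 s2 v w) = tensor s3 s4 (f v) (g w)"
    if "v \<in> V" "w \<in> W" for v w
    using *(2)[OF that] unfolding tensor_map_def by simp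
qed

lemma tspan_eqI:
  assumes "linear_on fscale s3 (tspan s1 s2 V W) F" "linear_on fscale s3 (tspan s1 s2 V W) G"
    and "vector_space s3"
    and "\<And>v w. v \<in> V \<Longrightarrow> w \<in> W \<Longrightarrow> F (tensor s1 s2 v w) = G (tensor s1 s2 v w)"
    and "t \<in> tspan s1 s2 V W"
  shows "F t = G t"
  by (rule linear_on_eq_on_span[OF assms(1,2)[unfolded tspan_def] vector_space_fscale assms(3) _
      assms(5)[unfolded tspan_def]]) (use assms(4) in auto)

lemma tspan_image:
  assumes "linear_on fscale s3 (tspan s1 s2 V W) F" "vector_space s3" "module.subspace s3 U"
    and "\<And>v w. v \<in> V \<Longrightarrow> w \<in> W \<Longrightarrow> F (tensor s1 s2 v w) \<in> U" "t \<in> tspan s1 s2 V W"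
  shows "F t \<in> U"
  by (rule linear_on_image_span[OF assms(1)[unfolded tspan_def] vector_space_fscale assms(2) _ assms(3)
      assms(5)[unfolded tspan_def]]) (use assms(4) in auto)

lemma tensor_map_into:
  assumes s: "vector_space s1" "vector_space s2" "vector_space s3" "vector_space s4"
    and V: "module.subspace s1 V" "module.subspace s2 W"
    and f: "linear_on s1 s3 V f" "f ` V \<subseteq> V'" and g: "linear_on s2 s4 W g" "g ` W \<subseteq> W'"
    and t: "t \<in> tspan s1 s2 V W"
  shows "tensor_map s1 s2 s3 s4 V W f g t \<in> tspan s3 s4 V' W'"
  by (rule tspan_image[OF tensor_map_linear(1)[OF s V f(1) g(1)] vector_space_fscale subspace_tspan _ t])
    (use f g in \<open>auto simp: tensor_map_linear(2)[OF s V f(1) g(1)] intro!: tspan_base\<close>)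

lemma tensor_map_comp:
  assumes s: "vector_space s1" "vector_space s2" "vector_space s3" "vector_space s4"
      "vector_space s5" "vector_space s6"
    and V: "module.subspace s1 V" "module.subspace s2 W" "module.subspace s3 V'" "module.subspace s4 W'"
    and f: "linear_on s1 s3 V f" "f ` V \<subseteq> V'" and g: "linear_on s2 s4 W g" "g ` W \<subseteq> W'"
    and f': "linear_on s3 s5 V' f'" and g': "linear_on s4 s6 W' g'"
    and t: "t \<in> tspan s1 s2 V W"
  shows "tensor_map s3 s4 s5 s6 V' W' f' g' (tensor_map s1 s2 s3 s4 V W f g t) =
    tensor_map s1 s2 s5 s6 V W (\<lambda>x. f' (f x)) (\<lambda>x. g' (g x)) t"
proof (rule tspan_eqI[OF _ _ vector_space_fscale _ t])
  note a = tensor_map_linear[OF s(1-4) V(1,2) f(1) g(1)]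
  note b = tensor_map_linear[OF s(3-6) V(3,4) f' g']
  note c = tensor_map_linear[OF s(1,2,5,6) V(1,2) linear_on_comp[OF f(1) f' f(2)]
      linear_on_comp[OF g(1) g' g(2)]]
  show "linear_on fscale fscale (tspan s1 s2 V W)
      (\<lambda>t. tensor_map s3 s4 s5 s6 V' W' f' g' (tensor_map s1 s2 s3 s4 V W f g t))"
    by (rule linear_on_comp[OF a(1) b(1)])
      (use tensor_map_into[OF s(1-4) V(1,2) f g] in blast)
  show "linear_on fscale fscale (tspan s1 s2 V W)
    (tensor_map s1 s2 s5 s6 V W (\<lambda>x. f' (f x)) (\<lambda>x. g' (g x)))" by (rule c(1))
  fix v w assume "v \<in> V" "w \<in> W"
  then show "tensor_map s3 s4 s5 s6 V' W' f' g' (tensor_map s1 s2 s3 s4 V W f g (tensor s1 s2 v w)) =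
    tensor_map s1 s2 s5 s6 V W (\<lambda>x. f' (f x)) (\<lambda>x. g' (g x)) (tensor s1 s2 v w)"
    using f g by (simp add: a(2) c(2)) (subst b(2), auto)
qed

lemma tensor_map_cong:
  assumes s: "vector_space s1" "vector_space s2" "vector_space s3" "vector_space s4"
    and V: "module.subspace s1 V" "module.subspace s2 W"
    and f: "linear_on s1 s3 V f" "\<And>x. x \<in> V \<Longrightarrow> f' x = f x"
    and g: "linear_on s2 s4 W g" "\<And>x. x \<in> W \<Longrightarrow> g' x = g x"
    and t: "t \<in> tspan s1 s2 V W"
  shows "tensor_map s1 s2 s3 s4 V W f' g' t = tensor_map s1 s2 s3 s4 V W f g t"
proof -
  have f': "linear_on s1 s3 V f'" by (rule linear_on_cong[OF f s(1) V(1)])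
  have g': "linear_on s2 s4 W g'" by (rule linear_on_cong[OF g s(2) V(2)])
  note a = tensor_map_linear[OF s V f(1) g(1)]
  note b = tensor_map_linear[OF s V f' g']
  show ?thesis
    by (rule tspan_eqI[OF b(1) a(1) vector_space_fscale _ t]) (simp add: a(2) b(2) f(2) g(2))
qed

lemma tensor_map_inj:
  assumes s: "vector_space s1" "vector_space s2" "vector_space s3" "vector_space s4"
    and V: "module.subspace s1 V" "module.subspace s2 W"
    and f: "linear_on s1 s3 V f" "inj_on f V" and g: "linear_on s2 s4 W g" "inj_on g W"
  shows "inj_on (tensor_map s1 s2 s3 s4 V W f g) (tspan s1 s2 V W)"
proof (rule inj_on_inverseI)
  fix t assume t: "t \<in> tspan s1 s2 V W"
  let ?f = "the_inv_into V f" and ?g = "the_inv_into W g"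
  have i: "linear_on s3 s1 (f ` V) ?f" "linear_on s4 s2 (g ` W) ?g"
    by (rule linear_on_inv_into[OF f s(1) V(1)] linear_on_inv_into[OF g s(2) V(2)])+
  have im: "module.subspace s3 (f ` V)" "module.subspace s4 (g ` W)"
    by (rule linear_on_image_subspace[OF f(1) s(1,3) V(1)] linear_on_image_subspace[OF g(1) s(2,4) V(2)])+
  have "tensor_map s3 s4 s1 s2 (f ` V) (g ` W) ?f ?g (tensor_map s1 s2 s3 s4 V W f g t) =
    tensor_map s1 s2 s1 s2 V W (\<lambda>x. ?f (f x)) (\<lambda>x. ?g (g x)) t"
    by (rule tensor_map_comp[OF s s(1,2) V im f(1) _ g(1) _ i t]) auto
  also have "\<dots> = tensor_map s1 s2 s1 s2 V W (\<lambda>x. x) (\<lambda>x. x) t"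
    by (rule tensor_map_cong[OF s(1,2,1,2) V linear_on_ident(1) _ linear_on_ident(1) _ t])
      (use f(2) g(2) in \<open>auto simp: the_inv_into_f_f\<close>)
  also have "\<dots> = t"
    by (rule tspan_eqI[OF tensor_map_linear(1)[OF s(1,2,1,2) V linear_on_ident(1) linear_on_ident(1)]
          linear_on_ident(1) vector_space_fscale _ t])
      (simp add: tensor_map_linear(2)[OF s(1,2,1,2) V linear_on_ident(1) linear_on_ident(1)])
  finally show "tensor_map s3 s4 s1 s2 (f ` V) (g ` W) ?f ?g (tensor_map s1 s2 s3 s4 V W f g t) = t" .
qed


section \<open>Tensor products of graded algebras\<close>

text \<open>Homogeneous components are unique, so maps on the summands may be prescribed independently.\<close>

lemma graded_lift:
  fixes s :: "'k::field \<Rightarrow> 'a::ab_group_add \<Rightarrow> 'a" and s2 :: "'k \<Rightarrow> 'c::ab_group_add \<Rightarrow> 'c"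
  assumes V: "graded_space s V" and s2: "vector_space s2"
    and g: "\<And>n. linear_on s s2 (V n) (g n)"
  obtains G where "linear_on s s2 (module.span s (\<Union>n. V n)) G" "\<And>n a. a \<in> V n \<Longrightarrow> G a = g n a"
proof -
  have s: "vector_space s" and sub: "\<And>n. module.subspace s (V n)"
    and dir: "\<And>N v. (\<forall>n\<le>N. v n \<in> V n) \<and> (\<Sum>n\<le>N. v n) = 0 \<longrightarrow> (\<forall>n\<le>N. v n = 0)"
    using V unfolding graded_space_def by blast+
  interpret a: vector_space s by fact
  interpret b: vector_space s2 by fact
  let ?X = "{(n, a). a \<in> V n}"
  define v where "v xs n = (\<Sum>(c, k, a)\<leftarrow>xs. if k = n then s c a else 0)" for xs :: "('k \<times> nat \<times> 'a) list" and n
  define w where "w xs n = (\<Sum>(c, k, a)\<leftarrow>xs. if k = n then s2 c (g k a) else 0)" for xs :: "('k \<times> nat \<times> 'a) list" and n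
  have vw: "v xs n \<in> V n \<and> g n (v xs n) = w xs n" if "set xs \<subseteq> UNIV \<times> ?X" for xs n
    using that
  proof (induction xs)
    case Nil
    have "0 \<in> V n" "g n 0 = 0"
      using a.subspace_0[OF sub] linear_on_zero[OF g s s2 a.subspace_0[OF sub]] by auto
    then show ?case by (simp add: v_def w_def)
  next
    case (Cons x xs)
    obtain c k y where x: "x = (c, k, y)" by (cases x) auto
    have y: "y \<in> V k" and IH: "v xs n \<in> V n" "g n (v xs n) = w xs n" using Cons x by auto
    show ?case
    proof (cases "k = n")
      case True
      have m: "s c y \<in> V n" using y True a.subspace_scale[OF sub] by blast
      have "v (x # xs) n = s c y + v xs n" "w (x # xs) n = s2 c (g n y) + w xs n"
        using x True by (simp_all add: v_def w_def)
      then show ?thesis using m IH y True a.subspace_add[OF sub m IH(1)]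
        by (simp add: linear_on_add[OF g] linear_on_scale[OF g])
    next
      case False
      then show ?thesis using x IH by (simp add: v_def w_def)
    qed
  qed
  have tot: "(\<Sum>n\<le>N. v xs n) = (\<Sum>(c, k, a)\<leftarrow>xs. s c a)" "(\<Sum>n\<le>N. w xs n) = (\<Sum>(c, k, a)\<leftarrow>xs. s2 c (g k a))"
    if "\<forall>(c, k, a)\<in>set xs. k \<le> N" for xs N
    using that by (induction xs) (auto simp: v_def w_def sum.distrib)
  have rel: "(\<Sum>(c, x)\<leftarrow>xs. s2 c (case x of (n, a) \<Rightarrow> g n a)) = 0"
    if xs: "set xs \<subseteq> UNIV \<times> ?X" and z: "(\<Sum>(c, x)\<leftarrow>xs. s c (snd x)) = 0" for xs
  proof -
    define N where "N = Max (insert 0 ((\<lambda>(c, k, a). k) ` set xs))"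
    have N: "\<forall>(c, k, a)\<in>set xs. k \<le> N"
      unfolding N_def by (auto intro!: Max_ge image_eqI[where x = "(_, _, _)"])
    have "(\<Sum>n\<le>N. v xs n) = 0" unfolding tot(1)[OF N] using z by (simp add: case_prod_unfold)
    then have "v xs n = 0" if "n \<le> N" for n using dir[of N "v xs"] vw[OF xs] that by blast
    moreover have "g n 0 = 0" for n by (rule linear_on_zero[OF g s s2 a.subspace_0[OF sub]])
    ultimately have "w xs n = 0" if "n \<le> N" for n using vw[OF xs, of n] that by simp
    then have "(\<Sum>n\<le>N. w xs n) = 0" by simp
    then show ?thesis unfolding tot(2)[OF N] by (simp add: case_prod_unfold)
  qed
  have im: "snd ` ?X = (\<Union>n. V n)" by force
  note L = lin_ext_linear[where X = ?X and e = snd and h = "\<lambda>(n, a). g n a", OF s s2 rel]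
  show thesis
  proof (rule that)
    show "linear_on s s2 (a.span (\<Union>n. V n)) (lin_ext s s2 ?X snd (\<lambda>(n, a). g n a))"
      using L(1) unfolding im .
    show "lin_ext s s2 ?X snd (\<lambda>(n, a). g n a) a = g n a" if "a \<in> V n" for n a
      using L(2)[of "(n, a)"] that by simp
  qed
qed

text \<open>Projections onto the summands show that a sum is direct.\<close>

lemma graded_spaceI:
  assumes s: "vector_space s" and sub: "\<And>n. module.subspace s (V n)"
    and P: "\<And>k. linear_on s s (module.span s (\<Union>n. V n)) (P k)"
    and Pv: "\<And>k n v. v \<in> V n \<Longrightarrow> P k v = (if k = n then v else 0)"
  shows "graded_space s V"
  unfolding graded_space_def
proof (intro conjI allI impI s sub)
  interpret vector_space s by fact
  fix N v n assume v: "(\<forall>n\<le>N. v n \<in> V n) \<and> (\<Sum>n\<le>N. v n) = 0" and n: "n \<le> N"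
  have "P n (\<Sum>k\<in>B. v k) = (\<Sum>k\<in>B. P n (v k))" if "finite B" "B \<subseteq> {..N}" for B
    using that
  proof (induction B rule: finite_induct)
    case empty then show ?case using linear_on_zero[OF P s s span_zero] by simp
  next
    case (insert k B)
    have "v k \<in> span (\<Union>n. V n)" using insert v by (auto intro: span_base)
    moreover have "(\<Sum>k\<in>B. v k) \<in> span (\<Union>n. V n)"
      using insert v by (intro span_sum span_base) auto
    ultimately show ?case using insert by (simp add: linear_on_add[OF P])
  qed
  then have "P n (\<Sum>k\<le>N. v k) = (\<Sum>k\<le>N. P n (v k))" by simp
  also have "\<dots> = (\<Sum>k\<le>N. if n = k then v k else 0)" using v by (intro sum.cong) (auto simp: Pv)
  finally show "v n = 0" using v n linear_on_zero[OF P s s span_zero] by simp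
qed

locale galg =
  fixes A :: "('k::field, 'a::ab_group_add) hopf"
  assumes ga: "graded_algebra A"
begin

lemma grsp: "graded_space (scl A) (gr A)" and vs: "vector_space (scl A)"
  and sub_gr: "module.subspace (scl A) (gr A n)"
  using ga by (auto simp: graded_algebra_def graded_space_def)

sublocale vector_space "scl A" by (rule vs)

lemma sub_C: "subspace (hcarrier A)" by (simp add: hcarrier_def)
lemma gr_C: "a \<in> gr A n \<Longrightarrow> a \<in> hcarrier A" unfolding hcarrier_def by (rule span_base) auto

lemma mult_gr: "a \<in> gr A i \<Longrightarrow> b \<in> gr A j \<Longrightarrow> mult A a b \<in> gr A (i + j)"
  and mult_lin2: "a \<in> hcarrier A \<Longrightarrow> linear_on (scl A) (scl A) (hcarrier A) (mult A a)"
  and mult_lin1: "b \<in> hcarrier A \<Longrightarrow> linear_on (scl A) (scl A) (hcarrier A) (\<lambda>a. mult A a b)"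
  and mult_assoc: "a \<in> hcarrier A \<Longrightarrow> b \<in> hcarrier A \<Longrightarrow> c \<in> hcarrier A \<Longrightarrow>
    mult A (mult A a b) c = mult A a (mult A b c)"
  and unit_gr: "unit A \<in> gr A 0"
  and unit_l: "a \<in> hcarrier A \<Longrightarrow> mult A (unit A) a = a"
  and unit_r: "a \<in> hcarrier A \<Longrightarrow> mult A a (unit A) = a"
  using ga by (auto simp: graded_algebra_def)

lemma unit_C: "unit A \<in> hcarrier A" using unit_gr gr_C by blast

lemma C_eqI:
  assumes "linear_on (scl A) s (hcarrier A) f" "linear_on (scl A) s (hcarrier A) g" "vector_space s"
    "\<And>n a. a \<in> gr A n \<Longrightarrow> f a = g a" "a \<in> hcarrier A"
  shows "f a = g a"
  by (rule linear_on_eq_on_span[OF assms(1,2)[unfolded hcarrier_def] vs assms(3) _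
      assms(5)[unfolded hcarrier_def]]) (use assms(4) in auto)

lemma C_image:
  assumes "linear_on (scl A) s (hcarrier A) f" "vector_space s" "module.subspace s U"
    "\<And>n a. a \<in> gr A n \<Longrightarrow> f a \<in> U" "a \<in> hcarrier A"
  shows "f a \<in> U"
  by (rule linear_on_image_span[OF assms(1)[unfolded hcarrier_def] vs assms(2) _ assms(3)
      assms(5)[unfolded hcarrier_def]]) (use assms(4) in auto)

lemma mult_C:
  assumes "a \<in> hcarrier A" "b \<in> hcarrier A" shows "mult A a b \<in> hcarrier A"
proof -
  have "mult A a b \<in> hcarrier A" if a: "a \<in> gr A i" for a i
    by (rule C_image[OF mult_lin2[OF gr_C[OF a]] vs sub_C _ assms(2)]) (use a mult_gr gr_C in blast)
  then show ?thesis by (intro C_image[OF mult_lin1[OF assms(2)] vs sub_C _ assms(1)])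
qed

lemma mult_scale1: "a \<in> hcarrier A \<Longrightarrow> b \<in> hcarrier A \<Longrightarrow> mult A (scl A c a) b = scl A c (mult A a b)"
  using linear_on_scale[OF mult_lin1] by blast

lemma mult_scale2: "a \<in> hcarrier A \<Longrightarrow> b \<in> hcarrier A \<Longrightarrow> mult A a (scl A c b) = scl A c (mult A a b)"
  using linear_on_scale[OF mult_lin2] by blast

lemma scale_C: "a \<in> hcarrier A \<Longrightarrow> scl A c a \<in> hcarrier A"
  using subspace_scale[OF sub_C] by blast

lemma scale_gr: "a \<in> gr A n \<Longrightarrow> scl A c a \<in> gr A n"
  using subspace_scale[OF sub_gr] by blast

end

text \<open>The linear map that multiplies elements of degree \<open>n\<close> by \<open>(-1)\<^sup>q\<^sup>n\<close>.\<close>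

definition parity :: "('k::field, 'a::ab_group_add) hopf \<Rightarrow> nat \<Rightarrow> 'a \<Rightarrow> 'a" where
  "parity A q = (SOME f. linear_on (scl A) (scl A) (hcarrier A) f \<and>
     (\<forall>n. \<forall>a\<in>gr A n. f a = scl A ((-1) ^ (q * n)) a))"

text \<open>The projection onto the summand of degree \<open>i\<close>.\<close>

definition gproj :: "('k::field, 'a::ab_group_add) hopf \<Rightarrow> nat \<Rightarrow> 'a \<Rightarrow> 'a" where
  "gproj A i = (SOME f. linear_on (scl A) (scl A) (hcarrier A) f \<and>
     (\<forall>n. \<forall>a\<in>gr A n. f a = (if n = i then a else 0)))"

context galg begin

lemma parity_lin: "linear_on (scl A) (scl A) (hcarrier A) (parity A q)"
  and parity_gr: "a \<in> gr A n \<Longrightarrow> parity A q a = scl A ((-1) ^ (q * n)) a"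
proof -
  have "linear_on (scl A) (scl A) (gr A n) (scl A ((-1) ^ (q * n)))" for n
    by (rule linear_on_scale_map[OF vs])
  then have "\<exists>f. linear_on (scl A) (scl A) (hcarrier A) f \<and>
      (\<forall>n. \<forall>a\<in>gr A n. f a = scl A ((-1) ^ (q * n)) a)"
    by (rule graded_lift[OF grsp vs]) (auto simp: hcarrier_def)
  from someI_ex[OF this] show "linear_on (scl A) (scl A) (hcarrier A) (parity A q)"
    "a \<in> gr A n \<Longrightarrow> parity A q a = scl A ((-1) ^ (q * n)) a"
    unfolding parity_def by blast+
qed

lemma gproj_lin: "linear_on (scl A) (scl A) (hcarrier A) (gproj A i)"
  and gproj_gr: "a \<in> gr A n \<Longrightarrow> gproj A i a = (if n = i then a else 0)"
proof -
  have "linear_on (scl A) (scl A) (gr A n) (\<lambda>a. if n = i then a else 0)" for n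
    using linear_on_ident(1)[of "scl A" "gr A n"] linear_on_null[OF vs] by (cases "n = i") auto
  then have "\<exists>f. linear_on (scl A) (scl A) (hcarrier A) f \<and>
      (\<forall>n. \<forall>a\<in>gr A n. f a = (if n = i then a else 0))"
    by (rule graded_lift[OF grsp vs]) (auto simp: hcarrier_def)
  from someI_ex[OF this] show "linear_on (scl A) (scl A) (hcarrier A) (gproj A i)"
    "a \<in> gr A n \<Longrightarrow> gproj A i a = (if n = i then a else 0)"
    unfolding gproj_def by blast+
qed

lemma parity_C: "a \<in> hcarrier A \<Longrightarrow> parity A q a \<in> hcarrier A"
  by (rule C_image[OF parity_lin vs sub_C]) (auto simp: parity_gr intro: scale_C gr_C)

end

definition tmult ::
  "('k::field, 'a::ab_group_add) hopf \<Rightarrow> ('k, 'b::ab_group_add) hopf \<Rightarrow>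
   ('k, 'a, 'b) tensor \<Rightarrow> ('k, 'a, 'b) tensor \<Rightarrow> ('k, 'a, 'b) tensor" where
  "tmult A B t u =
     lin_ext fscale fscale (homog A \<times> homog B) (\<lambda>((_, a), (_, b)). ten A B a b)
       (\<lambda>((_, a), (q, b)).
          lin_ext fscale fscale (homog A \<times> homog B) (\<lambda>((_, c), (_, d)). ten A B c d)
            (\<lambda>((r, c), (_, d)). fscale ((-1) ^ (q * r)) (ten A B (mult A a c) (mult B b d))) u) t"

lemma tensor_mult_eq: "tensor_mult A = tmult A A"
  by (simp add: fun_eq_iff tensor_mult_def tmult_def)

abbreviation tcar :: "('k::field, 'a::ab_group_add) hopf \<Rightarrow> ('k, 'b::ab_group_add) hopf \<Rightarrow> ('k, 'a, 'b) tensor set" where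
  "tcar A B \<equiv> tspan (scl A) (scl B) (hcarrier A) (hcarrier B)"

text \<open>The tensor product of two graded algebras, as an algebra only: comultiplication and counit are
  left undefined.\<close>

definition talg :: "('k::field, 'a::ab_group_add) hopf \<Rightarrow> ('k, 'b::ab_group_add) hopf \<Rightarrow>
    ('k, ('k, 'a, 'b) tensor) hopf" where
  "talg A B = \<lparr>scl = fscale,
     gr = (\<lambda>n. module.span fscale {ten A B b c |i j b c. i + j = n \<and> b \<in> gr A i \<and> c \<in> gr B j}),
     mult = tmult A B, unit = ten A B (unit A) (unit B), comult = undefined, counit = undefined\<rparr>"

lemma talg_simps [simp]:
  "scl (talg A B) = fscale" "mult (talg A B) = tmult A B" "unit (talg A B) = ten A B (unit A) (unit B)"
  by (simp_all add: talg_def)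

locale galg2 = A: galg A + B: galg B
  for A :: "('k::field, 'a::ab_group_add) hopf" and B :: "('k, 'b::ab_group_add) hopf"
begin

lemma homog_image:
  "(\<lambda>((_, a), (_, b)). ten A B a b) ` (homog A \<times> homog B) =
   (\<lambda>(v, w). tensor (scl A) (scl B) v w) ` ((\<Union>n. gr A n) \<times> (\<Union>n. gr B n))"
  by (force simp: homog_def ten_def)

lemma tcar_eq: "tcar A B = module.span fscale ((\<lambda>((_, a), (_, b)). ten A B a b) ` (homog A \<times> homog B))"
  unfolding homog_image hcarrier_def by (rule tspan_span[OF A.vs B.vs])

lemma ten_tcar: "a \<in> hcarrier A \<Longrightarrow> b \<in> hcarrier B \<Longrightarrow> ten A B a b \<in> tcar A B"
  unfolding ten_def by (rule tspan_base)

lemma tcar_eqI: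
  assumes "linear_on fscale s (tcar A B) F" "linear_on fscale s (tcar A B) G" "vector_space s"
    "\<And>i j a b. a \<in> gr A i \<Longrightarrow> b \<in> gr B j \<Longrightarrow> F (ten A B a b) = G (ten A B a b)" "t \<in> tcar A B"
  shows "F t = G t"
  by (rule linear_on_eq_on_span[OF assms(1,2)[unfolded tcar_eq] vector_space_fscale assms(3) _
      assms(5)[unfolded tcar_eq]]) (use assms(4) in \<open>auto simp: homog_def\<close>)

lemma tcar_image:
  assumes "linear_on fscale s (tcar A B) F" "vector_space s" "module.subspace s U"
    "\<And>i j a b. a \<in> gr A i \<Longrightarrow> b \<in> gr B j \<Longrightarrow> F (ten A B a b) \<in> U" "t \<in> tcar A B"
  shows "F t \<in> U"
  by (rule linear_on_image_span[OF assms(1)[unfolded tcar_eq] vector_space_fscale assms(2) _ assms(3)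
      assms(5)[unfolded tcar_eq]]) (use assms(4) in \<open>auto simp: homog_def\<close>)

lemma ten_scale:
  "ten A B (scl A c a) b = fscale c (ten A B a b)" "ten A B a (scl B c b) = fscale c (ten A B a b)"
  using tensor_bilinear(1)[of "scl A" "scl B" b] tensor_bilinear(2)[of "scl B" "scl A" a]
  by (auto simp: linear_on_def ten_def)

text \<open>The product with a homogeneous tensor. Its sign depends on the degree of the other factor;
  written with \<^const>\<open>parity\<close> it becomes visibly linear.\<close>

lemma tmult_inner:
  assumes a: "a \<in> gr A i" and b: "b \<in> gr B q"
  defines "I \<equiv> lin_ext fscale fscale (homog A \<times> homog B) (\<lambda>((_, c), (_, d)). ten A B c d)
            (\<lambda>((r, c), (_, d)). fscale ((-1) ^ (q * r)) (ten A B (mult A a c) (mult B b d)))"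
  shows "linear_on fscale fscale (tcar A B) I"
    and "c \<in> gr A r \<Longrightarrow> d \<in> gr B j \<Longrightarrow>
      I (ten A B c d) = fscale ((-1) ^ (q * r)) (ten A B (mult A a c) (mult B b d))"
proof -
  let ?f = "\<lambda>c. mult A a (parity A q c)" and ?g = "mult B b"
  let ?G = "tensor_map (scl A) (scl B) (scl A) (scl B) (hcarrier A) (hcarrier B) ?f ?g"
  have f: "linear_on (scl A) (scl A) (hcarrier A) ?f"
    by (rule linear_on_comp[OF A.parity_lin A.mult_lin2[OF A.gr_C[OF a]]]) (use A.parity_C in blast)
  note G = tensor_map_linear[OF A.vs B.vs A.vs B.vs A.sub_C B.sub_C f B.mult_lin2[OF B.gr_C[OF b]]]
  have eq: "?G (ten A B c d) = fscale ((-1) ^ (q * r)) (ten A B (mult A a c) (mult B b d))"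
    if "c \<in> gr A r" "d \<in> gr B j" for c r d j
    using that G(2)[of c d] A.gr_C B.gr_C a b
    by (simp add: ten_def A.parity_gr A.mult_scale2[OF A.gr_C A.gr_C] flip: ten_scale(1)[unfolded ten_def])
  have I: "I t = ?G t" if "t \<in> tcar A B" for t
    unfolding I_def
    by (rule lin_ext_eqI[OF vector_space_fscale vector_space_fscale])
      (use that eq G(1) in \<open>auto simp: tcar_eq homog_def\<close>)
  show "linear_on fscale fscale (tcar A B) I"
    by (rule linear_on_cong[OF G(1) I vector_space_fscale subspace_tspan])
  show "c \<in> gr A r \<Longrightarrow> d \<in> gr B j \<Longrightarrow>
      I (ten A B c d) = fscale ((-1) ^ (q * r)) (ten A B (mult A a c) (mult B b d))"
    using I[OF ten_tcar] eq A.gr_C B.gr_C by simp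
qed

definition "tmult_inner a q b = lin_ext fscale fscale (homog A \<times> homog B) (\<lambda>((_, c), (_, d)). ten A B c d)
            (\<lambda>((r, c), (_, d)). fscale ((-1) ^ (q * r)) (ten A B (mult A a c) (mult B b d)))"

lemma tmult_outer:
  assumes u: "u \<in> tcar A B"
  obtains G where "linear_on fscale fscale (tcar A B) G"
    "\<And>i q a b. a \<in> gr A i \<Longrightarrow> b \<in> gr B q \<Longrightarrow> G (ten A B a b) = tmult_inner a q b u"
proof -
  note inner = tmult_inner[folded tmult_inner_def]
  have "u \<in> tcar A B \<and> (\<exists>G. linear_on fscale fscale (tcar A B) G \<and>
    (\<forall>i q a b. a \<in> gr A i \<longrightarrow> b \<in> gr B q \<longrightarrow> G (ten A B a b) = tmult_inner a q b u))"
    using u[unfolded tcar_eq]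
  proof (induct rule: fs.span_induct_alt)
    case base
    have 0: "0 \<in> tcar A B" by (simp only: tspan_def fs.span_zero)
    have "tmult_inner a q b 0 = 0" if "a \<in> gr A i" "b \<in> gr B q" for a q b i
      by (rule linear_on_zero[OF inner(1)[OF that] vector_space_fscale vector_space_fscale 0])
    moreover obtain Z :: "('k, 'a, 'b) tensor \<Rightarrow> ('k, 'a, 'b) tensor" where Z: "Z = (\<lambda>_. 0)" by blast
    moreover have "linear_on fscale fscale (tcar A B) Z"
      unfolding Z by (rule linear_on_null[OF vector_space_fscale])
    ultimately have "\<exists>G. linear_on fscale fscale (tcar A B) G \<and> (\<forall>i q a b. a \<in> gr A i \<longrightarrow> b \<in> gr B q \<longrightarrow>
        G (ten A B a b) = tmult_inner a q b 0)" by (intro exI[of _ Z]) simp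
    then show ?case using 0 by (rule conjI[rotated])
  next
    case (step k x y)
    obtain r c j d where x: "c \<in> gr A r" "d \<in> gr B j" "x = ten A B c d"
      using step by (auto simp: homog_def)
    obtain G where G: "linear_on fscale fscale (tcar A B) G"
      "\<And>i q a b. a \<in> gr A i \<Longrightarrow> b \<in> gr B q \<Longrightarrow> G (ten A B a b) = tmult_inner a q b y"
      and y: "y \<in> tcar A B"
      using step by blast
    have xC: "x \<in> tcar A B" using x ten_tcar A.gr_C B.gr_C by blast
    let ?f = "\<lambda>a. mult A a c" and ?g = "\<lambda>b. mult B (parity B r b) d"
    let ?F = "tensor_map (scl A) (scl B) (scl A) (scl B) (hcarrier A) (hcarrier B) ?f ?g"
    have g: "linear_on (scl B) (scl B) (hcarrier B) ?g"
      by (rule linear_on_comp[OF B.parity_lin B.mult_lin1[OF B.gr_C[OF x(2)]]]) (use B.parity_C in blast)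
    note F = tensor_map_linear[OF A.vs B.vs A.vs B.vs A.sub_C B.sub_C A.mult_lin1[OF A.gr_C[OF x(1)]] g]
    have eq: "?F (ten A B a b) = tmult_inner a q b x" if "a \<in> gr A i" "b \<in> gr B q" for a b q i
    proof -
      have "?F (ten A B a b) = ten A B (mult A a c) (mult B (scl B ((-1) ^ (r * q)) b) d)"
        using that F(2)[of a b] A.gr_C B.gr_C by (simp add: ten_def B.parity_gr)
      also have "\<dots> = fscale ((-1) ^ (q * r)) (ten A B (mult A a c) (mult B b d))"
        using that x B.gr_C by (simp add: B.mult_scale1[OF B.gr_C B.gr_C] ten_scale mult.commute)
      finally show ?thesis using inner(2)[OF that x(1,2)] x(3) by simp
    qed
    have in_eq: "tmult_inner a q b (fscale k x + y) = fscale k (tmult_inner a q b x) + tmult_inner a q b y"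
      if "a \<in> gr A i" "b \<in> gr B q" for a b q i
      using linear_on_add[OF inner(1)[OF that] fs.subspace_scale[OF subspace_tspan xC] y]
        linear_on_scale[OF inner(1)[OF that] xC] by simp
    have "linear_on fscale fscale (tcar A B) (\<lambda>t. fscale k (?F t) + G t)"
      by (rule linear_on_plus[OF linear_on_scaled[OF F(1)] G(1)]) (rule vector_space_fscale)+
    moreover have "fscale k x + y \<in> tcar A B"
      by (rule fs.subspace_add[OF subspace_tspan fs.subspace_scale[OF subspace_tspan xC] y])
    moreover have "fscale k (?F (ten A B a b)) + G (ten A B a b) = tmult_inner a q b (fscale k x + y)"
      if "a \<in> gr A i" "b \<in> gr B q" for a b q i
      unfolding in_eq[OF that] eq[OF that] G(2)[OF that] ..
    ultimately show ?case by blast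
  qed
  then show thesis using that by blast
qed

lemma tmult_char:
  assumes u: "u \<in> tcar A B"
  shows "linear_on fscale fscale (tcar A B) (\<lambda>t. tmult A B t u)"
    and "a \<in> gr A i \<Longrightarrow> b \<in> gr B q \<Longrightarrow> tmult A B (ten A B a b) u = tmult_inner a q b u"
proof -
  obtain G where G: "linear_on fscale fscale (tcar A B) G"
    "\<And>i q a b. a \<in> gr A i \<Longrightarrow> b \<in> gr B q \<Longrightarrow> G (ten A B a b) = tmult_inner a q b u"
    using tmult_outer[OF u] by blast
  have *: "tmult A B t u = G t" if "t \<in> tcar A B" for t
    unfolding tmult_def
    by (rule lin_ext_eqI[OF vector_space_fscale vector_space_fscale])
      (use that G in \<open>auto simp: tcar_eq homog_def tmult_inner_def\<close>)
  show "linear_on fscale fscale (tcar A B) (\<lambda>t. tmult A B t u)"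
    by (rule linear_on_cong[OF G(1) * vector_space_fscale subspace_tspan])
  show "tmult A B (ten A B a b) u = tmult_inner a q b u" if "a \<in> gr A i" "b \<in> gr B q"
    using *[OF ten_tcar] G(2)[OF that] that A.gr_C B.gr_C by simp
qed

lemmas tmult_lin1 = tmult_char(1)

lemma tmult_ten:
  assumes "a \<in> gr A i" "b \<in> gr B q" "c \<in> gr A r" "d \<in> gr B j"
  shows "tmult A B (ten A B a b) (ten A B c d) =
    fscale ((-1) ^ (q * r)) (ten A B (mult A a c) (mult B b d))"
  using tmult_char(2)[OF ten_tcar assms(1,2)] tmult_inner(2)[OF assms] assms A.gr_C B.gr_C
  by (simp add: tmult_inner_def)

lemma tmult_lin2:
  assumes t: "t \<in> tcar A B"
  shows "linear_on fscale fscale (tcar A B) (tmult A B t)"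
  unfolding linear_on_def
proof (intro conjI ballI allI)
  have pure: "linear_on fscale fscale (tcar A B) (tmult A B (ten A B a b))"
    if "a \<in> gr A i" "b \<in> gr B q" for a b i q
    using tmult_inner(1)[OF that] tmult_char(2)[OF _ that]
    by (intro linear_on_cong[where g = "tmult A B (ten A B a b)", OF _ _ vector_space_fscale subspace_tspan])
      (auto simp: tmult_inner_def)
  fix u v c assume uv: "u \<in> tcar A B" "v \<in> tcar A B"
  have s: "u + v \<in> tcar A B" using fs.subspace_add[OF subspace_tspan uv] .
  show "tmult A B t (u + v) = tmult A B t u + tmult A B t v"
  proof (rule tcar_eqI[OF tmult_lin1[OF s] _ vector_space_fscale _ t])
    show "linear_on fscale fscale (tcar A B) (\<lambda>t. tmult A B t u + tmult A B t v)"
      by (rule linear_on_plus[OF tmult_lin1[OF uv(1)] tmult_lin1[OF uv(2)] vector_space_fscale])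
  qed (rule linear_on_add[OF pure uv])
next
  have pure: "linear_on fscale fscale (tcar A B) (tmult A B (ten A B a b))"
    if "a \<in> gr A i" "b \<in> gr B q" for a b i q
    using tmult_inner(1)[OF that] tmult_char(2)[OF _ that]
    by (intro linear_on_cong[where g = "tmult A B (ten A B a b)", OF _ _ vector_space_fscale subspace_tspan])
      (auto simp: tmult_inner_def)
  fix u c assume u: "u \<in> tcar A B"
  have s: "fscale c u \<in> tcar A B" using fs.subspace_scale[OF subspace_tspan u] .
  show "tmult A B t (fscale c u) = fscale c (tmult A B t u)"
  proof (rule tcar_eqI[OF tmult_lin1[OF s] _ vector_space_fscale _ t])
    show "linear_on fscale fscale (tcar A B) (\<lambda>t. fscale c (tmult A B t u))"
      by (rule linear_on_scaled[OF tmult_lin1[OF u] vector_space_fscale])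
  qed (rule linear_on_scale[OF pure u])
qed

lemma talg_gr_base: "b \<in> gr A i \<Longrightarrow> c \<in> gr B j \<Longrightarrow> i + j = n \<Longrightarrow> ten A B b c \<in> gr (talg A B) n"
  unfolding talg_def by (auto intro!: fs.span_base)

lemma talg_gr_tcar: "gr (talg A B) n \<subseteq> tcar A B"
  unfolding talg_def using ten_tcar A.gr_C B.gr_C
  by (simp, intro fs.span_minimal subspace_tspan) auto

lemma hcarrier_talg: "hcarrier (talg A B) = tcar A B"
proof
  show "hcarrier (talg A B) \<subseteq> tcar A B"
    unfolding hcarrier_def[of "talg A B"] talg_simps using talg_gr_tcar
    by (intro fs.span_minimal subspace_tspan) auto
  show "tcar A B \<subseteq> hcarrier (talg A B)"
    unfolding tcar_eq hcarrier_def[of "talg A B"] talg_simps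
    by (intro fs.span_mono) (auto simp: homog_def intro: talg_gr_base)
qed

lemma talg_gr_image:
  assumes "linear_on fscale s (tcar A B) F" "vector_space s" "module.subspace s U"
    "\<And>i j a b. a \<in> gr A i \<Longrightarrow> b \<in> gr B j \<Longrightarrow> i + j = n \<Longrightarrow> F (ten A B a b) \<in> U" "t \<in> gr (talg A B) n"
  shows "F t \<in> U"
proof -
  let ?S = "{ten A B b c |i j b c. i + j = n \<and> b \<in> gr A i \<and> c \<in> gr B j}"
  have t: "t \<in> fs.span ?S" using assms(5) by (simp add: talg_def)
  have "linear_on fscale s (fs.span ?S) F"
    using talg_gr_tcar[of n] by (intro linear_on_subset[OF assms(1)]) (simp add: talg_def)
  from linear_on_image_span[OF this vector_space_fscale assms(2) _ assms(3) t] show ?thesis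
    using assms(4) by auto
qed

lemma talg_gr_eqI:
  assumes "linear_on fscale s (tcar A B) F" "linear_on fscale s (tcar A B) G" "vector_space s"
    "\<And>i j a b. a \<in> gr A i \<Longrightarrow> b \<in> gr B j \<Longrightarrow> i + j = n \<Longrightarrow> F (ten A B a b) = G (ten A B a b)"
    "t \<in> gr (talg A B) n"
  shows "F t = G t"
proof -
  let ?S = "{ten A B b c |i j b c. i + j = n \<and> b \<in> gr A i \<and> c \<in> gr B j}"
  have t: "t \<in> fs.span ?S" using assms(5) by (simp add: talg_def)
  have "linear_on fscale s (fs.span ?S) F" "linear_on fscale s (fs.span ?S) G"
    using talg_gr_tcar[of n]
    by (auto intro!: linear_on_subset[OF assms(1)] linear_on_subset[OF assms(2)] simp: talg_def)
  from linear_on_eq_on_span[OF this vector_space_fscale assms(3) _ t] show ?thesis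
    using assms(4) by auto
qed

lemma sub_talg_gr: "module.subspace fscale (gr (talg A B) n)"
  by (simp add: talg_def)

lemma ten_zero: "ten A B 0 b = 0" "ten A B a 0 = 0"
  using linear_on_zero[OF tensor_bilinear(1) A.vs vector_space_fscale]
    linear_on_zero[OF tensor_bilinear(2) B.vs vector_space_fscale] by (auto simp: ten_def)

lemma graded_space_talg: "graded_space fscale (gr (talg A B))"
proof -
  let ?M = "\<lambda>i j. tensor_map (scl A) (scl B) (scl A) (scl B) (hcarrier A) (hcarrier B) (gproj A i) (gproj B j)"
  let ?P = "\<lambda>k t. \<Sum>i\<le>k. ?M i (k - i) t"
  note M = tensor_map_linear[OF A.vs B.vs A.vs B.vs A.sub_C B.sub_C A.gproj_lin B.gproj_lin]
  have P: "linear_on fscale fscale (tcar A B) (?P k)" for k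
    by (rule linear_on_sum_maps[OF M(1) vector_space_fscale])
  have sp: "fs.span (\<Union>n. gr (talg A B) n) = tcar A B"
    using hcarrier_talg by (simp add: hcarrier_def)
  show ?thesis
  proof (rule graded_spaceI[where P = ?P, OF vector_space_fscale sub_talg_gr])
    show "linear_on fscale fscale (fs.span (\<Union>n. gr (talg A B) n)) (?P k)" for k
      unfolding sp by (rule P)
    have pure: "?P k (ten A B a b) = (if k = n then ten A B a b else 0)"
      if "a \<in> gr A i" "b \<in> gr B j" "i + j = n" for a b i j n k
    proof -
      have "?P k (ten A B a b) = (\<Sum>l\<le>k. if l = i then (if k = n then ten A B a b else 0) else 0)"
      proof (rule sum.cong[OF refl])
        fix l assume l: "l \<in> {..k}"
        have "?M l (k - l) (ten A B a b) = ten A B (gproj A l a) (gproj B (k - l) b)"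
          using that A.gr_C B.gr_C by (simp add: ten_def M(2))
        moreover have "j = k - i \<longleftrightarrow> k = n" if "i \<le> k" using that \<open>i + j = n\<close> by auto
        ultimately show "?M l (k - l) (ten A B a b) = (if l = i then (if k = n then ten A B a b else 0) else 0)"
          using l that A.gproj_gr[OF that(1)] B.gproj_gr[OF that(2)] by (auto simp: ten_zero)
      qed
      also have "\<dots> = (if k = n then ten A B a b else 0)"
        using that by (subst sum.delta) (auto simp del: zero_fun_def)
      finally show ?thesis .
    qed
    show "?P k t = (if k = n then t else 0)" if "t \<in> gr (talg A B) n" for k n t
    proof (rule talg_gr_eqI[OF P _ vector_space_fscale _ that])
      show "linear_on fscale fscale (tcar A B) (\<lambda>t. if k = n then t else 0)"
        using linear_on_ident(1)[of fscale "tcar A B"] linear_on_null[OF vector_space_fscale, of fscale "tcar A B"]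
        by (cases "k = n") simp_all
    qed (use pure in blast)
  qed
qed

lemma tmult_gr:
  assumes t: "t \<in> gr (talg A B) n" and u: "u \<in> gr (talg A B) l"
  shows "tmult A B t u \<in> gr (talg A B) (n + l)"
proof (rule talg_gr_image[OF tmult_lin1 vector_space_fscale sub_talg_gr _ t])
  show u': "u \<in> tcar A B" using u talg_gr_tcar by blast
  fix i j a b assume ab: "a \<in> gr A i" "b \<in> gr B j" "i + j = n"
  show "tmult A B (ten A B a b) u \<in> gr (talg A B) (n + l)"
  proof (rule talg_gr_image[OF tmult_lin2 vector_space_fscale sub_talg_gr _ u])
    show "ten A B a b \<in> tcar A B" using ab ten_tcar A.gr_C B.gr_C by blast
    fix i' j' a' b' assume "a' \<in> gr A i'" "b' \<in> gr B j'" "i' + j' = l"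
    then show "tmult A B (ten A B a b) (ten A B a' b') \<in> gr (talg A B) (n + l)"
      using ab A.mult_gr[OF ab(1), of a' i'] B.mult_gr[OF ab(2), of b' j']
      by (subst tmult_ten) (auto intro!: fs.subspace_scale[OF sub_talg_gr] talg_gr_base)
  qed
qed

lemma tmult_tcar:
  assumes t: "t \<in> tcar A B" and u: "u \<in> tcar A B"
  shows "tmult A B t u \<in> tcar A B"
proof (rule tcar_image[OF tmult_lin1[OF u] vector_space_fscale subspace_tspan _ t])
  fix i j a b assume ab: "a \<in> gr A i" "b \<in> gr B j"
  show "tmult A B (ten A B a b) u \<in> tcar A B"
  proof (rule tcar_image[OF tmult_lin2 vector_space_fscale subspace_tspan _ u])
    show "ten A B a b \<in> tcar A B" using ab ten_tcar A.gr_C B.gr_C by blast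
    fix i' j' a' b' assume "a' \<in> gr A i'" "b' \<in> gr B j'"
    then show "tmult A B (ten A B a b) (ten A B a' b') \<in> tcar A B"
      using ab A.mult_gr[OF ab(1), of a' i'] B.mult_gr[OF ab(2), of b' j'] A.gr_C B.gr_C
      by (subst tmult_ten) (auto intro!: fs.subspace_scale[OF subspace_tspan] ten_tcar)
  qed
qed

lemma tmult_assoc_pure:
  assumes "a \<in> gr A i" "b \<in> gr B j" "a' \<in> gr A i'" "b' \<in> gr B j'" "a'' \<in> gr A i''" "b'' \<in> gr B j''"
  shows "tmult A B (tmult A B (ten A B a b) (ten A B a' b')) (ten A B a'' b'') =
    tmult A B (ten A B a b) (tmult A B (ten A B a' b') (ten A B a'' b''))"
proof -
  note m = A.mult_gr[OF assms(1,3)] A.mult_gr[OF assms(3,5)] B.mult_gr[OF assms(2,4)] B.mult_gr[OF assms(4,6)]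
  have C: "ten A B a'' b'' \<in> tcar A B" "ten A B (mult A a a') (mult B b b') \<in> tcar A B"
     "ten A B a b \<in> tcar A B" "ten A B (mult A a' a'') (mult B b' b'') \<in> tcar A B"
    using assms m A.gr_C B.gr_C ten_tcar by blast+
  have e: "(-1 :: 'k) ^ (j * i') * (-1) ^ ((j + j') * i'') = (-1) ^ (j' * i'') * (-1) ^ (j * (i' + i''))"
    by (simp add: algebra_simps flip: power_add)
  show ?thesis
    unfolding tmult_ten[OF assms(1-4)] tmult_ten[OF assms(3-6)]
      linear_on_scale[OF tmult_lin1[OF C(1)] C(2)] linear_on_scale[OF tmult_lin2[OF C(3)] C(4)]
      tmult_ten[OF m(1,3) assms(5,6)] tmult_ten[OF assms(1,2) m(2,4)]
    using A.mult_assoc[of a a' a''] B.mult_assoc[of b b' b''] assms A.gr_C B.gr_C e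
    by simp
qed

lemma tmult_assoc:
  assumes t: "t \<in> tcar A B" and u: "u \<in> tcar A B" and v: "v \<in> tcar A B"
  shows "tmult A B (tmult A B t u) v = tmult A B t (tmult A B u v)"
proof (rule tcar_eqI[OF _ tmult_lin1[OF tmult_tcar[OF u v]] vector_space_fscale _ t])
  show "linear_on fscale fscale (tcar A B) (\<lambda>t. tmult A B (tmult A B t u) v)"
    by (rule linear_on_comp[OF tmult_lin1[OF u] tmult_lin1[OF v]]) (use tmult_tcar u in blast)
  fix i j a b assume ab: "a \<in> gr A i" "b \<in> gr B j"
  then have 1: "ten A B a b \<in> tcar A B" using ten_tcar A.gr_C B.gr_C by blast
  show "tmult A B (tmult A B (ten A B a b) u) v = tmult A B (ten A B a b) (tmult A B u v)"
  proof (rule tcar_eqI[OF _ _ vector_space_fscale _ u])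
    show "linear_on fscale fscale (tcar A B) (\<lambda>u. tmult A B (tmult A B (ten A B a b) u) v)"
      by (rule linear_on_comp[OF tmult_lin2[OF 1] tmult_lin1[OF v]]) (use tmult_tcar 1 in blast)
    show "linear_on fscale fscale (tcar A B) (\<lambda>u. tmult A B (ten A B a b) (tmult A B u v))"
      by (rule linear_on_comp[OF tmult_lin1[OF v] tmult_lin2[OF 1]]) (use tmult_tcar v in blast)
    fix i' j' a' b' assume ab': "a' \<in> gr A i'" "b' \<in> gr B j'"
    then have 2: "ten A B a' b' \<in> tcar A B" using ten_tcar A.gr_C B.gr_C by blast
    show "tmult A B (tmult A B (ten A B a b) (ten A B a' b')) v =
      tmult A B (ten A B a b) (tmult A B (ten A B a' b') v)"
    proof (rule tcar_eqI[OF tmult_lin2[OF tmult_tcar[OF 1 2]] _ vector_space_fscale _ v])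
      show "linear_on fscale fscale (tcar A B) (\<lambda>v. tmult A B (ten A B a b) (tmult A B (ten A B a' b') v))"
        by (rule linear_on_comp[OF tmult_lin2[OF 2] tmult_lin2[OF 1]]) (use tmult_tcar 2 in blast)
    qed (use tmult_assoc_pure[OF ab ab'] in blast)
  qed
qed

lemma graded_algebra_talg: "graded_algebra (talg A B)"
  unfolding graded_algebra_def hcarrier_talg talg_simps
proof (intro conjI allI ballI)
  let ?u = "ten A B (unit A) (unit B)"
  have u: "?u \<in> tcar A B" using ten_tcar A.unit_C B.unit_C by blast
  show "graded_space fscale (gr (talg A B))" by (rule graded_space_talg)
  show "?u \<in> gr (talg A B) 0"
    using talg_gr_base[OF A.unit_gr B.unit_gr] by simp
  show "tmult A B ?u t = t" if t: "t \<in> tcar A B" for t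
    by (rule tcar_eqI[OF tmult_lin2[OF u] linear_on_ident(1) vector_space_fscale _ t])
      (simp add: tmult_ten[OF A.unit_gr B.unit_gr] A.unit_l B.unit_l A.gr_C B.gr_C)
  show "tmult A B t ?u = t" if t: "t \<in> tcar A B" for t
    by (rule tcar_eqI[OF tmult_lin1[OF u] linear_on_ident(1) vector_space_fscale _ t])
      (simp add: tmult_ten[OF _ _ A.unit_gr B.unit_gr] A.unit_r B.unit_r A.gr_C B.gr_C)
qed (use tmult_gr tmult_lin1 tmult_lin2 tmult_assoc in blast)+

sublocale T: galg "talg A B" by unfold_locales (rule graded_algebra_talg)

end


section \<open>Homomorphisms of graded algebras\<close>

definition alg_hom :: "('k::field, 'a::ab_group_add) hopf \<Rightarrow> ('k, 'b::ab_group_add) hopf \<Rightarrow> ('a \<Rightarrow> 'b) \<Rightarrow> bool" where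
  "alg_hom A B f \<longleftrightarrow> linear_on (scl A) (scl B) (hcarrier A) f \<and> (\<forall>n. f ` gr A n \<subseteq> gr B n) \<and>
     f (unit A) = unit B \<and> (\<forall>a\<in>hcarrier A. \<forall>b\<in>hcarrier A. f (mult A a b) = mult B (f a) (f b))"

lemma alg_homD:
  assumes "alg_hom A B f"
  shows "linear_on (scl A) (scl B) (hcarrier A) f" "a \<in> gr A n \<Longrightarrow> f a \<in> gr B n"
    "f (unit A) = unit B"
    "a \<in> hcarrier A \<Longrightarrow> b \<in> hcarrier A \<Longrightarrow> f (mult A a b) = mult B (f a) (f b)"
  using assms by (auto simp: alg_hom_def)

context galg2 begin

lemma alg_hom_C: "alg_hom A B f \<Longrightarrow> a \<in> hcarrier A \<Longrightarrow> f a \<in> hcarrier B"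
  by (rule A.C_image[OF alg_homD(1) B.vs B.sub_C]) (auto dest: alg_homD(2) intro: B.gr_C)

text \<open>Both sides of the multiplicativity equation are bilinear, so homogeneous elements suffice.\<close>

lemma alg_homI:
  assumes f: "linear_on (scl A) (scl B) (hcarrier A) f" and gr: "\<And>n a. a \<in> gr A n \<Longrightarrow> f a \<in> gr B n"
    and u: "f (unit A) = unit B"
    and m: "\<And>i j a b. a \<in> gr A i \<Longrightarrow> b \<in> gr A j \<Longrightarrow> f (mult A a b) = mult B (f a) (f b)"
  shows "alg_hom A B f"
proof -
  have C: "f a \<in> hcarrier B" if "a \<in> hcarrier A" for a
    by (rule A.C_image[OF f B.vs B.sub_C _ that]) (auto dest: gr intro: B.gr_C)
  have "f (mult A a b) = mult B (f a) (f b)" if a: "a \<in> hcarrier A" and b: "b \<in> hcarrier A" for a b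
  proof (rule A.C_eqI[OF _ _ B.vs _ a])
    show "linear_on (scl A) (scl B) (hcarrier A) (\<lambda>a. f (mult A a b))"
      by (rule linear_on_comp[OF A.mult_lin1[OF b] f]) (use A.mult_C b in blast)
    show "linear_on (scl A) (scl B) (hcarrier A) (\<lambda>a. mult B (f a) (f b))"
      by (rule linear_on_comp[OF f B.mult_lin1[OF C[OF b]]]) (use C in blast)
    fix n a assume a: "a \<in> gr A n"
    show "f (mult A a b) = mult B (f a) (f b)"
    proof (rule A.C_eqI[OF _ _ B.vs _ b])
      show "linear_on (scl A) (scl B) (hcarrier A) (\<lambda>b. f (mult A a b))"
        by (rule linear_on_comp[OF A.mult_lin2[OF A.gr_C[OF a]] f]) (use A.mult_C A.gr_C a in blast)
      show "linear_on (scl A) (scl B) (hcarrier A) (\<lambda>b. mult B (f a) (f b))"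
        by (rule linear_on_comp[OF f B.mult_lin2[OF C[OF A.gr_C[OF a]]]]) (use C in blast)
    qed (use m a in blast)
  qed
  then show ?thesis using f gr u by (auto simp: alg_hom_def)
qed

end

lemma alg_hom_comp:
  assumes "graded_algebra A" "graded_algebra B" "alg_hom A B f" "alg_hom B C g"
  shows "alg_hom A C (\<lambda>x. g (f x))"
proof -
  interpret galg2 A B by unfold_locales (fact assms)+
  have C: "f a \<in> hcarrier B" if "a \<in> hcarrier A" for a using alg_hom_C[OF assms(3) that] .
  note f = alg_homD[OF assms(3)] and g = alg_homD[OF assms(4)]
  show ?thesis unfolding alg_hom_def
  proof (intro conjI allI ballI)
    show "linear_on (scl A) (scl C) (hcarrier A) (\<lambda>x. g (f x))"
      by (rule linear_on_comp[OF f(1) g(1)]) (use C in blast)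
    show "(\<lambda>x. g (f x)) ` gr A n \<subseteq> gr C n" for n using f(2) g(2) by blast
  qed (simp_all add: f(3,4) g(3,4) C)
qed

lemma alg_hom_ident: "alg_hom A A (\<lambda>x. x)"
  by (simp add: alg_hom_def linear_on_ident)

text \<open>Pure tensors of homogeneous elements span, which reduces multiplicativity to their products, where
  the Koszul sign is explicit.\<close>

lemma alg_hom_from_talg:
  assumes "graded_algebra A" "graded_algebra B" "graded_algebra C"
    and F: "linear_on fscale (scl C) (tcar A B) F"
    and gr: "\<And>i j a b. a \<in> gr A i \<Longrightarrow> b \<in> gr B j \<Longrightarrow> F (ten A B a b) \<in> gr C (i + j)"
    and u: "F (ten A B (unit A) (unit B)) = unit C"
    and m: "\<And>i j r l a b c d. a \<in> gr A i \<Longrightarrow> b \<in> gr B j \<Longrightarrow> c \<in> gr A r \<Longrightarrow> d \<in> gr B l \<Longrightarrow>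
      scl C ((-1) ^ (j * r)) (F (ten A B (mult A a c) (mult B b d))) =
        mult C (F (ten A B a b)) (F (ten A B c d))"
  shows "alg_hom (talg A B) C F"
proof -
  interpret galg2 A B by unfold_locales (fact assms)+
  interpret C: galg C by unfold_locales (fact assms)
  interpret TC: galg2 "talg A B" C by unfold_locales
  have FC: "F t \<in> hcarrier C" if "t \<in> tcar A B" for t
    by (rule tcar_image[OF F C.vs C.sub_C _ that]) (use gr C.gr_C in blast)
  show ?thesis
  proof (rule TC.alg_homI)
    show "linear_on (scl (talg A B)) (scl C) (hcarrier (talg A B)) F"
      using F by (simp add: hcarrier_talg)
    show "F (unit (talg A B)) = unit C" using u by simp
    show "F a \<in> gr C n" if "a \<in> gr (talg A B) n" for n a
      by (rule talg_gr_image[OF F C.vs C.sub_gr _ that]) (use gr in blast)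
    fix i j t s assume ts: "t \<in> gr (talg A B) i" "s \<in> gr (talg A B) j"
    then have t: "t \<in> tcar A B" and s: "s \<in> tcar A B" using talg_gr_tcar by auto
    have "F (tmult A B t s) = mult C (F t) (F s)"
    proof (rule tcar_eqI[OF _ _ C.vs _ t])
      show "linear_on fscale (scl C) (tcar A B) (\<lambda>t. F (tmult A B t s))"
        by (rule linear_on_comp[OF tmult_lin1[OF s] F]) (use tmult_tcar s in blast)
      show "linear_on fscale (scl C) (tcar A B) (\<lambda>t. mult C (F t) (F s))"
        by (rule linear_on_comp[OF F C.mult_lin1[OF FC[OF s]]]) (use FC in blast)
      fix i j a b assume ab: "a \<in> gr A i" "b \<in> gr B j"
      then have abC: "ten A B a b \<in> tcar A B" using ten_tcar A.gr_C B.gr_C by blast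
      show "F (tmult A B (ten A B a b) s) = mult C (F (ten A B a b)) (F s)"
      proof (rule tcar_eqI[OF _ _ C.vs _ s])
        show "linear_on fscale (scl C) (tcar A B) (\<lambda>s. F (tmult A B (ten A B a b) s))"
          by (rule linear_on_comp[OF tmult_lin2[OF abC] F]) (use tmult_tcar abC in blast)
        show "linear_on fscale (scl C) (tcar A B) (\<lambda>s. mult C (F (ten A B a b)) (F s))"
          by (rule linear_on_comp[OF F C.mult_lin2[OF FC[OF abC]]]) (use FC in blast)
        fix r l c d assume cd: "c \<in> gr A r" "d \<in> gr B l"
        have "ten A B (mult A a c) (mult B b d) \<in> tcar A B"
          by (rule ten_tcar[OF A.mult_C[OF A.gr_C[OF ab(1)] A.gr_C[OF cd(1)]] B.mult_C[OF B.gr_C[OF ab(2)] B.gr_C[OF cd(2)]]])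
        from linear_on_scale[OF F this]
        show "F (tmult A B (ten A B a b) (ten A B c d)) = mult C (F (ten A B a b)) (F (ten A B c d))"
          unfolding tmult_ten[OF ab cd] m[OF ab cd, symmetric] .
      qed
    qed
    then show "F (mult (talg A B) t s) = mult C (F t) (F s)" by simp
  qed
qed

abbreviation tmap where
  "tmap A B C D f g \<equiv> tensor_map (scl A) (scl B) (scl C) (scl D) (hcarrier A) (hcarrier B) f g"

lemma tmap_lin:
  assumes "graded_algebra A" "graded_algebra B" "graded_algebra C" "graded_algebra D"
    and f: "alg_hom A C f" and g: "alg_hom B D g"
  shows "linear_on fscale fscale (tcar A B) (tmap A B C D f g)"
    and "\<And>a b. a \<in> hcarrier A \<Longrightarrow> b \<in> hcarrier B \<Longrightarrow> tmap A B C D f g (ten A B a b) = ten C D (f a) (g b)"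
proof -
  interpret galg2 A B by unfold_locales (fact assms)+
  interpret CD: galg2 C D by unfold_locales (fact assms)+
  note * = tensor_map_linear[OF A.vs B.vs CD.A.vs CD.B.vs A.sub_C B.sub_C alg_homD(1)[OF f] alg_homD(1)[OF g]]
  show "linear_on fscale fscale (tcar A B) (tmap A B C D f g)" by (rule *)
  show "\<And>a b. a \<in> hcarrier A \<Longrightarrow> b \<in> hcarrier B \<Longrightarrow> tmap A B C D f g (ten A B a b) = ten C D (f a) (g b)"
    using *(2) by (simp add: ten_def)
qed

lemma alg_hom_tmap:
  assumes "graded_algebra A" "graded_algebra B" "graded_algebra C" "graded_algebra D"
    and f: "alg_hom A C f" and g: "alg_hom B D g"
  shows "alg_hom (talg A B) (talg C D) (tmap A B C D f g)"
proof -
  interpret galg2 A B by unfold_locales (fact assms)+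
  interpret CD: galg2 C D by unfold_locales (fact assms)+
  note * = tmap_lin[OF assms]
  note f' = alg_homD[OF f] and g' = alg_homD[OF g]
  show ?thesis
  proof (rule alg_hom_from_talg[OF assms(1,2) CD.T.ga])
    show "linear_on fscale (scl (talg C D)) (tcar A B) (tmap A B C D f g)" using *(1) by simp
    show "tmap A B C D f g (ten A B a b) \<in> gr (talg C D) (i + j)" if "a \<in> gr A i" "b \<in> gr B j" for a b i j
      using that *(2) A.gr_C B.gr_C f'(2) g'(2) by (auto intro!: CD.talg_gr_base)
    show "tmap A B C D f g (ten A B (unit A) (unit B)) = unit (talg C D)"
      by (simp add: *(2) A.unit_C B.unit_C f' g')
    fix i j r l a b c d assume h: "a \<in> gr A i" "b \<in> gr B j" "c \<in> gr A r" "d \<in> gr B l"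
    note hC = A.gr_C[OF h(1)] B.gr_C[OF h(2)] A.gr_C[OF h(3)] B.gr_C[OF h(4)]
    show "scl (talg C D) ((- 1) ^ (j * r)) (tmap A B C D f g (ten A B (mult A a c) (mult B b d))) =
        mult (talg C D) (tmap A B C D f g (ten A B a b)) (tmap A B C D f g (ten A B c d))"
      unfolding *(2)[OF hC(1,2)] *(2)[OF hC(3,4)] *(2)[OF A.mult_C[OF hC(1,3)] B.mult_C[OF hC(2,4)]]
        talg_simps CD.tmult_ten[OF f'(2)[OF h(1)] g'(2)[OF h(2)] f'(2)[OF h(3)] g'(2)[OF h(4)]]
        f'(4)[OF hC(1,3)] g'(4)[OF hC(2,4)] ..
  qed
qed

text \<open>Reassociation of triple tensor products.\<close>

definition tassoc :: "('k::field, 'a::ab_group_add) hopf \<Rightarrow> ('k, ('k, 'a, 'a) tensor, 'a) tensor \<Rightarrow>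
    ('k, 'a, ('k, 'a, 'a) tensor) tensor" where
  "tassoc A = lin_ext fscale fscale (hcarrier A \<times> hcarrier A \<times> hcarrier A)
      (\<lambda>(x, y, z). tensor fscale (scl A) (ten A A x y) z)
      (\<lambda>(x, y, z). tensor (scl A) fscale x (ten A A y z))"

lemma tassoc:
  assumes "graded_algebra A"
  shows "linear_on fscale fscale (tcar (talg A A) A) (tassoc A)"
    and "x \<in> hcarrier A \<Longrightarrow> y \<in> hcarrier A \<Longrightarrow> z \<in> hcarrier A \<Longrightarrow>
      tassoc A (ten (talg A A) A (ten A A x y) z) = ten A (talg A A) x (ten A A y z)"
proof -
  interpret galg2 A A by unfold_locales (fact assms)+
  let ?C = "hcarrier A"
  let ?X = "?C \<times> ?C \<times> ?C"
  have "\<exists>G. linear_on fscale fscale (tcar A A) G \<and> (\<forall>x\<in>?C. \<forall>y\<in>?C. G (ten A A x y) = ten A (talg A A) x (ten A A y z))"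
    if z: "z \<in> ?C" for z
  proof -
    have 1: "linear_on (scl A) fscale ?C (\<lambda>y. ten A (talg A A) v (ten A A y z))" for v
      unfolding ten_def talg_simps
      by (rule linear_on_comp[OF tensor_lin1 tensor_lin2[where W = UNIV]]) auto
    have 2: "linear_on (scl A) fscale ?C (\<lambda>v. ten A (talg A A) v (ten A A w z))" for w
      unfolding ten_def talg_simps by (rule tensor_lin1)
    show ?thesis
      by (rule tensor_lift[OF A.vs A.vs vector_space_fscale A.sub_C A.sub_C 1 2]) (auto simp: ten_def)
  qed
  then obtain g where g: "\<And>z. z \<in> ?C \<Longrightarrow> linear_on fscale fscale (tcar A A) (g z)"
    "\<And>x y z. x \<in> ?C \<Longrightarrow> y \<in> ?C \<Longrightarrow> z \<in> ?C \<Longrightarrow> g z (ten A A x y) = ten A (talg A A) x (ten A A y z)"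
    by metis
  have g2: "linear_on (scl A) fscale ?C (\<lambda>z. g z t)" if t: "t \<in> tcar A A" for t
    unfolding linear_on_def
  proof (intro conjI ballI allI)
    fix z w c assume zw: "z \<in> ?C" "w \<in> ?C"
    then have s: "z + w \<in> ?C" using A.subspace_add[OF A.sub_C] by blast
    have "ten A (talg A A) x (ten A A y (z + w)) = ten A (talg A A) x (ten A A y z) + ten A (talg A A) x (ten A A y w)" for x y
      using linear_on_comp[OF tensor_bilinear(2)[of "scl A" "scl A" y] tensor_bilinear(2)[of fscale "scl A" x]]
      by (simp add: linear_on_def ten_def)
    then show "g (z + w) t = g z t + g w t"
      by (intro tcar_eqI[OF g(1)[OF s] linear_on_plus[OF g(1)[OF zw(1)] g(1)[OF zw(2)] vector_space_fscale] vector_space_fscale _ t])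
        (use zw s A.gr_C g(2) in simp)
  next
    fix z c assume z: "z \<in> ?C"
    then have s: "scl A c z \<in> ?C" using A.scale_C by blast
    have "ten A (talg A A) x (ten A A y (scl A c z)) = fscale c (ten A (talg A A) x (ten A A y z))" for x y
      using linear_on_comp[OF tensor_bilinear(2)[of "scl A" "scl A" y] tensor_bilinear(2)[of fscale "scl A" x]]
      by (simp add: linear_on_def ten_def)
    then show "g (scl A c z) t = fscale c (g z t)"
      by (intro tcar_eqI[OF g(1)[OF s] linear_on_scaled[OF g(1)[OF z] vector_space_fscale] vector_space_fscale _ t])
        (use z s A.gr_C g(2) in simp)
  qed
  obtain G where G: "linear_on fscale fscale (tspan fscale (scl A) (tcar A A) ?C) G"
    "\<And>t z. t \<in> tcar A A \<Longrightarrow> z \<in> ?C \<Longrightarrow> G (tensor fscale (scl A) t z) = g z t"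
    by (rule tensor_lift[where V = "tcar A A" and W = ?C and h = "\<lambda>t z. g z t",
          OF vector_space_fscale A.vs vector_space_fscale subspace_tspan A.sub_C g2 g(1)]) (assumption | rule that)+
  have span: "tcar (talg A A) A = module.span fscale ((\<lambda>(x, y, z). tensor fscale (scl A) (ten A A x y) z) ` ?X)"
  proof -
    have sp: "A.span ?C = ?C" using A.span_eq_iff A.sub_C by blast
    have "tcar (talg A A) A = module.span fscale ((\<lambda>(v, w). tensor fscale (scl A) v w) `
        ((\<lambda>(v, w). tensor (scl A) (scl A) v w) ` (?C \<times> ?C) \<times> ?C))"
      using tspan_span[OF vector_space_fscale A.vs, of "(\<lambda>(v, w). tensor (scl A) (scl A) v w) ` (?C \<times> ?C)" ?C]
        unfolding sp hcarrier_talg talg_simps tspan_def[of "scl A" "scl A"] .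
    also have "(\<lambda>(v, w). tensor fscale (scl A) v w) ` ((\<lambda>(v, w). tensor (scl A) (scl A) v w) ` (?C \<times> ?C) \<times> ?C)
      = (\<lambda>(x, y, z). tensor fscale (scl A) (ten A A x y) z) ` ?X"
      by (force simp: ten_def)
    finally show ?thesis .
  qed
  have G': "linear_on fscale fscale (fs.span ((\<lambda>(x, y, z). tensor fscale (scl A) (ten A A x y) z) ` ?X)) G"
    using G(1) unfolding span[symmetric] by (simp add: hcarrier_talg)
  have eq: "G ((\<lambda>(x, y, z). tensor fscale (scl A) (ten A A x y) z) w) = (\<lambda>(x, y, z). tensor (scl A) fscale x (ten A A y z)) w"
    if "w \<in> ?X" for w
    using that ten_tcar by (auto simp: G(2) g(2) ten_def[of A "talg A A"])
  have T: "tassoc A t = G t" if "t \<in> tcar (talg A A) A" for t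
    unfolding tassoc_def
    by (rule lin_ext_eqI[where e = "\<lambda>(x, y, z). tensor fscale (scl A) (ten A A x y) z"
          and h = "\<lambda>(x, y, z). tensor (scl A) fscale x (ten A A y z)" and X = ?X,
          OF vector_space_fscale vector_space_fscale G' eq that[unfolded span]])
  show "linear_on fscale fscale (tcar (talg A A) A) (tassoc A)"
    by (rule linear_on_cong[OF _ T vector_space_fscale subspace_tspan]) (use G(1) in \<open>simp add: hcarrier_talg\<close>)
  show "tassoc A (ten (talg A A) A (ten A A x y) z) = ten A (talg A A) x (ten A A y z)"
    if "x \<in> ?C" "y \<in> ?C" "z \<in> ?C"
  proof -
    have m: "ten (talg A A) A (ten A A x y) z \<in> tcar (talg A A) A"
      using that ten_tcar unfolding ten_def[of "talg A A"] by (intro tspan_base) (auto simp: hcarrier_talg)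
    show ?thesis using T[OF m] eq[of "(x, y, z)"] that by (simp add: ten_def[of "talg A A" A] ten_def[of A "talg A A"])
  qed
qed


section \<open>Reduced traces\<close>

locale traces =
  fixes comm :: "nat \<Rightarrow> nat \<Rightarrow> bool"
  assumes comm_sym: "comm i j \<Longrightarrow> comm j i" and comm_irrefl: "\<not> comm i i"
begin

definition dproj :: "nat \<Rightarrow> nat \<Rightarrow> (nat \<times> 'x) list \<Rightarrow> (nat \<times> 'x) list" where
  "dproj i j w = filter (\<lambda>l. fst l = i \<or> fst l = j) w"

text \<open>Two words are equivalent up to commutations of adjacent letters if and only if they have
  the same projections to all pairs of dependent indices.\<close>

definition teq :: "(nat \<times> 'x) list \<Rightarrow> (nat \<times> 'x) list \<Rightarrow> bool" where
  "teq w w' \<longleftrightarrow> (\<forall>i j. \<not> comm i j \<longrightarrow> dproj i j w = dproj i j w')"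

text \<open>A trace is represented by a chosen word of its class, so that equality of traces is equality of
  lists.\<close>

definition trep :: "(nat \<times> 'x) list \<Rightarrow> (nat \<times> 'x) list" where
  "trep w = (SOME w'. teq w w')"

definition tcons :: "nat \<times> 'x \<Rightarrow> (nat \<times> 'x) list \<Rightarrow> (nat \<times> 'x) list" where
  "tcons l t = trep (l # t)"

text \<open>The indices of the letters that can be moved to the front.\<close>

definition tinit :: "(nat \<times> 'x) list \<Rightarrow> nat set" where
  "tinit w = {i. \<forall>j. \<not> comm i j \<longrightarrow> dproj i j w \<noteq> [] \<and> fst (hd (dproj i j w)) = i}"

text \<open>Reduced traces over the alphabets \<open>B i\<close>: a letter may be put in front only if no letter with the
  same index can be moved there.\<close>

inductive_set tset :: "(nat \<Rightarrow> 'x set) \<Rightarrow> (nat \<times> 'x) list set" for B where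
  nil: "[] \<in> tset B"
| cons: "t \<in> tset B \<Longrightarrow> i \<notin> tinit t \<Longrightarrow> b \<in> B i \<Longrightarrow> tcons (i, b) t \<in> tset B"

lemma teq_trep: "teq w (trep w)"
  unfolding trep_def by (rule someI[of _ w]) (simp add: teq_def)

lemma trep_eq_iff: "trep w = trep w' \<longleftrightarrow> teq w w'"
proof
  assume "trep w = trep w'"
  then show "teq w w'" using teq_trep[of w] teq_trep[of w'] by (simp add: teq_def)
next
  assume "teq w w'"
  then have "teq w = teq w'" by (auto simp: fun_eq_iff teq_def)
  then show "trep w = trep w'" by (simp add: trep_def)
qed

lemma trep_trep: "trep (trep w) = trep w"
  using teq_trep[of w] by (simp add: trep_eq_iff) (simp add: teq_def)

lemma teq_Cons: "teq w w' \<Longrightarrow> teq (l # w) (l # w')"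
  by (simp add: teq_def dproj_def)

lemma tcons_trep: "tcons l (trep w) = tcons l w"
  unfolding tcons_def trep_eq_iff using teq_Cons[OF teq_trep[of w]] by (simp add: teq_def)

lemma teq_dproj_self: "teq w w' \<Longrightarrow> filter (\<lambda>x. fst x = i) w = filter (\<lambda>x. fst x = i) w'"
  using comm_irrefl[of i] by (force simp: teq_def dproj_def)

lemma teq_mset:
  fixes w w' :: "(nat \<times> 'b) list"
  assumes "teq w w'" shows "mset w = mset w'"
proof (rule multiset_eqI)
  fix l :: "nat \<times> 'b"
  have "filter (\<lambda>x. x = l) w = filter (\<lambda>x. x = l) (filter (\<lambda>x. fst x = fst l) w)" for w :: "(nat \<times> 'b) list"
    by (induction w) auto
  then have "filter (\<lambda>x. x = l) w = filter (\<lambda>x. x = l) w'"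
    using teq_dproj_self[OF assms, of "fst l"] by metis
  moreover have "count (mset w) l = length (filter (\<lambda>x. x = l) w)" for w :: "(nat \<times> 'b) list"
    by (induction w) auto
  ultimately show "count (mset w) l = count (mset w') l" by simp
qed

lemma mset_tcons: "mset (tcons l t) = add_mset l (mset t)"
  using teq_mset[OF teq_trep[of "l # t"]] by (simp add: tcons_def)

lemma sum_tcons: "(\<Sum>x\<leftarrow>tcons l t. f x) = (f l + (\<Sum>x\<leftarrow>t. f x) :: nat)"
proof -
  have "sum_mset (image_mset f (mset (tcons l t))) = sum_mset (image_mset f (mset (l # t)))"
    by (simp add: mset_tcons)
  then show ?thesis by (simp only: sum_mset_sum_list mset_map[symmetric]) simp
qed

lemma length_tcons: "length (tcons l t) = Suc (length t)"
  using arg_cong[OF mset_tcons[of l t], of size] by simp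

lemma trep_nil: "trep [] = []"
  using teq_mset[OF teq_trep[of "[]"]] by simp

lemma trep_tset: "t \<in> tset B \<Longrightarrow> trep t = t"
  by (induction rule: tset.induct) (simp_all add: trep_nil tcons_def trep_trep)

lemma tinit_teq: "teq w w' \<Longrightarrow> tinit w = tinit w'"
  by (auto simp: tinit_def teq_def)

lemma tinit_nil [simp]: "tinit [] = {}"
  using comm_irrefl by (auto simp: tinit_def dproj_def)

lemma tinit_tcons: "tinit (tcons (i, b) t) = insert i {j \<in> tinit t. comm i j}"
proof -
  have "tinit (tcons (i, b) t) = tinit ((i, b) # t)"
    unfolding tcons_def using tinit_teq[OF teq_trep] by blast
  also have "\<dots> = insert i {j \<in> tinit t. comm i j}"
  proof (intro set_eqI iffI)
    fix j assume j: "j \<in> tinit ((i, b) # t)"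
    show "j \<in> insert i {j \<in> tinit t. comm i j}"
    proof (cases "j = i")
      case False
      have c: "comm i j"
      proof (rule ccontr)
        assume "\<not> comm i j"
        then have "\<not> comm j i" using comm_sym by blast
        then have "fst (hd (dproj j i ((i, b) # t))) = j" using j by (simp add: tinit_def)
        then show False using False by (simp add: dproj_def)
      qed
      have "dproj j k ((i, b) # t) = dproj j k t" if "\<not> comm j k" for k
        using that c comm_sym False by (auto simp: dproj_def)
      then show ?thesis using j c by (auto simp: tinit_def)
    qed simp
  next
    fix j assume "j \<in> insert i {j \<in> tinit t. comm i j}"
    then consider "j = i" | "j \<noteq> i" "comm i j" "j \<in> tinit t" using comm_irrefl by auto
    then show "j \<in> tinit ((i, b) # t)"
    proof cases
      case 2
      have "dproj j k ((i, b) # t) = dproj j k t" if "\<not> comm j k" for k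
        using that 2 comm_sym by (auto simp: dproj_def)
      then show ?thesis using 2 by (auto simp: tinit_def)
    qed (simp add: tinit_def dproj_def)
  qed
  finally show ?thesis .
qed

lemma tinit_clique: "i \<in> tinit t \<Longrightarrow> j \<in> tinit t \<Longrightarrow> i \<noteq> j \<Longrightarrow> comm i j"
proof (rule ccontr)
  assume ij: "i \<in> tinit t" "j \<in> tinit t" "i \<noteq> j" "\<not> comm i j"
  then have "\<not> comm j i" using comm_sym by blast
  then have "fst (hd (dproj j i t)) = j" using ij(2) by (simp add: tinit_def)
  moreover have "fst (hd (dproj i j t)) = i" using ij(1,4) by (simp add: tinit_def)
  moreover have "dproj i j t = dproj j i t" unfolding dproj_def by (rule filter_cong) auto
  ultimately show False using ij(3) by simp
qed

lemma tcons_commute: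
  assumes "comm i j" shows "tcons (i, b) (tcons (j, c) t) = tcons (j, c) (tcons (i, b) t)"
proof -
  have "teq ((i, b) # (j, c) # t) ((j, c) # (i, b) # t)"
    using assms comm_sym comm_irrefl by (auto simp: teq_def dproj_def)
  then show ?thesis
    unfolding tcons_def[of "(j, c)"] tcons_def[of "(i, b)" t] tcons_trep
    by (simp add: tcons_def trep_eq_iff)
qed

lemma tcons_inject:
  assumes "trep t = t" "trep s = s" "tcons (i, b) t = tcons (i, c) s"
  shows "b = c \<and> t = s"
proof -
  have e: "teq ((i, b) # t) ((i, c) # s)" using assms(3) by (simp add: tcons_def trep_eq_iff)
  have "dproj i i ((i, b) # t) = dproj i i ((i, c) # s)"
    using e comm_irrefl unfolding teq_def by blast
  then have b: "b = c" by (simp add: dproj_def)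
  have "dproj k l t = dproj k l s" if "\<not> comm k l" for k l
  proof -
    have "dproj k l ((i, b) # t) = dproj k l ((i, c) # s)" using e that by (simp add: teq_def)
    then show ?thesis by (simp add: dproj_def split: if_splits)
  qed
  then have "trep t = trep s" by (simp add: trep_eq_iff teq_def)
  then show ?thesis using assms b by simp
qed

text \<open>Induction on the trace: an initial letter other than the one put in front last commutes with the
  latter, and can therefore be extracted before it.\<close>

lemma tset_split:
  assumes "t \<in> tset B" "i \<in> tinit t"
  shows "\<exists>b r. b \<in> B i \<and> r \<in> tset B \<and> i \<notin> tinit r \<and> t = tcons (i, b) r"
  using assms
proof (induction arbitrary: i rule: tset.induct)
  case (cons s j c)
  show ?case
  proof (cases "i = j")
    case True then show ?thesis using cons by blast
  next
    case False
    then have c: "comm j i" "i \<in> tinit s" using cons.prems by (auto simp: tinit_tcons)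
    then obtain b r where r: "b \<in> B i" "r \<in> tset B" "i \<notin> tinit r" "s = tcons (i, b) r"
      using cons.IH by blast
    have j: "j \<notin> tinit r" using cons.hyps r c comm_sym by (auto simp: tinit_tcons)
    have "tcons (j, c) s = tcons (i, b) (tcons (j, c) r)" using tcons_commute[OF c(1)] r by simp
    moreover have "tcons (j, c) r \<in> tset B" using r j cons.hyps by (intro tset.cons)
    moreover have "i \<notin> tinit (tcons (j, c) r)" using r False by (auto simp: tinit_tcons)
    ultimately show ?thesis using r by blast
  qed
qed simp

lemma tset_tinit_empty: "t \<in> tset B \<Longrightarrow> tinit t = {} \<Longrightarrow> t = []"
  by (induction rule: tset.induct) (auto simp: tinit_tcons)

lemma tset_letters: "t \<in> tset B \<Longrightarrow> (i, b) \<in> set t \<Longrightarrow> b \<in> B i"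
proof (induction rule: tset.induct)
  case (cons t j c)
  have "set (tcons (j, c) t) = insert (j, c) (set t)"
    using arg_cong[OF mset_tcons[of "(j, c)" t], of set_mset] by simp
  then show ?case using cons by auto
qed simp

lemma tinit_letters: "i \<in> tinit t \<Longrightarrow> i \<in> fst ` set t"
proof -
  assume "i \<in> tinit t"
  then have "dproj i i t \<noteq> []" using comm_irrefl by (simp add: tinit_def)
  then show ?thesis by (force simp: dproj_def filter_empty_conv)
qed

end


section \<open>Homogeneous bases of connected Hopf algebras\<close>

locale chopf =
  fixes A :: "('k::field, 'a::ab_group_add) hopf"
  assumes ch: "connected_hopf A"
begin

sublocale galg A by unfold_locales (use ch in \<open>simp add: connected_hopf_def\<close>)

lemma comult_lin: "linear_on (scl A) fscale (hcarrier A) (comult A)"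
  and counit_lin: "linear_on (scl A) (*) (hcarrier A) (counit A)"
  and counit_pos: "0 < n \<Longrightarrow> a \<in> gr A n \<Longrightarrow> counit A a = 0"
  and comult_unit: "comult A (unit A) = ten A A (unit A) (unit A)"
  and comult_mult: "a \<in> hcarrier A \<Longrightarrow> b \<in> hcarrier A \<Longrightarrow>
    comult A (mult A a b) = tmult A A (comult A a) (comult A b)"
  and counit_unit: "counit A (unit A) = 1"
  and counit_mult: "a \<in> hcarrier A \<Longrightarrow> b \<in> hcarrier A \<Longrightarrow>
    counit A (mult A a b) = counit A a * counit A b"
  and gr0: "gr A 0 = range (\<lambda>c. scl A c (unit A))"
  and comult_gr: "a \<in> gr A n \<Longrightarrow> comult A a \<in> gr (talg A A) n"
  and coassoc: "a \<in> hcarrier A \<Longrightarrow>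
     tassoc A (tensor_map (scl A) (scl A) fscale (scl A) (hcarrier A) (hcarrier A) (comult A) id (comult A a)) =
     tensor_map (scl A) (scl A) (scl A) fscale (hcarrier A) (hcarrier A) id (comult A) (comult A a)"
  and counit_l: "a \<in> hcarrier A \<Longrightarrow>
     lin_ext fscale (scl A) (hcarrier A \<times> hcarrier A) (\<lambda>(x, y). ten A A x y) (\<lambda>(x, y). scl A (counit A x) y) (comult A a) = a"
  and counit_r: "a \<in> hcarrier A \<Longrightarrow>
     lin_ext fscale (scl A) (hcarrier A \<times> hcarrier A) (\<lambda>(x, y). ten A A x y) (\<lambda>(x, y). scl A (counit A y) x) (comult A a) = a"
  using ch unfolding connected_hopf_def graded_coalgebra_def Let_def tensor_mult_eq tassoc_def
  by (simp_all only: talg_def) (simp_all, blast?)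

sublocale AA: galg2 A A by unfold_locales

lemma alg_hom_comult: "alg_hom A (talg A A) (comult A)"
  unfolding alg_hom_def talg_simps
  by (intro conjI allI ballI image_subsetI comult_lin comult_unit comult_mult comult_gr)

lemma comult_tcar: "a \<in> hcarrier A \<Longrightarrow> comult A a \<in> tcar A A"
  by (rule C_image[OF comult_lin vector_space_fscale subspace_tspan])
    (use comult_gr AA.talg_gr_tcar in blast)+

lemma unit_nonzero: "unit A \<noteq> 0"
  using counit_unit linear_on_zero[OF counit_lin vs vector_space_times subspace_0[OF sub_C]] by auto

end

text \<open>In degree \<open>0\<close> the basis is the unit, so that the remaining basis elements span the augmentation
  ideal.\<close>

definition hbasis :: "('k::field, 'a::ab_group_add) hopf \<Rightarrow> nat \<Rightarrow> 'a set" where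
  "hbasis A n = (if n = 0 then {unit A} else
     (SOME B. B \<subseteq> gr A n \<and> \<not> module.dependent (scl A) B \<and> gr A n = module.span (scl A) B))"

definition hbases :: "('k::field, 'a::ab_group_add) hopf \<Rightarrow> 'a set" where
  "hbases A = (\<Union>n. hbasis A n)"

definition hdeg :: "('k::field, 'a::ab_group_add) hopf \<Rightarrow> 'a \<Rightarrow> nat" where
  "hdeg A b = (THE n. b \<in> hbasis A n)"

text \<open>Extension by linearity, chosen among the maps with the prescribed values on \<open>S\<close>; for independent
  \<open>S\<close> it is determined on the span.\<close>

definition blift :: "('k::field \<Rightarrow> 'b \<Rightarrow> 'b) \<Rightarrow> ('k \<Rightarrow> 'c \<Rightarrow> 'c) \<Rightarrow> 'b::ab_group_add set \<Rightarrow>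
    ('b \<Rightarrow> 'c::ab_group_add) \<Rightarrow> 'b \<Rightarrow> 'c" where
  "blift s1 s2 S f = (SOME g. linear_on s1 s2 (module.span s1 S) g \<and> (\<forall>b\<in>S. g b = f b))"

lemma blift:
  assumes "vector_space s1" "vector_space s2" "\<not> module.dependent s1 S"
  shows "linear_on s1 s2 (module.span s1 S) (blift s1 s2 S f)" "b \<in> S \<Longrightarrow> blift s1 s2 S f b = f b"
proof -
  interpret vector_space_pair s1 s2 using assms by (simp add: vector_space_pair_def)
  obtain g where g: "Vector_Spaces.linear s1 s2 g" "\<forall>x\<in>S. g x = f x"
    using linear_independent_extend[OF assms(3), of f] by blast
  have "\<exists>g. linear_on s1 s2 (module.span s1 S) g \<and> (\<forall>b\<in>S. g b = f b)"
    using g(2) vs_linear_add[OF g(1)] vs_linear_scale[OF g(1)] by (intro exI[of _ g]) (simp add: linear_on_def)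
  from someI_ex[OF this]
  show "linear_on s1 s2 (module.span s1 S) (blift s1 s2 S f)" "b \<in> S \<Longrightarrow> blift s1 s2 S f b = f b"
    unfolding blift_def by blast+
qed

context chopf begin

lemma hbasis: "hbasis A n \<subseteq> gr A n" "independent (hbasis A n)" "gr A n = span (hbasis A n)"
proof -
  have "hbasis A n \<subseteq> gr A n \<and> independent (hbasis A n) \<and> gr A n = span (hbasis A n)"
  proof (cases "n = 0")
    case True
    have "independent {unit A}" using unit_nonzero by simp
    moreover have "span {unit A} = gr A 0" by (simp add: span_singleton gr0)
    ultimately show ?thesis using True unit_gr by (simp add: hbasis_def)
  next
    case False
    obtain B where B: "B \<subseteq> gr A n" "independent B" "gr A n \<subseteq> span B"
      using maximal_independent_subset by blast
    have "span B = gr A n" using B sub_gr by (simp add: span_minimal subset_antisym)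
    then have "\<exists>B. B \<subseteq> gr A n \<and> independent B \<and> gr A n = span B" using B by blast
    from someI_ex[OF this] show ?thesis using False by (simp add: hbasis_def)
  qed
  then show "hbasis A n \<subseteq> gr A n" "independent (hbasis A n)" "gr A n = span (hbasis A n)" by blast+
qed

lemma hbasis_0: "hbasis A 0 = {unit A}" by (simp add: hbasis_def)

lemma hbasis_disjoint: "b \<in> hbasis A n \<Longrightarrow> b \<in> hbasis A l \<Longrightarrow> n = l"
proof (rule ccontr)
  assume b: "b \<in> hbasis A n" "b \<in> hbasis A l" "n \<noteq> l"
  have "gproj A n b = b" using gproj_gr[OF subsetD[OF hbasis(1) b(1)], of n] by simp
  moreover have "gproj A n b = 0" using gproj_gr[OF subsetD[OF hbasis(1) b(2)], of n] b(3) by simp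
  ultimately have "b = 0" by simp
  then show False using b hbasis(2)[of n] dependent_zero by auto
qed

lemma hdeg: "b \<in> hbasis A n \<Longrightarrow> hdeg A b = n"
  unfolding hdeg_def using hbasis_disjoint by blast

lemma hdeg_unit: "hdeg A (unit A) = 0" using hdeg hbasis_0 by blast

lemma unit_hbases: "unit A \<in> hbases A" using hbasis_0 by (auto simp: hbases_def)

lemma hbases_gr: "b \<in> hbases A \<Longrightarrow> b \<in> gr A (hdeg A b)"
  using hbasis(1) hdeg by (auto simp: hbases_def)

lemma hbases_C: "b \<in> hbases A \<Longrightarrow> b \<in> hcarrier A" using hbases_gr gr_C by blast

lemma hdeg_zero_iff: "b \<in> hbases A \<Longrightarrow> hdeg A b = 0 \<longleftrightarrow> b = unit A"
  using hdeg hbasis_0 by (auto simp: hbases_def)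

lemma hbases_deg: "{b \<in> hbases A. hdeg A b = n} = hbasis A n"
  using hdeg by (auto simp: hbases_def)

lemma independent_hbases: "independent (hbases A)"
  unfolding dependent_explicit
proof
  assume "\<exists>t u. finite t \<and> t \<subseteq> hbases A \<and> (\<Sum>v\<in>t. scl A (u v) v) = 0 \<and> (\<exists>v\<in>t. u v \<noteq> 0)"
  then obtain t u v where t: "finite t" "t \<subseteq> hbases A" "(\<Sum>v\<in>t. scl A (u v) v) = 0" "v \<in> t" "u v \<noteq> 0"
    by blast
  define n where "n = hdeg A v"
  have "gproj A n (\<Sum>v\<in>s. scl A (u v) v) = (\<Sum>v\<in>s. if hdeg A v = n then scl A (u v) v else 0)"
    if "finite s" "s \<subseteq> hbases A" for s
    using that
  proof (induction s rule: finite_induct)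
    case empty
    show ?case using linear_on_zero[OF gproj_lin vs vs subspace_0[OF sub_C]] by simp
  next
    case (insert x s)
    have x: "scl A (u x) x \<in> gr A (hdeg A x)" using insert hbases_gr scale_gr by blast
    have s: "(\<Sum>v\<in>s. scl A (u v) v) \<in> hcarrier A"
      using insert hbases_C scale_C by (intro subspace_sum[OF sub_C]) blast
    show ?case using insert linear_on_add[OF gproj_lin gr_C[OF x] s] gproj_gr[OF x] by simp
  qed
  from this[OF t(1,2)] have "(\<Sum>v\<in>t. if hdeg A v = n then scl A (u v) v else 0) = 0"
    using t(3) linear_on_zero[OF gproj_lin vs vs subspace_0[OF sub_C]] by simp
  then have "(\<Sum>v\<in>{v\<in>t. hdeg A v = n}. scl A (u v) v) = 0"
    using t(1) by (simp add: sum.inter_filter)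
  moreover have "{v\<in>t. hdeg A v = n} \<subseteq> hbasis A n" using t(2) hbases_deg by blast
  ultimately have "dependent (hbasis A n)"
    unfolding dependent_explicit using t n_def by (intro exI[of _ "{v\<in>t. hdeg A v = n}"] exI[of _ u]) auto
  then show False using hbasis(2) by blast
qed

lemma span_hbases: "span (hbases A) = hcarrier A"
proof
  show "span (hbases A) \<subseteq> hcarrier A" using hbases_C by (intro span_minimal sub_C) blast
  have "gr A n \<subseteq> span (hbases A)" for n
    unfolding hbasis(3)[of n] by (rule span_mono) (auto simp: hbases_def)
  then show "hcarrier A \<subseteq> span (hbases A)" unfolding hcarrier_def by (intro span_minimal) auto
qed

lemma hb_eqI:
  assumes "linear_on (scl A) s (hcarrier A) f" "linear_on (scl A) s (hcarrier A) g" "vector_space s"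
    "\<And>b. b \<in> hbases A \<Longrightarrow> f b = g b" "a \<in> hcarrier A"
  shows "f a = g a"
  by (rule linear_on_eq_on_span[OF assms(1,2)[folded span_hbases] vs assms(3,4)
      assms(5)[folded span_hbases]])

lemma hb_image:
  assumes "linear_on (scl A) s (hcarrier A) f" "vector_space s" "module.subspace s U"
    "\<And>b. b \<in> hbases A \<Longrightarrow> f b \<in> U" "a \<in> hcarrier A"
  shows "f a \<in> U"
  by (rule linear_on_image_span[OF assms(1)[folded span_hbases] vs assms(2,4,3)
      assms(5)[folded span_hbases]])

lemma hb_gr_image:
  assumes "linear_on (scl A) s (hcarrier A) f" "vector_space s" "module.subspace s U"
    "\<And>b. b \<in> hbasis A n \<Longrightarrow> f b \<in> U" "a \<in> gr A n"
  shows "f a \<in> U"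
  by (rule linear_on_image_span[OF linear_on_subset[OF assms(1), of "span (hbasis A n)"] vs assms(2,4,3)
      assms(5)[unfolded hbasis(3)]]) (use gr_C hbasis(3) in blast)+

lemma hb_gr_eqI:
  assumes "linear_on (scl A) s (hcarrier A) f" "linear_on (scl A) s (hcarrier A) g" "vector_space s"
    "\<And>b. b \<in> hbasis A n \<Longrightarrow> f b = g b" "a \<in> gr A n"
  shows "f a = g a"
  by (rule linear_on_eq_on_span[OF linear_on_subset[OF assms(1), of "span (hbasis A n)"]
      linear_on_subset[OF assms(2), of "span (hbasis A n)"] vs assms(3,4)
      assms(5)[unfolded hbasis(3)]]) (use gr_C hbasis(3) in blast)+

lemma hb_lift:
  assumes "vector_space s"
  shows "linear_on (scl A) s (hcarrier A) (blift (scl A) s (hbases A) f)"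
    "b \<in> hbases A \<Longrightarrow> blift (scl A) s (hbases A) f b = f b"
  using blift[OF vs assms independent_hbases] by (simp_all add: span_hbases)

end


section \<open>Letters acting on reduced traces\<close>

lemma minus_one_power_eq: "even (x + y) \<Longrightarrow> (-1 :: 'k::field) ^ x = (-1) ^ y"
  by (auto simp: minus_one_power_iff)

lemma minus_one_power_square: "(-1 :: 'k::field) ^ x * (-1) ^ x = 1"
  by (simp flip: power_add)

locale gprod =
  fixes m :: nat and K :: "nat set set" and A :: "nat \<Rightarrow> ('k::field, 'a::ab_group_add) hopf"
  assumes flag: "flag_complex m K"
    and hopf: "\<And>i. i \<in> {1..m} \<Longrightarrow> connected_hopf (A i)"
begin

definition comm :: "nat \<Rightarrow> nat \<Rightarrow> bool" where "comm i j \<longleftrightarrow> i \<noteq> j \<and> {i, j} \<in> K"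

sublocale traces comm
  by unfold_locales (auto simp: comm_def insert_commute)

lemma chi: "i \<in> {1..m} \<Longrightarrow> chopf (A i)"
  by unfold_locales (rule hopf)

lemma comm_range: "comm i j \<Longrightarrow> i \<in> {1..m}" "comm i j \<Longrightarrow> j \<in> {1..m}"
proof -
  have "K \<subseteq> Pow {1..m}" using flag unfolding flag_complex_def simplicial_complex_def by (rule conjunct1[OF conjunct1])
  then have K: "\<sigma> \<in> K \<Longrightarrow> x \<in> \<sigma> \<Longrightarrow> x \<in> {1..m}" for \<sigma> x by blast
  show "comm i j \<Longrightarrow> i \<in> {1..m}" "comm i j \<Longrightarrow> j \<in> {1..m}"
    unfolding comm_def by (erule conjE, erule K, simp)+
qed

definition Bp :: "nat \<Rightarrow> 'a set" where
  "Bp i = (if i \<in> {1..m} then hbases (A i) - {unit (A i)} else {})"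

definition T :: "(nat \<times> 'a) list set" where "T = tset Bp"

text \<open>A letter \<open>b\<close> with index \<open>i\<close> that is moved past the letters of \<open>t\<close> with smaller index picks up the
  sign with exponent \<open>hdeg (A i) b * dbelow i t\<close>.\<close>

definition dbelow :: "nat \<Rightarrow> (nat \<times> 'a) list \<Rightarrow> nat" where
  "dbelow i t = (\<Sum>l\<leftarrow>t. if fst l < i then hdeg (A (fst l)) (snd l) else 0)"

definition tdeg :: "(nat \<times> 'a) list \<Rightarrow> nat" where
  "tdeg t = (\<Sum>l\<leftarrow>t. hdeg (A (fst l)) (snd l))"

text \<open>The trace \<open>b r\<close>, where the unit of \<^term>\<open>A i\<close> stands for the absence of a letter.\<close>

definition join :: "nat \<Rightarrow> 'a \<Rightarrow> (nat \<times> 'a) list \<Rightarrow> (nat \<times> 'a) list" where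
  "join i b r = (if b = unit (A i) then r else tcons (i, b) r)"

definition U :: "nat \<Rightarrow> (nat \<times> 'a) list set" where "U i = {r \<in> T. i \<notin> tinit r}"

lemma nil_U: "[] \<in> U i" by (simp add: U_def T_def tset.nil)

lemma U_T: "r \<in> U i \<Longrightarrow> r \<in> T" by (simp add: U_def)

lemma T_trep: "t \<in> T \<Longrightarrow> trep t = t" unfolding T_def by (rule trep_tset)

lemma join_T: "i \<in> {1..m} \<Longrightarrow> b \<in> hbases (A i) \<Longrightarrow> r \<in> U i \<Longrightarrow> join i b r \<in> T"
  by (auto simp: join_def U_def T_def Bp_def intro!: tset.cons)

lemma tinit_join: "r \<in> U i \<Longrightarrow> tinit (join i b r) =
    (if b = unit (A i) then tinit r else insert i {j \<in> tinit r. comm i j})"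
  by (simp add: join_def tinit_tcons)

lemma join_inject:
  assumes "r \<in> U i" "s \<in> U i" "join i b r = join i c s" shows "b = c \<and> r = s"
proof (cases "b = unit (A i) \<longleftrightarrow> c = unit (A i)")
  case True
  then show ?thesis
    using assms tcons_inject[of r s i b c] T_trep[OF U_T[OF assms(1)]] T_trep[OF U_T[OF assms(2)]]
    by (auto simp: join_def split: if_splits)
next
  case False
  have "i \<in> tinit (join i b r) \<longleftrightarrow> b \<noteq> unit (A i)" "i \<in> tinit (join i c s) \<longleftrightarrow> c \<noteq> unit (A i)"
    using assms(1,2) by (simp_all add: tinit_join) (simp_all add: U_def)
  then show ?thesis using assms(3) False by auto
qed

lemma join_exists:
  assumes "t \<in> T" "i \<in> {1..m}"
  obtains b r where "b \<in> hbases (A i)" "r \<in> U i" "t = join i b r"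
proof (cases "i \<in> tinit t")
  case True
  then obtain b r where "b \<in> Bp i" "r \<in> T" "i \<notin> tinit r" "t = tcons (i, b) r"
    using tset_split assms unfolding T_def by blast
  then show thesis using that[of b r] assms by (auto simp: join_def U_def Bp_def)
next
  case False
  then show thesis using that[of "unit (A i)" t] assms chopf.unit_hbases[OF chi]
    by (auto simp: join_def U_def)
qed

lemma dbelow_join: "j \<in> {1..m} \<Longrightarrow>
    dbelow i (join j b r) = (if j < i then hdeg (A j) b else 0) + dbelow i r"
  using chopf.hdeg_unit[OF chi] by (auto simp: dbelow_def join_def sum_tcons)

lemma tdeg_join: "j \<in> {1..m} \<Longrightarrow> tdeg (join j b r) = hdeg (A j) b + tdeg r"
  using chopf.hdeg_unit[OF chi] by (auto simp: tdeg_def join_def sum_tcons)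

lemma join_U:
  assumes "comm i j" "r \<in> U i" "r \<in> U j" "b \<in> hbases (A j)" shows "join j b r \<in> U i"
  using join_T[OF comm_range(2)[OF assms(1)] assms(4,3)] assms
  by (auto simp: U_def join_def tinit_tcons comm_def)

lemma join_commute: "comm i j \<Longrightarrow> join i b (join j c r) = join j c (join i b r)"
  using tcons_commute[of i j b c r] by (simp add: join_def)

text \<open>Every trace is uniquely of the form \<open>b r\<close> with \<open>b\<close> in the basis of \<^term>\<open>A i\<close> and no initial letter
  of \<open>r\<close> with index \<open>i\<close>; this recovers \<open>b\<close> and \<open>r\<close>.\<close>

definition dec :: "nat \<Rightarrow> (nat \<times> 'a) list \<Rightarrow> 'a \<times> (nat \<times> 'a) list" where
  "dec i t = (THE p. fst p \<in> hbases (A i) \<and> snd p \<in> U i \<and> t = join i (fst p) (snd p))"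

lemma dec_join: "b \<in> hbases (A i) \<Longrightarrow> r \<in> U i \<Longrightarrow> dec i (join i b r) = (b, r)"
proof -
  assume b: "b \<in> hbases (A i)" "r \<in> U i"
  show ?thesis unfolding dec_def
  proof (rule the_equality)
    fix p assume p: "fst p \<in> hbases (A i) \<and> snd p \<in> U i \<and> join i b r = join i (fst p) (snd p)"
    then show "p = (b, r)" using join_inject[of r i "snd p" b "fst p"] b by (simp add: prod_eq_iff)
  qed (use b in simp)
qed

definition e :: "(nat \<times> 'a) list \<Rightarrow> ('k, 'a) word_space" where
  "e t = (\<lambda>w. if w = t then 1 else 0)"

definition N :: "('k, 'a) word_space set" where "N = module.span fscale (e ` T)"

definition ngr :: "nat \<Rightarrow> ('k, 'a) word_space set" where
  "ngr n = module.span fscale (e ` {t \<in> T. tdeg t = n})"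

lemma e_inj: "inj e"
  by (rule injI) (metis e_def zero_neq_one)

lemma independent_e: "\<not> module.dependent fscale (e ` S)"
  unfolding fs.dependent_explicit
proof
  assume "\<exists>t u. finite t \<and> t \<subseteq> e ` S \<and> (\<Sum>v\<in>t. fscale (u v) v) = 0 \<and> (\<exists>v\<in>t. u v \<noteq> 0)"
  then obtain W u v where W: "finite W" "W \<subseteq> e ` S" "(\<Sum>v\<in>W. fscale (u v) v) = 0" "v \<in> W" "u v \<noteq> 0"
    by blast
  obtain t where t: "v = e t" using W by blast
  have "(\<Sum>v\<in>W'. fscale (u v) v) t = (\<Sum>v\<in>W'. u v * v t)" if "finite W'" for W'
    using that by (induction W' rule: finite_induct) (simp_all add: fscale_def)
  from this[OF W(1)] have "(\<Sum>w\<in>W. u w * w t) = 0" using W(3) by simp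
  moreover have "(\<Sum>w\<in>W. u w * w t) = (\<Sum>w\<in>W. if w = v then u v else 0)"
  proof (rule sum.cong[OF refl])
    fix w assume "w \<in> W"
    then obtain t' where t': "w = e t'" using W(2) by blast
    show "u w * w t = (if w = v then u v else 0)"
    proof (cases "t' = t")
      case False
      then have "w \<noteq> v" unfolding t t' using injD[OF e_inj] by blast
      then show ?thesis using False by (simp add: t' e_def)
    qed (simp add: t t' e_def)
  qed
  ultimately show False using W by simp
qed

lemma subspace_N: "module.subspace fscale N" and subspace_ngr: "module.subspace fscale (ngr n)"
  by (simp_all add: N_def ngr_def)

lemma e_N: "t \<in> T \<Longrightarrow> e t \<in> N" unfolding N_def by (rule fs.span_base) auto

lemma e_ngr: "t \<in> T \<Longrightarrow> tdeg t = n \<Longrightarrow> e t \<in> ngr n"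
  unfolding ngr_def by (rule fs.span_base) auto

lemma ngr_N: "ngr n \<subseteq> N" unfolding ngr_def N_def by (rule fs.span_mono) auto

definition nlift :: "('k \<Rightarrow> 'c \<Rightarrow> 'c) \<Rightarrow> ((nat \<times> 'a) list \<Rightarrow> 'c::ab_group_add) \<Rightarrow> ('k, 'a) word_space \<Rightarrow> 'c" where
  "nlift s h = blift fscale s (e ` T) (\<lambda>v. h (the_inv e v))"

lemma nlift:
  assumes "vector_space s"
  shows "linear_on fscale s N (nlift s h)" "t \<in> T \<Longrightarrow> nlift s h (e t) = h t"
  using blift[OF vector_space_fscale assms independent_e[of T], where f = "\<lambda>v. h (the_inv e v)"]
  unfolding N_def nlift_def by (auto simp: the_inv_f_f[OF e_inj])

lemma N_eqI:
  assumes "linear_on fscale s N F" "linear_on fscale s N G" "vector_space s"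
    "\<And>t. t \<in> T \<Longrightarrow> F (e t) = G (e t)" "x \<in> N"
  shows "F x = G x"
  by (rule linear_on_eq_on_span[OF assms(1,2)[unfolded N_def] vector_space_fscale assms(3) _
      assms(5)[unfolded N_def]]) (use assms(4) in auto)

lemma N_image:
  assumes "linear_on fscale s N F" "vector_space s" "module.subspace s W"
    "\<And>t. t \<in> T \<Longrightarrow> F (e t) \<in> W" "x \<in> N"
  shows "F x \<in> W"
  by (rule linear_on_image_span[OF assms(1)[unfolded N_def] vector_space_fscale assms(2) _ assms(3)
      assms(5)[unfolded N_def]]) (use assms(4) in auto)

lemma ngr_image:
  assumes "linear_on fscale s N F" "vector_space s" "module.subspace s W"
    "\<And>t. t \<in> T \<Longrightarrow> tdeg t = n \<Longrightarrow> F (e t) \<in> W" "x \<in> ngr n"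
  shows "F x \<in> W"
  by (rule linear_on_image_span[OF linear_on_subset[OF assms(1) ngr_N, of n, unfolded ngr_def]
      vector_space_fscale assms(2) _ assms(3) assms(5)[unfolded ngr_def]]) (use assms(4) in auto)

text \<open>The subspace of traces \<open>b r\<close> with fixed \<open>r\<close> is a copy of \<^term>\<open>A i\<close>. The sign says that \<open>b\<close>
  has been moved past the letters of \<open>r\<close> with smaller index.\<close>

definition P :: "nat \<Rightarrow> (nat \<times> 'a) list \<Rightarrow> 'a \<Rightarrow> ('k, 'a) word_space" where
  "P i r = blift (scl (A i)) fscale (hbases (A i))
     (\<lambda>b. fscale ((-1) ^ (hdeg (A i) b * dbelow i r)) (e (join i b r)))"

text \<open>Left multiplication by \<open>a\<close>, which replaces the initial letter \<open>b\<close> with index \<open>i\<close>, or the unit in its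
  place, by \<open>a b\<close>. The two signs make it compatible with \<^const>\<open>P\<close>.\<close>

definition L :: "nat \<Rightarrow> 'a \<Rightarrow> ('k, 'a) word_space \<Rightarrow> ('k, 'a) word_space" where
  "L i a = nlift fscale (\<lambda>t. case dec i t of (b, r) \<Rightarrow>
     fscale ((-1) ^ (hdeg (A i) b * dbelow i r)) (P i r (mult (A i) a b)))"

context
  fixes i assumes i: "i \<in> {1..m}"
begin

interpretation Ai: chopf "A i" by (rule chi[OF i])

lemma P_lin: "linear_on (scl (A i)) fscale (hcarrier (A i)) (P i r)"
  unfolding P_def by (rule Ai.hb_lift(1)[OF vector_space_fscale])

lemma P_basis: "b \<in> hbases (A i) \<Longrightarrow> P i r b = fscale ((-1) ^ (hdeg (A i) b * dbelow i r)) (e (join i b r))"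
  unfolding P_def by (rule Ai.hb_lift(2)[OF vector_space_fscale])

lemma P_unit: "P i r (unit (A i)) = e r"
  using P_basis[OF Ai.unit_hbases] by (simp add: Ai.hdeg_unit join_def)

lemma e_join: "b \<in> hbases (A i) \<Longrightarrow> e (join i b r) = fscale ((-1) ^ (hdeg (A i) b * dbelow i r)) (P i r b)"
  by (simp only: P_basis fs.scale_scale minus_one_power_square fs.scale_one)

lemma P_N: "r \<in> U i \<Longrightarrow> a \<in> hcarrier (A i) \<Longrightarrow> P i r a \<in> N"
  by (rule Ai.hb_image[OF P_lin vector_space_fscale subspace_N])
    (auto simp only: P_basis intro!: fs.subspace_scale[OF subspace_N] e_N join_T[OF i])

lemma P_ngr:
  assumes r: "r \<in> U i" and a: "a \<in> gr (A i) d" shows "P i r a \<in> ngr (d + tdeg r)"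
proof (rule Ai.hb_gr_image[OF P_lin vector_space_fscale subspace_ngr _ a])
  fix b assume b: "b \<in> hbasis (A i) d"
  then have hb: "b \<in> hbases (A i)" and d: "hdeg (A i) b = d" using Ai.hdeg by (auto simp: hbases_def)
  show "P i r b \<in> ngr (d + tdeg r)" unfolding P_basis[OF hb]
    by (intro fs.subspace_scale[OF subspace_ngr] e_ngr join_T[OF i hb r]) (simp add: tdeg_join[OF i] d)
qed

lemma N_eqI_P:
  assumes F: "linear_on fscale s N F" and G: "linear_on fscale s N G" and s: "vector_space s"
    and eq: "\<And>r b. r \<in> U i \<Longrightarrow> b \<in> hbases (A i) \<Longrightarrow> F (P i r b) = G (P i r b)" and x: "x \<in> N"
  shows "F x = G x"
proof (rule N_eqI[OF F G s _ x])
  fix t assume "t \<in> T"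
  then obtain b r where b: "b \<in> hbases (A i)" "r \<in> U i" "t = join i b r" using join_exists[OF _ i] by blast
  have p: "P i r b \<in> N" by (rule P_N[OF b(2) Ai.hbases_C[OF b(1)]])
  show "F (e t) = G (e t)"
    unfolding b(3) e_join[OF b(1)] linear_on_scale[OF F p] linear_on_scale[OF G p] eq[OF b(2,1)] ..
qed

lemma L_lin: "linear_on fscale fscale N (L i a)"
  unfolding L_def by (rule nlift(1)[OF vector_space_fscale])

lemma L_P:
  assumes r: "r \<in> U i" and a: "a \<in> hcarrier (A i)" and b: "b \<in> hcarrier (A i)"
  shows "L i a (P i r b) = P i r (mult (A i) a b)"
proof (rule Ai.hb_eqI[OF _ _ vector_space_fscale _ b])
  show "linear_on (scl (A i)) fscale (hcarrier (A i)) (\<lambda>b. L i a (P i r b))"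
    by (rule linear_on_comp[OF P_lin L_lin]) (use P_N[OF r] in blast)
  show "linear_on (scl (A i)) fscale (hcarrier (A i)) (\<lambda>b. P i r (mult (A i) a b))"
    by (rule linear_on_comp[OF Ai.mult_lin2[OF a] P_lin]) (use Ai.mult_C a in blast)
  fix b assume b: "b \<in> hbases (A i)"
  have t: "join i b r \<in> T" by (rule join_T[OF i b r])
  have "L i a (e (join i b r)) = fscale ((-1) ^ (hdeg (A i) b * dbelow i r)) (P i r (mult (A i) a b))"
    unfolding L_def nlift(2)[OF vector_space_fscale t] dec_join[OF b r] by simp
  then show "L i a (P i r b) = P i r (mult (A i) a b)"
    unfolding P_basis[OF b] linear_on_scale[OF L_lin e_N[OF t]]
    by (simp only: fs.scale_scale minus_one_power_square fs.scale_one)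
qed

lemma L_N: 
  assumes a: "a \<in> hcarrier (A i)" and x: "x \<in> N" shows "L i a x \<in> N"
proof (rule N_image[OF L_lin vector_space_fscale subspace_N _ x])
  fix t assume "t \<in> T"
  then obtain b r where b: "b \<in> hbases (A i)" "r \<in> U i" "t = join i b r" using join_exists[OF _ i] by blast
  have bC: "b \<in> hcarrier (A i)" by (rule Ai.hbases_C[OF b(1)])
  show "L i a (e t) \<in> N"
    unfolding b(3) e_join[OF b(1)] linear_on_scale[OF L_lin P_N[OF b(2) bC]] L_P[OF b(2) a bC]
    by (rule fs.subspace_scale[OF subspace_N P_N[OF b(2) Ai.mult_C[OF a bC]]])
qed

lemma L_ngr:
  assumes a: "a \<in> gr (A i) d" and x: "x \<in> ngr n" shows "L i a x \<in> ngr (d + n)"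
proof (rule ngr_image[OF L_lin vector_space_fscale subspace_ngr _ x])
  fix t assume t: "t \<in> T" "tdeg t = n"
  then obtain b r where b: "b \<in> hbases (A i)" "r \<in> U i" "t = join i b r" using join_exists[OF _ i] by blast
  have bC: "b \<in> hcarrier (A i)" by (rule Ai.hbases_C[OF b(1)])
  have d: "d + n = (d + hdeg (A i) b) + tdeg r" using t b by (simp add: tdeg_join[OF i])
  show "L i a (e t) \<in> ngr (d + n)"
    unfolding b(3) e_join[OF b(1)] linear_on_scale[OF L_lin P_N[OF b(2) bC]] L_P[OF b(2) Ai.gr_C[OF a] bC] d
    by (rule fs.subspace_scale[OF subspace_ngr P_ngr[OF b(2) Ai.mult_gr[OF a Ai.hbases_gr[OF b(1)]]]])
qed

lemma L_lin1: 
  assumes x: "x \<in> N" shows "linear_on (scl (A i)) fscale (hcarrier (A i)) (\<lambda>a. L i a x)"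
  unfolding linear_on_def
proof (intro conjI ballI allI)
  fix a b assume ab: "a \<in> hcarrier (A i)" "b \<in> hcarrier (A i)"
  have abC: "a + b \<in> hcarrier (A i)" by (rule Ai.subspace_add[OF Ai.sub_C ab])
  show "L i (a + b) x = L i a x + L i b x"
  proof (rule N_eqI_P[OF L_lin linear_on_plus[OF L_lin L_lin vector_space_fscale] vector_space_fscale _ x])
    fix r c assume r: "r \<in> U i" "c \<in> hbases (A i)"
    note c = Ai.hbases_C[OF r(2)]
    show "L i (a + b) (P i r c) = L i a (P i r c) + L i b (P i r c)"
      unfolding L_P[OF r(1) ab(1) c] L_P[OF r(1) ab(2) c] L_P[OF r(1) abC c]
        linear_on_add[OF Ai.mult_lin1[OF c] ab]
      by (rule linear_on_add[OF P_lin Ai.mult_C[OF ab(1) c] Ai.mult_C[OF ab(2) c]])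
  qed
next
  fix k a assume a: "a \<in> hcarrier (A i)"
  show "L i (scl (A i) k a) x = fscale k (L i a x)"
  proof (rule N_eqI_P[OF L_lin linear_on_scaled[OF L_lin vector_space_fscale] vector_space_fscale _ x])
    fix r c assume r: "r \<in> U i" "c \<in> hbases (A i)"
    note c = Ai.hbases_C[OF r(2)]
    show "L i (scl (A i) k a) (P i r c) = fscale k (L i a (P i r c))"
      unfolding L_P[OF r(1) a c] L_P[OF r(1) Ai.scale_C[OF a] c] Ai.mult_scale1[OF a c]
      by (rule linear_on_scale[OF P_lin Ai.mult_C[OF a c]])
  qed
qed

lemma L_unit: "x \<in> N \<Longrightarrow> L i (unit (A i)) x = x"
proof (rule N_eqI_P[OF L_lin linear_on_ident(1) vector_space_fscale])
  fix r c assume r: "r \<in> U i" "c \<in> hbases (A i)"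
  then show "L i (unit (A i)) (P i r c) = P i r c"
    using L_P[OF r(1) Ai.unit_C Ai.hbases_C[OF r(2)]] Ai.unit_l[OF Ai.hbases_C[OF r(2)]] by (simp only:)
qed

lemma L_mult:
  assumes ab: "a \<in> hcarrier (A i)" "b \<in> hcarrier (A i)" and x: "x \<in> N"
  shows "L i (mult (A i) a b) x = L i a (L i b x)"
proof (rule N_eqI_P[OF L_lin _ vector_space_fscale _ x])
  show "linear_on fscale fscale N (\<lambda>x. L i a (L i b x))"
    by (rule linear_on_comp[OF L_lin L_lin]) (use L_N[OF ab(2)] in blast)
  fix r c assume r: "r \<in> U i" "c \<in> hbases (A i)"
  note c = Ai.hbases_C[OF r(2)]
  show "L i (mult (A i) a b) (P i r c) = L i a (L i b (P i r c))"
    unfolding L_P[OF r(1) ab(2) c] L_P[OF r(1) ab(1) Ai.mult_C[OF ab(2) c]]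
      L_P[OF r(1) Ai.mult_C[OF ab] c] Ai.mult_assoc[OF ab c] ..
qed

end

text \<open>Two commuting letters in front of a trace that starts with neither of their indices.\<close>

lemma L_P_commute_basis:
  assumes ij: "comm i j" and r: "r \<in> U i" "r \<in> U j" and b: "b \<in> hbases (A i)" and c: "c \<in> hbases (A j)"
  shows "L i b (P j r c) = fscale ((-1) ^ (hdeg (A i) b * dbelow i (join j c r) + hdeg (A j) c * dbelow j r))
     (e (join i b (join j c r)))"
proof -
  note i = comm_range(1)[OF ij] and j = comm_range(2)[OF ij]
  interpret Ai: chopf "A i" by (rule chi[OF i])
  have u: "join j c r \<in> U i" by (rule join_U[OF ij r c])
  have bC: "b \<in> hcarrier (A i)" by (rule Ai.hbases_C[OF b])
  have "L i b (e (join j c r)) = fscale ((-1) ^ (hdeg (A i) b * dbelow i (join j c r))) (e (join i b (join j c r)))"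
    using L_P[OF i u bC Ai.unit_C] unfolding P_unit[OF i] Ai.unit_r[OF bC] P_basis[OF i b] .
  then show ?thesis
    unfolding P_basis[OF j c] linear_on_scale[OF L_lin[OF i] e_N[OF U_T[OF u]]]
    by (simp only: fs.scale_scale power_add mult.commute)
qed

text \<open>The two letters commute as letters of a trace. Exactly one of the indices lies below the other, so
  the two orders of insertion differ by the Koszul sign of one passing the other.\<close>

lemma L_P_commute:
  assumes ij: "comm i j" and r: "r \<in> U i" "r \<in> U j" and a: "a \<in> gr (A i) d" and b: "b \<in> gr (A j) q"
  shows "L i a (P j r b) = fscale ((-1) ^ (d * q)) (L j b (P i r a))"
proof -
  note i = comm_range(1)[OF ij] and j = comm_range(2)[OF ij]
  interpret Ai: chopf "A i" by (rule chi[OF i])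
  interpret Aj: chopf "A j" by (rule chi[OF j])
  have ji: "comm j i" using comm_sym[OF ij] .
  have basis: "L i b (P j r c) = fscale ((-1) ^ (d * q)) (L j c (P i r b))"
    if h: "b \<in> hbasis (A i) d" "c \<in> hbasis (A j) q" for b c
  proof -
    have b: "b \<in> hbases (A i)" and c: "c \<in> hbases (A j)" using h by (auto simp: hbases_def)
    have "even (hdeg (A i) b * dbelow i (join j c r) + hdeg (A j) c * dbelow j r +
        (d * q + (hdeg (A j) c * dbelow j (join i b r) + hdeg (A i) b * dbelow i r)))"
      unfolding dbelow_join[OF i] dbelow_join[OF j] Ai.hdeg[OF h(1)] Aj.hdeg[OF h(2)]
      using ij by (cases "i < j") (auto simp: comm_def)
    from minus_one_power_eq[OF this] show ?thesis
      unfolding L_P_commute_basis[OF ij r b c] L_P_commute_basis[OF ji r(2,1) c b] join_commute[OF ij]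
        fs.scale_scale power_add[symmetric] by (rule arg_cong)
  qed
  have a1: "L i a (P j r c) = fscale ((-1) ^ (d * q)) (L j c (P i r a))" if c: "c \<in> hbasis (A j) q" for c
  proof (rule Ai.hb_gr_eqI[OF L_lin1[OF i] _ vector_space_fscale _ a])
    have cC: "c \<in> hcarrier (A j)" using c Aj.hbases_C by (auto simp: hbases_def)
    then show "P j r c \<in> N" by (rule P_N[OF j r(2)])
    show "linear_on (scl (A i)) fscale (hcarrier (A i)) (\<lambda>a. fscale ((-1) ^ (d * q)) (L j c (P i r a)))"
      by (rule linear_on_scaled[OF linear_on_comp[OF P_lin[OF i] L_lin[OF j]] vector_space_fscale])
        (use P_N[OF i r(1)] in blast)
  qed (rule basis[OF _ c])
  show ?thesis
  proof (rule Aj.hb_gr_eqI[OF _ _ vector_space_fscale a1 b])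
    show "linear_on (scl (A j)) fscale (hcarrier (A j)) (\<lambda>b. L i a (P j r b))"
      by (rule linear_on_comp[OF P_lin[OF j] L_lin[OF i]]) (use P_N[OF j r(2)] in blast)
    show "linear_on (scl (A j)) fscale (hcarrier (A j)) (\<lambda>b. fscale ((-1) ^ (d * q)) (L j b (P i r a)))"
      by (rule linear_on_scaled[OF L_lin1[OF j P_N[OF i r(1) Ai.gr_C[OF a]]] vector_space_fscale])
  qed
qed

lemma L_commute:
  assumes ij: "comm i j" and a: "a \<in> gr (A i) d" and b: "b \<in> gr (A j) q" and x: "x \<in> N"
  shows "L i a (L j b x) = fscale ((-1) ^ (d * q)) (L j b (L i a x))"
proof -
  note i = comm_range(1)[OF ij] and j = comm_range(2)[OF ij]
  have ji: "comm j i" using comm_sym[OF ij] .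
  interpret Ai: chopf "A i" by (rule chi[OF i])
  interpret Aj: chopf "A j" by (rule chi[OF j])
  note aC = Ai.gr_C[OF a] and bC = Aj.gr_C[OF b]
  show ?thesis
  proof (rule N_eqI[OF _ _ vector_space_fscale _ x])
    show "linear_on fscale fscale N (\<lambda>x. L i a (L j b x))"
      by (rule linear_on_comp[OF L_lin[OF j] L_lin[OF i]]) (use L_N[OF j bC] in blast)
    show "linear_on fscale fscale N (\<lambda>x. fscale ((-1) ^ (d * q)) (L j b (L i a x)))"
      by (rule linear_on_scaled[OF linear_on_comp[OF L_lin[OF i] L_lin[OF j]] vector_space_fscale])
        (use L_N[OF i aC] in blast)
    fix t assume t: "t \<in> T"
    obtain \<beta> u where u: "\<beta> \<in> hbases (A i)" "u \<in> U i" "t = join i \<beta> u" using join_exists[OF t i] by blast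
    obtain \<gamma> r where r: "\<gamma> \<in> hbases (A j)" "r \<in> U j" "u = join j \<gamma> r" using join_exists[OF U_T[OF u(2)] j] by blast
    have ri: "r \<in> U i"
      using u(2) U_T[OF r(2)] ji comm_sym ij unfolding r(3) U_def
      by (auto simp: tinit_join[OF r(2)] split: if_splits)
    define y where "y = L i \<beta> (P j r \<gamma>)"
    have \<beta>: "\<beta> \<in> gr (A i) (hdeg (A i) \<beta>)" by (rule Ai.hbases_gr[OF u(1)])
    have \<gamma>: "\<gamma> \<in> gr (A j) (hdeg (A j) \<gamma>)" by (rule Aj.hbases_gr[OF r(1)])
    note \<beta>C = Ai.gr_C[OF \<beta>] and \<gamma>C = Aj.gr_C[OF \<gamma>]
    let ?d = "hdeg (A i) \<beta>" and ?q = "hdeg (A j) \<gamma>"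
    note PN = P_N[OF j r(2) \<gamma>C] P_N[OF j r(2) Aj.mult_C[OF bC \<gamma>C]] P_N[OF i ri \<beta>C]
    have pull: "L j b (L i a' (P j r \<gamma>)) = fscale ((-1) ^ (d' * q)) (L i a' (P j r (mult (A j) b \<gamma>)))"
      if a': "a' \<in> gr (A i) d'" for a' d'
    proof -
      note a'N = P_N[OF i ri Ai.gr_C[OF a']]
      have "L j b (L i a' (P j r \<gamma>)) = fscale ((-1) ^ (d' * ?q)) (L j b (L j \<gamma> (P i r a')))"
        unfolding L_P_commute[OF ij ri r(2) a' \<gamma>]
        by (rule linear_on_scale[OF L_lin[OF j] L_N[OF j \<gamma>C a'N]])
      also have "\<dots> = fscale ((-1) ^ (d' * ?q)) (L j (mult (A j) b \<gamma>) (P i r a'))"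
        unfolding L_mult[OF j bC \<gamma>C a'N] ..
      also have "\<dots> = fscale ((-1) ^ (d' * ?q) * (-1) ^ ((q + ?q) * d')) (L i a' (P j r (mult (A j) b \<gamma>)))"
        unfolding L_P_commute[OF ji r(2) ri Aj.mult_gr[OF b \<gamma>] a'] by (rule fs.scale_scale)
      also have "(-1 :: 'k) ^ (d' * ?q) * (-1) ^ ((q + ?q) * d') = (-1) ^ (d' * q)"
        unfolding power_add[symmetric] by (rule minus_one_power_eq) (auto simp: algebra_simps)
      finally show ?thesis .
    qed
    have "L i a (L j b y) = fscale ((-1) ^ (?d * q)) (L i a (L i \<beta> (P j r (mult (A j) b \<gamma>))))"
      unfolding y_def pull[OF \<beta>] by (rule linear_on_scale[OF L_lin[OF i] L_N[OF i \<beta>C PN(2)]])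
    also have "\<dots> = fscale ((-1) ^ (?d * q)) (L i (mult (A i) a \<beta>) (P j r (mult (A j) b \<gamma>)))"
      unfolding L_mult[OF i aC \<beta>C PN(2)] ..
    also have "\<dots> = fscale ((-1) ^ (d * q) * (-1) ^ ((d + ?d) * q)) (L i (mult (A i) a \<beta>) (P j r (mult (A j) b \<gamma>)))"
      unfolding power_add[symmetric]
      by (rule arg_cong[where f = "\<lambda>c. fscale c _"]) (rule minus_one_power_eq, auto simp: algebra_simps)
    also have "\<dots> = fscale ((-1) ^ (d * q)) (L j b (L i (mult (A i) a \<beta>) (P j r \<gamma>)))"
      unfolding pull[OF Ai.mult_gr[OF a \<beta>]] by (rule fs.scale_scale[symmetric])
    also have "\<dots> = fscale ((-1) ^ (d * q)) (L j b (L i a y))"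
      unfolding y_def L_mult[OF i aC \<beta>C PN(1)] ..
    finally have y: "L i a (L j b y) = fscale ((-1) ^ (d * q)) (L j b (L i a y))" .
    obtain c where c: "e t = fscale c y"
    proof -
      let ?n = "hdeg (A i) \<beta> * dbelow i (join j \<gamma> r) + hdeg (A j) \<gamma> * dbelow j r"
      have "fscale ((-1) ^ ?n) y = e t"
        unfolding y_def L_P_commute_basis[OF ij ri r(2) u(1) r(1)] u(3) r(3)
        by (simp only: fs.scale_scale minus_one_power_square fs.scale_one)
      then show ?thesis using that by metis
    qed
    have yN: "y \<in> N" unfolding y_def by (rule L_N[OF i \<beta>C PN(1)])
    note Ly = L_N[OF i aC yN] L_N[OF j bC yN]
    show "L i a (L j b (e t)) = fscale ((-1) ^ (d * q)) (L j b (L i a (e t)))"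
      unfolding c linear_on_scale[OF L_lin[OF i] yN] linear_on_scale[OF L_lin[OF j] yN]
        linear_on_scale[OF L_lin[OF i] Ly(2)] linear_on_scale[OF L_lin[OF j] Ly(1)] y
      by (simp only: fs.scale_scale mult.commute)
  qed
qed

end

section \<open>The universal property of the span of the reduced traces\<close>

text \<open>Actions of the \<open>A i\<close> on \<open>V\<close> that satisfy the defining relations of the graph product. They extend to
  an action of the reduced traces, here evaluated on the vector \<open>v0\<close>.\<close>

locale gp_action = gprod m K A
  for m K and A :: "nat \<Rightarrow> ('k::field, 'a::ab_group_add) hopf" +
  fixes s :: "'k \<Rightarrow> 'c::ab_group_add \<Rightarrow> 'c" and V :: "'c::ab_group_add set" and f :: "nat \<Rightarrow> 'a \<Rightarrow> 'c \<Rightarrow> 'c" and v0 :: 'c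
  assumes s: "vector_space s" and V: "module.subspace s V" and v0: "v0 \<in> V"
    and f_V: "\<And>i a v. i \<in> {1..m} \<Longrightarrow> a \<in> hcarrier (A i) \<Longrightarrow> v \<in> V \<Longrightarrow> f i a v \<in> V"
    and f_lin: "\<And>i a. i \<in> {1..m} \<Longrightarrow> a \<in> hcarrier (A i) \<Longrightarrow> linear_on s s V (f i a)"
    and f_lin1: "\<And>i v. i \<in> {1..m} \<Longrightarrow> v \<in> V \<Longrightarrow> linear_on (scl (A i)) s (hcarrier (A i)) (\<lambda>a. f i a v)"
    and f_unit: "\<And>i v. i \<in> {1..m} \<Longrightarrow> v \<in> V \<Longrightarrow> f i (unit (A i)) v = v"
    and f_mult: "\<And>i a b v. i \<in> {1..m} \<Longrightarrow> a \<in> hcarrier (A i) \<Longrightarrow> b \<in> hcarrier (A i) \<Longrightarrow> v \<in> V \<Longrightarrow>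
      f i (mult (A i) a b) v = f i a (f i b v)"
    and f_comm: "\<And>i j a b d q v. i \<noteq> j \<Longrightarrow> {i, j} \<in> K \<Longrightarrow> a \<in> gr (A i) d \<Longrightarrow> b \<in> gr (A j) q \<Longrightarrow> v \<in> V \<Longrightarrow>
      f i a (f j b v) = s ((-1) ^ (d * q)) (f j b (f i a v))"
begin

interpretation vs: vector_space s by (rule s)

text \<open>The letters of a trace are applied to \<open>v0\<close> one after the other. Of the initial letters the one with
  the smallest index is split off, and the first argument bounds the number of steps.\<close>

primrec FTn :: "nat \<Rightarrow> (nat \<times> 'a) list \<Rightarrow> 'c" where
  "FTn 0 t = v0"
| "FTn (Suc n) t = (if t = [] then v0 else (case dec (Min (tinit t)) t of (b, r) \<Rightarrow>
     s ((-1) ^ (hdeg (A (Min (tinit t))) b * dbelow (Min (tinit t)) r)) (f (Min (tinit t)) b (FTn n r))))"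

definition FT :: "(nat \<times> 'a) list \<Rightarrow> 'c" where "FT t = FTn (length t) t"

lemma tinit_T: "t \<in> T \<Longrightarrow> i \<in> tinit t \<Longrightarrow> i \<in> {1..m}"
proof -
  assume t: "t \<in> T" "i \<in> tinit t"
  obtain b where b: "(i, b) \<in> set t" using tinit_letters[OF t(2)] by auto
  have "b \<in> Bp i" by (rule tset_letters[OF t(1)[unfolded T_def] b])
  then show ?thesis by (simp add: Bp_def split: if_splits)
qed

lemma Min_tinit: "t \<in> T \<Longrightarrow> t \<noteq> [] \<Longrightarrow> Min (tinit t) \<in> tinit t"
proof (rule Min_in)
  assume t: "t \<in> T" "t \<noteq> []"
  show "finite (tinit t)"
    by (rule finite_subset[OF subsetI finite_atLeastAtMost]) (rule tinit_T[OF t(1)])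
  show "tinit t \<noteq> {}" using tset_tinit_empty[OF t(1)[unfolded T_def]] t(2) by blast
qed

lemma FTn_V: "t \<in> T \<Longrightarrow> FTn n t \<in> V"
proof (induction n arbitrary: t)
  case (Suc n)
  show ?case
  proof (cases "t = []")
    case False
    have i: "Min (tinit t) \<in> {1..m}" by (rule tinit_T[OF Suc.prems Min_tinit[OF Suc.prems False]])
    then interpret Ai: chopf "A (Min (tinit t))" by (rule chi)
    obtain b r where b: "b \<in> hbases (A (Min (tinit t)))" "r \<in> U (Min (tinit t))" "t = join (Min (tinit t)) b r"
      using join_exists[OF Suc.prems i] by blast
    have "dec (Min (tinit t)) t = (b, r)" using dec_join[OF b(1,2)] b(3) by simp
    then show ?thesis
      using False f_V[OF i Ai.hbases_C[OF b(1)] Suc.IH[OF U_T[OF b(2)]]] vs.subspace_scale[OF V] by simp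
  qed (simp add: v0)
qed (simp add: v0)

lemma FT_V: "t \<in> T \<Longrightarrow> FT t \<in> V" by (simp add: FT_def FTn_V)

text \<open>If the given letter is not the one that the recursion splits off, both are initial letters, so they
  commute and the trace is the product of both with a shorter one. The relations for the action and the
  induction hypothesis for the shorter traces then compare the two decompositions.\<close>

lemma FT_tcons:
  assumes "i \<in> {1..m}" "b \<in> hbases (A i)" "b \<noteq> unit (A i)" "r \<in> U i"
  shows "FT (join i b r) = s ((-1) ^ (hdeg (A i) b * dbelow i r)) (f i b (FT r))"
  using assms
proof (induction "length r" arbitrary: i b r rule: less_induct)
  case less
  define t where "t = join i b r"
  have len: "length t = Suc (length r)" using less.prems by (simp add: t_def join_def length_tcons)
  have t: "t \<in> T" unfolding t_def by (rule join_T[OF less.prems(1,2,4)])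
  define j where "j = Min (tinit t)"
  have jt: "j \<in> tinit t" unfolding j_def by (rule Min_tinit[OF t]) (use len in auto)
  have j: "j \<in> {1..m}" using tinit_T[OF t jt] .
  obtain c u where u: "c \<in> hbases (A j)" "u \<in> U j" "t = join j c u" using join_exists[OF t j] by blast
  have cu: "c \<noteq> unit (A j)" using jt u by (auto simp: join_def U_def)
  have lenu: "length u = length r" using len u(3) cu by (simp add: join_def length_tcons)
  have "dec j t = (c, u)" using dec_join[OF u(1,2)] u(3) by simp
  then have FTt: "FT t = s ((-1) ^ (hdeg (A j) c * dbelow j u)) (f j c (FT u))"
    using len lenu by (auto simp: FT_def j_def)
  show ?case
  proof (cases "j = i")
    case True
    then have "c = b \<and> u = r" using join_inject[of u i r c b] u less.prems t_def by auto
    then show ?thesis using FTt True by (simp add: t_def)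
  next
    case False
    have ij: "comm i j" and jr: "j \<in> tinit r"
      using jt False less.prems unfolding t_def by (auto simp: tinit_join)
    then have ji: "comm j i" using comm_sym by blast
    interpret Ai: chopf "A i" by (rule chi[OF less.prems(1)])
    interpret Aj: chopf "A j" by (rule chi[OF j])
    obtain c' w where w: "c' \<in> hbases (A j)" "w \<in> U j" "r = join j c' w"
      using join_exists[OF U_T[OF less.prems(4)] j] by blast
    have c'u: "c' \<noteq> unit (A j)" using jr w by (auto simp: join_def U_def)
    have wi: "w \<in> U i"
      using less.prems(4) U_T[OF w(2)] ji ij unfolding w(3) U_def by (auto simp: tinit_join[OF w(2)] split: if_splits)
    have bw: "join i b w \<in> U j" by (rule join_U[OF ji w(2) wi less.prems(2)])
    have "t = join j c' (join i b w)" unfolding t_def w(3) by (rule join_commute[OF ij])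
    then have "join j c' (join i b w) = join j c u" using u(3) by simp
    from join_inject[OF bw u(2) this] have c: "c' = c" "u = join i b w" by simp_all
    have lenw: "length w < length r" using w(3) c'u by (simp add: join_def length_tcons)
    have FTu: "FT u = s ((-1) ^ (hdeg (A i) b * dbelow i w)) (f i b (FT w))"
      unfolding c(2) by (rule less.hyps[OF lenw less.prems(1-3) wi])
    have FTr: "FT r = s ((-1) ^ (hdeg (A j) c * dbelow j w)) (f j c (FT w))"
      unfolding w(3) using less.hyps[OF lenw j w(1) c'u w(2)] c(1) by simp
    note wV = FT_V[OF U_T[OF w(2)]]
    note bC = Ai.hbases_C[OF less.prems(2)] and cC = Aj.hbases_C[OF u(1)]
    have ij': "i \<noteq> j" "{i, j} \<in> K" using ij by (auto simp: comm_def)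
    have e: "even (hdeg (A j) c * dbelow j u + hdeg (A i) b * dbelow i w +
      (hdeg (A i) b * dbelow i r + hdeg (A j) c * dbelow j w + hdeg (A i) b * hdeg (A j) c))"
      unfolding c(2) w(3) dbelow_join[OF j] dbelow_join[OF less.prems(1)] c(1)
      using False by (cases "i < j") (auto simp: algebra_simps)
    have "FT t = s ((-1) ^ (hdeg (A j) c * dbelow j u + hdeg (A i) b * dbelow i w)) (f j c (f i b (FT w)))"
      unfolding FTt FTu linear_on_scale[OF f_lin[OF j cC] f_V[OF less.prems(1) bC wV]]
      by (simp only: vs.scale_scale power_add)
    also have "\<dots> = s ((-1) ^ (hdeg (A i) b * dbelow i r + hdeg (A j) c * dbelow j w)) (f i b (f j c (FT w)))"
      unfolding f_comm[OF ij' Ai.hbases_gr[OF less.prems(2)] Aj.hbases_gr[OF u(1)] wV]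
        minus_one_power_eq[OF e] by (simp only: vs.scale_scale power_add)
    also have "\<dots> = s ((-1) ^ (hdeg (A i) b * dbelow i r)) (f i b (FT r))"
      unfolding FTr linear_on_scale[OF f_lin[OF less.prems(1) bC] f_V[OF j cC wV]]
      by (simp only: vs.scale_scale power_add)
    finally show ?thesis by (simp only: t_def)
  qed
qed

lemma FT_join:
  assumes i: "i \<in> {1..m}" and b: "b \<in> hbases (A i)" and r: "r \<in> U i"
  shows "FT (join i b r) = s ((-1) ^ (hdeg (A i) b * dbelow i r)) (f i b (FT r))"
proof (cases "b = unit (A i)")
  case True
  then show ?thesis using f_unit[OF i FT_V[OF U_T[OF r]]] chopf.hdeg_unit[OF chi[OF i]]
    by (simp add: join_def)
qed (rule FT_tcons[OF i b _ r])

definition act :: "('k, 'a) word_space \<Rightarrow> 'c" where "act = nlift s FT"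

lemma act_lin: "linear_on fscale s N act" unfolding act_def by (rule nlift(1)[OF s])

lemma act_e: "t \<in> T \<Longrightarrow> act (e t) = FT t" unfolding act_def by (rule nlift(2)[OF s])

lemma act_nil: "act (e []) = v0"
  using act_e[OF U_T[OF nil_U]] by (simp add: FT_def)

lemma act_V: "x \<in> N \<Longrightarrow> act x \<in> V"
  by (rule N_image[OF act_lin s V]) (simp_all add: act_e FT_V)

lemma act_P:
  assumes i: "i \<in> {1..m}" and r: "r \<in> U i" and a: "a \<in> hcarrier (A i)"
  shows "act (P i r a) = f i a (FT r)"
proof -
  interpret Ai: chopf "A i" by (rule chi[OF i])
  show ?thesis
  proof (rule Ai.hb_eqI[OF _ f_lin1[OF i FT_V[OF U_T[OF r]]] s _ a])
    show "linear_on (scl (A i)) s (hcarrier (A i)) (\<lambda>a. act (P i r a))"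
      by (rule linear_on_comp[OF P_lin[OF i] act_lin]) (use P_N[OF i r] in blast)
    fix b assume b: "b \<in> hbases (A i)"
    show "act (P i r b) = f i b (FT r)"
      unfolding P_basis[OF i b] linear_on_scale[OF act_lin e_N[OF join_T[OF i b r]]] act_e[OF join_T[OF i b r]]
        FT_join[OF i b r]
      by (simp only: vs.scale_scale minus_one_power_square vs.scale_one)
  qed
qed

lemma act_L:
  assumes i: "i \<in> {1..m}" and a: "a \<in> hcarrier (A i)" and x: "x \<in> N"
  shows "act (L i a x) = f i a (act x)"
proof -
  interpret Ai: chopf "A i" by (rule chi[OF i])
  show ?thesis
  proof (rule N_eqI_P[OF i _ _ s _ x])
    show "linear_on fscale s N (\<lambda>x. act (L i a x))"
      by (rule linear_on_comp[OF L_lin[OF i] act_lin]) (use L_N[OF i a] in blast)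
    show "linear_on fscale s N (\<lambda>x. f i a (act x))"
      by (rule linear_on_comp[OF act_lin f_lin[OF i a]]) (use act_V in blast)
    fix r b assume r: "r \<in> U i" and b: "b \<in> hbases (A i)"
    note bC = Ai.hbases_C[OF b]
    show "act (L i a (P i r b)) = f i a (act (P i r b))"
      unfolding L_P[OF i r a bC] act_P[OF i r bC] act_P[OF i r Ai.mult_C[OF a bC]]
      by (rule f_mult[OF i a bC FT_V[OF U_T[OF r]]])
  qed
qed

lemma act_gr:
  assumes W: "\<And>n. module.subspace s (W n)" and w0: "v0 \<in> W l" and sub: "\<And>n. W n \<subseteq> V"
    and f: "\<And>i a v d n. i \<in> {1..m} \<Longrightarrow> a \<in> gr (A i) d \<Longrightarrow> v \<in> W n \<Longrightarrow> f i a v \<in> W (d + n)"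
    and x: "x \<in> ngr n"
  shows "act x \<in> W (n + l)"
proof -
  have FT: "FT t \<in> W (tdeg t + l)" if "t \<in> T" for t
    using that unfolding T_def
  proof (induction rule: tset.induct)
    case nil then show ?case using w0 by (simp add: FT_def tdeg_def)
  next
    case (cons t i b)
    have i: "i \<in> {1..m}" and b: "b \<in> hbases (A i)" "b \<noteq> unit (A i)"
      using cons by (auto simp: Bp_def split: if_splits)
    interpret Ai: chopf "A i" by (rule chi[OF i])
    have t: "t \<in> U i" using cons by (simp add: U_def T_def)
    have eq: "tcons (i, b) t = join i b t" using b by (simp add: join_def)
    have "f i b (FT t) \<in> W (tdeg (join i b t) + l)"
      using f[OF i Ai.hbases_gr[OF b(1)] cons.IH] by (simp add: tdeg_join[OF i] add.assoc)
    then show ?case unfolding eq FT_join[OF i b(1) t] by (rule vs.subspace_scale[OF W])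
  qed
  show ?thesis
    by (rule ngr_image[OF act_lin s W _ x]) (use FT in \<open>auto simp: act_e\<close>)
qed

end


section \<open>The graph product of graded algebras\<close>

context gprod begin

lemma action_L: "y \<in> N \<Longrightarrow> gp_action m K A fscale N L y"
  by unfold_locales
    (use vector_space_fscale subspace_N L_N L_lin L_lin1 L_unit L_mult in
      \<open>auto intro: L_commute[unfolded comm_def] simp: vector_space_fscale\<close>)

text \<open>The letters of the first factor act on the second one.\<close>

definition mmult :: "('k, 'a) word_space \<Rightarrow> ('k, 'a) word_space \<Rightarrow> ('k, 'a) word_space" where
  "mmult x y = gp_action.act m K A fscale L y x"

lemma mmult_lin1: "y \<in> N \<Longrightarrow> linear_on fscale fscale N (\<lambda>x. mmult x y)"
  unfolding mmult_def by (rule gp_action.act_lin[OF action_L])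

lemma mmult_nil: "y \<in> N \<Longrightarrow> mmult (e []) y = y"
  unfolding mmult_def by (rule gp_action.act_nil[OF action_L])

lemma mmult_N: "x \<in> N \<Longrightarrow> y \<in> N \<Longrightarrow> mmult x y \<in> N"
  unfolding mmult_def by (rule gp_action.act_V[OF action_L])

lemma mmult_L: "i \<in> {1..m} \<Longrightarrow> a \<in> hcarrier (A i) \<Longrightarrow> x \<in> N \<Longrightarrow> y \<in> N \<Longrightarrow>
    mmult (L i a x) y = L i a (mmult x y)"
  unfolding mmult_def by (rule gp_action.act_L[OF action_L])

lemma nil_T: "[] \<in> T" by (rule U_T[OF nil_U])

lemma e_tcons:
  assumes i: "i \<in> {1..m}" and b: "b \<in> hbases (A i)" and t: "t \<in> U i"
  shows "e (join i b t) = fscale ((-1) ^ (hdeg (A i) b * dbelow i t)) (L i b (e t))"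
proof -
  interpret Ai: chopf "A i" by (rule chi[OF i])
  have "L i b (e t) = P i t b"
    using L_P[OF i t Ai.hbases_C[OF b] Ai.unit_C] Ai.unit_r[OF Ai.hbases_C[OF b]] by (simp only: P_unit[OF i])
  then show ?thesis using e_join[OF i b] by simp
qed

text \<open>Every basis trace arises, up to sign, from the empty one by multiplication with letters.\<close>

lemma N_gen_eqI:
  assumes F: "linear_on fscale s N F" and G: "linear_on fscale s N G" and s: "vector_space s"
    and nil: "F (e []) = G (e [])"
    and step: "\<And>i b x. i \<in> {1..m} \<Longrightarrow> b \<in> hcarrier (A i) \<Longrightarrow> x \<in> N \<Longrightarrow> F x = G x \<Longrightarrow> F (L i b x) = G (L i b x)"
    and x: "x \<in> N"
  shows "F x = G x"
proof (rule N_eqI[OF F G s _ x])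
  show "F (e t) = G (e t)" if "t \<in> T" for t
    using that unfolding T_def
  proof (induction rule: tset.induct)
    case (cons t i b)
    have i: "i \<in> {1..m}" and b: "b \<in> hbases (A i)" "b \<noteq> unit (A i)"
      using cons by (auto simp: Bp_def split: if_splits)
    have t: "t \<in> U i" using cons by (simp add: U_def T_def)
    have bC: "b \<in> hcarrier (A i)" by (rule chopf.hbases_C[OF chi[OF i] b(1)])
    have eq: "tcons (i, b) t = join i b t" using b by (simp add: join_def)
    note LN = L_N[OF i bC e_N[OF U_T[OF t]]]
    show ?case
      unfolding eq e_tcons[OF i b(1) t] linear_on_scale[OF F LN] linear_on_scale[OF G LN]
        step[OF i bC e_N[OF U_T[OF t]] cons.IH] ..
  qed (rule nil)
qed

lemma N_gen_subset:
  assumes W: "module.subspace fscale W" and nil: "e [] \<in> W"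
    and step: "\<And>i b x. i \<in> {1..m} \<Longrightarrow> b \<in> hcarrier (A i) \<Longrightarrow> x \<in> N \<Longrightarrow> x \<in> W \<Longrightarrow> L i b x \<in> W"
  shows "N \<subseteq> W"
  unfolding N_def
proof (rule fs.span_minimal[OF _ W], rule image_subsetI)
  show "e t \<in> W" if "t \<in> T" for t
    using that unfolding T_def
  proof (induction rule: tset.induct)
    case (cons t i b)
    have i: "i \<in> {1..m}" and b: "b \<in> hbases (A i)" "b \<noteq> unit (A i)"
      using cons by (auto simp: Bp_def split: if_splits)
    have t: "t \<in> U i" using cons by (simp add: U_def T_def)
    have bC: "b \<in> hcarrier (A i)" by (rule chopf.hbases_C[OF chi[OF i] b(1)])
    have eq: "tcons (i, b) t = join i b t" using b by (simp add: join_def)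
    show ?case unfolding eq e_tcons[OF i b(1) t]
      by (rule fs.subspace_scale[OF W step[OF i bC e_N[OF U_T[OF t]] cons.IH]])
  qed (rule nil)
qed

lemma mmult_lin2: 
  assumes x: "x \<in> N" shows "linear_on fscale fscale N (mmult x)"
  unfolding linear_on_def
proof (intro conjI ballI allI)
  fix y z assume yz: "y \<in> N" "z \<in> N"
  have s: "y + z \<in> N" by (rule fs.subspace_add[OF subspace_N yz])
  show "mmult x (y + z) = mmult x y + mmult x z"
  proof (rule N_gen_eqI[OF mmult_lin1[OF s] linear_on_plus[OF mmult_lin1[OF yz(1)] mmult_lin1[OF yz(2)] vector_space_fscale]
        vector_space_fscale _ _ x])
    show "mmult (e []) (y + z) = mmult (e []) y + mmult (e []) z"
      unfolding mmult_nil[OF s] mmult_nil[OF yz(1)] mmult_nil[OF yz(2)] ..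
    fix i b x assume i: "i \<in> {1..m}" "b \<in> hcarrier (A i)" "x \<in> N" and h: "mmult x (y + z) = mmult x y + mmult x z"
    show "mmult (L i b x) (y + z) = mmult (L i b x) y + mmult (L i b x) z"
      unfolding mmult_L[OF i s] mmult_L[OF i yz(1)] mmult_L[OF i yz(2)] h
      by (rule linear_on_add[OF L_lin[OF i(1)] mmult_N[OF i(3) yz(1)] mmult_N[OF i(3) yz(2)]])
  qed
next
  fix c y assume y: "y \<in> N"
  have s: "fscale c y \<in> N" by (rule fs.subspace_scale[OF subspace_N y])
  show "mmult x (fscale c y) = fscale c (mmult x y)"
  proof (rule N_gen_eqI[OF mmult_lin1[OF s] linear_on_scaled[OF mmult_lin1[OF y] vector_space_fscale]
        vector_space_fscale _ _ x])
    show "mmult (e []) (fscale c y) = fscale c (mmult (e []) y)"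
      unfolding mmult_nil[OF s] mmult_nil[OF y] ..
    fix i b x assume i: "i \<in> {1..m}" "b \<in> hcarrier (A i)" "x \<in> N" and h: "mmult x (fscale c y) = fscale c (mmult x y)"
    show "mmult (L i b x) (fscale c y) = fscale c (mmult (L i b x) y)"
      unfolding mmult_L[OF i s] mmult_L[OF i y] h
      by (rule linear_on_scale[OF L_lin[OF i(1)] mmult_N[OF i(3) y]])
  qed
qed

lemma mmult_assoc:
  assumes x: "x \<in> N" and y: "y \<in> N" and z: "z \<in> N"
  shows "mmult (mmult x y) z = mmult x (mmult y z)"
proof (rule N_gen_eqI[OF _ mmult_lin1[OF mmult_N[OF y z]] vector_space_fscale _ _ x])
  show "linear_on fscale fscale N (\<lambda>x. mmult (mmult x y) z)"
    by (rule linear_on_comp[OF mmult_lin1[OF y] mmult_lin1[OF z]]) (use mmult_N y in blast)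
  show "mmult (mmult (e []) y) z = mmult (e []) (mmult y z)"
    unfolding mmult_nil[OF y] mmult_nil[OF mmult_N[OF y z]] ..
  fix i b x assume i: "i \<in> {1..m}" "b \<in> hcarrier (A i)" "x \<in> N" and h: "mmult (mmult x y) z = mmult x (mmult y z)"
  show "mmult (mmult (L i b x) y) z = mmult (L i b x) (mmult y z)"
    unfolding mmult_L[OF i y] mmult_L[OF i mmult_N[OF y z]] mmult_L[OF i(1,2) mmult_N[OF i(3) y] z] h ..
qed

lemma mmult_nil_right: "x \<in> N \<Longrightarrow> mmult x (e []) = x"
proof (rule N_gen_eqI[OF mmult_lin1[OF e_N[OF nil_T]] linear_on_ident(1) vector_space_fscale])
  show "mmult (e []) (e []) = e []" by (rule mmult_nil[OF e_N[OF nil_T]])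
  fix i b x assume i: "i \<in> {1..m}" "b \<in> hcarrier (A i)" "x \<in> N" and h: "mmult x (e []) = x"
  show "mmult (L i b x) (e []) = L i b x" unfolding mmult_L[OF i e_N[OF nil_T]] h ..
qed

lemma tdeg_nil: "tdeg [] = 0" by (simp add: tdeg_def)

lemma mmult_ngr: 
  assumes x: "x \<in> ngr n" and y: "y \<in> ngr l" shows "mmult x y \<in> ngr (n + l)"
proof -
  have yN: "y \<in> N" using y ngr_N by blast
  show ?thesis unfolding mmult_def
    by (rule gp_action.act_gr[OF action_L[OF yN], where W = ngr, OF subspace_ngr y ngr_N L_ngr x])
qed

text \<open>The graph product as an algebra. Its coalgebra structure comes from the universal property below.\<close>

definition M0 :: "('k, ('k, 'a) word_space) hopf" where
  "M0 = \<lparr>scl = fscale, gr = ngr, mult = mmult, unit = e [], comult = undefined, counit = undefined\<rparr>"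

lemma M0_simps: "scl M0 = fscale" "gr M0 = ngr" "mult M0 = mmult" "unit M0 = e []"
  by (simp_all add: M0_def)

lemma ngr_eqI:
  assumes "linear_on fscale s N F" "linear_on fscale s N G" "vector_space s"
    "\<And>t. t \<in> T \<Longrightarrow> tdeg t = n \<Longrightarrow> F (e t) = G (e t)" "x \<in> ngr n"
  shows "F x = G x"
  by (rule linear_on_eq_on_span[OF linear_on_subset[OF assms(1) ngr_N, of n, unfolded ngr_def]
      linear_on_subset[OF assms(2) ngr_N, of n, unfolded ngr_def]
      vector_space_fscale assms(3) _ assms(5)[unfolded ngr_def]]) (use assms(4) in auto)

lemma span_ngr: "module.span fscale (\<Union>n. ngr n) = N"
proof
  show "fs.span (\<Union>n. ngr n) \<subseteq> N" using ngr_N by (intro fs.span_minimal subspace_N) blast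
  show "N \<subseteq> fs.span (\<Union>n. ngr n)" unfolding N_def
    using e_ngr by (intro fs.span_mono) blast
qed

lemma hcarrier_M0: "hcarrier M0 = N" by (simp add: hcarrier_def M0_simps span_ngr)

lemma graded_algebra_M0: "graded_algebra M0"
  unfolding graded_algebra_def hcarrier_M0 M0_simps
proof (intro conjI allI ballI)
  let ?P = "\<lambda>k. nlift fscale (\<lambda>t. if tdeg t = k then e t else 0)"
  show "graded_space fscale ngr"
  proof (rule graded_spaceI[where P = ?P, OF vector_space_fscale subspace_ngr])
    show "linear_on fscale fscale (fs.span (\<Union>n. ngr n)) (?P k)" for k
      unfolding span_ngr by (rule nlift(1)[OF vector_space_fscale])
    show "?P k x = (if k = n then x else 0)" if x: "x \<in> ngr n" for k n x
    proof (cases "k = n")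
      case True
      have "?P k x = x"
        by (rule ngr_eqI[OF nlift(1)[OF vector_space_fscale] linear_on_ident(1) vector_space_fscale _ x])
          (simp add: nlift(2)[OF vector_space_fscale] True)
      then show ?thesis using True by simp
    next
      case False
      have "?P k x \<in> {0}"
        by (rule ngr_image[OF nlift(1)[OF vector_space_fscale] vector_space_fscale fs.subspace_single_0 _ x])
          (use False in \<open>simp add: nlift(2)[OF vector_space_fscale] zero_fun_def\<close>)
      then have "?P k x = 0" by (simp only: singleton_iff)
      then show ?thesis using False by (simp only: if_False)
    qed
  qed
  show "e [] \<in> ngr 0" by (rule e_ngr[OF nil_T tdeg_nil])
qed (use mmult_ngr mmult_lin1 mmult_lin2 mmult_assoc mmult_nil mmult_nil_right in blast)+

definition iota :: "nat \<Rightarrow> 'a \<Rightarrow> ('k, 'a) word_space" where "iota i a = L i a (e [])"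

lemma iota_mult: "i \<in> {1..m} \<Longrightarrow> a \<in> hcarrier (A i) \<Longrightarrow> y \<in> N \<Longrightarrow> mmult (iota i a) y = L i a y"
  unfolding iota_def by (simp only: mmult_L e_N[OF nil_T] mmult_nil)

lemma iota_alg_hom: "i \<in> {1..m} \<Longrightarrow> alg_hom (A i) M0 (iota i)"
  unfolding alg_hom_def M0_simps
proof (intro conjI allI ballI image_subsetI)
  assume i: "i \<in> {1..m}"
  interpret Ai: chopf "A i" by (rule chi[OF i])
  show "linear_on (scl (A i)) fscale (hcarrier (A i)) (iota i)"
    unfolding iota_def by (rule L_lin1[OF i e_N[OF nil_T]])
  show "iota i a \<in> ngr n" if "a \<in> gr (A i) n" for a n
    using L_ngr[OF i that e_ngr[OF nil_T tdeg_nil]] by (simp add: iota_def)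
  show "iota i (unit (A i)) = e []" unfolding iota_def by (rule L_unit[OF i e_N[OF nil_T]])
  fix a b assume ab: "a \<in> hcarrier (A i)" "b \<in> hcarrier (A i)"
  have bN: "iota i b \<in> N" unfolding iota_def by (rule L_N[OF i ab(2) e_N[OF nil_T]])
  show "iota i (mult (A i) a b) = mmult (iota i a) (iota i b)"
    unfolding iota_mult[OF i ab(1) bN]
    unfolding iota_def by (rule L_mult[OF i ab e_N[OF nil_T]])
qed

lemma iota_N: "i \<in> {1..m} \<Longrightarrow> a \<in> hcarrier (A i) \<Longrightarrow> iota i a \<in> N"
  unfolding iota_def by (rule L_N[OF _ _ e_N[OF nil_T]])

end

definition supercomm ::
  "('k::field, 'a::ab_group_add) hopf \<Rightarrow> ('k, 'b::ab_group_add) hopf \<Rightarrow> ('k, 'c::ab_group_add) hopf \<Rightarrow>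
   ('a \<Rightarrow> 'c) \<Rightarrow> ('b \<Rightarrow> 'c) \<Rightarrow> bool" where
  "supercomm A B R f g \<longleftrightarrow> (\<forall>d q. \<forall>a\<in>gr A d. \<forall>b\<in>gr B q.
     mult R (f a) (g b) = scl R ((-1) ^ (d * q)) (mult R (g b) (f a)))"

context gprod begin

lemma iota_supercomm: "comm i j \<Longrightarrow> supercomm (A i) (A j) M0 (iota i) (iota j)"
  unfolding supercomm_def M0_simps
proof (intro allI ballI)
  assume ij: "comm i j"
  note i = comm_range(1)[OF ij] and j = comm_range(2)[OF ij]
  interpret Ai: chopf "A i" by (rule chi[OF i])
  interpret Aj: chopf "A j" by (rule chi[OF j])
  fix d q a b assume a: "a \<in> gr (A i) d" and b: "b \<in> gr (A j) q"
  note aC = Ai.gr_C[OF a] and bC = Aj.gr_C[OF b]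
  show "mmult (iota i a) (iota j b) = fscale ((-1) ^ (d * q)) (mmult (iota j b) (iota i a))"
    unfolding iota_mult[OF i aC iota_N[OF j bC]] iota_mult[OF j bC iota_N[OF i aC]]
    unfolding iota_def by (rule L_commute[OF ij a b e_N[OF nil_T]])
qed

lemma alg_hom_M0_eqI:
  assumes R: "graded_algebra R" and F: "alg_hom M0 R F" and G: "alg_hom M0 R G"
    and eq: "\<And>i a. i \<in> {1..m} \<Longrightarrow> a \<in> hcarrier (A i) \<Longrightarrow> F (iota i a) = G (iota i a)"
    and x: "x \<in> N"
  shows "F x = G x"
proof -
  interpret R: galg R by unfold_locales (rule R)
  note F' = alg_homD[OF F, unfolded hcarrier_M0 M0_simps] and G' = alg_homD[OF G, unfolded hcarrier_M0 M0_simps]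
  show ?thesis
  proof (rule N_gen_eqI[OF F'(1) G'(1) R.vs _ _ x])
    show "F (e []) = G (e [])" unfolding F'(3) G'(3) ..
    fix i b x assume i: "i \<in> {1..m}" "b \<in> hcarrier (A i)" "x \<in> N" and h: "F x = G x"
    show "F (L i b x) = G (L i b x)"
      unfolding iota_mult[OF i, symmetric] F'(4)[OF iota_N[OF i(1,2)] i(3)] G'(4)[OF iota_N[OF i(1,2)] i(3)]
        eq[OF i(1,2)] h ..
  qed
qed

text \<open>The \<open>A i\<close> act on \<open>R\<close> by left multiplication through the \<open>f i\<close>; the action on the unit of \<open>R\<close> is the
  homomorphism.\<close>

lemma alg_hom_M0_exists:
  assumes R: "graded_algebra R" and f: "\<And>i. i \<in> {1..m} \<Longrightarrow> alg_hom (A i) R (f i)"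
    and comm: "\<And>i j. i \<noteq> j \<Longrightarrow> {i, j} \<in> K \<Longrightarrow> supercomm (A i) (A j) R (f i) (f j)"
  obtains F where "alg_hom M0 R F" "\<And>i a. i \<in> {1..m} \<Longrightarrow> a \<in> hcarrier (A i) \<Longrightarrow> F (iota i a) = f i a"
proof -
  interpret R: galg R by unfold_locales (rule R)
  have fC: "f i a \<in> hcarrier R" if i: "i \<in> {1..m}" and "a \<in> hcarrier (A i)" for i a
  proof -
    interpret galg2 "A i" R by unfold_locales (use hopf[OF i] R in \<open>auto simp: connected_hopf_def\<close>)
    show ?thesis by (rule alg_hom_C[OF f[OF i] that(2)])
  qed
  let ?f = "\<lambda>i a v. mult R (f i a) v"
  interpret gp_action m K A "scl R" "hcarrier R" ?f "unit R"
  proof unfold_locales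
    show "R.subspace (hcarrier R)" "unit R \<in> hcarrier R" by (rule R.sub_C R.unit_C)+
    show "?f i a v \<in> hcarrier R" if "i \<in> {1..m}" "a \<in> hcarrier (A i)" "v \<in> hcarrier R" for i a v
      by (rule R.mult_C[OF fC[OF that(1,2)] that(3)])
    show "linear_on (scl R) (scl R) (hcarrier R) (?f i a)" if "i \<in> {1..m}" "a \<in> hcarrier (A i)" for i a
      by (rule R.mult_lin2[OF fC[OF that]])
    show "linear_on (scl (A i)) (scl R) (hcarrier (A i)) (\<lambda>a. ?f i a v)" if "i \<in> {1..m}" "v \<in> hcarrier R" for i v
      by (rule linear_on_comp[OF alg_homD(1)[OF f[OF that(1)]] R.mult_lin1[OF that(2)]]) (use fC that in blast)
    show "?f i (unit (A i)) v = v" if "i \<in> {1..m}" "v \<in> hcarrier R" for i v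
      unfolding alg_homD(3)[OF f[OF that(1)]] by (rule R.unit_l[OF that(2)])
    show "?f i (mult (A i) a b) v = ?f i a (?f i b v)"
      if "i \<in> {1..m}" "a \<in> hcarrier (A i)" "b \<in> hcarrier (A i)" "v \<in> hcarrier R" for i a b v
      unfolding alg_homD(4)[OF f[OF that(1)] that(2,3)]
      by (rule R.mult_assoc[OF fC[OF that(1,2)] fC[OF that(1,3)] that(4)])
    show "?f i a (?f j b v) = scl R ((-1) ^ (d * q)) (?f j b (?f i a v))"
      if ij: "i \<noteq> j" "{i, j} \<in> K" and a: "a \<in> gr (A i) d" and b: "b \<in> gr (A j) q" and v: "v \<in> hcarrier R"
      for i j a b d q v
    proof -
      have i: "i \<in> {1..m}" and j: "j \<in> {1..m}" using comm_range[of i j] ij by (simp_all add: comm_def)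
      interpret Ai: chopf "A i" by (rule chi[OF i])
      interpret Aj: chopf "A j" by (rule chi[OF j])
      note fa = fC[OF i Ai.gr_C[OF a]] and fb = fC[OF j Aj.gr_C[OF b]]
      have "mult R (f i a) (f j b) = scl R ((-1) ^ (d * q)) (mult R (f j b) (f i a))"
        using comm[OF ij] a b by (simp add: supercomm_def)
      then show ?thesis
        using R.mult_assoc[OF fa fb v] R.mult_assoc[OF fb fa v] R.mult_scale1[OF R.mult_C[OF fb fa] v]
        by simp
    qed
  qed
  have mult: "act (mmult x y) = mult R (act x) (act y)" if x: "x \<in> N" and y: "y \<in> N" for x y
  proof (rule N_gen_eqI[OF _ _ R.vs _ _ x])
    show "linear_on fscale (scl R) N (\<lambda>x. act (mmult x y))"
      by (rule linear_on_comp[OF mmult_lin1[OF y] act_lin]) (use mmult_N y in blast)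
    show "linear_on fscale (scl R) N (\<lambda>x. mult R (act x) (act y))"
      by (rule linear_on_comp[OF act_lin R.mult_lin1[OF act_V[OF y]]]) (use act_V in blast)
    show "act (mmult (e []) y) = mult R (act (e [])) (act y)"
      unfolding mmult_nil[OF y] act_nil by (rule R.unit_l[OF act_V[OF y], symmetric])
    fix i b x assume i: "i \<in> {1..m}" "b \<in> hcarrier (A i)" "x \<in> N" and h: "act (mmult x y) = mult R (act x) (act y)"
    show "act (mmult (L i b x) y) = mult R (act (L i b x)) (act y)"
      unfolding mmult_L[OF i y] act_L[OF i(1,2) mmult_N[OF i(3) y]] act_L[OF i] h
      by (rule R.mult_assoc[OF fC[OF i(1,2)] act_V[OF i(3)] act_V[OF y], symmetric])
  qed
  have "alg_hom M0 R act" unfolding alg_hom_def hcarrier_M0 M0_simps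
  proof (intro conjI allI ballI image_subsetI act_lin act_nil mult)
    fix n x assume x: "x \<in> ngr n"
    have "act x \<in> gr R (n + 0)"
    proof (rule act_gr[where W = "gr R", OF R.sub_gr R.unit_gr _ _ x])
      show "gr R n \<subseteq> hcarrier R" for n using R.gr_C by blast
      show "?f i a v \<in> gr R (d + n)" if "i \<in> {1..m}" "a \<in> gr (A i) d" "v \<in> gr R n" for i a v d n
        by (rule R.mult_gr[OF alg_homD(2)[OF f[OF that(1)] that(2)] that(3)])
    qed
    then show "act x \<in> gr R n" by simp
  qed
  moreover have "act (iota i a) = f i a" if "i \<in> {1..m}" "a \<in> hcarrier (A i)" for i a
    unfolding iota_def act_L[OF that e_N[OF nil_T]] act_nil by (rule R.unit_r[OF fC[OF that]])
  ultimately show thesis by (rule that)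
qed

end


section \<open>Homomorphisms out of tensor powers\<close>

text \<open>The signs in the products of tensors contribute the mixed terms of the product of the total
  degrees.\<close>

lemma supercomm_tmap:
  assumes X: "graded_algebra X" and Y: "graded_algebra Y" and R: "graded_algebra R"
    and f: "alg_hom X R f" and g: "alg_hom Y R g" and fg: "supercomm X Y R f g"
  shows "supercomm (talg X X) (talg Y Y) (talg R R) (tmap X X R R f f) (tmap Y Y R R g g)"
  unfolding supercomm_def talg_simps
proof (intro allI ballI)
  interpret X: galg2 X X by unfold_locales (rule X)+
  interpret Y: galg2 Y Y by unfold_locales (rule Y)+
  interpret R: galg2 R R by unfold_locales (rule R)+
  let ?F = "tmap X X R R f f" and ?G = "tmap Y Y R R g g"
  note F = tmap_lin[OF X X R R f f] and G = tmap_lin[OF Y Y R R g g]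
  note f' = alg_homD[OF f] and g' = alg_homD[OF g]
  fix d q t u assume t: "t \<in> gr (talg X X) d" and u: "u \<in> gr (talg Y Y) q"
  have tC: "t \<in> tcar X X" and uC: "u \<in> tcar Y Y" using t u X.talg_gr_tcar Y.talg_gr_tcar by blast+
  have FC: "?F s \<in> tcar R R" if "s \<in> tcar X X" for s
  proof (rule X.tcar_image[OF F(1) vector_space_fscale subspace_tspan _ that])
    fix i j a b assume h: "a \<in> gr X i" "b \<in> gr X j"
    show "?F (ten X X a b) \<in> tcar R R"
      unfolding F(2)[OF X.A.gr_C[OF h(1)] X.A.gr_C[OF h(2)]]
      by (rule R.ten_tcar[OF R.A.gr_C[OF f'(2)[OF h(1)]] R.A.gr_C[OF f'(2)[OF h(2)]]])
  qed
  have GC: "?G s \<in> tcar R R" if "s \<in> tcar Y Y" for s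
  proof (rule Y.tcar_image[OF G(1) vector_space_fscale subspace_tspan _ that])
    fix i j a b assume h: "a \<in> gr Y i" "b \<in> gr Y j"
    show "?G (ten Y Y a b) \<in> tcar R R"
      unfolding G(2)[OF Y.A.gr_C[OF h(1)] Y.A.gr_C[OF h(2)]]
      by (rule R.ten_tcar[OF R.A.gr_C[OF g'(2)[OF h(1)]] R.A.gr_C[OF g'(2)[OF h(2)]]])
  qed
  show "tmult R R (?F t) (?G u) = fscale ((-1) ^ (d * q)) (tmult R R (?G u) (?F t))"
  proof (rule X.talg_gr_eqI[OF _ _ vector_space_fscale _ t])
    show "linear_on fscale fscale (tcar X X) (\<lambda>t. tmult R R (?F t) (?G u))"
      by (rule linear_on_comp[OF F(1) R.tmult_lin1[OF GC[OF uC]]]) (use FC in blast)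
    show "linear_on fscale fscale (tcar X X) (\<lambda>t. fscale ((-1) ^ (d * q)) (tmult R R (?G u) (?F t)))"
      by (rule linear_on_scaled[OF linear_on_comp[OF F(1) R.tmult_lin2[OF GC[OF uC]]] vector_space_fscale])
        (use FC in blast)
    fix i j a a' assume a: "a \<in> gr X i" "a' \<in> gr X j" and ij: "i + j = d"
    have aC: "ten X X a a' \<in> tcar X X" by (rule X.ten_tcar[OF X.A.gr_C[OF a(1)] X.A.gr_C[OF a(2)]])
    show "tmult R R (?F (ten X X a a')) (?G u) = fscale ((-1) ^ (d * q)) (tmult R R (?G u) (?F (ten X X a a')))"
    proof (rule Y.talg_gr_eqI[OF _ _ vector_space_fscale _ u])
      show "linear_on fscale fscale (tcar Y Y) (\<lambda>u. tmult R R (?F (ten X X a a')) (?G u))"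
        by (rule linear_on_comp[OF G(1) R.tmult_lin2[OF FC[OF aC]]]) (use GC in blast)
      show "linear_on fscale fscale (tcar Y Y) (\<lambda>u. fscale ((-1) ^ (d * q)) (tmult R R (?G u) (?F (ten X X a a'))))"
        by (rule linear_on_scaled[OF linear_on_comp[OF G(1) R.tmult_lin1[OF FC[OF aC]]] vector_space_fscale])
          (use GC in blast)
      fix k l b b' assume b: "b \<in> gr Y k" "b' \<in> gr Y l" and kl: "k + l = q"
      have c1: "mult R (f a) (g b) = scl R ((-1) ^ (i * k)) (mult R (g b) (f a))"
        and c2: "mult R (f a') (g b') = scl R ((-1) ^ (j * l)) (mult R (g b') (f a'))"
        using fg a b unfolding supercomm_def by blast+
      show "tmult R R (?F (ten X X a a')) (?G (ten Y Y b b')) =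
        fscale ((-1) ^ (d * q)) (tmult R R (?G (ten Y Y b b')) (?F (ten X X a a')))"
        unfolding F(2)[OF X.A.gr_C[OF a(1)] X.A.gr_C[OF a(2)]] G(2)[OF Y.A.gr_C[OF b(1)] Y.A.gr_C[OF b(2)]]
          R.tmult_ten[OF f'(2)[OF a(1)] f'(2)[OF a(2)] g'(2)[OF b(1)] g'(2)[OF b(2)]]
          R.tmult_ten[OF g'(2)[OF b(1)] g'(2)[OF b(2)] f'(2)[OF a(1)] f'(2)[OF a(2)]]
          c1 c2 R.ten_scale fs.scale_scale power_add[symmetric]
        by (rule arg_cong[where f = "\<lambda>c. fscale c _"], rule minus_one_power_eq)
          (simp add: ij[symmetric] kl[symmetric] algebra_simps)
    qed
  qed
qed

lemma tcar3_eqI: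
  assumes X: "graded_algebra X"
    and F: "linear_on fscale s (tcar (talg X X) X) F" and G: "linear_on fscale s (tcar (talg X X) X) G"
    and s: "vector_space s"
    and eq: "\<And>i j k a b c. a \<in> gr X i \<Longrightarrow> b \<in> gr X j \<Longrightarrow> c \<in> gr X k \<Longrightarrow>
      F (ten (talg X X) X (ten X X a b) c) = G (ten (talg X X) X (ten X X a b) c)"
    and t: "t \<in> tcar (talg X X) X"
  shows "F t = G t"
proof -
  interpret X: galg2 X X by unfold_locales (rule X)+
  interpret TX: galg2 "talg X X" X by unfold_locales
  show ?thesis
  proof (rule TX.tcar_eqI[OF F[folded talg_simps(1)[of X X]] G[folded talg_simps(1)[of X X]] s _ t[folded talg_simps(1)[of X X]]])
    fix i k u c assume u: "u \<in> gr (talg X X) i" and c: "c \<in> gr X k"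
    have T: "linear_on fscale fscale (tcar X X) (\<lambda>u. ten (talg X X) X u c)"
      unfolding ten_def talg_simps by (rule tensor_lin1)
    have im: "(\<lambda>u. ten (talg X X) X u c) ` tcar X X \<subseteq> tcar (talg X X) X"
      using TX.ten_tcar[OF _ X.A.gr_C[OF c]] by (auto simp: X.hcarrier_talg)
    show "F (ten (talg X X) X u c) = G (ten (talg X X) X u c)"
      by (rule X.talg_gr_eqI[OF linear_on_comp[OF T F] linear_on_comp[OF T G] s eq u])
        (use im c in \<open>auto simp: talg_simps\<close>)
  qed
qed

lemma tassoc_ten:
  assumes X: "graded_algebra X" and a: "a \<in> gr X i" "b \<in> gr X j" "c \<in> gr X k"
  shows "tassoc X (ten (talg X X) X (ten X X a b) c) = ten X (talg X X) a (ten X X b c)"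
proof -
  interpret X: galg X by unfold_locales (rule X)
  show ?thesis by (rule tassoc(2)[OF X X.gr_C[OF a(1)] X.gr_C[OF a(2)] X.gr_C[OF a(3)]])
qed

lemma alg_hom_tassoc:
  assumes X: "graded_algebra X"
  shows "alg_hom (talg (talg X X) X) (talg X (talg X X)) (tassoc X)"
proof -
  interpret X: galg2 X X by unfold_locales (rule X)+
  interpret TX: galg2 "talg X X" X by unfold_locales
  interpret XT: galg2 X "talg X X" by unfold_locales
  let ?F = "tassoc X"
  have F: "linear_on fscale fscale (tcar (talg X X) X) ?F" using tassoc(1)[OF X] by simp
  have tenl: "linear_on fscale fscale (tcar X X) (\<lambda>u. ten (talg X X) X u c)" for c
    unfolding ten_def talg_simps by (rule tensor_lin1)
  have tenC: "ten (talg X X) X u c \<in> tcar (talg X X) X" if "u \<in> tcar X X" "c \<in> hcarrier X" for u c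
    using TX.ten_tcar that by (simp add: X.hcarrier_talg)
  have Fl: "linear_on fscale fscale (tcar X X) (\<lambda>u. ?F (ten (talg X X) X u c))" if c: "c \<in> hcarrier X" for c
    by (rule linear_on_comp[OF tenl F]) (use tenC[OF _ c] in blast)
  note T = tassoc_ten[OF X]
  have Fgr: "?F (ten (talg X X) X a b) \<in> gr (talg X (talg X X)) (i + j)"
    if a: "a \<in> gr (talg X X) i" and b: "b \<in> gr X j" for a b i j
  proof (rule X.talg_gr_image[OF Fl[OF X.A.gr_C[OF b]] vector_space_fscale XT.sub_talg_gr _ a])
    fix p q x y assume xy: "x \<in> gr X p" "y \<in> gr X q" "p + q = i"
    show "?F (ten (talg X X) X (ten X X x y) b) \<in> gr (talg X (talg X X)) (i + j)"
      unfolding T[OF xy(1,2) b] using xy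
      by (intro XT.talg_gr_base[OF xy(1) X.talg_gr_base[OF xy(2) b refl]]) simp
  qed
  have FC: "?F (ten (talg X X) X a b) \<in> tcar X (talg X X)"
    if a: "a \<in> gr (talg X X) i" and b: "b \<in> gr X j" for a b i j
    using Fgr[OF a b] XT.talg_gr_tcar by blast
  have FC': "?F (ten (talg X X) X a b) \<in> tcar X (talg X X)"
    if a: "a \<in> tcar X X" and b: "b \<in> gr X j" for a b j
  proof (rule X.tcar_image[OF Fl[OF X.A.gr_C[OF b]] vector_space_fscale subspace_tspan _ a])
    fix i j' x y assume "x \<in> gr X i" "y \<in> gr X j'"
    then show "?F (ten (talg X X) X (ten X X x y) b) \<in> tcar X (talg X X)"
      using FC[OF X.talg_gr_base b] by blast
  qed
  show ?thesis
  proof (rule alg_hom_from_talg[OF X.T.ga X XT.T.ga])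
    show "linear_on fscale (scl (talg X (talg X X))) (tcar (talg X X) X) ?F" using F by simp
    show "?F (ten (talg X X) X (unit (talg X X)) (unit X)) = unit (talg X (talg X X))"
      using T[OF X.A.unit_gr X.A.unit_gr X.A.unit_gr] by simp
    fix i j r l a b c d
    assume a: "a \<in> gr (talg X X) i" and b: "b \<in> gr X j" and c: "c \<in> gr (talg X X) r" and d: "d \<in> gr X l"
    note aC = subsetD[OF X.talg_gr_tcar a] and cC = subsetD[OF X.talg_gr_tcar c]
    note bC = X.A.gr_C[OF b] and dC = X.A.gr_C[OF d]
    note bd = X.A.mult_C[OF bC dC]
    have "fscale ((- 1) ^ (j * r)) (?F (ten (talg X X) X (tmult X X a c) (mult X b d))) =
        tmult X (talg X X) (?F (ten (talg X X) X a b)) (?F (ten (talg X X) X c d))"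
    proof (rule X.talg_gr_eqI[OF _ _ vector_space_fscale _ a])
      show "linear_on fscale fscale (tcar X X)
         (\<lambda>a. fscale ((- 1) ^ (j * r)) (?F (ten (talg X X) X (tmult X X a c) (mult X b d))))"
        by (rule linear_on_scaled[OF linear_on_comp[OF X.tmult_lin1[OF cC] Fl[OF bd]] vector_space_fscale])
          (use X.tmult_tcar[OF _ cC] in blast)
      show "linear_on fscale fscale (tcar X X)
         (\<lambda>a. tmult X (talg X X) (?F (ten (talg X X) X a b)) (?F (ten (talg X X) X c d)))"
        by (rule linear_on_comp[OF Fl[OF bC] XT.tmult_lin1[OF FC[OF c d]]]) (use FC'[OF _ b] in blast)
      fix p q x y assume xy: "x \<in> gr X p" "y \<in> gr X q" and pq: "p + q = i"
      note xyC = X.ten_tcar[OF X.A.gr_C[OF xy(1)] X.A.gr_C[OF xy(2)]]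
      show "fscale ((- 1) ^ (j * r)) (?F (ten (talg X X) X (tmult X X (ten X X x y) c) (mult X b d))) =
        tmult X (talg X X) (?F (ten (talg X X) X (ten X X x y) b)) (?F (ten (talg X X) X c d))"
      proof (rule X.talg_gr_eqI[OF _ _ vector_space_fscale _ c])
        show "linear_on fscale fscale (tcar X X)
         (\<lambda>c. fscale ((- 1) ^ (j * r)) (?F (ten (talg X X) X (tmult X X (ten X X x y) c) (mult X b d))))"
          by (rule linear_on_scaled[OF linear_on_comp[OF X.tmult_lin2[OF xyC] Fl[OF bd]] vector_space_fscale])
            (use X.tmult_tcar[OF xyC] in blast)
        show "linear_on fscale fscale (tcar X X)
         (\<lambda>c. tmult X (talg X X) (?F (ten (talg X X) X (ten X X x y) b)) (?F (ten (talg X X) X c d)))"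
          by (rule linear_on_comp[OF Fl[OF dC] XT.tmult_lin2[OF FC'[OF xyC b]]]) (use FC'[OF _ d] in blast)
        fix p' q' x' y' assume xy': "x' \<in> gr X p'" "y' \<in> gr X q'" and r: "p' + q' = r"
        note yb = X.talg_gr_base[OF xy(2) b refl] and yd = X.talg_gr_base[OF xy'(2) d refl]
        note xx = X.A.mult_gr[OF xy(1) xy'(1)] and yy = X.A.mult_gr[OF xy(2) xy'(2)] and bd' = X.A.mult_gr[OF b d]
        have 1: "?F (ten (talg X X) X (fscale k (ten X X (mult X x x') (mult X y y'))) (mult X b d)) =
            fscale k (ten X (talg X X) (mult X x x') (ten X X (mult X y y') (mult X b d)))" for k
          using linear_on_scale[OF Fl[OF bd] X.ten_tcar[OF X.A.gr_C[OF xx] X.A.gr_C[OF yy]], of k]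
          unfolding T[OF xx yy bd'] .
        show "fscale ((- 1) ^ (j * r)) (?F (ten (talg X X) X (tmult X X (ten X X x y) (ten X X x' y')) (mult X b d))) =
          tmult X (talg X X) (?F (ten (talg X X) X (ten X X x y) b)) (?F (ten (talg X X) X (ten X X x' y') d))"
          unfolding X.tmult_ten[OF xy xy'] 1 T[OF xy b] T[OF xy' d] XT.tmult_ten[OF xy(1) yb xy'(1) yd]
            talg_simps X.tmult_ten[OF xy(2) b xy'(2) d] XT.ten_scale(2)[unfolded talg_simps] fs.scale_scale power_add[symmetric]
          by (rule arg_cong[where f = "\<lambda>c. fscale c _"], rule minus_one_power_eq)
            (simp add: r[symmetric] algebra_simps)
      qed
    qed
    then show "scl (talg X (talg X X)) ((- 1) ^ (j * r)) (?F (ten (talg X X) X (mult (talg X X) a c) (mult X b d))) =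
        mult (talg X (talg X X)) (?F (ten (talg X X) X a b)) (?F (ten (talg X X) X c d))"
      by (simp only: talg_simps)
  qed (rule Fgr)
qed

lemma tassoc_natural:
  assumes X: "graded_algebra X" and Y: "graded_algebra Y" and f: "alg_hom X Y f"
    and t: "t \<in> tcar (talg X X) X"
  shows "tassoc Y (tmap (talg X X) X (talg Y Y) Y (tmap X X Y Y f f) f t) =
    tmap X (talg X X) Y (talg Y Y) f (tmap X X Y Y f f) (tassoc X t)"
proof -
  interpret X: galg2 X X by unfold_locales (rule X)+
  interpret Y: galg2 Y Y by unfold_locales (rule Y)+
  interpret TX: galg2 "talg X X" X by unfold_locales
  interpret XT: galg2 X "talg X X" by unfold_locales
  interpret TY: galg2 "talg Y Y" Y by unfold_locales
  interpret XY: galg2 X Y by unfold_locales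
  note f' = alg_homD[OF f]
  note ff = alg_hom_tmap[OF X X Y Y f f]
  note L = alg_hom_comp[OF TX.T.ga TY.T.ga alg_hom_tmap[OF X.T.ga X Y.T.ga Y ff f] alg_hom_tassoc[OF Y]]
  note R = alg_hom_comp[OF TX.T.ga XT.T.ga alg_hom_tassoc[OF X] alg_hom_tmap[OF X X.T.ga Y Y.T.ga f ff]]
  have L': "linear_on fscale fscale (tcar (talg X X) X)
      (\<lambda>t. tassoc Y (tmap (talg X X) X (talg Y Y) Y (tmap X X Y Y f f) f t))"
    using alg_homD(1)[OF L] unfolding TX.hcarrier_talg talg_simps .
  have R': "linear_on fscale fscale (tcar (talg X X) X)
      (\<lambda>t. tmap X (talg X X) Y (talg Y Y) f (tmap X X Y Y f f) (tassoc X t))"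
    using alg_homD(1)[OF R] unfolding TX.hcarrier_talg talg_simps .
  show ?thesis
  proof (rule tcar3_eqI[OF X L' R' vector_space_fscale _ t])
    fix i j k a b c assume h: "a \<in> gr X i" "b \<in> gr X j" "c \<in> gr X k"
    note C = X.A.gr_C[OF h(1)] X.A.gr_C[OF h(2)] X.A.gr_C[OF h(3)]
    have ab: "ten X X a b \<in> hcarrier (talg X X)" "ten X X b c \<in> hcarrier (talg X X)"
      unfolding X.hcarrier_talg by (rule X.ten_tcar[OF C(1,2)] X.ten_tcar[OF C(2,3)])+
    show "tassoc Y (tmap (talg X X) X (talg Y Y) Y (tmap X X Y Y f f) f (ten (talg X X) X (ten X X a b) c)) =
      tmap X (talg X X) Y (talg Y Y) f (tmap X X Y Y f f) (tassoc X (ten (talg X X) X (ten X X a b) c))"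
      unfolding tmap_lin(2)[OF X.T.ga X Y.T.ga Y ff f ab(1) C(3)] tmap_lin(2)[OF X X Y Y f f C(1,2)]
        tassoc_ten[OF X h] tassoc_ten[OF Y f'(2)[OF h(1)] f'(2)[OF h(2)] f'(2)[OF h(3)]]
        tmap_lin(2)[OF X X.T.ga Y Y.T.ga f ff C(1) ab(2)] tmap_lin(2)[OF X X Y Y f f C(2,3)] ..
  qed
qed


text \<open>The ground field, whose algebra homomorphisms are the augmentations.\<close>

definition kalg :: "('k::field, 'k) hopf" where
  "kalg = \<lparr>scl = (*), gr = (\<lambda>n. if n = 0 then UNIV else {0}), mult = (*), unit = 1,
     comult = undefined, counit = undefined\<rparr>"

lemma kalg_simps: "scl kalg = (*)" "gr kalg n = (if n = 0 then UNIV else {0})" "mult kalg = (*)" "unit kalg = 1"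
  by (simp_all add: kalg_def)

lemma hcarrier_kalg: "hcarrier kalg = UNIV"
proof -
  interpret vector_space "(*) :: 'a \<Rightarrow> _" by (rule vector_space_times)
  have "(\<Union>n. gr (kalg :: ('a, 'a) hopf) n) = UNIV" by (auto simp: kalg_simps intro: exI[of _ 0])
  then show ?thesis by (simp add: hcarrier_def kalg_simps)
qed

lemma graded_algebra_kalg: "graded_algebra (kalg :: ('k::field, 'k) hopf)"
  unfolding graded_algebra_def hcarrier_kalg
proof (intro conjI allI ballI)
  interpret vector_space "(*) :: 'k \<Rightarrow> _" by (rule vector_space_times)
  show "graded_space (scl (kalg :: ('k, 'k) hopf)) (gr kalg)"
    unfolding kalg_simps(1)
  proof (rule graded_spaceI[where P = "\<lambda>k x. if k = 0 then x else 0", OF vector_space_times])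
    show "subspace (gr kalg n)" for n by (simp add: kalg_simps subspace_single_0)
    show "linear_on (*) (*) (span (\<Union>n. gr kalg n)) (\<lambda>x. if k = 0 then x else 0)" for k :: nat
      by (simp add: linear_on_def)
  qed (auto simp: kalg_simps split: if_splits)
qed (auto simp: kalg_simps linear_on_def algebra_simps split: if_splits)

definition contr_l :: "('k::field, 'a::ab_group_add) hopf \<Rightarrow> ('a \<Rightarrow> 'k) \<Rightarrow> ('k, 'a, 'a) tensor \<Rightarrow> 'a" where
  "contr_l A \<epsilon> = lin_ext fscale (scl A) (hcarrier A \<times> hcarrier A) (\<lambda>(x, y). ten A A x y) (\<lambda>(x, y). scl A (\<epsilon> x) y)"

definition contr_r :: "('k::field, 'a::ab_group_add) hopf \<Rightarrow> ('a \<Rightarrow> 'k) \<Rightarrow> ('k, 'a, 'a) tensor \<Rightarrow> 'a" where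
  "contr_r A \<epsilon> = lin_ext fscale (scl A) (hcarrier A \<times> hcarrier A) (\<lambda>(x, y). ten A A x y) (\<lambda>(x, y). scl A (\<epsilon> y) x)"

lemma contr:
  assumes X: "graded_algebra X" and l: "linear_on (scl X) (*) (hcarrier X) \<epsilon>"
  shows "linear_on fscale (scl X) (tcar X X) (contr_l X \<epsilon>)" "linear_on fscale (scl X) (tcar X X) (contr_r X \<epsilon>)"
    and "x \<in> hcarrier X \<Longrightarrow> y \<in> hcarrier X \<Longrightarrow> contr_l X \<epsilon> (ten X X x y) = scl X (\<epsilon> x) y"
    and "x \<in> hcarrier X \<Longrightarrow> y \<in> hcarrier X \<Longrightarrow> contr_r X \<epsilon> (ten X X x y) = scl X (\<epsilon> y) x"
proof -
  interpret X: galg2 X X by unfold_locales (rule X)+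
  have e: "linear_on (scl X) (scl X) (hcarrier X) (\<lambda>x. scl X (\<epsilon> x) y)" for y
    using l by (simp add: linear_on_def X.A.scale_left_distrib)
  note L = tensor_universal[where h = "\<lambda>x y. scl X (\<epsilon> x) y", OF X.A.vs X.A.vs X.A.vs X.A.sub_C X.A.sub_C
      linear_on_scale_map[OF X.A.vs] e]
  note R = tensor_universal[where h = "\<lambda>x y. scl X (\<epsilon> y) x", OF X.A.vs X.A.vs X.A.vs X.A.sub_C X.A.sub_C
      e linear_on_scale_map[OF X.A.vs]]
  show "linear_on fscale (scl X) (tcar X X) (contr_l X \<epsilon>)" "linear_on fscale (scl X) (tcar X X) (contr_r X \<epsilon>)"
    using L(1) R(1) unfolding tspan_def contr_l_def contr_r_def ten_def by auto
  show "x \<in> hcarrier X \<Longrightarrow> y \<in> hcarrier X \<Longrightarrow> contr_l X \<epsilon> (ten X X x y) = scl X (\<epsilon> x) y"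
    "x \<in> hcarrier X \<Longrightarrow> y \<in> hcarrier X \<Longrightarrow> contr_r X \<epsilon> (ten X X x y) = scl X (\<epsilon> y) x"
    using L(2)[of x y] R(2)[of x y] unfolding contr_l_def contr_r_def ten_def by auto
qed

lemma alg_hom_contr:
  assumes X: "graded_algebra X" and \<epsilon>: "alg_hom X kalg \<epsilon>"
  shows "alg_hom (talg X X) X (contr_l X \<epsilon>)" "alg_hom (talg X X) X (contr_r X \<epsilon>)"
proof -
  interpret X: galg2 X X by unfold_locales (rule X)+
  note e = alg_homD[OF \<epsilon>, unfolded kalg_simps]
  note c = contr[OF X e(1)]
  have pos: "\<epsilon> a = 0" if "a \<in> gr X n" "n \<noteq> 0" for a n using e(2)[OF that(1)] that(2) by simp
  have sg: "scl X ((-1) ^ (j * r)) (scl X k x) = scl X k x" if "k = 0 \<or> j = 0 \<or> r = 0" for j r k x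
    using that by auto
  show "alg_hom (talg X X) X (contr_l X \<epsilon>)"
  proof (rule alg_hom_from_talg[OF X X X c(1)])
    show "contr_l X \<epsilon> (ten X X a b) \<in> gr X (i + j)" if h: "a \<in> gr X i" "b \<in> gr X j" for a b i j
      unfolding c(3)[OF X.A.gr_C[OF h(1)] X.A.gr_C[OF h(2)]]
      using pos[OF h(1)] X.A.scale_gr[OF h(2)] X.A.subspace_0[OF X.A.sub_gr] by (cases "i = 0") auto
    show "contr_l X \<epsilon> (ten X X (unit X) (unit X)) = unit X"
      unfolding c(3)[OF X.A.unit_C X.A.unit_C] e(3) by simp
    fix i j r l a b c' d assume h: "a \<in> gr X i" "b \<in> gr X j" "c' \<in> gr X r" "d \<in> gr X l"
    note hC = X.A.gr_C[OF h(1)] X.A.gr_C[OF h(2)] X.A.gr_C[OF h(3)] X.A.gr_C[OF h(4)]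
    have k: "\<epsilon> a * \<epsilon> c' = 0 \<or> j = 0 \<or> r = 0" using pos[OF h(3)] by auto
    show "scl X ((- 1) ^ (j * r)) (contr_l X \<epsilon> (ten X X (mult X a c') (mult X b d))) =
       mult X (contr_l X \<epsilon> (ten X X a b)) (contr_l X \<epsilon> (ten X X c' d))"
      unfolding c(3)[OF hC(1,2)] c(3)[OF hC(3,4)] c(3)[OF X.A.mult_C[OF hC(1,3)] X.A.mult_C[OF hC(2,4)]]
        e(4)[OF hC(1,3)] sg[OF k] X.A.mult_scale1[OF hC(2) X.A.scale_C[OF hC(4)]] X.A.mult_scale2[OF hC(2,4)]
      by simp
  qed
  show "alg_hom (talg X X) X (contr_r X \<epsilon>)"
  proof (rule alg_hom_from_talg[OF X X X c(2)])
    show "contr_r X \<epsilon> (ten X X a b) \<in> gr X (i + j)" if h: "a \<in> gr X i" "b \<in> gr X j" for a b i j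
      unfolding c(4)[OF X.A.gr_C[OF h(1)] X.A.gr_C[OF h(2)]]
      using pos[OF h(2)] X.A.scale_gr[OF h(1)] X.A.subspace_0[OF X.A.sub_gr] by (cases "j = 0") auto
    show "contr_r X \<epsilon> (ten X X (unit X) (unit X)) = unit X"
      unfolding c(4)[OF X.A.unit_C X.A.unit_C] e(3) by simp
    fix i j r l a b c' d assume h: "a \<in> gr X i" "b \<in> gr X j" "c' \<in> gr X r" "d \<in> gr X l"
    note hC = X.A.gr_C[OF h(1)] X.A.gr_C[OF h(2)] X.A.gr_C[OF h(3)] X.A.gr_C[OF h(4)]
    have k: "\<epsilon> b * \<epsilon> d = 0 \<or> j = 0 \<or> r = 0" using pos[OF h(2)] by auto
    show "scl X ((- 1) ^ (j * r)) (contr_r X \<epsilon> (ten X X (mult X a c') (mult X b d))) =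
       mult X (contr_r X \<epsilon> (ten X X a b)) (contr_r X \<epsilon> (ten X X c' d))"
      unfolding c(4)[OF hC(1,2)] c(4)[OF hC(3,4)] c(4)[OF X.A.mult_C[OF hC(1,3)] X.A.mult_C[OF hC(2,4)]]
        e(4)[OF hC(2,4)] sg[OF k] X.A.mult_scale1[OF hC(1) X.A.scale_C[OF hC(3)]] X.A.mult_scale2[OF hC(1,3)]
      by simp
  qed
qed

lemma contr_natural:
  assumes X: "graded_algebra X" and Y: "graded_algebra Y" and f: "alg_hom X Y f"
    and ex: "linear_on (scl X) (*) (hcarrier X) \<epsilon>" and ey: "linear_on (scl Y) (*) (hcarrier Y) \<eta>"
    and eq: "\<And>x. x \<in> hcarrier X \<Longrightarrow> \<eta> (f x) = \<epsilon> x" and t: "t \<in> tcar X X"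
  shows "contr_l Y \<eta> (tmap X X Y Y f f t) = f (contr_l X \<epsilon> t)"
    "contr_r Y \<eta> (tmap X X Y Y f f t) = f (contr_r X \<epsilon> t)"
proof -
  interpret X: galg2 X X by unfold_locales (rule X)+
  interpret Y: galg2 Y Y by unfold_locales (rule Y)+
  interpret XY: galg2 X Y by unfold_locales
  interpret TT: galg2 "talg X X" "talg Y Y" by unfold_locales
  note cx = contr[OF X ex] and cy = contr[OF Y ey]
  note F = tmap_lin[OF X X Y Y f f]
  have FC: "tmap X X Y Y f f ` tcar X X \<subseteq> tcar Y Y"
    using TT.alg_hom_C[OF alg_hom_tmap[OF X X Y Y f f]] by (auto simp: X.hcarrier_talg Y.hcarrier_talg)
  have C: "contr_l X \<epsilon> ` tcar X X \<subseteq> hcarrier X" "contr_r X \<epsilon> ` tcar X X \<subseteq> hcarrier X"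
  proof safe
    show "contr_l X \<epsilon> t \<in> hcarrier X" if "t \<in> tcar X X" for t
      by (rule X.tcar_image[OF cx(1) X.A.vs X.A.sub_C _ that]) (simp add: cx(3) X.A.gr_C X.A.scale_C)
    show "contr_r X \<epsilon> t \<in> hcarrier X" if "t \<in> tcar X X" for t
      by (rule X.tcar_image[OF cx(2) X.A.vs X.A.sub_C _ that]) (simp add: cx(4) X.A.gr_C X.A.scale_C)
  qed
  note f' = alg_homD[OF f]
  show "contr_l Y \<eta> (tmap X X Y Y f f t) = f (contr_l X \<epsilon> t)"
  proof (rule X.tcar_eqI[OF linear_on_comp[OF F(1) cy(1) FC] linear_on_comp[OF cx(1) f'(1) C(1)] Y.A.vs _ t])
    fix i j a b assume "a \<in> gr X i" "b \<in> gr X j"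
    then have h: "a \<in> hcarrier X" "b \<in> hcarrier X" using X.A.gr_C by auto
    show "contr_l Y \<eta> (tmap X X Y Y f f (ten X X a b)) = f (contr_l X \<epsilon> (ten X X a b))"
      unfolding F(2)[OF h] cx(3)[OF h] cy(3)[OF XY.alg_hom_C[OF f h(1)] XY.alg_hom_C[OF f h(2)]] eq[OF h(1)]
        linear_on_scale[OF f'(1) h(2)] ..
  qed
  show "contr_r Y \<eta> (tmap X X Y Y f f t) = f (contr_r X \<epsilon> t)"
  proof (rule X.tcar_eqI[OF linear_on_comp[OF F(1) cy(2) FC] linear_on_comp[OF cx(2) f'(1) C(2)] Y.A.vs _ t])
    fix i j a b assume "a \<in> gr X i" "b \<in> gr X j"
    then have h: "a \<in> hcarrier X" "b \<in> hcarrier X" using X.A.gr_C by auto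
    show "contr_r Y \<eta> (tmap X X Y Y f f (ten X X a b)) = f (contr_r X \<epsilon> (ten X X a b))"
      unfolding F(2)[OF h] cx(4)[OF h] cy(4)[OF XY.alg_hom_C[OF f h(1)] XY.alg_hom_C[OF f h(2)]] eq[OF h(2)]
        linear_on_scale[OF f'(1) h(1)] ..
  qed
qed


section \<open>The Hopf algebra structure of the graph product\<close>

context gprod begin

definition delta :: "nat \<Rightarrow> 'a \<Rightarrow> ('k, ('k, 'a) word_space, ('k, 'a) word_space) tensor" where
  "delta i a = tmap (A i) (A i) M0 M0 (iota i) (iota i) (comult (A i) a)"

text \<open>Characterized by the universal property: on the image of \<^term>\<open>A i\<close> it is the comultiplication of
  \<^term>\<open>A i\<close>.\<close>

definition mcomult where
  "mcomult = (SOME F. alg_hom M0 (talg M0 M0) F \<and>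
     (\<forall>i\<in>{1..m}. \<forall>a\<in>hcarrier (A i). F (iota i a) = delta i a))"

definition mcounit :: "('k, 'a) word_space \<Rightarrow> 'k" where
  "mcounit = (SOME F. alg_hom M0 kalg F \<and>
     (\<forall>i\<in>{1..m}. \<forall>a\<in>hcarrier (A i). F (iota i a) = counit (A i) a))"

definition M :: "('k, ('k, 'a) word_space) hopf" where
  "M = \<lparr>scl = fscale, gr = ngr, mult = mmult, unit = e [], comult = mcomult, counit = mcounit\<rparr>"

lemma M_simps: "scl M = fscale" "gr M = ngr" "mult M = mmult" "unit M = e []" "comult M = mcomult"
  "counit M = mcounit"
  by (simp_all add: M_def)

sublocale M0: galg2 M0 M0 by unfold_locales (rule graded_algebra_M0)+

lemma delta_alg_hom:
  assumes i: "i \<in> {1..m}" shows "alg_hom (A i) (talg M0 M0) (delta i)"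
proof -
  interpret Ai: chopf "A i" by (rule chi[OF i])
  show ?thesis
    using alg_hom_comp[OF Ai.ga Ai.AA.T.ga Ai.alg_hom_comult
        alg_hom_tmap[OF Ai.ga Ai.ga graded_algebra_M0 graded_algebra_M0 iota_alg_hom[OF i] iota_alg_hom[OF i]]]
    by (simp add: delta_def[abs_def])
qed

lemma delta_supercomm:
  assumes ij: "i \<noteq> j" "{i, j} \<in> K"
  shows "supercomm (A i) (A j) (talg M0 M0) (delta i) (delta j)"
proof -
  have c: "comm i j" using ij by (simp add: comm_def)
  note i = comm_range(1)[OF c] and j = comm_range(2)[OF c]
  interpret Ai: chopf "A i" by (rule chi[OF i])
  interpret Aj: chopf "A j" by (rule chi[OF j])
  show ?thesis
    using supercomm_tmap[OF Ai.ga Aj.ga graded_algebra_M0 iota_alg_hom[OF i] iota_alg_hom[OF j] iota_supercomm[OF c]]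
      Ai.comult_gr Aj.comult_gr
    unfolding supercomm_def delta_def by blast
qed

lemma mcomult: "alg_hom M0 (talg M0 M0) mcomult"
  "i \<in> {1..m} \<Longrightarrow> a \<in> hcarrier (A i) \<Longrightarrow> mcomult (iota i a) = delta i a"
proof -
  have "\<exists>F. alg_hom M0 (talg M0 M0) F \<and> (\<forall>i\<in>{1..m}. \<forall>a\<in>hcarrier (A i). F (iota i a) = delta i a)"
    by (rule alg_hom_M0_exists[OF M0.T.ga delta_alg_hom delta_supercomm]) blast+
  from someI_ex[OF this, folded mcomult_def] show "alg_hom M0 (talg M0 M0) mcomult"
    "i \<in> {1..m} \<Longrightarrow> a \<in> hcarrier (A i) \<Longrightarrow> mcomult (iota i a) = delta i a"
    by blast+
qed

lemma alg_hom_counit: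
  assumes "chopf B" shows "alg_hom B kalg (counit B)"
proof -
  interpret chopf B by fact
  show ?thesis unfolding alg_hom_def kalg_simps
    by (intro conjI allI ballI image_subsetI counit_lin counit_unit counit_mult) (simp add: counit_pos)
qed

lemma mcounit: "alg_hom M0 kalg mcounit"
  "i \<in> {1..m} \<Longrightarrow> a \<in> hcarrier (A i) \<Longrightarrow> mcounit (iota i a) = counit (A i) a"
proof -
  have sc: "supercomm (A i) (A j) kalg (counit (A i)) (counit (A j))" if ij: "i \<noteq> j" "{i, j} \<in> K" for i j
  proof -
    have c: "comm i j" using ij by (simp add: comm_def)
    interpret Ai: chopf "A i" by (rule chi[OF comm_range(1)[OF c]])
    show ?thesis unfolding supercomm_def kalg_simps
    proof (intro allI ballI)
      fix d q a b assume "a \<in> gr (A i) d"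
      then show "counit (A i) a * counit (A j) b = (-1) ^ (d * q) * (counit (A j) b * counit (A i) a)"
        using Ai.counit_pos[of d a] by (cases "d = 0") auto
    qed
  qed
  have "\<exists>F. alg_hom M0 kalg F \<and> (\<forall>i\<in>{1..m}. \<forall>a\<in>hcarrier (A i). F (iota i a) = counit (A i) a)"
    by (rule alg_hom_M0_exists[OF graded_algebra_kalg alg_hom_counit[OF chi] sc]) blast+
  from someI_ex[OF this, folded mcounit_def] show "alg_hom M0 kalg mcounit"
    "i \<in> {1..m} \<Longrightarrow> a \<in> hcarrier (A i) \<Longrightarrow> mcounit (iota i a) = counit (A i) a"
    by blast+
qed

text \<open>Both sides are algebra homomorphisms, so they agree if they agree on the images of the \<open>A i\<close>, where
  this is coassociativity of \<open>A i\<close>.\<close>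

lemma mcoassoc:
  assumes x: "x \<in> N"
  shows "tassoc M0 (tmap M0 M0 (talg M0 M0) M0 mcomult (\<lambda>x. x) (mcomult x)) =
    tmap M0 M0 M0 (talg M0 M0) (\<lambda>x. x) mcomult (mcomult x)"
proof -
  interpret TM: galg2 "talg M0 M0" M0 by unfold_locales
  interpret MT: galg2 M0 "talg M0 M0" by unfold_locales
  note G = graded_algebra_M0 and TG = M0.T.ga
  note id = alg_hom_ident[of M0] and mc = mcomult(1)
  note F1 = alg_hom_comp[OF G TG mc alg_hom_tmap[OF G G TG G mc id]]
  note F = alg_hom_comp[OF G TM.T.ga F1 alg_hom_tassoc[OF G]]
  note H = alg_hom_comp[OF G TG mc alg_hom_tmap[OF G G G TG id mc]]
  show ?thesis
  proof (rule alg_hom_M0_eqI[OF MT.T.ga F H _ x])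
    fix i a assume i: "i \<in> {1..m}" and a: "a \<in> hcarrier (A i)"
    interpret Ai: chopf "A i" by (rule chi[OF i])
    interpret TA: galg2 "talg (A i) (A i)" "A i" by unfold_locales
    note io = iota_alg_hom[OF i] and g = Ai.ga and Tg = Ai.AA.T.ga and c = Ai.alg_hom_comult and ida = alg_hom_ident[of "A i"]
    define t where "t = comult (A i) a"
    have t: "t \<in> tcar (A i) (A i)" unfolding t_def by (rule Ai.comult_tcar[OF a])
    interpret AM: galg2 "A i" M0 by unfold_locales
    interpret ATA: galg2 "A i" "talg (A i) (A i)" by unfold_locales
    let ?io2 = "tmap (A i) (A i) M0 M0 (iota i) (iota i)"
    note io2 = alg_hom_tmap[OF g g G G io io]
    have step: "tmap M0 M0 (talg M0 M0) M0 mcomult (\<lambda>x. x) (?io2 t) =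
        tmap (talg (A i) (A i)) (A i) (talg M0 M0) M0 ?io2 (iota i) (tmap (A i) (A i) (talg (A i) (A i)) (A i) (comult (A i)) (\<lambda>x. x) t)"
    proof (rule Ai.AA.tcar_eqI[OF _ _ vector_space_fscale _ t])
      show "linear_on fscale fscale (tcar (A i) (A i)) (\<lambda>t. tmap M0 M0 (talg M0 M0) M0 mcomult (\<lambda>x. x) (?io2 t))"
        using alg_homD(1)[OF alg_hom_comp[OF Tg TG io2 alg_hom_tmap[OF G G TG G mc id]]]
        unfolding Ai.AA.hcarrier_talg talg_simps .
      show "linear_on fscale fscale (tcar (A i) (A i)) (\<lambda>t. tmap (talg (A i) (A i)) (A i) (talg M0 M0) M0 ?io2 (iota i)
            (tmap (A i) (A i) (talg (A i) (A i)) (A i) (comult (A i)) (\<lambda>x. x) t))"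
        using alg_homD(1)[OF alg_hom_comp[OF Tg TA.T.ga alg_hom_tmap[OF g g Tg g c ida] alg_hom_tmap[OF Tg g TG G io2 io]]]
        unfolding Ai.AA.hcarrier_talg talg_simps .
      fix p q x y assume "x \<in> gr (A i) p" "y \<in> gr (A i) q"
      then have h: "x \<in> hcarrier (A i)" "y \<in> hcarrier (A i)" using Ai.gr_C by auto
      have cC: "comult (A i) x \<in> hcarrier (talg (A i) (A i))"
        unfolding Ai.AA.hcarrier_talg by (rule Ai.comult_tcar[OF h(1)])
      note ih = AM.alg_hom_C[OF io h(1)] AM.alg_hom_C[OF io h(2)]
      show "tmap M0 M0 (talg M0 M0) M0 mcomult (\<lambda>x. x) (?io2 (ten (A i) (A i) x y)) =
        tmap (talg (A i) (A i)) (A i) (talg M0 M0) M0 ?io2 (iota i)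
            (tmap (A i) (A i) (talg (A i) (A i)) (A i) (comult (A i)) (\<lambda>x. x) (ten (A i) (A i) x y))"
        unfolding tmap_lin(2)[OF g g G G io io h] tmap_lin(2)[OF G G TG G mc id ih]
          tmap_lin(2)[OF g g Tg g c ida h] tmap_lin(2)[OF Tg g TG G io2 io cC h(2)]
          mcomult(2)[OF i h(1)] delta_def ..
    qed
    have step2: "tmap M0 M0 M0 (talg M0 M0) (\<lambda>x. x) mcomult (?io2 t) =
        tmap (A i) (talg (A i) (A i)) M0 (talg M0 M0) (iota i) ?io2 (tmap (A i) (A i) (A i) (talg (A i) (A i)) (\<lambda>x. x) (comult (A i)) t)"
    proof (rule Ai.AA.tcar_eqI[OF _ _ vector_space_fscale _ t])
      show "linear_on fscale fscale (tcar (A i) (A i)) (\<lambda>t. tmap M0 M0 M0 (talg M0 M0) (\<lambda>x. x) mcomult (?io2 t))"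
        using alg_homD(1)[OF alg_hom_comp[OF Tg TG io2 alg_hom_tmap[OF G G G TG id mc]]]
        unfolding Ai.AA.hcarrier_talg talg_simps .
      show "linear_on fscale fscale (tcar (A i) (A i)) (\<lambda>t. tmap (A i) (talg (A i) (A i)) M0 (talg M0 M0) (iota i) ?io2
            (tmap (A i) (A i) (A i) (talg (A i) (A i)) (\<lambda>x. x) (comult (A i)) t))"
        using alg_homD(1)[OF alg_hom_comp[OF Tg ATA.T.ga alg_hom_tmap[OF g g g Tg ida c] alg_hom_tmap[OF g Tg G TG io io2]]]
        unfolding Ai.AA.hcarrier_talg talg_simps .
      fix p q x y assume "x \<in> gr (A i) p" "y \<in> gr (A i) q"
      then have h: "x \<in> hcarrier (A i)" "y \<in> hcarrier (A i)" using Ai.gr_C by auto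
      have cC: "comult (A i) y \<in> hcarrier (talg (A i) (A i))"
        unfolding Ai.AA.hcarrier_talg by (rule Ai.comult_tcar[OF h(2)])
      note ih = AM.alg_hom_C[OF io h(1)] AM.alg_hom_C[OF io h(2)]
      show "tmap M0 M0 M0 (talg M0 M0) (\<lambda>x. x) mcomult (?io2 (ten (A i) (A i) x y)) =
        tmap (A i) (talg (A i) (A i)) M0 (talg M0 M0) (iota i) ?io2
            (tmap (A i) (A i) (A i) (talg (A i) (A i)) (\<lambda>x. x) (comult (A i)) (ten (A i) (A i) x y))"
        unfolding tmap_lin(2)[OF g g G G io io h] tmap_lin(2)[OF G G G TG id mc ih]
          tmap_lin(2)[OF g g g Tg ida c h] tmap_lin(2)[OF g Tg G TG io io2 h(1) cC]
          mcomult(2)[OF i h(2)] delta_def ..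
    qed
    interpret TT: galg2 "talg (A i) (A i)" "talg (talg (A i) (A i)) (A i)" by unfold_locales
    have t3: "tmap (A i) (A i) (talg (A i) (A i)) (A i) (comult (A i)) (\<lambda>x. x) t \<in> tcar (talg (A i) (A i)) (A i)"
      using TT.alg_hom_C[OF alg_hom_tmap[OF g g Tg g c ida], of t] t
      unfolding Ai.AA.hcarrier_talg TA.hcarrier_talg by simp
    have co: "tassoc (A i) (tmap (A i) (A i) (talg (A i) (A i)) (A i) (comult (A i)) (\<lambda>x. x) t) =
        tmap (A i) (A i) (A i) (talg (A i) (A i)) (\<lambda>x. x) (comult (A i)) t"
      using Ai.coassoc[OF a] by (simp add: t_def id_def)
    show "tassoc M0 (tmap M0 M0 (talg M0 M0) M0 mcomult (\<lambda>x. x) (mcomult (iota i a))) =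
      tmap M0 M0 M0 (talg M0 M0) (\<lambda>x. x) mcomult (mcomult (iota i a))"
      unfolding mcomult(2)[OF i a] delta_def t_def[symmetric] step step2
        tassoc_natural[OF g G io t3] co ..
  qed
qed

lemma mcounit_contr:
  assumes x: "x \<in> N" shows "contr_l M0 mcounit (mcomult x) = x" "contr_r M0 mcounit (mcomult x) = x"
proof -
  note G = graded_algebra_M0 and TG = M0.T.ga
  note cn = alg_hom_contr[OF G mcounit(1)]
  have *: "contr_l M0 mcounit (mcomult (iota i a)) = iota i a \<and> contr_r M0 mcounit (mcomult (iota i a)) = iota i a"
    if i: "i \<in> {1..m}" and a: "a \<in> hcarrier (A i)" for i a
  proof -
    interpret Ai: chopf "A i" by (rule chi[OF i])
    have l: "linear_on (scl M0) (*) (hcarrier M0) mcounit"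
      using alg_homD(1)[OF mcounit(1)] by (simp only: kalg_simps)
    note nat = contr_natural[where \<eta> = mcounit and \<epsilon> = "counit (A i)" and f = "iota i", OF Ai.ga G iota_alg_hom[OF i] Ai.counit_lin l mcounit(2)[OF i] Ai.comult_tcar[OF a]]
    have "contr_l (A i) (counit (A i)) (comult (A i) a) = a" "contr_r (A i) (counit (A i)) (comult (A i) a) = a"
      using Ai.counit_l[OF a] Ai.counit_r[OF a] by (simp_all only: contr_l_def contr_r_def)
    then have "contr_l M0 mcounit (delta i a) = iota i a" "contr_r M0 mcounit (delta i a) = iota i a"
      unfolding delta_def using nat by simp_all
    then show ?thesis unfolding mcomult(2)[OF i a] ..
  qed
  show "contr_l M0 mcounit (mcomult x) = x"
    by (rule alg_hom_M0_eqI[OF G alg_hom_comp[OF G TG mcomult(1) cn(1)] alg_hom_ident _ x]) (use * in blast)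
  show "contr_r M0 mcounit (mcomult x) = x"
    by (rule alg_hom_M0_eqI[OF G alg_hom_comp[OF G TG mcomult(1) cn(2)] alg_hom_ident _ x]) (use * in blast)
qed

lemma ten_M: "ten M B = ten M0 B" "ten B M = ten B M0" "ten M M = ten M0 M0"
  by (simp_all add: fun_eq_iff ten_def M_simps M0_simps)

lemma hcarrier_M: "hcarrier M = N"
  using hcarrier_M0 by (simp add: hcarrier_def M_simps M0_simps)

lemma talg_M: "talg M M = talg M0 M0"
proof -
  have "homog M = homog M0" by (simp add: homog_def M_simps M0_simps)
  then have "tmult M M = tmult M0 M0" by (simp add: fun_eq_iff tmult_def ten_M M_simps M0_simps)
  then show ?thesis by (simp add: talg_def ten_M M_simps M0_simps)
qed

lemma graded_algebra_M: "graded_algebra M"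
  using graded_algebra_M0 unfolding graded_algebra_def hcarrier_M hcarrier_M0 M_simps M0_simps .

lemma alg_hom_M: "alg_hom M R f = alg_hom M0 R f" "alg_hom R M f = alg_hom R M0 f"
  unfolding alg_hom_def hcarrier_M hcarrier_M0 M_simps M0_simps by (rule refl)+

lemma tdeg_zero_iff: "t \<in> T \<Longrightarrow> tdeg t = 0 \<longleftrightarrow> t = []"
proof -
  assume t: "t \<in> T"
  have "0 < hdeg (A i) b" if "(i, b) \<in> set t" for i b
  proof -
    have "b \<in> Bp i" by (rule tset_letters[OF t[unfolded T_def] that])
    then have b: "b \<in> hbases (A i)" "b \<noteq> unit (A i)" and i: "i \<in> {1..m}"
      by (auto simp: Bp_def split: if_splits)
    show ?thesis using chopf.hdeg_zero_iff[OF chi[OF i] b(1)] b(2) by simp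
  qed
  then show ?thesis by (cases t) (auto simp: tdeg_def)
qed

lemma connected_hopf_M: "connected_hopf M"
  unfolding connected_hopf_def
proof (intro conjI ballI)
  note mc = alg_homD[OF mcomult(1), unfolded talg_simps hcarrier_M0 M0_simps]
  note me = alg_homD[OF mcounit(1), unfolded kalg_simps hcarrier_M0 M0_simps]
  show "graded_algebra M" by (rule graded_algebra_M)
  show "comult M (unit M) = ten M M (unit M) (unit M)"
    using mc(3) by (simp only: M_simps ten_M)
  show "counit M (unit M) = 1" using me(3) by (simp only: M_simps)
  show "comult M (mult M a b) = tensor_mult M (comult M a) (comult M b)" if "a \<in> hcarrier M" "b \<in> hcarrier M" for a b
    using mc(4)[of a b] that talg_simps(2)[of M M] unfolding talg_M talg_simps tensor_mult_eq hcarrier_M M_simps by simp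
  show "counit M (mult M a b) = counit M a * counit M b" if "a \<in> hcarrier M" "b \<in> hcarrier M" for a b
    using me(4)[of a b] that unfolding hcarrier_M M_simps by simp
  show "gr M 0 = range (\<lambda>c. scl M c (unit M))"
  proof -
    have "{t \<in> T. tdeg t = 0} = {[]}" using tdeg_zero_iff nil_T by auto
    then show ?thesis by (simp add: M_simps ngr_def fs.span_singleton)
  qed
  show "graded_coalgebra M"
    unfolding graded_coalgebra_def Let_def hcarrier_M M_simps
  proof (intro conjI ballI allI impI)
    show "graded_space fscale ngr" using M0.A.grsp by (simp only: M0_simps)
    show "linear_on fscale fscale N mcomult" by (rule mc(1))
    show "linear_on fscale (*) N mcounit" by (rule me(1))
    show "mcomult a \<in> fs.span {ten M M b c |i j b c. i + j = n \<and> b \<in> ngr i \<and> c \<in> ngr j}" if "a \<in> ngr n" for a n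
      using mc(2)[OF that] unfolding talg_def ten_M M0_simps by simp
    show "mcounit a = 0" if "0 < n" "a \<in> ngr n" for a n
      using me(2)[OF that(2)] that(1) by simp
    fix a assume a: "a \<in> N"
    show "lin_ext fscale fscale (N \<times> N \<times> N)
         (\<lambda>(x, y, z). tensor fscale fscale (ten M M x y) z) (\<lambda>(x, y, z). tensor fscale fscale x (ten M M y z))
         (tensor_map fscale fscale fscale fscale N N mcomult id (mcomult a)) =
       tensor_map fscale fscale fscale fscale N N id mcomult (mcomult a)"
      using mcoassoc[OF a] unfolding tassoc_def hcarrier_M0 talg_simps M0_simps ten_M id_def .
    show "lin_ext fscale fscale (N \<times> N) (\<lambda>(x, y). ten M M x y) (\<lambda>(x, y). fscale (mcounit x) y) (mcomult a) = a"
      using mcounit_contr(1)[OF a] unfolding contr_l_def hcarrier_M0 M0_simps ten_M .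
    show "lin_ext fscale fscale (N \<times> N) (\<lambda>(x, y). ten M M x y) (\<lambda>(x, y). fscale (mcounit y) x) (mcomult a) = a"
      using mcounit_contr(2)[OF a] unfolding contr_r_def hcarrier_M0 M0_simps ten_M .
  qed
qed

end


section \<open>Ordered products\<close>

definition lprod :: "('k, 'b) hopf \<Rightarrow> (nat \<Rightarrow> 'b) \<Rightarrow> nat list \<Rightarrow> 'b" where
  "lprod R g is = foldr (\<lambda>i. mult R (g i)) is (unit R)"

lemma lprod_simps [simp]: "lprod R g [] = unit R" "lprod R g (i # is) = mult R (g i) (lprod R g is)"
  by (simp_all add: lprod_def)

lemma lprod_cong: "(\<And>i. i \<in> set is \<Longrightarrow> g i = h i) \<Longrightarrow> lprod R g is = lprod R h is"
  by (induction "is") auto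

lemma lprod_unit: "lprod kalg g is = (\<Prod>i\<leftarrow>is. g i)"
  by (induction "is") (auto simp: kalg_simps)

text \<open>The exponent of the Koszul sign, along a list of indices.\<close>

fun koszul_list :: "nat list \<Rightarrow> (nat \<Rightarrow> nat) \<Rightarrow> (nat \<Rightarrow> nat) \<Rightarrow> nat" where
  "koszul_list [] d q = 0"
| "koszul_list (i # is) d q = (\<Sum>j\<leftarrow>is. d j) * q i + koszul_list is d q"

lemma koszul_sign_list:
  assumes "finite \<sigma>"
  shows "koszul_sign \<sigma> d q = (-1) ^ koszul_list (sorted_list_of_set \<sigma>) d q"
proof -
  have "(\<Sum>i\<in>set is. \<Sum>j\<in>{j\<in>set is. j < i}. d i * q j) = koszul_list is d q"
    if "sorted is" "distinct is" for "is"
    using that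
  proof (induction "is")
    case (Cons k "is")
    have lt: "k < i" if i: "i \<in> set is" for i
    proof -
      have "k \<le> i" "k \<noteq> i" using Cons.prems i by auto
      then show ?thesis by simp
    qed
    have e: "{j \<in> set (k # is). j < k} = {}" using lt by force
    have "(\<Sum>i\<in>set (k # is). \<Sum>j\<in>{j\<in>set (k # is). j < i}. d i * q j) =
        (\<Sum>j\<in>{j\<in>set (k # is). j < k}. d k * q j) +
        (\<Sum>i\<in>set is. \<Sum>j\<in>{j\<in>set (k # is). j < i}. d i * q j)"
      using Cons.prems by (subst (1) list.set(2), subst sum.insert) auto
    also have "\<dots> = (\<Sum>i\<in>set is. \<Sum>j\<in>{j\<in>set (k # is). j < i}. d i * q j)"
      unfolding e by simp
    also have "(\<Sum>i\<in>set is. \<Sum>j\<in>{j\<in>set (k # is). j < i}. d i * q j) =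
        (\<Sum>i\<in>set is. d i * q k + (\<Sum>j\<in>{j\<in>set is. j < i}. d i * q j))"
    proof (rule sum.cong[OF refl])
      fix i assume i: "i \<in> set is"
      have "{j\<in>set (k # is). j < i} = insert k {j\<in>set is. j < i}" using lt[OF i] by auto
      then show "(\<Sum>j\<in>{j\<in>set (k # is). j < i}. d i * q j) = d i * q k + (\<Sum>j\<in>{j\<in>set is. j < i}. d i * q j)"
        using Cons.prems by simp
    qed
    finally show ?case using Cons
      by (simp add: sum.distrib sum_distrib_right[symmetric] sum_list_distinct_conv_sum_set)
  qed simp
  from this[of "sorted_list_of_set \<sigma>"] show ?thesis using assms by (simp add: koszul_sign_def)
qed

context galg begin

lemma lprod_C: "(\<And>i. i \<in> set is \<Longrightarrow> g i \<in> hcarrier A) \<Longrightarrow> lprod A g is \<in> hcarrier A"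
  by (induction "is") (simp_all add: unit_C mult_C)

lemma lprod_gr: "(\<And>i. i \<in> set is \<Longrightarrow> g i \<in> gr A (d i)) \<Longrightarrow> lprod A g is \<in> gr A (\<Sum>i\<leftarrow>is. d i)"
  by (induction "is") (simp_all add: unit_gr mult_gr)

lemma lprod_filter:
  "(\<And>i. i \<in> set is \<Longrightarrow> g i \<in> hcarrier A) \<Longrightarrow> (\<And>i. i \<in> set is \<Longrightarrow> \<not> Q i \<Longrightarrow> g i = unit A) \<Longrightarrow>
   lprod A g (filter Q is) = lprod A g is"
  by (induction "is") (simp_all add: unit_l lprod_C)

lemma lprod_linear:
  assumes h: "\<And>j. j \<in> set is \<Longrightarrow> linear_on (s j) (scl A) (V j) (h j) \<and> h j ` V j \<subseteq> hcarrier A"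
    and a: "\<And>j. j \<in> set is \<Longrightarrow> a j \<in> V j" and i: "i \<in> set is" "distinct is"
  shows "linear_on (s i) (scl A) (V i) (\<lambda>x. lprod A (\<lambda>j. h j ((a(i := x)) j)) is)"
  using assms
proof (induction "is")
  case (Cons k "is")
  have rest: "lprod A (\<lambda>j. h j (a j)) is \<in> hcarrier A"
    by (rule lprod_C) (use Cons.prems(1,2) in \<open>simp add: image_subset_iff\<close>)
  show ?case
  proof (cases "k = i")
    case True
    have "lprod A (\<lambda>j. h j ((a(i := x)) j)) is = lprod A (\<lambda>j. h j (a j)) is" for x
      by (rule lprod_cong) (use Cons.prems(4) True in auto)
    then have "(\<lambda>x. lprod A (\<lambda>j. h j ((a(i := x)) j)) (k # is)) = (\<lambda>x. mult A (h i x) (lprod A (\<lambda>j. h j (a j)) is))"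
      using True by simp
    then show ?thesis
      using linear_on_comp[OF conjunct1[OF Cons.prems(1)[of i]] mult_lin1[OF rest]] Cons.prems(1)[of i] True by simp
  next
    case False
    then have i: "i \<in> set is" using Cons.prems by simp
    have IH: "linear_on (s i) (scl A) (V i) (\<lambda>x. lprod A (\<lambda>j. h j ((a(i := x)) j)) is)"
      by (rule Cons.IH) (use Cons.prems i in auto)
    have C: "lprod A (\<lambda>j. h j ((a(i := x)) j)) is \<in> hcarrier A" if "x \<in> V i" for x
      by (rule lprod_C) (use Cons.prems(1,2) that in \<open>simp add: image_subset_iff\<close>)
    have "h k (a k) \<in> hcarrier A" using Cons.prems(1,2)[of k] by auto
    from linear_on_comp[OF IH mult_lin2[OF this]] show ?thesis using C False by (simp add: image_subset_iff)
  qed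
qed simp

lemma lprod_move:
  assumes y: "y \<in> gr A q" and x: "\<And>i. i \<in> set is \<Longrightarrow> x i \<in> gr A (d i)"
    and c: "\<And>i. i \<in> set is \<Longrightarrow> mult A (x i) y = scl A ((-1) ^ (d i * q)) (mult A y (x i))"
  shows "mult A (lprod A x is) y = scl A ((-1) ^ ((\<Sum>i\<leftarrow>is. d i) * q)) (mult A y (lprod A x is))"
  using x c
proof (induction "is")
  case Nil then show ?case using y by (simp add: unit_l unit_r gr_C)
next
  case (Cons k "is")
  note yC = gr_C[OF y]
  have xk: "x k \<in> gr A (d k)" using Cons.prems by simp
  note xkC = gr_C[OF xk]
  have xs: "lprod A x is \<in> hcarrier A" by (rule lprod_C) (use Cons.prems gr_C in auto)
  have IH: "mult A (lprod A x is) y = scl A ((-1) ^ ((\<Sum>i\<leftarrow>is. d i) * q)) (mult A y (lprod A x is))"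
    by (rule Cons.IH) (use Cons.prems in auto)
  have "mult A (lprod A x (k # is)) y = mult A (x k) (mult A (lprod A x is) y)"
    using mult_assoc[OF xkC xs yC] by simp
  also have "\<dots> = scl A ((-1) ^ ((\<Sum>i\<leftarrow>is. d i) * q)) (mult A (mult A (x k) y) (lprod A x is))"
    unfolding IH mult_scale2[OF xkC mult_C[OF yC xs]] mult_assoc[OF xkC yC xs] ..
  also have "\<dots> = scl A ((-1) ^ ((\<Sum>i\<leftarrow>k # is. d i) * q)) (mult A y (lprod A x (k # is)))"
    using Cons.prems(2)[of k] mult_scale1[OF mult_C[OF yC xkC] xs] mult_assoc[OF yC xkC xs]
    by (simp add: power_add algebra_simps)
  finally show ?case .
qed

text \<open>Reordering \<open>x\<^sub>1 x\<^sub>2 \<dots> y\<^sub>1 y\<^sub>2 \<dots>\<close> to \<open>x\<^sub>1 y\<^sub>1 x\<^sub>2 y\<^sub>2 \<dots>\<close>: each \<open>y\<^sub>i\<close> is moved past the \<open>x\<^sub>j\<close> with \<open>j\<close> after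
  \<open>i\<close>, which is what the exponent records.\<close>

lemma lprod_mult:
  assumes x: "\<And>i. i \<in> set is \<Longrightarrow> x i \<in> gr A (d i)" and y: "\<And>i. i \<in> set is \<Longrightarrow> y i \<in> gr A (q i)"
    and c: "\<And>i j. i \<in> set is \<Longrightarrow> j \<in> set is \<Longrightarrow> i \<noteq> j \<Longrightarrow>
      mult A (x i) (y j) = scl A ((-1) ^ (d i * q j)) (mult A (y j) (x i))"
    and "distinct is"
  shows "mult A (lprod A x is) (lprod A y is) =
    scl A ((-1) ^ koszul_list is d q) (lprod A (\<lambda>i. mult A (x i) (y i)) is)"
  using assms
proof (induction "is")
  case Nil then show ?case by (simp add: unit_l unit_C)
next
  case (Cons k "is")
  have xk: "x k \<in> gr A (d k)" and yk: "y k \<in> gr A (q k)" using Cons.prems by simp_all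
  note xkC = gr_C[OF xk] and ykC = gr_C[OF yk]
  have xs: "lprod A x is \<in> hcarrier A" by (rule lprod_C, rule gr_C, rule Cons.prems(1)) simp
  have ys: "lprod A y is \<in> hcarrier A" by (rule lprod_C, rule gr_C, rule Cons.prems(2)) simp
  have xys: "lprod A (\<lambda>i. mult A (x i) (y i)) is \<in> hcarrier A"
  proof (rule lprod_C)
    fix i assume "i \<in> set is"
    then show "mult A (x i) (y i) \<in> hcarrier A"
      using mult_C[OF gr_C[OF Cons.prems(1)[of i]] gr_C[OF Cons.prems(2)[of i]]] by simp
  qed
  have IH: "mult A (lprod A x is) (lprod A y is) =
    scl A ((-1) ^ koszul_list is d q) (lprod A (\<lambda>i. mult A (x i) (y i)) is)"
    by (rule Cons.IH) (use Cons.prems in auto)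
  have mv: "mult A (lprod A x is) (y k) = scl A ((-1) ^ ((\<Sum>i\<leftarrow>is. d i) * q k)) (mult A (y k) (lprod A x is))"
    by (rule lprod_move[OF yk]) (use Cons.prems in auto)
  let ?c = "(-1) ^ ((\<Sum>i\<leftarrow>is. d i) * q k)"
  have "mult A (lprod A x (k # is)) (lprod A y (k # is)) =
      mult A (x k) (mult A (mult A (lprod A x is) (y k)) (lprod A y is))"
    using mult_assoc[OF xkC xs mult_C[OF ykC ys]] mult_assoc[OF xs ykC ys] by simp
  also have "\<dots> = scl A ?c (mult A (x k) (mult A (y k) (mult A (lprod A x is) (lprod A y is))))"
    unfolding mv mult_scale1[OF mult_C[OF ykC xs] ys] mult_assoc[OF ykC xs ys]
      mult_scale2[OF xkC mult_C[OF ykC mult_C[OF xs ys]]] ..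
  also have "\<dots> = scl A (?c * (-1) ^ koszul_list is d q) (mult A (x k) (mult A (y k) (lprod A (\<lambda>i. mult A (x i) (y i)) is)))"
    unfolding IH mult_scale2[OF ykC xys] mult_scale2[OF xkC mult_C[OF ykC xys]] by simp
  also have "\<dots> = scl A ((-1) ^ koszul_list (k # is) d q) (lprod A (\<lambda>i. mult A (x i) (y i)) (k # is))"
    using mult_assoc[OF xkC ykC xys] by (simp add: power_add)
  finally show ?case .
qed

end

lemma (in galg2) lprod_ten:
  assumes "\<And>i. i \<in> set is \<Longrightarrow> x i \<in> gr A (d i)" "\<And>i. i \<in> set is \<Longrightarrow> y i \<in> gr B (q i)"
  shows "lprod (talg A B) (\<lambda>i. ten A B (x i) (y i)) is =
    fscale ((-1) ^ koszul_list is d q) (ten A B (lprod A x is) (lprod B y is))"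
  using assms
proof (induction "is")
  case (Cons k "is")
  have xs: "lprod A x is \<in> gr A (\<Sum>i\<leftarrow>is. d i)" by (rule A.lprod_gr) (use Cons.prems in auto)
  have ys: "lprod B y is \<in> gr B (\<Sum>i\<leftarrow>is. q i)" by (rule B.lprod_gr) (use Cons.prems in auto)
  have xk: "x k \<in> gr A (d k)" and yk: "y k \<in> gr B (q k)" using Cons.prems by simp_all
  have IH: "lprod (talg A B) (\<lambda>i. ten A B (x i) (y i)) is =
    fscale ((-1) ^ koszul_list is d q) (ten A B (lprod A x is) (lprod B y is))"
    by (rule Cons.IH) (use Cons.prems in auto)
  have C: "ten A B (lprod A x is) (lprod B y is) \<in> tcar A B" "ten A B (x k) (y k) \<in> tcar A B"
    by (rule ten_tcar[OF A.gr_C[OF xs] B.gr_C[OF ys]] ten_tcar[OF A.gr_C[OF xk] B.gr_C[OF yk]])+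
  show ?case
    unfolding lprod_simps IH talg_simps linear_on_scale[OF tmult_lin2[OF C(2)] C(1)] tmult_ten[OF xk yk xs ys]
      fs.scale_scale power_add[symmetric] koszul_list.simps by (simp only: ac_simps)
qed (simp_all only: lprod_simps koszul_list.simps talg_simps power_0 fs.scale_one)

lemma alg_hom_lprod:
  assumes A: "graded_algebra A" and f: "alg_hom A B f" and g: "\<And>i. i \<in> set is \<Longrightarrow> g i \<in> hcarrier A"
  shows "f (lprod A g is) = lprod B (\<lambda>i. f (g i)) is"
proof -
  interpret A: galg A by unfold_locales (rule A)
  show ?thesis using g
    by (induction "is") (simp_all add: alg_homD(3)[OF f] alg_homD(4)[OF f] A.lprod_C)
qed

section \<open>Multilinear expansion\<close>

text \<open>Multilinearity expands one factor at a time.\<close>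

lemma mtensor_span:
  assumes fin: "finite \<sigma>" and s: "\<And>i. i \<in> \<sigma> \<Longrightarrow> vector_space (s i)"
    and t: "\<And>i. i \<in> \<sigma> \<Longrightarrow> t i \<in> module.span (s i) (S i)"
  shows "mtensor s \<sigma> t \<in> module.span fscale {mtensor s \<sigma> t' |t'. \<forall>i\<in>\<sigma>. t' i \<in> S i}"
proof -
  let ?W = "module.span fscale {mtensor s \<sigma> t' |t'. \<forall>i\<in>\<sigma>. t' i \<in> S i}"
  have "mtensor s \<sigma> t \<in> ?W" if "finite F" "F \<subseteq> \<sigma>" "\<forall>i\<in>F. t i \<in> module.span (s i) (S i)" "\<forall>i\<in>\<sigma> - F. t i \<in> S i" for F t
    using that
  proof (induction F arbitrary: t rule: finite_induct)
    case empty then show ?case by (intro fs.span_base) auto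
  next
    case (insert i F)
    have i: "i \<in> \<sigma>" using insert by simp
    have "mtensor s \<sigma> (t(i := t i)) \<in> ?W"
    proof (rule linear_on_image_span[where f = "\<lambda>x. mtensor s \<sigma> (t(i := x))", OF _ s[OF i] vector_space_fscale])
      show "linear_on (s i) fscale (module.span (s i) (S i)) (\<lambda>x. mtensor s \<sigma> (t(i := x)))"
        by (rule linear_on_subset[OF mtensor_multilinear[OF fin i] subset_UNIV])
      show "t i \<in> module.span (s i) (S i)" using insert by simp
      show "mtensor s \<sigma> (t(i := x)) \<in> ?W" if "x \<in> S i" for x
        by (rule insert.IH) (use insert that in auto)
    qed simp
    then show ?case by simp
  qed
  from this[of \<sigma> t] show ?thesis using fin t by simp
qed

lemma mtensor_cong: "(\<And>i. i \<in> \<sigma> \<Longrightarrow> a i = b i) \<Longrightarrow> mtensor s \<sigma> a = mtensor s \<sigma> b"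
  by (simp add: mtensor_def fun_eq_iff cong: prod.cong)

section \<open>The tensor product over a simplex inside the graph product\<close>

locale gprod_simplex = gprod m K A
  for m K and A :: "nat \<Rightarrow> ('k::field, 'a::ab_group_add) hopf" +
  fixes \<sigma> :: "nat set"
  assumes \<sigma>: "\<sigma> \<in> K"
begin

lemma \<sigma>_sub: "\<sigma> \<subseteq> {1..m}"
proof -
  have "K \<subseteq> Pow {1..m}" using flag unfolding flag_complex_def simplicial_complex_def by (rule conjunct1[OF conjunct1])
  then show ?thesis using \<sigma> by blast
qed

lemma finite_\<sigma>: "finite \<sigma>" by (rule finite_subset[OF \<sigma>_sub]) simp

lemma \<sigma>_comm: "i \<in> \<sigma> \<Longrightarrow> j \<in> \<sigma> \<Longrightarrow> i \<noteq> j \<Longrightarrow> comm i j"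
proof -
  have "\<forall>\<sigma>\<in>K. \<forall>\<tau>. \<tau> \<subseteq> \<sigma> \<longrightarrow> \<tau> \<in> K" using flag unfolding flag_complex_def simplicial_complex_def by blast
  then have "\<tau> \<subseteq> \<sigma> \<Longrightarrow> \<tau> \<in> K" for \<tau> using \<sigma> by blast
  from this[of "{i, j}"] show "i \<in> \<sigma> \<Longrightarrow> j \<in> \<sigma> \<Longrightarrow> i \<noteq> j \<Longrightarrow> comm i j" by (simp add: comm_def)
qed

lemma \<sigma>_chi: "i \<in> \<sigma> \<Longrightarrow> chopf (A i)" and \<sigma>_m: "i \<in> \<sigma> \<Longrightarrow> i \<in> {1..m}"
  using \<sigma>_sub chi by blast+

abbreviation "sl \<equiv> sorted_list_of_set \<sigma>"

lemma sl: "set sl = \<sigma>" "distinct sl" "sorted sl" using finite_\<sigma> by simp_all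

definition X :: "(nat \<Rightarrow> 'a) set" where "X = {a. \<forall>i\<in>\<sigma>. a i \<in> hcarrier (A i)}"

definition DC where "DC = hcarrier (hopf_tensor A \<sigma>)"

text \<open>The comparison with the graph product multiplies the factors in increasing order of their
  indices.\<close>

definition psi :: "('k, 'a) mtensor \<Rightarrow> ('k, 'a) word_space" where
  "psi = lin_ext fscale fscale X (mten A \<sigma>) (\<lambda>a. lprod M0 (\<lambda>i. iota i (a i)) sl)"

lemma iota_lin: "i \<in> {1..m} \<Longrightarrow> linear_on (scl (A i)) fscale (hcarrier (A i)) (iota i)"
  using alg_homD(1)[OF iota_alg_hom] by (simp only: M0_simps)

lemma psi_mten: "a \<in> X \<Longrightarrow> psi (mten A \<sigma> a) = lprod M0 (\<lambda>i. iota i (a i)) sl"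
  and psi_lin_span: "linear_on fscale fscale (module.span fscale (mten A \<sigma> ` X)) psi"
proof -
  have 1: "vector_space (scl (A i)) \<and> module.subspace (scl (A i)) (hcarrier (A i))" if "i \<in> \<sigma>" for i
  proof -
    interpret Ai: chopf "A i" by (rule \<sigma>_chi[OF that])
    show ?thesis using Ai.vs Ai.sub_C by blast
  qed
  have 2: "linear_on (scl (A i)) fscale (hcarrier (A i)) (\<lambda>x. lprod M0 (\<lambda>j. iota j ((a(i := x)) j)) sl)"
    if "i \<in> \<sigma>" "\<forall>j\<in>\<sigma>. a j \<in> hcarrier (A j)" for i a
  proof (rule M0.A.lprod_linear[where s = "\<lambda>j. scl (A j)" and V = "\<lambda>j. hcarrier (A j)", unfolded M0_simps hcarrier_M0])
    show "linear_on (scl (A j)) fscale (hcarrier (A j)) (iota j) \<and> iota j ` hcarrier (A j) \<subseteq> N" if "j \<in> set sl" for j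
      using that \<sigma>_m iota_lin iota_N unfolding sl(1) by blast
  qed (use that sl in auto)
  have 3: "lprod M0 (\<lambda>i. iota i (a i)) sl = lprod M0 (\<lambda>i. iota i (b i)) sl" if "\<forall>i\<in>\<sigma>. a i = b i" for a b
    by (rule lprod_cong) (use that sl in auto)
  note * = mtensor_universal[where V = "\<lambda>i. hcarrier (A i)" and s = "\<lambda>i. scl (A i)" and h = "\<lambda>a. lprod M0 (\<lambda>i. iota i (a i)) sl",
      OF finite_\<sigma> vector_space_fscale 1 2 3, folded X_def mten_def, folded psi_def]
  show "a \<in> X \<Longrightarrow> psi (mten A \<sigma> a) = lprod M0 (\<lambda>i. iota i (a i)) sl" by (rule *(2))
  show "linear_on fscale fscale (module.span fscale (mten A \<sigma> ` X)) psi" by (rule *(1))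
qed

lemma homog_X: "(d, a) \<in> homog_family A \<sigma> \<Longrightarrow> a \<in> X"
  unfolding X_def
proof safe
  fix i assume h: "(d, a) \<in> homog_family A \<sigma>" "i \<in> \<sigma>"
  interpret Ai: chopf "A i" by (rule \<sigma>_chi[OF h(2)])
  have "a i \<in> gr (A i) (d i)" using h by (simp add: homog_family_def)
  then show "a i \<in> hcarrier (A i)" by (rule Ai.gr_C)
qed

lemma DC_eq: "DC = module.span fscale ((\<lambda>(d, a). mten A \<sigma> a) ` homog_family A \<sigma>)" (is "_ = fs.span ?S")
proof
  let ?g = "\<lambda>n. {mten A \<sigma> a |d a. (d, a) \<in> homog_family A \<sigma> \<and> (\<Sum>i\<in>\<sigma>. d i) = n}"
  have DC: "DC = fs.span (\<Union>n. fs.span (?g n))" by (simp add: DC_def hcarrier_def hopf_tensor_def)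
  have "fs.span (?g n) \<subseteq> fs.span ?S" for n by (rule fs.span_mono) auto
  then show "DC \<subseteq> fs.span ?S" unfolding DC by (intro fs.span_minimal) auto
  have "x \<in> DC" if x: "x \<in> ?S" for x
  proof -
    obtain p where "p \<in> homog_family A \<sigma>" "x = (\<lambda>(d, a). mten A \<sigma> a) p" using x by blast
    moreover obtain d a where "p = (d, a)" by (cases p)
    ultimately have "(d, a) \<in> homog_family A \<sigma>" "x = mten A \<sigma> a" by simp_all
    then have "x \<in> fs.span (?g (\<Sum>i\<in>\<sigma>. d i))" by (intro fs.span_base) blast
    then show ?thesis unfolding DC by (intro fs.span_base) blast
  qed
  then show "fs.span ?S \<subseteq> DC" by (intro fs.span_minimal) (auto simp: DC)
qed

lemma mten_homog_DC: "(d, a) \<in> homog_family A \<sigma> \<Longrightarrow> mten A \<sigma> a \<in> DC"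
  unfolding DC_eq by (rule fs.span_base) force

lemma sub_DC: "module.subspace fscale DC" by (simp add: DC_eq)

lemma mten_DC: assumes "a \<in> X" shows "mten A \<sigma> a \<in> DC"
proof -
  have "mtensor (\<lambda>i. scl (A i)) \<sigma> a \<in> fs.span {mtensor (\<lambda>i. scl (A i)) \<sigma> t' |t'. \<forall>i\<in>\<sigma>. t' i \<in> (\<Union>n. gr (A i) n)}"
  proof (rule mtensor_span[OF finite_\<sigma>])
    fix i assume "i \<in> \<sigma>"
    then interpret Ai: chopf "A i" by (rule \<sigma>_chi)
    show "vector_space (scl (A i))" by (rule Ai.vs)
    show "a i \<in> module.span (scl (A i)) (\<Union>n. gr (A i) n)" using assms \<open>i \<in> \<sigma>\<close> by (simp add: X_def hcarrier_def)
  qed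
  also have "\<dots> \<subseteq> DC"
  proof (rule fs.span_minimal[OF _ sub_DC], safe)
    fix t assume "\<forall>i\<in>\<sigma>. t i \<in> (\<Union>n. gr (A i) n)"
    then have "\<forall>i\<in>\<sigma>. \<exists>n. t i \<in> gr (A i) n" by blast
    then obtain d where "\<forall>i\<in>\<sigma>. t i \<in> gr (A i) (d i)" by metis
    then show "mtensor (\<lambda>i. scl (A i)) \<sigma> t \<in> DC"
      using mten_homog_DC[of d t] by (simp add: homog_family_def mten_def)
  qed
  finally show ?thesis by (simp add: mten_def)
qed

lemma DC_span_X: "DC = module.span fscale (mten A \<sigma> ` X)"
proof
  show "DC \<subseteq> fs.span (mten A \<sigma> ` X)" unfolding DC_eq using homog_X by (intro fs.span_mono) auto
  show "fs.span (mten A \<sigma> ` X) \<subseteq> DC" using mten_DC by (intro fs.span_minimal sub_DC) auto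
qed

lemma psi_lin: "linear_on fscale fscale DC psi" using psi_lin_span by (simp only: DC_span_X)

lemma DC_eqI:
  assumes "linear_on fscale s DC F" "linear_on fscale s DC G" "vector_space s"
    "\<And>d a. (d, a) \<in> homog_family A \<sigma> \<Longrightarrow> F (mten A \<sigma> a) = G (mten A \<sigma> a)" "x \<in> DC"
  shows "F x = G x"
  by (rule linear_on_eq_on_span[OF assms(1,2)[unfolded DC_eq] vector_space_fscale assms(3) _
      assms(5)[unfolded DC_eq]]) (use assms(4) in auto)

lemma DC_image:
  assumes "linear_on fscale s DC F" "vector_space s" "module.subspace s W"
    "\<And>d a. (d, a) \<in> homog_family A \<sigma> \<Longrightarrow> F (mten A \<sigma> a) \<in> W" "x \<in> DC"
  shows "F x \<in> W"
  by (rule linear_on_image_span[OF assms(1)[unfolded DC_eq] vector_space_fscale assms(2) _ assms(3)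
      assms(5)[unfolded DC_eq]]) (use assms(4) in auto)

lemma iota_X_N: "a \<in> X \<Longrightarrow> i \<in> set sl \<Longrightarrow> iota i (a i) \<in> hcarrier M0"
  using iota_N \<sigma>_m unfolding hcarrier_M0 sl(1) X_def by blast

lemma psi_N: "x \<in> DC \<Longrightarrow> psi x \<in> N"
proof (rule DC_image[OF psi_lin vector_space_fscale subspace_N])
  fix d a assume "(d, a) \<in> homog_family A \<sigma>"
  then have a: "a \<in> X" by (rule homog_X)
  show "psi (mten A \<sigma> a) \<in> N"
    unfolding psi_mten[OF a] using M0.A.lprod_C[OF iota_X_N[OF a]] unfolding hcarrier_M0 .
qed

text \<open>The trace to which \<^const>\<open>psi\<close> sends a tensor of basis elements, and below it the exponent of the
  sign.\<close>

definition jn :: "(nat \<Rightarrow> 'a) \<Rightarrow> nat list \<Rightarrow> (nat \<times> 'a) list" where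
  "jn \<beta> is = foldr (\<lambda>i. join i (\<beta> i)) is []"

fun jsign :: "(nat \<Rightarrow> 'a) \<Rightarrow> nat list \<Rightarrow> nat" where
  "jsign \<beta> [] = 0"
| "jsign \<beta> (i # is) = hdeg (A i) (\<beta> i) * dbelow i (jn \<beta> is) + jsign \<beta> is"

lemma jn_T:
  assumes "set is \<subseteq> \<sigma>" "distinct is" "\<And>i. i \<in> \<sigma> \<Longrightarrow> \<beta> i \<in> hbases (A i)"
  shows "jn \<beta> is \<in> T \<and> (\<forall>i\<in>\<sigma> - set is. jn \<beta> is \<in> U i)"
  using assms
proof (induction "is")
  case Nil then show ?case using nil_U nil_T by (simp add: jn_def)
next
  case (Cons k "is")
  have eq: "jn \<beta> (k # is) = join k (\<beta> k) (jn \<beta> is)" by (simp add: jn_def)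
  have k: "k \<in> \<sigma>" "k \<notin> set is" and IH: "\<And>i. i \<in> \<sigma> - set is \<Longrightarrow> jn \<beta> is \<in> U i" using Cons by auto
  have kU: "jn \<beta> is \<in> U k" using IH k by blast
  have "join k (\<beta> k) (jn \<beta> is) \<in> U i" if "i \<in> \<sigma> - set (k # is)" for i
    using join_U[OF \<sigma>_comm[of i k] IH[of i] kU Cons.prems(3)[OF k(1)]] that k by auto
  then show ?case unfolding eq using join_T[OF \<sigma>_m[OF k(1)] Cons.prems(3)[OF k(1)] kU] by blast
qed

lemma lprod_jn:
  assumes "set is \<subseteq> \<sigma>" "distinct is" "\<And>i. i \<in> \<sigma> \<Longrightarrow> \<beta> i \<in> hbases (A i)"
  shows "lprod M0 (\<lambda>i. iota i (\<beta> i)) is = fscale ((-1) ^ jsign \<beta> is) (e (jn \<beta> is))"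
  using assms
proof (induction "is")
  case Nil
  show ?case by (simp only: lprod_simps M0_simps jn_def foldr.simps id_apply jsign.simps power_0 fs.scale_one)
next
  case (Cons k "is")
  have k: "k \<in> \<sigma>" "k \<notin> set is" using Cons by auto
  note km = \<sigma>_m[OF k(1)] and bk = Cons.prems(3)[OF k(1)]
  have J: "jn \<beta> is \<in> T" "jn \<beta> is \<in> U k" using jn_T[of "is" \<beta>] Cons.prems k by auto
  have IH: "lprod M0 (\<lambda>i. iota i (\<beta> i)) is = fscale ((-1) ^ jsign \<beta> is) (e (jn \<beta> is))"
    by (rule Cons.IH) (use Cons.prems in auto)
  have bC: "\<beta> k \<in> hcarrier (A k)" by (rule chopf.hbases_C[OF \<sigma>_chi[OF k(1)] bk])
  have L: "L k (\<beta> k) (e (jn \<beta> is)) = fscale ((-1) ^ (hdeg (A k) (\<beta> k) * dbelow k (jn \<beta> is))) (e (join k (\<beta> k) (jn \<beta> is)))"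
    unfolding e_tcons[OF km bk J(2)] by (simp only: fs.scale_scale minus_one_power_square fs.scale_one)
  have N: "fscale ((-1) ^ jsign \<beta> is) (e (jn \<beta> is)) \<in> N" by (rule fs.subspace_scale[OF subspace_N e_N[OF J(1)]])
  show ?case
    unfolding lprod_simps IH M0_simps iota_mult[OF km bC N] linear_on_scale[OF L_lin[OF km] e_N[OF J(1)]] L fs.scale_scale
      jsign.simps power_add by (simp only: jn_def foldr.simps comp_apply mult.commute)
qed

lemma jn_inject:
  assumes "set is \<subseteq> \<sigma>" "distinct is" "\<And>i. i \<in> \<sigma> \<Longrightarrow> \<beta> i \<in> hbases (A i)" "\<And>i. i \<in> \<sigma> \<Longrightarrow> \<gamma> i \<in> hbases (A i)"
    "jn \<beta> is = jn \<gamma> is"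
  shows "\<forall>i\<in>set is. \<beta> i = \<gamma> i"
  using assms
proof (induction "is")
  case (Cons k "is")
  have k: "k \<in> \<sigma> - set is" and s: "set is \<subseteq> \<sigma>" "distinct is" using Cons.prems(1,2) by auto
  have "jn \<beta> is \<in> U k" "jn \<gamma> is \<in> U k"
    using jn_T[OF s Cons.prems(3)] jn_T[OF s Cons.prems(4)] k by blast+
  moreover have "join k (\<beta> k) (jn \<beta> is) = join k (\<gamma> k) (jn \<gamma> is)" using Cons.prems(5) by (simp add: jn_def)
  ultimately have "\<beta> k = \<gamma> k \<and> jn \<beta> is = jn \<gamma> is" by (rule join_inject)
  then show ?case using Cons.IH[OF s Cons.prems(3,4)] by simp
qed simp

text \<open>A left inverse sends the trace of a tensor of basis elements back to that tensor. This is consistent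
  because distinct tensors of basis elements have distinct traces.\<close>

lemma psi_inj: "inj_on psi DC"
proof -
  define Bf where "Bf = {\<beta>. \<forall>i\<in>\<sigma>. \<beta> i \<in> hbases (A i)}"
  \<comment> \<open>The left inverse on traces; those that do not come from the simplex are sent to 0.\<close>
  define h where "h t = (if \<exists>\<beta>\<in>Bf. t = jn \<beta> sl then
     (let \<beta> = (SOME \<beta>. \<beta> \<in> Bf \<and> t = jn \<beta> sl) in fscale ((-1) ^ jsign \<beta> sl) (mten A \<sigma> \<beta>)) else 0)" for t
  have jn_cong: "jn \<beta> is = jn \<gamma> is" if "\<forall>i\<in>set is. \<beta> i = \<gamma> i" for "is" \<beta> \<gamma>
    using that by (induction "is") (auto simp: jn_def)
  have jcong: "jsign \<beta> is = jsign \<gamma> is" if "\<forall>i\<in>set is. \<beta> i = \<gamma> i" for \<beta> \<gamma> "is"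
    using that
  proof (induction "is")
    case (Cons k "is") then show ?case using jn_cong[of "is" \<beta> \<gamma>] by simp
  qed simp
  have h: "h (jn \<beta> sl) = fscale ((-1) ^ jsign \<beta> sl) (mten A \<sigma> \<beta>)" if \<beta>: "\<beta> \<in> Bf" for \<beta>
  proof -
    define \<gamma> where "\<gamma> = (SOME \<gamma>. \<gamma> \<in> Bf \<and> jn \<beta> sl = jn \<gamma> sl)"
    have \<gamma>: "\<gamma> \<in> Bf" "jn \<beta> sl = jn \<gamma> sl" unfolding \<gamma>_def using someI[of "\<lambda>\<gamma>. \<gamma> \<in> Bf \<and> jn \<beta> sl = jn \<gamma> sl" \<beta>] \<beta> by auto
    have eq: "\<forall>i\<in>set sl. \<beta> i = \<gamma> i"
      by (rule jn_inject) (use \<beta> \<gamma> sl in \<open>auto simp: Bf_def\<close>)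
    then have "mten A \<sigma> \<beta> = mten A \<sigma> \<gamma>" unfolding mten_def by (intro mtensor_cong) (simp add: finite_\<sigma>)
    then show ?thesis using jcong[OF eq] \<beta> by (auto simp: h_def \<gamma>_def[symmetric] Let_def)
  qed
  have span: "DC \<subseteq> fs.span (mten A \<sigma> ` Bf)"
    unfolding DC_span_X
  proof (rule fs.span_minimal, rule image_subsetI)
    fix a assume a: "a \<in> X"
    have "mtensor (\<lambda>i. scl (A i)) \<sigma> a \<in> fs.span {mtensor (\<lambda>i. scl (A i)) \<sigma> t' |t'. \<forall>i\<in>\<sigma>. t' i \<in> hbases (A i)}"
    proof (rule mtensor_span[OF finite_\<sigma>])
      fix i assume i: "i \<in> \<sigma>"
      then interpret Ai: chopf "A i" by (rule \<sigma>_chi)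
      show "vector_space (scl (A i))" by (rule Ai.vs)
      show "a i \<in> module.span (scl (A i)) (hbases (A i))" using a i by (simp add: X_def Ai.span_hbases)
    qed
    also have "{mtensor (\<lambda>i. scl (A i)) \<sigma> t' |t'. \<forall>i\<in>\<sigma>. t' i \<in> hbases (A i)} = mten A \<sigma> ` Bf"
      by (auto simp: mten_def Bf_def)
    finally show "mten A \<sigma> a \<in> fs.span (mten A \<sigma> ` Bf)" by (simp add: mten_def)
  qed simp
  have Bf_X: "Bf \<subseteq> X" using chopf.hbases_C[OF \<sigma>_chi] by (auto simp: Bf_def X_def)
  have sub: "fs.span (mten A \<sigma> ` Bf) \<subseteq> DC" unfolding DC_span_X using Bf_X by (intro fs.span_mono) blast
  have comp: "linear_on fscale fscale DC (\<lambda>x. nlift fscale h (psi x))"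
    by (rule linear_on_comp[OF psi_lin nlift(1)[OF vector_space_fscale]]) (use psi_N in blast)
  show ?thesis
  proof (rule inj_on_inverseI[where g = "nlift fscale h"])
    fix x assume x: "x \<in> DC"
    show "nlift fscale h (psi x) = x"
  proof (rule linear_on_eq_on_span[OF linear_on_subset[OF comp sub] linear_on_ident(1) vector_space_fscale vector_space_fscale _ subsetD[OF span x]])
    fix v assume "v \<in> mten A \<sigma> ` Bf"
    then obtain \<beta> where \<beta>: "\<beta> \<in> Bf" "v = mten A \<sigma> \<beta>" by blast
    have b: "\<And>i. i \<in> \<sigma> \<Longrightarrow> \<beta> i \<in> hbases (A i)" using \<beta> by (simp add: Bf_def)
    have J: "jn \<beta> sl \<in> T" using jn_T[of sl \<beta>] b sl by auto
    have p: "psi v = fscale ((-1) ^ jsign \<beta> sl) (e (jn \<beta> sl))"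
      unfolding \<beta>(2) psi_mten[OF subsetD[OF Bf_X \<beta>(1)]] by (rule lprod_jn) (use b sl in auto)
    show "nlift fscale h (psi v) = v"
      unfolding p linear_on_scale[OF nlift(1)[OF vector_space_fscale] e_N[OF J]] nlift(2)[OF vector_space_fscale J] h[OF \<beta>(1)]
      unfolding \<beta>(2) by (simp only: fs.scale_scale minus_one_power_square fs.scale_one)
  qed
  qed
qed

end


context gprod_simplex begin

lemma homog_mult:
  assumes a: "(d, a) \<in> homog_family A \<sigma>" and b: "(q, b) \<in> homog_family A \<sigma>"
  shows "(\<lambda>i. mult (A i) (a i) (b i)) \<in> X"
    "mmult (psi (mten A \<sigma> a)) (psi (mten A \<sigma> b)) =
      fscale (koszul_sign \<sigma> d q) (psi (mten A \<sigma> (\<lambda>i. mult (A i) (a i) (b i))))"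
proof -
  have ag: "a i \<in> gr (A i) (d i)" "b i \<in> gr (A i) (q i)" if "i \<in> \<sigma>" for i
    using a b that by (auto simp: homog_family_def)
  have iog: "iota i (a i) \<in> ngr (d i)" "iota i (b i) \<in> ngr (q i)" if "i \<in> \<sigma>" for i
    using alg_homD(2)[OF iota_alg_hom[OF \<sigma>_m[OF that]] ag(1)[OF that]]
      alg_homD(2)[OF iota_alg_hom[OF \<sigma>_m[OF that]] ag(2)[OF that]] by (simp_all only: M0_simps)
  show X: "(\<lambda>i. mult (A i) (a i) (b i)) \<in> X"
    unfolding X_def
  proof safe
    fix i assume i: "i \<in> \<sigma>"
    interpret Ai: chopf "A i" by (rule \<sigma>_chi[OF i])
    show "mult (A i) (a i) (b i) \<in> hcarrier (A i)" by (rule Ai.mult_C[OF Ai.gr_C[OF ag(1)[OF i]] Ai.gr_C[OF ag(2)[OF i]]])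
  qed
  have "mmult (lprod M0 (\<lambda>i. iota i (a i)) sl) (lprod M0 (\<lambda>i. iota i (b i)) sl) =
      fscale ((-1) ^ koszul_list sl d q) (lprod M0 (\<lambda>i. mmult (iota i (a i)) (iota i (b i))) sl)"
  proof (rule M0.A.lprod_mult[unfolded M0_simps])
    fix i j assume ij: "i \<in> set sl" "j \<in> set sl" "i \<noteq> j"
    show "mmult (iota i (a i)) (iota j (b j)) = fscale ((-1) ^ (d i * q j)) (mmult (iota j (b j)) (iota i (a i)))"
      using iota_supercomm[OF \<sigma>_comm[of i j]] ij ag unfolding supercomm_def M0_simps sl(1) by blast
  qed (use iog sl in auto)
  also have "lprod M0 (\<lambda>i. mmult (iota i (a i)) (iota i (b i))) sl = lprod M0 (\<lambda>i. iota i (mult (A i) (a i) (b i))) sl"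
  proof (rule lprod_cong)
    fix i assume "i \<in> set sl"
    then have i: "i \<in> \<sigma>" by (simp only: sl(1))
    interpret Ai: chopf "A i" by (rule \<sigma>_chi[OF i])
    show "mmult (iota i (a i)) (iota i (b i)) = iota i (mult (A i) (a i) (b i))"
      using alg_homD(4)[OF iota_alg_hom[OF \<sigma>_m[OF i]] Ai.gr_C[OF ag(1)[OF i]] Ai.gr_C[OF ag(2)[OF i]]]
      by (simp only: M0_simps)
  qed
  finally show "mmult (psi (mten A \<sigma> a)) (psi (mten A \<sigma> b)) =
      fscale (koszul_sign \<sigma> d q) (psi (mten A \<sigma> (\<lambda>i. mult (A i) (a i) (b i))))"
    unfolding psi_mten[OF homog_X[OF a]] psi_mten[OF homog_X[OF b]] psi_mten[OF X] koszul_sign_list[OF finite_\<sigma>] .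
qed

lemma sub_im: "module.subspace fscale (psi ` DC)"
  by (rule linear_on_image_subspace[OF psi_lin vector_space_fscale vector_space_fscale sub_DC])

lemma im_N: "psi ` DC \<subseteq> N" using psi_N by blast

lemma im_mult:
  assumes x: "x \<in> DC" and y: "y \<in> DC" shows "mmult (psi x) (psi y) \<in> psi ` DC"
proof (rule DC_image[where F = "\<lambda>x. mmult (psi x) (psi y)", OF _ vector_space_fscale sub_im _ x])
  show "linear_on fscale fscale DC (\<lambda>x. mmult (psi x) (psi y))"
    by (rule linear_on_comp[OF psi_lin mmult_lin1[OF psi_N[OF y]]]) (rule im_N)
  fix d a assume a: "(d, a) \<in> homog_family A \<sigma>"
  note aN = psi_N[OF mten_homog_DC[OF a]]
  show "mmult (psi (mten A \<sigma> a)) (psi y) \<in> psi ` DC"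
  proof (rule DC_image[where F = "\<lambda>y. mmult (psi (mten A \<sigma> a)) (psi y)", OF _ vector_space_fscale sub_im _ y])
    show "linear_on fscale fscale DC (\<lambda>y. mmult (psi (mten A \<sigma> a)) (psi y))"
      by (rule linear_on_comp[OF psi_lin mmult_lin2[OF aN]]) (rule im_N)
    fix q b assume b: "(q, b) \<in> homog_family A \<sigma>"
    show "mmult (psi (mten A \<sigma> a)) (psi (mten A \<sigma> b)) \<in> psi ` DC"
      unfolding homog_mult(2)[OF a b]
      by (rule fs.subspace_scale[OF sub_im imageI[OF mten_DC[OF homog_mult(1)[OF a b]]]])
  qed
qed

abbreviation "pinv \<equiv> the_inv_into DC psi"

lemma pinv_psi: "x \<in> DC \<Longrightarrow> pinv (psi x) = x" by (rule the_inv_into_f_f[OF psi_inj])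

lemma pinv_lin: "linear_on fscale fscale (psi ` DC) pinv"
  by (rule linear_on_inv_into[OF psi_lin psi_inj vector_space_fscale sub_DC])

lemma psi_pinv: "y \<in> psi ` DC \<Longrightarrow> psi (pinv y) = y" by (rule f_the_inv_into_f[OF psi_inj])

text \<open>The image of \<^const>\<open>psi\<close> is closed under products, so products of tensors may be computed in the graph
  product. In particular the prescribed products of pure tensors are consistent.\<close>

lemma mten_mult:
  assumes t: "t \<in> DC" and u: "u \<in> DC"
  shows "mten_mult A \<sigma> t u = pinv (mmult (psi t) (psi u))"
proof -
  let ?H = "homog_family A \<sigma>" and ?e = "\<lambda>(d, a). mten A \<sigma> a"
  have inner: "lin_ext fscale fscale ?H (\<lambda>(e, b). mten A \<sigma> b)
          (\<lambda>(e, b). fscale (koszul_sign \<sigma> d e) (mten A \<sigma> (\<lambda>i. mult (A i) (a i) (b i)))) u =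
      pinv (mmult (psi (mten A \<sigma> a)) (psi u))" if a: "(d, a) \<in> ?H" for d a
  proof (rule lin_ext_eqI[where G = "\<lambda>u. pinv (mmult (psi (mten A \<sigma> a)) (psi u))", OF vector_space_fscale vector_space_fscale])
    note aD = mten_homog_DC[OF a]
    have "linear_on fscale fscale DC (\<lambda>u. mmult (psi (mten A \<sigma> a)) (psi u))"
      by (rule linear_on_comp[OF psi_lin mmult_lin2[OF psi_N[OF aD]]]) (rule im_N)
    from linear_on_comp[OF this pinv_lin]
    show "linear_on fscale fscale (fs.span (?e ` ?H)) (\<lambda>u. pinv (mmult (psi (mten A \<sigma> a)) (psi u)))"
      unfolding DC_eq[symmetric] using im_mult[OF aD] by blast
    show "u \<in> fs.span (?e ` ?H)" using u by (simp only: DC_eq)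
    fix x assume "x \<in> ?H"
    then obtain q b where x: "x = (q, b)" "(q, b) \<in> ?H" by (cases x) simp
    note m = homog_mult[OF a x(2)]
    note mD = mten_DC[OF m(1)]
    show "pinv (mmult (psi (mten A \<sigma> a)) (psi (?e x))) =
        (\<lambda>(e, b). fscale (koszul_sign \<sigma> d e) (mten A \<sigma> (\<lambda>i. mult (A i) (a i) (b i)))) x"
      unfolding x(1) prod.case m(2) linear_on_scale[OF pinv_lin imageI[OF mD]] pinv_psi[OF mD] ..
  qed
  show ?thesis unfolding mten_mult_def
  proof (rule lin_ext_eqI[where G = "\<lambda>t. pinv (mmult (psi t) (psi u))", OF vector_space_fscale vector_space_fscale])
    have "linear_on fscale fscale DC (\<lambda>t. mmult (psi t) (psi u))"
      by (rule linear_on_comp[OF psi_lin mmult_lin1[OF psi_N[OF u]]]) (rule im_N)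
    from linear_on_comp[OF this pinv_lin]
    show "linear_on fscale fscale (fs.span (?e ` ?H)) (\<lambda>t. pinv (mmult (psi t) (psi u)))"
      unfolding DC_eq[symmetric] using im_mult[OF _ u] by blast
    show "t \<in> fs.span (?e ` ?H)" using t by (simp only: DC_eq)
    fix x assume "x \<in> ?H"
    then obtain d a where x: "x = (d, a)" "(d, a) \<in> ?H" by (cases x) simp
    show "pinv (mmult (psi (?e x)) (psi u)) = (\<lambda>(d, a). lin_ext fscale fscale ?H (\<lambda>(e, b). mten A \<sigma> b)
          (\<lambda>(e, b). fscale (koszul_sign \<sigma> d e) (mten A \<sigma> (\<lambda>i. mult (A i) (a i) (b i)))) u) x"
      unfolding x(1) prod.case inner[OF x(2)] ..
  qed
qed

lemma mten_mult_DC: "t \<in> DC \<Longrightarrow> u \<in> DC \<Longrightarrow> mten_mult A \<sigma> t u \<in> DC"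
  unfolding mten_mult by (rule the_inv_into_into[OF psi_inj im_mult order_refl])

lemma psi_mult: "t \<in> DC \<Longrightarrow> u \<in> DC \<Longrightarrow> psi (mten_mult A \<sigma> t u) = mmult (psi t) (psi u)"
  unfolding mten_mult by (rule psi_pinv[OF im_mult])

lemma unit_X: "(\<lambda>i. unit (A i)) \<in> X" "(\<lambda>_. 0, \<lambda>i. unit (A i)) \<in> homog_family A \<sigma>"
proof -
  have "unit (A i) \<in> gr (A i) 0" if "i \<in> \<sigma>" for i
  proof -
    interpret Ai: chopf "A i" by (rule \<sigma>_chi[OF that])
    show ?thesis by (rule Ai.unit_gr)
  qed
  then show h: "(\<lambda>_. 0, \<lambda>i. unit (A i)) \<in> homog_family A \<sigma>" by (simp add: homog_family_def)
  show "(\<lambda>i. unit (A i)) \<in> X" by (rule homog_X[OF h])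
qed

lemma psi_unit: "psi (mten A \<sigma> (\<lambda>i. unit (A i))) = e []"
proof -
  have "iota i (unit (A i)) = unit M0" if "i \<in> set sl" for i
    using alg_homD(3)[OF iota_alg_hom[OF \<sigma>_m]] that by (simp only: sl(1))
  then have "lprod M0 (\<lambda>i. iota i (unit (A i))) sl = lprod M0 (\<lambda>i. unit M0) sl" by (rule lprod_cong)
  also have "\<dots> = lprod M0 (\<lambda>i. unit M0) (filter (\<lambda>_. False) sl)"
    by (rule M0.A.lprod_filter[symmetric]) (simp_all add: M0.A.unit_C)
  finally show ?thesis unfolding psi_mten[OF unit_X(1)] by (simp add: M0_simps)
qed

text \<open>The tensor square of \<^const>\<open>psi\<close>, and the multiplicative map on the tensor product of the
  tensor squares.\<close>

definition PP where "PP = tensor_map fscale fscale fscale fscale DC DC psi psi"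

definition Gam where
  "Gam = lin_ext fscale fscale {t. \<forall>i\<in>\<sigma>. t i \<in> tcar (A i) (A i)} (mtensor (\<lambda>_. fscale) \<sigma>)
    (\<lambda>t. lprod (talg M0 M0) (\<lambda>i. tmap (A i) (A i) M0 M0 (iota i) (iota i) (t i)) sl)"

lemma PP: "linear_on fscale fscale (tspan fscale fscale DC DC) PP"
  "x \<in> DC \<Longrightarrow> y \<in> DC \<Longrightarrow> PP (tensor fscale fscale x y) = ten M0 M0 (psi x) (psi y)"
  "inj_on PP (tspan fscale fscale DC DC)"
  unfolding PP_def ten_def M0_simps
  by (rule tensor_map_linear[OF vector_space_fscale vector_space_fscale vector_space_fscale vector_space_fscale
      sub_DC sub_DC psi_lin psi_lin] | assumption |
    rule tensor_map_inj[OF vector_space_fscale vector_space_fscale vector_space_fscale vector_space_fscale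
      sub_DC sub_DC psi_lin psi_inj psi_lin psi_inj])+

lemma Gam: "t \<in> {t. \<forall>i\<in>\<sigma>. t i \<in> tcar (A i) (A i)} \<Longrightarrow>
    Gam (mtensor (\<lambda>_. fscale) \<sigma> t) = lprod (talg M0 M0) (\<lambda>i. tmap (A i) (A i) M0 M0 (iota i) (iota i) (t i)) sl"
  and Gam_lin: "linear_on fscale fscale
    (module.span fscale (mtensor (\<lambda>_. fscale) \<sigma> ` {t. \<forall>i\<in>\<sigma>. t i \<in> tcar (A i) (A i)})) Gam"
proof -
  let ?io2 = "\<lambda>i. tmap (A i) (A i) M0 M0 (iota i) (iota i)"
  have io2: "linear_on fscale fscale (tcar (A i) (A i)) (?io2 i) \<and> ?io2 i ` tcar (A i) (A i) \<subseteq> tcar M0 M0" if "i \<in> \<sigma>" for i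
  proof -
    interpret Ai: chopf "A i" by (rule \<sigma>_chi[OF that])
    interpret T: galg2 "talg (A i) (A i)" "talg M0 M0" by unfold_locales
    note h = alg_hom_tmap[OF Ai.ga Ai.ga graded_algebra_M0 graded_algebra_M0 iota_alg_hom[OF \<sigma>_m[OF that]] iota_alg_hom[OF \<sigma>_m[OF that]]]
    show ?thesis using alg_homD(1)[OF h] T.alg_hom_C[OF h] unfolding Ai.AA.hcarrier_talg M0.hcarrier_talg talg_simps by blast
  qed
  have 1: "vector_space (fscale :: 'k \<Rightarrow> ('k, 'a, 'a) tensor \<Rightarrow> _) \<and> module.subspace fscale (tcar (A i) (A i))" if "i \<in> \<sigma>" for i
    using vector_space_fscale subspace_tspan by blast
  have 2: "linear_on fscale fscale (tcar (A i) (A i)) (\<lambda>x. lprod (talg M0 M0) (\<lambda>j. ?io2 j ((a(i := x)) j)) sl)"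
    if "i \<in> \<sigma>" "\<forall>j\<in>\<sigma>. a j \<in> tcar (A j) (A j)" for i a
    by (rule M0.T.lprod_linear[where s = "\<lambda>_. fscale" and V = "\<lambda>j. tcar (A j) (A j)" and h = ?io2, unfolded talg_simps M0.hcarrier_talg])
      (use that sl io2 in auto)
  have 3: "lprod (talg M0 M0) (\<lambda>i. ?io2 i (a i)) sl = lprod (talg M0 M0) (\<lambda>i. ?io2 i (b i)) sl" if "\<forall>i\<in>\<sigma>. a i = b i" for a b
    by (rule lprod_cong) (use that sl in auto)
  note * = mtensor_universal[where V = "\<lambda>i. tcar (A i) (A i)" and s = "\<lambda>_. fscale" and h = "\<lambda>a. lprod (talg M0 M0) (\<lambda>i. ?io2 i (a i)) sl",
      OF finite_\<sigma> vector_space_fscale 1 2 3, folded Gam_def]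
  show "t \<in> {t. \<forall>i\<in>\<sigma>. t i \<in> tcar (A i) (A i)} \<Longrightarrow>
    Gam (mtensor (\<lambda>_. fscale) \<sigma> t) = lprod (talg M0 M0) (\<lambda>i. ?io2 i (t i)) sl" by (rule *(2))
  show "linear_on fscale fscale (module.span fscale (mtensor (\<lambda>_. fscale) \<sigma> ` {t. \<forall>i\<in>\<sigma>. t i \<in> tcar (A i) (A i)})) Gam"
    by (rule *(1))
qed

abbreviation "shgen \<equiv> (\<lambda>((d, a), (e, b)). mtensor (\<lambda>_. fscale) \<sigma> (\<lambda>i. ten (A i) (A i) (a i) (b i))) `
    (homog_family A \<sigma> \<times> homog_family A \<sigma>)"

abbreviation "PPinv \<equiv> the_inv_into (tspan fscale fscale DC DC) PP"

lemma shgen_sub: "module.span fscale shgen \<subseteq> module.span fscale (mtensor (\<lambda>_. fscale) \<sigma> ` {t. \<forall>i\<in>\<sigma>. t i \<in> tcar (A i) (A i)})"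
proof (rule fs.span_mono, safe)
  fix d a q b assume h: "(d, a) \<in> homog_family A \<sigma>" "(q, b) \<in> homog_family A \<sigma>"
  have "ten (A i) (A i) (a i) (b i) \<in> tcar (A i) (A i)" if "i \<in> \<sigma>" for i
  proof -
    interpret Ai: chopf "A i" by (rule \<sigma>_chi[OF that])
    show ?thesis by (rule Ai.AA.ten_tcar) (use homog_X[OF h(1)] homog_X[OF h(2)] that in \<open>auto simp: X_def\<close>)
  qed
  then show "mtensor (\<lambda>_. fscale) \<sigma> (\<lambda>i. ten (A i) (A i) (a i) (b i)) \<in>
      mtensor (\<lambda>_. fscale) \<sigma> ` {t. \<forall>i\<in>\<sigma>. t i \<in> tcar (A i) (A i)}" by blast
qed

lemma Gam_pure:
  assumes h: "(d, a) \<in> homog_family A \<sigma>" "(q, b) \<in> homog_family A \<sigma>"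
  shows "Gam (mtensor (\<lambda>_. fscale) \<sigma> (\<lambda>i. ten (A i) (A i) (a i) (b i))) =
    PP (fscale (koszul_sign \<sigma> d q) (tensor fscale fscale (mten A \<sigma> a) (mten A \<sigma> b)))"
proof -
  let ?io2 = "\<lambda>i. tmap (A i) (A i) M0 M0 (iota i) (iota i)"
  have ag: "a i \<in> gr (A i) (d i)" "b i \<in> gr (A i) (q i)" if "i \<in> \<sigma>" for i
    using h that by (auto simp: homog_family_def)
  have io2: "ten (A i) (A i) (a i) (b i) \<in> tcar (A i) (A i) \<and>
      ?io2 i (ten (A i) (A i) (a i) (b i)) = ten M0 M0 (iota i (a i)) (iota i (b i))" if i: "i \<in> \<sigma>" for i
  proof -
    interpret Ai: chopf "A i" by (rule \<sigma>_chi[OF i])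
    note C = Ai.gr_C[OF ag(1)[OF i]] Ai.gr_C[OF ag(2)[OF i]]
    show ?thesis
      using Ai.AA.ten_tcar[OF C] tmap_lin(2)[OF Ai.ga Ai.ga graded_algebra_M0 graded_algebra_M0
          iota_alg_hom[OF \<sigma>_m[OF i]] iota_alg_hom[OF \<sigma>_m[OF i]] C] by blast
  qed
  have iog: "iota i (a i) \<in> gr M0 (d i)" "iota i (b i) \<in> gr M0 (q i)" if "i \<in> set sl" for i
    using that alg_homD(2)[OF iota_alg_hom[OF \<sigma>_m] ag(1)] alg_homD(2)[OF iota_alg_hom[OF \<sigma>_m] ag(2)]
    unfolding sl(1) by blast+
  have "Gam (mtensor (\<lambda>_. fscale) \<sigma> (\<lambda>i. ten (A i) (A i) (a i) (b i))) =
      lprod (talg M0 M0) (\<lambda>i. ?io2 i (ten (A i) (A i) (a i) (b i))) sl"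
    by (rule Gam) (use io2 in blast)
  also have "\<dots> = lprod (talg M0 M0) (\<lambda>i. ten M0 M0 (iota i (a i)) (iota i (b i))) sl"
    by (rule lprod_cong) (use io2 in \<open>simp add: finite_\<sigma>\<close>)
  also have "\<dots> = fscale ((-1) ^ koszul_list sl d q) (ten M0 M0 (psi (mten A \<sigma> a)) (psi (mten A \<sigma> b)))"
    unfolding psi_mten[OF homog_X[OF h(1)]] psi_mten[OF homog_X[OF h(2)]] by (rule M0.lprod_ten[OF iog])
  also have "\<dots> = PP (fscale (koszul_sign \<sigma> d q) (tensor fscale fscale (mten A \<sigma> a) (mten A \<sigma> b)))"
    unfolding PP(2)[OF mten_homog_DC[OF h(1)] mten_homog_DC[OF h(2)], symmetric] koszul_sign_list[OF finite_\<sigma>]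
    by (rule linear_on_scale[OF PP(1) tspan_base[OF mten_homog_DC[OF h(1)] mten_homog_DC[OF h(2)]], symmetric])
  finally show ?thesis .
qed

lemma sub_imPP: "module.subspace fscale (PP ` tspan fscale fscale DC DC)"
  by (rule linear_on_image_subspace[OF PP(1) vector_space_fscale vector_space_fscale subspace_tspan])

lemma PPinv_lin: "linear_on fscale fscale (PP ` tspan fscale fscale DC DC) PPinv"
  by (rule linear_on_inv_into[OF PP(1,3) vector_space_fscale subspace_tspan])

lemma tens_DC: "(d, a) \<in> homog_family A \<sigma> \<Longrightarrow> (q, b) \<in> homog_family A \<sigma> \<Longrightarrow>
    fscale c (tensor fscale fscale (mten A \<sigma> a) (mten A \<sigma> b)) \<in> tspan fscale fscale DC DC"
  by (rule fs.subspace_scale[OF subspace_tspan tspan_base[OF mten_homog_DC mten_homog_DC]])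

lemma Gam_im: "t \<in> module.span fscale shgen \<Longrightarrow> Gam t \<in> PP ` tspan fscale fscale DC DC"
proof (rule linear_on_image_span[OF linear_on_subset[OF Gam_lin shgen_sub] vector_space_fscale vector_space_fscale _ sub_imPP])
  fix x assume "x \<in> shgen"
  then obtain d a q b where h: "(d, a) \<in> homog_family A \<sigma>" "(q, b) \<in> homog_family A \<sigma>"
    "x = mtensor (\<lambda>_. fscale) \<sigma> (\<lambda>i. ten (A i) (A i) (a i) (b i))" by auto
  show "Gam x \<in> PP ` tspan fscale fscale DC DC" unfolding h(3) Gam_pure[OF h(1,2)] by (rule imageI[OF tens_DC[OF h(1,2)]])
qed

text \<open>The Koszul sign of the shuffle is the one that arises in the tensor square of the graph product when
  the ordered product of the \<open>a i \<otimes> b i\<close> is multiplied out.\<close>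

lemma shuffle_eq:
  assumes t: "t \<in> module.span fscale shgen" shows "shuffle A \<sigma> t = PPinv (Gam t)"
  unfolding shuffle_def
proof (rule lin_ext_eqI[where G = "\<lambda>t. PPinv (Gam t)", OF vector_space_fscale vector_space_fscale _ _ t])
  show "linear_on fscale fscale (module.span fscale shgen) (\<lambda>t. PPinv (Gam t))"
    by (rule linear_on_comp[OF linear_on_subset[OF Gam_lin shgen_sub] PPinv_lin]) (use Gam_im in blast)
  fix x assume "x \<in> homog_family A \<sigma> \<times> homog_family A \<sigma>"
  then obtain d a q b where x: "x = ((d, a), (q, b))" and h: "(d, a) \<in> homog_family A \<sigma>" "(q, b) \<in> homog_family A \<sigma>"
    by (cases x) auto
  show "PPinv (Gam ((\<lambda>((d, a), e, b). mtensor (\<lambda>_. fscale) \<sigma> (\<lambda>i. ten (A i) (A i) (a i) (b i))) x)) =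
      (\<lambda>((d, a), e, b). fscale (koszul_sign \<sigma> d e) (tensor fscale fscale (mten A \<sigma> a) (mten A \<sigma> b))) x"
    unfolding x prod.case Gam_pure[OF h] by (rule the_inv_into_f_f[OF PP(3) tens_DC[OF h]])
qed

lemma comult_shgen:
  assumes a: "a \<in> X" shows "mtensor (\<lambda>_. fscale) \<sigma> (\<lambda>i. comult (A i) (a i)) \<in> module.span fscale shgen"
proof -
  let ?S = "\<lambda>i. (\<lambda>((_, a), (_, b)). ten (A i) (A i) a b) ` (homog (A i) \<times> homog (A i))"
  have "mtensor (\<lambda>_. fscale) \<sigma> (\<lambda>i. comult (A i) (a i)) \<in> module.span fscale {mtensor (\<lambda>_. fscale) \<sigma> t' |t'. \<forall>i\<in>\<sigma>. t' i \<in> ?S i}"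
  proof (rule mtensor_span[OF finite_\<sigma> vector_space_fscale])
    fix i assume i: "i \<in> \<sigma>"
    interpret Ai: chopf "A i" by (rule \<sigma>_chi[OF i])
    have "comult (A i) (a i) \<in> tcar (A i) (A i)" by (rule Ai.comult_tcar) (use a i in \<open>simp add: X_def\<close>)
    then show "comult (A i) (a i) \<in> fs.span (?S i)" unfolding Ai.AA.tcar_eq .
  qed
  also have "\<dots> \<subseteq> module.span fscale shgen"
  proof (rule fs.span_mono, safe)
    fix t assume "\<forall>i\<in>\<sigma>. t i \<in> ?S i"
    then have "\<forall>i\<in>\<sigma>. \<exists>d a q b. a \<in> gr (A i) d \<and> b \<in> gr (A i) q \<and> t i = ten (A i) (A i) a b"
      by (force simp: homog_def)
    then obtain d a q b where h: "\<forall>i\<in>\<sigma>. a i \<in> gr (A i) (d i) \<and> b i \<in> gr (A i) (q i) \<and> t i = ten (A i) (A i) (a i) (b i)"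
      by metis
    have "mtensor (\<lambda>_. fscale) \<sigma> t = mtensor (\<lambda>_. fscale) \<sigma> (\<lambda>i. ten (A i) (A i) (a i) (b i))"
      by (rule mtensor_cong) (use h in blast)
    moreover have "(d, a) \<in> homog_family A \<sigma>" "(q, b) \<in> homog_family A \<sigma>" using h by (auto simp: homog_family_def)
    ultimately show "mtensor (\<lambda>_. fscale) \<sigma> t \<in> shgen"
      by (intro image_eqI[where x = "((d, a), (q, b))"]) auto
  qed
  finally show ?thesis .
qed

lemma mcomult_psi:
  assumes a: "a \<in> X"
  shows "mcomult (psi (mten A \<sigma> a)) = Gam (mtensor (\<lambda>_. fscale) \<sigma> (\<lambda>i. comult (A i) (a i)))"
proof -
  have aC: "a i \<in> hcarrier (A i)" if "i \<in> \<sigma>" for i using a that by (simp add: X_def)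
  have "mcomult (psi (mten A \<sigma> a)) = lprod (talg M0 M0) (\<lambda>i. mcomult (iota i (a i))) sl"
    unfolding psi_mten[OF a] by (rule alg_hom_lprod[OF graded_algebra_M0 mcomult(1) iota_X_N[OF a]])
  also have "\<dots> = lprod (talg M0 M0) (\<lambda>i. tmap (A i) (A i) M0 M0 (iota i) (iota i) (comult (A i) (a i))) sl"
  proof (rule lprod_cong)
    fix i assume "i \<in> set sl"
    then have i: "i \<in> \<sigma>" by (simp only: sl(1))
    show "mcomult (iota i (a i)) = tmap (A i) (A i) M0 M0 (iota i) (iota i) (comult (A i) (a i))"
      using mcomult(2)[OF \<sigma>_m[OF i] aC[OF i]] by (simp only: delta_def)
  qed
  also have "\<dots> = Gam (mtensor (\<lambda>_. fscale) \<sigma> (\<lambda>i. comult (A i) (a i)))"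
    by (rule Gam[symmetric]) (use chopf.comult_tcar[OF \<sigma>_chi aC] in blast)
  finally show ?thesis .
qed

lemma mcomult_im: "x \<in> DC \<Longrightarrow> mcomult (psi x) \<in> PP ` tspan fscale fscale DC DC"
proof (rule DC_image[where F = "\<lambda>x. mcomult (psi x)", OF _ vector_space_fscale sub_imPP])
  show "linear_on fscale fscale DC (\<lambda>x. mcomult (psi x))"
    by (rule linear_on_comp[OF psi_lin alg_homD(1)[OF mcomult(1), unfolded hcarrier_M0 M0_simps talg_simps] im_N])
  fix d a assume "(d, a) \<in> homog_family A \<sigma>"
  then have a: "a \<in> X" by (rule homog_X)
  show "mcomult (psi (mten A \<sigma> a)) \<in> PP ` tspan fscale fscale DC DC"
    unfolding mcomult_psi[OF a] by (rule Gam_im[OF comult_shgen[OF a]])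
qed

lemma D_simps: "scl (hopf_tensor A \<sigma>) = fscale" "mult (hopf_tensor A \<sigma>) = mten_mult A \<sigma>"
  "unit (hopf_tensor A \<sigma>) = mten A \<sigma> (\<lambda>i. unit (A i))" "hcarrier (hopf_tensor A \<sigma>) = DC"
  by (simp_all add: hopf_tensor_def DC_def)

lemma comult_D:
  assumes x: "x \<in> DC" shows "comult (hopf_tensor A \<sigma>) x = PPinv (mcomult (psi x))"
proof -
  let ?H = "homog_family A \<sigma>" and ?e = "\<lambda>(d, a). mten A \<sigma> a"
  show ?thesis unfolding hopf_tensor_def hopf.simps
  proof (rule lin_ext_eqI[where G = "\<lambda>x. PPinv (mcomult (psi x))", OF vector_space_fscale vector_space_fscale])
    have "linear_on fscale fscale DC (\<lambda>x. mcomult (psi x))"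
      by (rule linear_on_comp[OF psi_lin alg_homD(1)[OF mcomult(1), unfolded hcarrier_M0 M0_simps talg_simps] im_N])
    from linear_on_comp[OF this PPinv_lin] show "linear_on fscale fscale (fs.span (?e ` ?H)) (\<lambda>x. PPinv (mcomult (psi x)))"
      unfolding DC_eq[symmetric] using mcomult_im by blast
    show "x \<in> fs.span (?e ` ?H)" using x by (simp only: DC_eq)
    fix y assume "y \<in> ?H"
    then obtain d a where y: "y = (d, a)" "(d, a) \<in> ?H" by (cases y) simp
    show "PPinv (mcomult (psi (?e y))) = (\<lambda>(d, a). shuffle A \<sigma> (mtensor (\<lambda>_. fscale) \<sigma> (\<lambda>i. comult (A i) (a i)))) y"
      unfolding y(1) prod.case mcomult_psi[OF homog_X[OF y(2)]] shuffle_eq[OF comult_shgen[OF homog_X[OF y(2)]]] ..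
  qed
qed

lemma PP_comult: "x \<in> DC \<Longrightarrow> PP (comult (hopf_tensor A \<sigma>) x) = mcomult (psi x)"
  unfolding comult_D by (rule f_the_inv_into_f[OF PP(3) mcomult_im])

lemma comult_D_tspan: "x \<in> DC \<Longrightarrow> comult (hopf_tensor A \<sigma>) x \<in> tspan fscale fscale DC DC"
  unfolding comult_D by (rule the_inv_into_into[OF PP(3) mcomult_im order_refl])

lemma counit_D:
  assumes x: "x \<in> DC" shows "counit (hopf_tensor A \<sigma>) x = mcounit (psi x)"
proof -
  let ?H = "homog_family A \<sigma>" and ?e = "\<lambda>(d, a). mten A \<sigma> a"
  show ?thesis unfolding hopf_tensor_def hopf.simps
  proof (rule lin_ext_eqI[where G = "\<lambda>x. mcounit (psi x)", OF vector_space_fscale vector_space_times])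
    show "linear_on fscale (*) (fs.span (?e ` ?H)) (\<lambda>x. mcounit (psi x))"
      using linear_on_comp[OF psi_lin alg_homD(1)[OF mcounit(1), unfolded hcarrier_M0 M0_simps kalg_simps] im_N]
      unfolding DC_eq[symmetric] .
    show "x \<in> fs.span (?e ` ?H)" using x by (simp only: DC_eq)
    fix y assume "y \<in> ?H"
    then obtain d a where y: "y = (d, a)" "(d, a) \<in> ?H" by (cases y) simp
    note a = homog_X[OF y(2)]
    have "mcounit (psi (mten A \<sigma> a)) = lprod kalg (\<lambda>i. mcounit (iota i (a i))) sl"
      unfolding psi_mten[OF a] by (rule alg_hom_lprod[OF graded_algebra_M0 mcounit(1) iota_X_N[OF a]])
    also have "\<dots> = lprod kalg (\<lambda>i. counit (A i) (a i)) sl"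
    proof (rule lprod_cong)
      fix i assume "i \<in> set sl"
      then have i: "i \<in> \<sigma>" by (simp only: sl(1))
      show "mcounit (iota i (a i)) = counit (A i) (a i)"
        by (rule mcounit(2)[OF \<sigma>_m[OF i]]) (use a i in \<open>simp add: X_def\<close>)
    qed
    also have "\<dots> = (\<Prod>i\<in>\<sigma>. counit (A i) (a i))"
      unfolding lprod_unit using prod.distinct_set_conv_list[OF sl(2), of "\<lambda>i. counit (A i) (a i)"] sl(1) by simp
    finally show "mcounit (psi (?e y)) = (\<lambda>(d, a). \<Prod>i\<in>\<sigma>. counit (A i) (a i)) y"
      by (simp only: y(1) prod.case)
  qed
qed

lemma gr_D_image: "psi ` gr (hopf_tensor A \<sigma>) n \<subseteq> ngr n" "gr (hopf_tensor A \<sigma>) n \<subseteq> DC"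
proof -
  let ?S = "{mten A \<sigma> a |d a. (d, a) \<in> homog_family A \<sigma> \<and> (\<Sum>i\<in>\<sigma>. d i) = n}"
  have S: "?S \<subseteq> DC" using mten_homog_DC by blast
  have sub: "fs.span ?S \<subseteq> DC" by (rule fs.span_minimal[OF S sub_DC])
  then show "gr (hopf_tensor A \<sigma>) n \<subseteq> DC" by (simp add: hopf_tensor_def)
  have "psi x \<in> ngr n" if "x \<in> fs.span ?S" for x
  proof (rule linear_on_image_span[OF linear_on_subset[OF psi_lin sub] vector_space_fscale vector_space_fscale _ subspace_ngr that])
    fix x assume "x \<in> ?S"
    then obtain d a where h: "(d, a) \<in> homog_family A \<sigma>" "(\<Sum>i\<in>\<sigma>. d i) = n" "x = mten A \<sigma> a" by blast
    have "lprod M0 (\<lambda>i. iota i (a i)) sl \<in> gr M0 (\<Sum>i\<leftarrow>sl. d i)"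
    proof (rule M0.A.lprod_gr)
      fix i assume "i \<in> set sl"
      then have i: "i \<in> \<sigma>" by (simp only: sl(1))
      show "iota i (a i) \<in> gr M0 (d i)"
        by (rule alg_homD(2)[OF iota_alg_hom[OF \<sigma>_m[OF i]]]) (use h i in \<open>simp add: homog_family_def\<close>)
    qed
    moreover have "(\<Sum>i\<leftarrow>sl. d i) = n" using h(2) sl by (simp add: sum_list_distinct_conv_sum_set)
    ultimately show "psi x \<in> ngr n" unfolding h(3) psi_mten[OF homog_X[OF h(1)]] by (simp add: M0_simps)
  qed
  then show "psi ` gr (hopf_tensor A \<sigma>) n \<subseteq> ngr n" by (auto simp: hopf_tensor_def)
qed

lemma hopf_hom_psi: "hopf_hom (hopf_tensor A \<sigma>) M psi"
  unfolding hopf_hom_def D_simps M_simps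
  using psi_lin gr_D_image(1) psi_unit psi_mult counit_D PP_comult
  by (simp add: PP_def)

end


section \<open>Homomorphisms of Hopf algebras\<close>

lemma hopf_homD:
  assumes "hopf_hom A B f"
  shows "linear_on (scl A) (scl B) (hcarrier A) f" "a \<in> gr A n \<Longrightarrow> f a \<in> gr B n"
    "f (unit A) = unit B"
    "a \<in> hcarrier A \<Longrightarrow> b \<in> hcarrier A \<Longrightarrow> f (mult A a b) = mult B (f a) (f b)"
    "a \<in> hcarrier A \<Longrightarrow> counit B (f a) = counit A a"
    "a \<in> hcarrier A \<Longrightarrow> comult B (f a) = tmap A A B B f f (comult A a)"
  using assms by (auto simp: hopf_hom_def)

lemma hopf_hom_alg_hom: "hopf_hom A B f \<Longrightarrow> alg_hom A B f"
  unfolding hopf_hom_def alg_hom_def by blast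

lemma hopf_hom_C:
  assumes f: "hopf_hom A B f" and s: "vector_space (scl A)" "vector_space (scl B)" and a: "a \<in> hcarrier A"
  shows "f a \<in> hcarrier B"
proof -
  interpret B: vector_space "scl B" by fact
  show ?thesis unfolding hcarrier_def[of B]
    by (rule linear_on_image_span[OF hopf_homD(1)[OF f, unfolded hcarrier_def] s _ _ a[unfolded hcarrier_def]])
      (use hopf_homD(2)[OF f] in \<open>auto intro: B.span_base\<close>)
qed

lemma hopf_hom_comp:
  assumes f: "hopf_hom A B f" and g: "hopf_hom B C g"
    and s: "vector_space (scl A)" "vector_space (scl B)" "vector_space (scl C)"
    and c: "\<And>a. a \<in> hcarrier A \<Longrightarrow> comult A a \<in> tcar A A"
  shows "hopf_hom A C (\<lambda>x. g (f x))"
proof -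
  note f' = hopf_homD[OF f] and g' = hopf_homD[OF g]
  have C: "f a \<in> hcarrier B" if "a \<in> hcarrier A" for a by (rule hopf_hom_C[OF f s(1,2) that])
  then have im: "f ` hcarrier A \<subseteq> hcarrier B" by blast
  have sub: "module.subspace (scl A) (hcarrier A)" "module.subspace (scl B) (hcarrier B)"
    unfolding hcarrier_def by (rule module.subspace_span[OF vs_module[OF s(1)]] module.subspace_span[OF vs_module[OF s(2)]])+
  show ?thesis unfolding hopf_hom_def
  proof (intro conjI allI ballI)
    show "linear_on (scl A) (scl C) (hcarrier A) (\<lambda>x. g (f x))" by (rule linear_on_comp[OF f'(1) g'(1) im])
    show "(\<lambda>x. g (f x)) ` gr A n \<subseteq> gr C n" for n using f'(2) g'(2) by blast
    show "g (f (unit A)) = unit C" by (simp only: f'(3) g'(3))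
    fix a assume a: "a \<in> hcarrier A"
    show "g (f (mult A a b)) = mult C (g (f a)) (g (f b))" if "b \<in> hcarrier A" for b
      by (simp only: f'(4)[OF a that] g'(4)[OF C[OF a] C[OF that]])
    show "counit C (g (f a)) = counit A a" by (simp only: f'(5)[OF a] g'(5)[OF C[OF a]])
    show "comult C (g (f a)) = tmap A A C C (\<lambda>x. g (f x)) (\<lambda>x. g (f x)) (comult A a)"
      unfolding g'(6)[OF C[OF a]] f'(6)[OF a]
      by (rule tensor_map_comp[OF s(1,1,2,2,3,3) sub(1,1,2,2) f'(1) im f'(1) im g'(1) g'(1) c[OF a]])
  qed
qed

lemma hopf_hom_ident:
  assumes "connected_hopf A" shows "hopf_hom A A (\<lambda>x. x)"
proof -
  interpret chopf A by unfold_locales fact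
  have t: "tmap A A A A (\<lambda>x. x) (\<lambda>x. x) t = t" if "t \<in> tcar A A" for t
    by (rule tspan_eqI[OF tensor_map_linear(1)[OF vs vs vs vs sub_C sub_C linear_on_ident(1) linear_on_ident(1)]
          linear_on_ident(1) vector_space_fscale _ that])
      (simp only: tensor_map_linear(2)[OF vs vs vs vs sub_C sub_C linear_on_ident(1) linear_on_ident(1)])
  show ?thesis unfolding hopf_hom_def
    by (intro conjI allI ballI linear_on_ident(1) refl t[OF comult_tcar, symmetric]) simp_all
qed

section \<open>The graph product as a colimit\<close>

context gprod begin

lemma K_facts: "i \<in> {1..m} \<Longrightarrow> {i} \<in> K" "\<sigma> \<in> K \<Longrightarrow> \<tau> \<subseteq> \<sigma> \<Longrightarrow> \<tau> \<in> K" "\<sigma> \<in> K \<Longrightarrow> \<sigma> \<subseteq> {1..m}"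
proof -
  note F = flag[unfolded flag_complex_def simplicial_complex_def, THEN conjunct1]
  note f = F[THEN conjunct1] F[THEN conjunct2, THEN conjunct1] F[THEN conjunct2, THEN conjunct2, THEN conjunct2]
  show "i \<in> {1..m} \<Longrightarrow> {i} \<in> K" by (rule bspec[OF f(3)])
  show "\<sigma> \<in> K \<Longrightarrow> \<tau> \<subseteq> \<sigma> \<Longrightarrow> \<tau> \<in> K" by (rule f(2)[rule_format])
  show "\<sigma> \<in> K \<Longrightarrow> \<sigma> \<subseteq> {1..m}" using subsetD[OF f(1)] by simp
qed

abbreviation "Psi \<equiv> gprod_simplex.psi m K A"

lemma simplexI: "\<sigma> \<in> K \<Longrightarrow> gprod_simplex m K A \<sigma>" by unfold_locales

context
  fixes \<sigma> \<tau> assumes \<sigma>: "\<sigma> \<in> K" and \<tau>: "\<tau> \<in> K" and sub: "\<sigma> \<subseteq> \<tau>"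
begin

interpretation S: gprod_simplex m K A \<sigma> by (rule simplexI[OF \<sigma>])
interpretation T: gprod_simplex m K A \<tau> by (rule simplexI[OF \<tau>])

lemma incl_mten: "a \<in> S.X \<Longrightarrow> hopf_incl A \<sigma> \<tau> (mten A \<sigma> a) = mten A \<tau> (\<lambda>i. if i \<in> \<sigma> then a i else unit (A i))"
  and incl_lin: "linear_on fscale fscale S.DC (hopf_incl A \<sigma> \<tau>)"
  and ext_X: "a \<in> S.X \<Longrightarrow> (\<lambda>i. if i \<in> \<sigma> then a i else unit (A i)) \<in> T.X"
proof -
  let ?x = "\<lambda>a i. if i \<in> \<sigma> then a i else unit (A i)"
  have 1: "vector_space (scl (A i)) \<and> module.subspace (scl (A i)) (hcarrier (A i))" if "i \<in> \<sigma>" for i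
  proof -
    interpret Ai: chopf "A i" by (rule S.\<sigma>_chi[OF that])
    show ?thesis using Ai.vs Ai.sub_C by blast
  qed
  have 2: "linear_on (scl (A i)) fscale (hcarrier (A i)) (\<lambda>x. mten A \<tau> (?x (a(i := x))))"
    if "i \<in> \<sigma>" "\<forall>j\<in>\<sigma>. a j \<in> hcarrier (A j)" for i a
  proof -
    have "?x (a(i := x)) = (?x a)(i := x)" for x using that(1) by auto
    then show ?thesis
      using linear_on_subset[OF mtensor_multilinear[OF T.finite_\<sigma>, of i "\<lambda>i. scl (A i)" "?x a"] subset_UNIV] that(1) sub
      by (auto simp: mten_def)
  qed
  have 3: "mten A \<tau> (?x a) = mten A \<tau> (?x b)" if "\<forall>i\<in>\<sigma>. a i = b i" for a b
    unfolding mten_def by (rule mtensor_cong) (use that in auto)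
  let ?G = "lin_ext fscale fscale S.X (mten A \<sigma>) (\<lambda>a. mten A \<tau> (?x a))"
  note * = mtensor_universal[where V = "\<lambda>i. hcarrier (A i)" and s = "\<lambda>i. scl (A i)" and h = "\<lambda>a. mten A \<tau> (?x a)",
      OF S.finite_\<sigma> vector_space_fscale 1 2 3, folded S.X_def mten_def, folded S.DC_span_X]
  have G1: "linear_on fscale fscale S.DC ?G" by (rule *(1)) assumption+
  have G2: "?G (mten A \<sigma> a) = mten A \<tau> (?x a)" if "a \<in> S.X" for a
    by (rule *(2)) (assumption | rule that)+
  have eq: "hopf_incl A \<sigma> \<tau> x = ?G x" if "x \<in> S.DC" for x
    unfolding hopf_incl_def
  proof (rule lin_ext_eqI[OF vector_space_fscale vector_space_fscale])
    show "linear_on fscale fscale (fs.span ((\<lambda>(d, a). mten A \<sigma> a) ` homog_family A \<sigma>)) ?G"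
      using G1 unfolding S.DC_eq[symmetric] .
    show "x \<in> fs.span ((\<lambda>(d, a). mten A \<sigma> a) ` homog_family A \<sigma>)" using that by (simp only: S.DC_eq)
    fix y assume "y \<in> homog_family A \<sigma>"
    then obtain d a where y: "y = (d, a)" "(d, a) \<in> homog_family A \<sigma>" by (cases y) simp
    show "?G ((\<lambda>(d, a). mten A \<sigma> a) y) = (\<lambda>(d, a). mten A \<tau> (?x a)) y"
      unfolding y(1) prod.case by (rule G2[OF S.homog_X[OF y(2)]])
  qed
  show "linear_on fscale fscale S.DC (hopf_incl A \<sigma> \<tau>)"
    by (rule linear_on_cong[OF G1 eq vector_space_fscale S.sub_DC])
  show "hopf_incl A \<sigma> \<tau> (mten A \<sigma> a) = mten A \<tau> (?x a)" if "a \<in> S.X" for a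
    using eq[OF S.mten_DC[OF that]] G2[OF that] by simp
  show "?x a \<in> T.X" if "a \<in> S.X" for a using that T.unit_X(1) by (auto simp: S.X_def T.X_def)
qed

lemma psi_incl: "x \<in> S.DC \<Longrightarrow> T.psi (hopf_incl A \<sigma> \<tau> x) = S.psi x"
  and incl_DC: "x \<in> S.DC \<Longrightarrow> hopf_incl A \<sigma> \<tau> x \<in> T.DC"
proof -
  show I: "hopf_incl A \<sigma> \<tau> x \<in> T.DC" if "x \<in> S.DC" for x
    by (rule S.DC_image[OF incl_lin vector_space_fscale T.sub_DC _ that])
      (use T.mten_DC ext_X S.homog_X in \<open>simp only: incl_mten\<close>)
  show "T.psi (hopf_incl A \<sigma> \<tau> x) = S.psi x" if "x \<in> S.DC" for x
  proof (rule S.DC_eqI[OF _ S.psi_lin vector_space_fscale _ that])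
    show "linear_on fscale fscale S.DC (\<lambda>x. T.psi (hopf_incl A \<sigma> \<tau> x))"
      by (rule linear_on_comp[OF incl_lin T.psi_lin]) (use I in blast)
    fix d a assume "(d, a) \<in> homog_family A \<sigma>"
    then have a: "a \<in> S.X" by (rule S.homog_X)
    let ?x = "\<lambda>i. if i \<in> \<sigma> then a i else unit (A i)"
    have "filter (\<lambda>i. i \<in> \<sigma>) T.sl = S.sl"
      by (rule sorted_distinct_set_unique) (use sub S.finite_\<sigma> T.finite_\<sigma> in \<open>auto intro: sorted_wrt_filter\<close>)
    then have "lprod M0 (\<lambda>i. iota i (?x i)) S.sl = lprod M0 (\<lambda>i. iota i (?x i)) (filter (\<lambda>i. i \<in> \<sigma>) T.sl)" by simp
    also have "\<dots> = lprod M0 (\<lambda>i. iota i (?x i)) T.sl"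
    proof (rule M0.A.lprod_filter[OF T.iota_X_N[OF ext_X[OF a]]])
      fix i assume "i \<in> set T.sl" "i \<notin> \<sigma>"
      then have "i \<in> \<tau>" using T.sl(1) by blast
      then show "iota i (?x i) = unit M0" using alg_homD(3)[OF iota_alg_hom[OF T.\<sigma>_m]] \<open>i \<notin> \<sigma>\<close> by simp
    qed
    finally have "lprod M0 (\<lambda>i. iota i (?x i)) T.sl = lprod M0 (\<lambda>i. iota i (?x i)) S.sl" by simp
    also have "\<dots> = lprod M0 (\<lambda>i. iota i (a i)) S.sl" by (rule lprod_cong) (simp add: S.finite_\<sigma>)
    finally show "T.psi (hopf_incl A \<sigma> \<tau> (mten A \<sigma> a)) = S.psi (mten A \<sigma> a)"
      unfolding incl_mten[OF a] T.psi_mten[OF ext_X[OF a]] S.psi_mten[OF a] .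
  qed
qed

end

lemma cocone_M: "polyhedral_cocone K A M Psi"
  unfolding polyhedral_cocone_def
proof (intro conjI ballI impI)
  show "hopf_hom (hopf_tensor A \<sigma>) M (Psi \<sigma>)" if "\<sigma> \<in> K" for \<sigma>
    by (rule gprod_simplex.hopf_hom_psi[OF simplexI[OF that]])
  show "Psi \<tau> (hopf_incl A \<sigma> \<tau> x) = Psi \<sigma> x"
    if "\<sigma> \<in> K" "\<tau> \<in> K" "\<sigma> \<subseteq> \<tau>" "x \<in> hcarrier (hopf_tensor A \<sigma>)" for \<sigma> \<tau> x
    using psi_incl[OF that(1-3)] that(4) gprod_simplex.D_simps(4)[OF simplexI[OF that(1)]] by simp
qed

text \<open>The embedding of \<^term>\<open>A i\<close> as the tensor product over a vertex.\<close>

definition vtx :: "nat \<Rightarrow> 'a \<Rightarrow> ('k, 'a) mtensor" where "vtx i a = mten A {i} (\<lambda>_. a)"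

context
  fixes i assumes i: "i \<in> {1..m}"
begin

interpretation Ai: chopf "A i" by (rule chi[OF i])
interpretation V: gprod_simplex m K A "{i}" by (rule simplexI[OF K_facts(1)[OF i]])

lemma vtx_DC: "a \<in> hcarrier (A i) \<Longrightarrow> vtx i a \<in> V.DC"
  unfolding vtx_def by (rule V.mten_DC) (simp add: V.X_def)

lemma vtx_psi: "a \<in> hcarrier (A i) \<Longrightarrow> V.psi (vtx i a) = iota i a"
proof -
  assume a: "a \<in> hcarrier (A i)"
  have "V.psi (mten A {i} (\<lambda>_. a)) = lprod M0 (\<lambda>i. iota i a) V.sl" by (rule V.psi_mten) (simp add: V.X_def a)
  then show "V.psi (vtx i a) = iota i a"
    using M0.A.unit_r[of "iota i a"] iota_N[OF i a] by (simp add: vtx_def hcarrier_M0)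
qed

lemma vtx_lin: "linear_on (scl (A i)) fscale (hcarrier (A i)) (vtx i)"
proof -
  have "mtensor (\<lambda>i. scl (A i)) {i} ((\<lambda>_. 0)(i := x)) = vtx i x" for x
    unfolding vtx_def mten_def by (rule mtensor_cong) simp
  then show ?thesis
    using linear_on_subset[OF mtensor_multilinear[of "{i}" i "\<lambda>i. scl (A i)" "\<lambda>_. 0"] subset_UNIV, of "hcarrier (A i)"]
    by simp
qed

lemma vtx_gr: "a \<in> gr (A i) n \<Longrightarrow> vtx i a \<in> gr (hopf_tensor A {i}) n"
proof -
  assume a: "a \<in> gr (A i) n"
  then have "((\<lambda>_. n), (\<lambda>_. a)) \<in> homog_family A {i} \<and> (\<Sum>i\<in>{i}. n) = n" by (simp add: homog_family_def)
  then show ?thesis unfolding hopf_tensor_def vtx_def by (auto intro!: fs.span_base)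
qed

lemma vtx_comult:
  assumes a: "a \<in> hcarrier (A i)"
  shows "comult (hopf_tensor A {i}) (vtx i a) =
    tensor_map (scl (A i)) (scl (A i)) fscale fscale (hcarrier (A i)) (hcarrier (A i)) (vtx i) (vtx i) (comult (A i) a)"
    (is "?l = ?r")
proof (rule inj_onD[OF V.PP(3)])
  note c = Ai.comult_tcar[OF a]
  have im: "vtx i ` hcarrier (A i) \<subseteq> V.DC" using vtx_DC by blast
  note vf = vector_space_fscale
  show "?l \<in> tspan fscale fscale V.DC V.DC" by (rule V.comult_D_tspan[OF vtx_DC[OF a]])
  show "?r \<in> tspan fscale fscale V.DC V.DC"
    by (rule tensor_map_into[OF Ai.vs Ai.vs vf vf Ai.sub_C Ai.sub_C vtx_lin im vtx_lin im c])
  have "V.PP ?r = tensor_map (scl (A i)) (scl (A i)) fscale fscale (hcarrier (A i)) (hcarrier (A i))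
      (\<lambda>x. V.psi (vtx i x)) (\<lambda>x. V.psi (vtx i x)) (comult (A i) a)"
    unfolding V.PP_def
    by (rule tensor_map_comp[OF Ai.vs Ai.vs vf vf vf vf Ai.sub_C Ai.sub_C V.sub_DC V.sub_DC vtx_lin im vtx_lin im V.psi_lin V.psi_lin c])
  also have "\<dots> = delta i a"
    unfolding delta_def M0_simps
    by (rule tensor_map_cong[OF Ai.vs Ai.vs vf vf Ai.sub_C Ai.sub_C V.iota_lin[OF i] vtx_psi V.iota_lin[OF i] vtx_psi c])
  also have "\<dots> = V.PP ?l"
    unfolding V.PP_comult[OF vtx_DC[OF a]] vtx_psi[OF a] mcomult(2)[OF i a] ..
  finally show "V.PP ?l = V.PP ?r" by simp
qed

end

end

locale gprod_cocone = gprod m K A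
  for m K and A :: "nat \<Rightarrow> ('k::field, 'a::ab_group_add) hopf" +
  fixes H :: "('k, 'h::ab_group_add) hopf" and \<phi> :: "nat set \<Rightarrow> ('k, 'a) mtensor \<Rightarrow> 'h"
  assumes H: "connected_hopf H" and cocone: "polyhedral_cocone K A H \<phi>"
begin

sublocale H: chopf H by unfold_locales (rule H)

definition fi :: "nat \<Rightarrow> 'a \<Rightarrow> 'h" where "fi i a = \<phi> {i} (vtx i a)"

lemma phi_hom: "\<sigma> \<in> K \<Longrightarrow> hopf_hom (hopf_tensor A \<sigma>) H (\<phi> \<sigma>)"
  and phi_incl: "\<sigma> \<in> K \<Longrightarrow> \<tau> \<in> K \<Longrightarrow> \<sigma> \<subseteq> \<tau> \<Longrightarrow> x \<in> hcarrier (hopf_tensor A \<sigma>) \<Longrightarrow> \<phi> \<tau> (hopf_incl A \<sigma> \<tau> x) = \<phi> \<sigma> x"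
  using cocone unfolding polyhedral_cocone_def by blast+

lemma fi:
  assumes i: "i \<in> {1..m}"
  shows "alg_hom (A i) H (fi i)"
    and "a \<in> hcarrier (A i) \<Longrightarrow> counit H (fi i a) = counit (A i) a"
    and "a \<in> hcarrier (A i) \<Longrightarrow> comult H (fi i a) = tmap (A i) (A i) H H (fi i) (fi i) (comult (A i) a)"
proof -
  interpret Ai: chopf "A i" by (rule chi[OF i])
  interpret V: gprod_simplex m K A "{i}" by (rule simplexI[OF K_facts(1)[OF i]])
  note ph = hopf_homD[OF phi_hom[OF K_facts(1)[OF i]], unfolded V.D_simps]
  have im: "vtx i ` hcarrier (A i) \<subseteq> V.DC" using vtx_DC[OF i] by blast
  show "alg_hom (A i) H (fi i)" unfolding alg_hom_def fi_def
  proof (intro conjI allI ballI image_subsetI)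
    show "linear_on (scl (A i)) (scl H) (hcarrier (A i)) (\<lambda>a. \<phi> {i} (vtx i a))"
      by (rule linear_on_comp[OF vtx_lin[OF i] ph(1) im])
    show "\<phi> {i} (vtx i a) \<in> gr H n" if "a \<in> gr (A i) n" for a n by (rule ph(2)[OF vtx_gr[OF i that]])
    have "vtx i (unit (A i)) = mten A {i} (\<lambda>i. unit (A i))" unfolding vtx_def mten_def by (rule mtensor_cong) simp
    then show "\<phi> {i} (vtx i (unit (A i))) = unit H" using ph(3) by simp
    fix a b assume a: "a \<in> hcarrier (A i)" and b: "b \<in> hcarrier (A i)"
    note D = vtx_DC[OF i a] vtx_DC[OF i b] and ab = Ai.mult_C[OF a b]
    have "vtx i (mult (A i) a b) = mten_mult A {i} (vtx i a) (vtx i b)"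
    proof (rule inj_onD[OF V.psi_inj _ vtx_DC[OF i ab] V.mten_mult_DC[OF D]])
      show "V.psi (vtx i (mult (A i) a b)) = V.psi (mten_mult A {i} (vtx i a) (vtx i b))"
        unfolding V.psi_mult[OF D] vtx_psi[OF i a] vtx_psi[OF i b] vtx_psi[OF i ab]
        using alg_homD(4)[OF iota_alg_hom[OF i] a b] by (simp only: M0_simps)
    qed
    then show "\<phi> {i} (vtx i (mult (A i) a b)) = mult H (\<phi> {i} (vtx i a)) (\<phi> {i} (vtx i b))"
      using ph(4)[OF D] by simp
  qed
  assume a: "a \<in> hcarrier (A i)"
  show "counit H (fi i a) = counit (A i) a"
    unfolding fi_def ph(5)[OF vtx_DC[OF i a]] V.counit_D[OF vtx_DC[OF i a]] vtx_psi[OF i a] by (rule mcounit(2)[OF i a])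
  note vf = vector_space_fscale
  show "comult H (fi i a) = tmap (A i) (A i) H H (fi i) (fi i) (comult (A i) a)"
    unfolding fi_def[abs_def] ph(6)[OF vtx_DC[OF i a]] vtx_comult[OF i a]
    by (rule tensor_map_comp[OF Ai.vs Ai.vs vf vf H.vs H.vs Ai.sub_C Ai.sub_C V.sub_DC V.sub_DC vtx_lin[OF i] im vtx_lin[OF i] im ph(1) ph(1) Ai.comult_tcar[OF a]])
qed

lemma incl_vtx:
  assumes \<tau>: "\<tau> \<in> K" and i: "i \<in> \<tau>" and a: "a \<in> hcarrier (A i)"
  shows "hopf_incl A {i} \<tau> (vtx i a) \<in> gprod_simplex.DC A \<tau>" "Psi \<tau> (hopf_incl A {i} \<tau> (vtx i a)) = iota i a"
    "\<phi> \<tau> (hopf_incl A {i} \<tau> (vtx i a)) = fi i a"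
proof -
  have im: "i \<in> {1..m}" using K_facts(3)[OF \<tau>] i by blast
  note iK = K_facts(1)[OF im]
  interpret V: gprod_simplex m K A "{i}" by (rule simplexI[OF iK])
  have s: "{i} \<subseteq> \<tau>" using i by simp
  note D = vtx_DC[OF im a]
  show "hopf_incl A {i} \<tau> (vtx i a) \<in> gprod_simplex.DC A \<tau>" by (rule incl_DC[OF iK \<tau> s D])
  show "Psi \<tau> (hopf_incl A {i} \<tau> (vtx i a)) = iota i a" unfolding psi_incl[OF iK \<tau> s D] by (rule vtx_psi[OF im a])
  show "\<phi> \<tau> (hopf_incl A {i} \<tau> (vtx i a)) = fi i a"
    unfolding fi_def by (rule phi_incl[OF iK \<tau> s]) (simp only: V.D_simps D)
qed

text \<open>Both factors map to the tensor product over the edge \<open>{i, j}\<close>, in which they commute up to sign.\<close>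

lemma fi_supercomm:
  assumes ij: "i \<noteq> j" "{i, j} \<in> K" shows "supercomm (A i) (A j) H (fi i) (fi j)"
  unfolding supercomm_def
proof (intro allI ballI)
  have c: "comm i j" using ij by (simp add: comm_def)
  note i = comm_range(1)[OF c] and j = comm_range(2)[OF c]
  interpret Ai: chopf "A i" by (rule chi[OF i])
  interpret Aj: chopf "A j" by (rule chi[OF j])
  interpret T: gprod_simplex m K A "{i, j}" by (rule simplexI[OF ij(2)])
  note ph = hopf_homD[OF phi_hom[OF ij(2)], unfolded T.D_simps]
  fix d q a b assume a: "a \<in> gr (A i) d" and b: "b \<in> gr (A j) q"
  let ?x = "hopf_incl A {i} {i, j} (vtx i a)" and ?y = "hopf_incl A {j} {i, j} (vtx j b)"
  note x = incl_vtx[OF ij(2) _ Ai.gr_C[OF a], simplified] and y = incl_vtx[OF ij(2) _ Aj.gr_C[OF b], simplified]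
  note xy = T.mten_mult_DC[OF x(1) y(1)] and yx = T.mten_mult_DC[OF y(1) x(1)]
  have "mten_mult A {i, j} ?x ?y = fscale ((-1) ^ (d * q)) (mten_mult A {i, j} ?y ?x)"
  proof (rule inj_onD[OF T.psi_inj _ xy fs.subspace_scale[OF T.sub_DC yx]])
    show "T.psi (mten_mult A {i, j} ?x ?y) = T.psi (fscale ((-1) ^ (d * q)) (mten_mult A {i, j} ?y ?x))"
      unfolding linear_on_scale[OF T.psi_lin yx] T.psi_mult[OF x(1) y(1)] T.psi_mult[OF y(1) x(1)] x(2) y(2)
      using iota_supercomm[OF c] a b unfolding supercomm_def M0_simps by blast
  qed
  from arg_cong[OF this, of "\<phi> {i, j}"]
  show "mult H (fi i a) (fi j b) = scl H ((-1) ^ (d * q)) (mult H (fi j b) (fi i a))"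
    unfolding linear_on_scale[OF ph(1) yx] ph(4)[OF x(1) y(1)] ph(4)[OF y(1) x(1)] x(3) y(3) .
qed

text \<open>A cocone restricts to maps on the factors that commute up to sign along the edges, so it induces an
  algebra homomorphism. Its compatibility with the remaining structure, and with the cocone, is tested on
  the images of the factors.\<close>

lemma from_M_exists:
  obtains v where "hopf_hom M H v" "\<And>i a. i \<in> {1..m} \<Longrightarrow> a \<in> hcarrier (A i) \<Longrightarrow> v (iota i a) = fi i a"
    "\<And>\<sigma> x. \<sigma> \<in> K \<Longrightarrow> x \<in> hcarrier (hopf_tensor A \<sigma>) \<Longrightarrow> v (Psi \<sigma> x) = \<phi> \<sigma> x"
proof -
  obtain v where v: "alg_hom M0 H v" and vi: "\<And>i a. i \<in> {1..m} \<Longrightarrow> a \<in> hcarrier (A i) \<Longrightarrow> v (iota i a) = fi i a"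
    by (rule alg_hom_M0_exists[OF H.ga fi(1) fi_supercomm]) blast+
  note G = graded_algebra_M0
  note v' = alg_homD[OF v]
  interpret MH: galg2 M0 H by unfold_locales
  have vC: "v x \<in> hcarrier H" if "x \<in> hcarrier M0" for x by (rule MH.alg_hom_C[OF v that])
  then have vim: "v ` hcarrier M0 \<subseteq> hcarrier H" by blast
  have co: "comult H (v x) = tmap M0 M0 H H v v (mcomult x)" if x: "x \<in> N" for x
  proof (rule alg_hom_M0_eqI[OF H.AA.T.ga alg_hom_comp[OF G H.ga v H.alg_hom_comult]
        alg_hom_comp[OF G M0.T.ga mcomult(1) alg_hom_tmap[OF G G H.ga H.ga v v]] _ x])
    fix i a assume i: "i \<in> {1..m}" and a: "a \<in> hcarrier (A i)"
    interpret Ai: chopf "A i" by (rule chi[OF i])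
    interpret AM: galg2 "A i" M0 by unfold_locales
    note io = iota_alg_hom[OF i]
    have im: "iota i ` hcarrier (A i) \<subseteq> hcarrier M0" using AM.alg_hom_C[OF io] by blast
    note c = Ai.comult_tcar[OF a] and il = alg_homD(1)[OF io] and fl = alg_homD(1)[OF fi(1)[OF i]]
    have "tmap M0 M0 H H v v (mcomult (iota i a)) = tmap (A i) (A i) H H (\<lambda>x. v (iota i x)) (\<lambda>x. v (iota i x)) (comult (A i) a)"
      unfolding mcomult(2)[OF i a] delta_def
      by (rule tensor_map_comp[OF Ai.vs Ai.vs M0.A.vs M0.A.vs H.vs H.vs Ai.sub_C Ai.sub_C M0.A.sub_C M0.A.sub_C il im il im v'(1) v'(1) c])
    also have "\<dots> = tmap (A i) (A i) H H (fi i) (fi i) (comult (A i) a)"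
      by (rule tensor_map_cong[OF Ai.vs Ai.vs H.vs H.vs Ai.sub_C Ai.sub_C fl vi[OF i] fl vi[OF i] c])
    finally show "comult H (v (iota i a)) = tmap M0 M0 H H v v (mcomult (iota i a))"
      unfolding vi[OF i a] fi(3)[OF i a] by simp
  qed
  have cu: "counit H (v x) = mcounit x" if x: "x \<in> N" for x
  proof (rule alg_hom_M0_eqI[OF graded_algebra_kalg alg_hom_comp[OF G H.ga v alg_hom_counit] mcounit(1) _ x])
    show "chopf H" by (rule H.chopf_axioms)
    show "counit H (v (iota i a)) = mcounit (iota i a)" if "i \<in> {1..m}" "a \<in> hcarrier (A i)" for i a
      unfolding vi[OF that] fi(2)[OF that] mcounit(2)[OF that] ..
  qed
  have hv: "hopf_hom M H v"
    unfolding hopf_hom_def hcarrier_M M_simps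
    using v' co cu by (simp add: hcarrier_M0 M0_simps image_subset_iff)
  have "v (Psi \<sigma> x) = \<phi> \<sigma> x" if \<sigma>: "\<sigma> \<in> K" and x: "x \<in> hcarrier (hopf_tensor A \<sigma>)" for \<sigma> x
  proof -
    interpret S: gprod_simplex m K A \<sigma> by (rule simplexI[OF \<sigma>])
    note ph = hopf_homD[OF phi_hom[OF \<sigma>], unfolded S.D_simps]
    have "v (S.psi x) = \<phi> \<sigma> x"
    proof (rule S.DC_eqI[OF _ ph(1) H.vs _ x[unfolded S.D_simps]])
      show "linear_on fscale (scl H) S.DC (\<lambda>x. v (S.psi x))"
        by (rule linear_on_comp[OF S.psi_lin v'(1)[unfolded hcarrier_M0 M0_simps] S.im_N])
      fix d a assume "(d, a) \<in> homog_family A \<sigma>"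
      then have a: "a \<in> S.X" by (rule S.homog_X)
      define y where "y is = foldr (\<lambda>i. mten_mult A \<sigma> (hopf_incl A {i} \<sigma> (vtx i (a i)))) is (mten A \<sigma> (\<lambda>i. unit (A i)))" for "is"
      have y: "y is \<in> S.DC \<and> S.psi (y is) = lprod M0 (\<lambda>i. iota i (a i)) is \<and> \<phi> \<sigma> (y is) = lprod H (\<lambda>i. fi i (a i)) is"
        if "set is \<subseteq> \<sigma>" for "is"
        using that
      proof (induction "is")
        case Nil
        then show ?case using S.mten_DC[OF S.unit_X(1)] S.psi_unit ph(3) by (simp add: y_def M0_simps)
      next
        case (Cons i "is")
        have i: "i \<in> \<sigma>" and aC: "a i \<in> hcarrier (A i)" using Cons.prems a by (auto simp: S.X_def)
        note z = incl_vtx[OF \<sigma> i aC]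
        have IH: "y is \<in> S.DC" "S.psi (y is) = lprod M0 (\<lambda>i. iota i (a i)) is" "\<phi> \<sigma> (y is) = lprod H (\<lambda>i. fi i (a i)) is"
          using Cons by auto
        have yy: "y (i # is) = mten_mult A \<sigma> (hopf_incl A {i} \<sigma> (vtx i (a i))) (y is)" by (simp add: y_def)
        show ?case unfolding yy S.psi_mult[OF z(1) IH(1)] ph(4)[OF z(1) IH(1)] z(2,3) IH(2,3) lprod_simps M0_simps
          using S.mten_mult_DC[OF z(1) IH(1)] by simp
      qed
      note ys = y[of S.sl, unfolded S.sl(1), OF order_refl]
      have "y S.sl = mten A \<sigma> a"
        by (rule inj_onD[OF S.psi_inj _ conjunct1[OF ys] S.mten_DC[OF a]]) (simp only: S.psi_mten[OF a] ys)
      then have "\<phi> \<sigma> (mten A \<sigma> a) = lprod H (\<lambda>i. fi i (a i)) S.sl" using ys by simp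
      also have "\<dots> = lprod H (\<lambda>i. v (iota i (a i))) S.sl"
      proof (rule lprod_cong)
        fix i assume "i \<in> set S.sl"
        then have i: "i \<in> \<sigma>" by (simp only: S.sl(1))
        show "fi i (a i) = v (iota i (a i))" by (rule vi[OF S.\<sigma>_m[OF i], symmetric]) (use a i in \<open>simp add: S.X_def\<close>)
      qed
      also have "\<dots> = v (S.psi (mten A \<sigma> a))"
        unfolding S.psi_mten[OF a] by (rule alg_hom_lprod[OF G v S.iota_X_N[OF a], symmetric])
      finally show "v (S.psi (mten A \<sigma> a)) = \<phi> \<sigma> (mten A \<sigma> a)" by simp
    qed
    then show ?thesis .
  qed
  from that[OF hv vi this] show thesis .
qed

end

context gprod begin

text \<open>Uniqueness of colimits: the Hopf algebra \<open>H\<close> and the graph product live on the type to which the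
  universal property of \<open>H\<close> applies.\<close>

lemma polyhedral_product_iso:
  assumes P: "is_polyhedral_product K A H \<phi>"
  obtains u v where "hopf_hom H M u" "hopf_hom M H v" "\<And>h. h \<in> hcarrier H \<Longrightarrow> v (u h) = h"
    "\<And>x. x \<in> N \<Longrightarrow> u (v x) = x"
    "\<And>i a. i \<in> {1..m} \<Longrightarrow> a \<in> hcarrier (A i) \<Longrightarrow> v (iota i a) = \<phi> {i} (vtx i a)"
proof -
  have H: "connected_hopf H" and c: "polyhedral_cocone K A H \<phi>"
    and ex: "\<And>(B :: ('k, ('k, 'a) word_space) hopf) \<psi>. connected_hopf B \<Longrightarrow> polyhedral_cocone K A B \<psi> \<Longrightarrow>
        \<exists>u. hopf_hom H B u \<and> (\<forall>\<sigma>\<in>K. \<forall>x\<in>hcarrier (hopf_tensor A \<sigma>). u (\<phi> \<sigma> x) = \<psi> \<sigma> x) \<and>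
           (\<forall>v. hopf_hom H B v \<and> (\<forall>\<sigma>\<in>K. \<forall>x\<in>hcarrier (hopf_tensor A \<sigma>). v (\<phi> \<sigma> x) = \<psi> \<sigma> x) \<longrightarrow>
              (\<forall>h\<in>hcarrier H. v h = u h))"
    using P unfolding is_polyhedral_product_def by blast+
  interpret gprod_cocone m K A H \<phi> by unfold_locales (rule H c)+
  obtain v where v: "hopf_hom M H v" "\<And>i a. i \<in> {1..m} \<Longrightarrow> a \<in> hcarrier (A i) \<Longrightarrow> v (iota i a) = fi i a"
    "\<And>\<sigma> x. \<sigma> \<in> K \<Longrightarrow> x \<in> hcarrier (hopf_tensor A \<sigma>) \<Longrightarrow> v (Psi \<sigma> x) = \<phi> \<sigma> x"
    by (rule from_M_exists) blast
  obtain u where u: "hopf_hom H M u" "\<And>\<sigma> x. \<sigma> \<in> K \<Longrightarrow> x \<in> hcarrier (hopf_tensor A \<sigma>) \<Longrightarrow> u (\<phi> \<sigma> x) = Psi \<sigma> x"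
    using ex[OF connected_hopf_M cocone_M] by blast
  obtain w where "\<forall>v. hopf_hom H H v \<and> (\<forall>\<sigma>\<in>K. \<forall>x\<in>hcarrier (hopf_tensor A \<sigma>). v (\<phi> \<sigma> x) = \<phi> \<sigma> x) \<longrightarrow>
      (\<forall>h\<in>hcarrier H. v h = w h)"
    using ex[OF H c] by blast
  then have w: "v h = w h" if "hopf_hom H H v"
    "\<And>\<sigma> x. \<sigma> \<in> K \<Longrightarrow> x \<in> hcarrier (hopf_tensor A \<sigma>) \<Longrightarrow> v (\<phi> \<sigma> x) = \<phi> \<sigma> x" "h \<in> hcarrier H" for v h
    using that by blast
  have vM: "vector_space (scl M)" by (simp add: M_simps vector_space_fscale)
  have vu: "v (u h) = h" if h: "h \<in> hcarrier H" for h
  proof -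
    have vuphi: "v (u (\<phi> \<sigma> x)) = \<phi> \<sigma> x" if "\<sigma> \<in> K" "x \<in> hcarrier (hopf_tensor A \<sigma>)" for \<sigma> x
      unfolding u(2)[OF that] by (rule v(3)[OF that])
    have "v (u h) = w h"
      by (rule w[of "\<lambda>h. v (u h)", OF hopf_hom_comp[OF u(1) v(1) H.vs vM H.vs H.comult_tcar] vuphi h])
    moreover have "h = w h" by (rule w[OF hopf_hom_ident[OF H] refl h])
    ultimately show ?thesis by simp
  qed
  have uv: "u (v x) = x" if x: "x \<in> N" for x
  proof (rule alg_hom_M0_eqI[OF graded_algebra_M0 _ alg_hom_ident _ x])
    show "alg_hom M0 M0 (\<lambda>x. u (v x))"
      using alg_hom_comp[OF graded_algebra_M0 H.ga] hopf_hom_alg_hom[OF v(1)] hopf_hom_alg_hom[OF u(1)]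
      unfolding alg_hom_M by blast
    fix i a assume i: "i \<in> {1..m}" and a: "a \<in> hcarrier (A i)"
    note iK = K_facts(1)[OF i]
    have x: "vtx i a \<in> hcarrier (hopf_tensor A {i})"
      using vtx_DC[OF i a] gprod_simplex.D_simps(4)[OF simplexI[OF iK]] by simp
    show "u (v (iota i a)) = iota i a"
      unfolding v(2)[OF i a] fi_def u(2)[OF iK x] vtx_psi[OF i a] ..
  qed
  show thesis by (rule that[OF u(1) v(1) vu uv]) (simp_all add: v(2) fi_def)
qed

end


section \<open>Cotensor products along surjections\<close>

lemma (in vector_space) dim_family:
  assumes I: "finite I" and V: "v ` I \<subseteq> V" "V \<subseteq> span (v ` I)"
    and ind: "\<And>u. (\<Sum>x\<in>I. scale (u x) (v x)) = 0 \<Longrightarrow> \<forall>x\<in>I. u x = 0"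
  shows "dim V = card I"
proof -
  have inj: "inj_on v I"
  proof (rule inj_onI, rule ccontr)
    fix x y assume xy: "x \<in> I" "y \<in> I" "v x = v y" "x \<noteq> y"
    define u where "u z = (if z = x then 1 else if z = y then -1 else 0 :: 'a)" for z
    have "(\<Sum>z\<in>I. scale (u z) (v z)) = (\<Sum>z\<in>I. if z = x then v x else if z = y then - v y else 0)"
      by (rule sum.cong) (auto simp: u_def)
    also have "\<dots> = (\<Sum>z\<in>I. if z = x then v x else 0) + (\<Sum>z\<in>I. if z = y then - v y else 0)"
      unfolding sum.distrib[symmetric] by (rule sum.cong) (use xy in auto)
    also have "\<dots> = 0" using I xy by simp
    finally show False using ind[of u] xy by (auto simp: u_def)
  qed
  have "independent (v ` I)"
  proof (rule independent_if_scalars_zero)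
    show "finite (v ` I)" using I by simp
    fix f x assume s: "(\<Sum>x\<in>v ` I. scale (f x) x) = 0" and x: "x \<in> v ` I"
    have "(\<Sum>y\<in>I. scale (f (v y)) (v y)) = 0" using s unfolding sum.reindex[OF inj] by simp
    then show "f x = 0" using ind[of "\<lambda>y. f (v y)"] x by auto
  qed
  then show ?thesis using dim_unique[OF V(1,2)] card_image[OF inj] by simp
qed

lemma (in vector_space) finite_basis:
  assumes "finite B" "V \<subseteq> span B" "subspace V"
  obtains C where "finite C" "C \<subseteq> V" "independent C" "V = span C" "card C = dim V"
proof -
  obtain C where C: "C \<subseteq> V" "independent C" "V \<subseteq> span C" "card C = dim V" using basis_exists by blast
  have "finite C" using independent_span_bound[OF assms(1) C(2)] C(1) assms(2) by blast
  moreover have "V = span C" using C span_minimal[OF C(1) assms(3)] by blast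
  ultimately show thesis using that C by blast
qed

locale hopf_surj = H: chopf H + E: chopf E
  for H :: "('k::field, 'h::ab_group_add) hopf" and E :: "('k, 'e::ab_group_add) hopf" +
  fixes q :: "'h \<Rightarrow> 'e"
  assumes q: "hopf_hom H E q" and surj: "\<And>n. gr E n \<subseteq> q ` gr H n"
    and fin_H: "finite_type (scl H) (gr H)" and fin_E: "finite_type (scl E) (gr E)"
begin

sublocale HE: galg2 H E by unfold_locales

lemmas q' = hopf_homD[OF q]

lemma q_alg: "alg_hom H E q" by (rule hopf_hom_alg_hom[OF q])

lemma q_C: "x \<in> hcarrier H \<Longrightarrow> q x \<in> hcarrier E" by (rule HE.alg_hom_C[OF q_alg])

text \<open>The coaction of \<open>E\<close> on \<open>H\<close>.\<close>

definition rho :: "'h \<Rightarrow> ('k, 'h, 'e) tensor" where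
  "rho h = tmap H H H E (\<lambda>x. x) q (comult H h)"

lemma rho_map: "linear_on fscale fscale (tcar H H) (tmap H H H E (\<lambda>x. x) q)"
  "x \<in> hcarrier H \<Longrightarrow> y \<in> hcarrier H \<Longrightarrow> tmap H H H E (\<lambda>x. x) q (ten H H x y) = ten H E x (q y)"
  using tmap_lin[OF H.ga H.ga H.ga E.ga alg_hom_ident q_alg] by blast+

lemma rho_alg_hom: "alg_hom H (talg H E) rho"
  unfolding rho_def[abs_def]
  by (rule alg_hom_comp[OF H.ga H.AA.T.ga H.alg_hom_comult alg_hom_tmap[OF H.ga H.ga H.ga E.ga alg_hom_ident q_alg]])

lemma rho_tcar: "h \<in> hcarrier H \<Longrightarrow> rho h \<in> tcar H E"
proof -
  interpret HT: galg2 H "talg H E" by unfold_locales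
  show "h \<in> hcarrier H \<Longrightarrow> rho h \<in> tcar H E" using HT.alg_hom_C[OF rho_alg_hom] by (simp only: HE.hcarrier_talg)
qed

lemma rho_lin: "linear_on (scl H) fscale (hcarrier H) rho"
  using alg_homD(1)[OF rho_alg_hom] by (simp only: talg_simps)

text \<open>Evaluation of the second factor by a linear functional.\<close>

definition eval2 :: "('e \<Rightarrow> 'k) \<Rightarrow> ('k, 'h, 'e) tensor \<Rightarrow> 'h" where
  "eval2 g = lin_ext fscale (scl H) (hcarrier H \<times> hcarrier E) (\<lambda>(x, y). tensor (scl H) (scl E) x y)
     (\<lambda>(x, y). scl H (g y) x)"

lemma eval2:
  assumes "linear_on (scl E) (*) (hcarrier E) g"
  shows "linear_on fscale (scl H) (tcar H E) (eval2 g)"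
    "x \<in> hcarrier H \<Longrightarrow> y \<in> hcarrier E \<Longrightarrow> eval2 g (ten H E x y) = scl H (g y) x"
proof -
  have e: "linear_on (scl E) (scl H) (hcarrier E) (\<lambda>y. scl H (g y) x)" for x
    using assms by (simp add: linear_on_def H.scale_left_distrib)
  note * = tensor_universal[where h = "\<lambda>x y. scl H (g y) x", OF H.vs E.vs H.vs H.sub_C E.sub_C e linear_on_scale_map[OF H.vs]]
  show "linear_on fscale (scl H) (tcar H E) (eval2 g)"
    "x \<in> hcarrier H \<Longrightarrow> y \<in> hcarrier E \<Longrightarrow> eval2 g (ten H E x y) = scl H (g y) x"
    using * unfolding tspan_def eval2_def ten_def by auto
qed

lemma eval2_C:
  assumes "linear_on (scl E) (*) (hcarrier E) g" "t \<in> tcar H E" shows "eval2 g t \<in> hcarrier H"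
  by (rule HE.tcar_image[OF eval2(1)[OF assms(1)] H.vs H.sub_C _ assms(2)])
    (simp add: eval2(2)[OF assms(1)] H.gr_C E.gr_C H.scale_C)

lemma eval2_contr:
  assumes g: "linear_on (scl E) (*) (hcarrier E) g" and h: "h \<in> hcarrier H"
  shows "eval2 g (rho h) = contr_r H (\<lambda>x. g (q x)) (comult H h)"
  unfolding rho_def
proof (rule H.AA.tcar_eqI[OF _ _ H.vs _ H.comult_tcar[OF h]])
  have gq: "linear_on (scl H) (*) (hcarrier H) (\<lambda>x. g (q x))"
    by (rule linear_on_comp[OF q'(1) g]) (use q_C in blast)
  show "linear_on fscale (scl H) (tcar H H) (contr_r H (\<lambda>x. g (q x)))" by (rule contr(2)[OF H.ga gq])
  have "tmap H H H E (\<lambda>x. x) q ` tcar H H \<subseteq> tcar H E"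
    by (rule image_subsetI, rule H.AA.tcar_image[OF rho_map(1) vector_space_fscale subspace_tspan])
      (simp_all add: rho_map(2) H.gr_C HE.ten_tcar q_C)
  then show "linear_on fscale (scl H) (tcar H H) (\<lambda>t. eval2 g (tmap H H H E (\<lambda>x. x) q t))"
    by (rule linear_on_comp[OF rho_map(1) eval2(1)[OF g]])
  fix i j a b assume "a \<in> gr H i" "b \<in> gr H j"
  then have ab: "a \<in> hcarrier H" "b \<in> hcarrier H" using H.gr_C by auto
  show "eval2 g (tmap H H H E (\<lambda>x. x) q (ten H H a b)) = contr_r H (\<lambda>x. g (q x)) (ten H H a b)"
    unfolding rho_map(2)[OF ab] eval2(2)[OF g ab(1) q_C[OF ab(2)]] contr(4)[OF H.ga gq ab] ..
qed

text \<open>The coordinates with respect to a homogeneous basis of \<^term>\<open>E\<close>.\<close>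

definition coord :: "'e \<Rightarrow> 'e \<Rightarrow> 'k" where
  "coord b = blift (scl E) (*) (hbases E) (\<lambda>c. if c = b then 1 else 0)"

lemma coord_lin: "linear_on (scl E) (*) (hcarrier E) (coord b)"
  and coord_basis: "c \<in> hbases E \<Longrightarrow> coord b c = (if c = b then 1 else 0)"
  unfolding coord_def by (rule E.hb_lift[OF vector_space_times], assumption?)+

lemma coord_gr: "b \<in> hbases E \<Longrightarrow> z \<in> gr E j \<Longrightarrow> j \<noteq> hdeg E b \<Longrightarrow> coord b z = 0"
proof (rule E.hb_gr_eqI[OF coord_lin linear_on_null[OF vector_space_times] vector_space_times])
  fix c assume h: "b \<in> hbases E" "j \<noteq> hdeg E b" "c \<in> hbasis E j"
  then have "c \<in> hbases E" "c \<noteq> b" using E.hdeg[OF h(3)] by (auto simp: hbases_def)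
  then show "coord b c = 0" using coord_basis[of c b] by simp
qed

text \<open>Stated for all large finite sets of basis elements, because the basis is infinite in general while each
  tensor involves only finitely many of its elements.\<close>

lemma tcar_expand:
  assumes "t \<in> tcar H E"
  shows "\<exists>F. finite F \<and> F \<subseteq> hbases E \<and> (\<forall>F'. finite F' \<and> F \<subseteq> F' \<and> F' \<subseteq> hbases E \<longrightarrow>
     t = (\<Sum>b\<in>F'. ten H E (eval2 (coord b) t) b))"
proof -
  let ?S = "\<lambda>F t. \<Sum>b\<in>F. ten H E (eval2 (coord b) t) b"
  have Sl: "linear_on fscale fscale (tcar H E) (?S F)" for F
    by (rule linear_on_sum_maps[OF linear_on_comp[OF eval2(1)[OF coord_lin], where W = UNIV] vector_space_fscale])
      (auto simp: ten_def intro: tensor_lin1)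
  have pure: "?S F' (ten H E x c) = ten H E x c" if x: "x \<in> hcarrier H" and c: "c \<in> F'" "finite F'" "F' \<subseteq> hbases E" for x c F'
  proof -
    have "?S F' (ten H E x c) = (\<Sum>b\<in>F'. if b = c then ten H E x c else 0)"
    proof (rule sum.cong[OF refl])
      fix b assume "b \<in> F'"
      have "eval2 (coord b) (ten H E x c) = scl H (coord b c) x"
        by (rule eval2(2)[OF coord_lin x]) (use c E.hbases_C in blast)
      then show "ten H E (eval2 (coord b) (ten H E x c)) b = (if b = c then ten H E x c else 0)"
        using coord_basis[of c b] c by (auto simp: HE.ten_zero)
    qed
    also have "\<dots> = ten H E x c" unfolding sum.delta[OF c(2)] using c(1) by (simp only: if_True)
    finally show ?thesis .
  qed
  have eq: "tcar H E = fs.span ((\<lambda>(v, w). tensor (scl H) (scl E) v w) ` (hcarrier H \<times> hbases E))"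
  proof -
    have "H.span (hcarrier H) = hcarrier H" using H.span_eq_iff H.sub_C by blast
    then show ?thesis using tspan_span[OF H.vs E.vs, of "hcarrier H" "hbases E"] by (simp only: E.span_hbases)
  qed
  have "t \<in> tcar H E \<and> (\<exists>F. finite F \<and> F \<subseteq> hbases E \<and> (\<forall>F'. finite F' \<and> F \<subseteq> F' \<and> F' \<subseteq> hbases E \<longrightarrow> ?S F' t = t))"
    using assms[unfolded eq]
  proof (induct rule: fs.span_induct_alt)
    case base
    have z: "0 \<in> tcar H E" by (rule fs.subspace_0[OF subspace_tspan])
    have "?S F' 0 = 0" for F' by (rule linear_on_zero[OF Sl vector_space_fscale vector_space_fscale z])
    then have "finite {} \<and> {} \<subseteq> hbases E \<and> (\<forall>F'. finite F' \<and> {} \<subseteq> F' \<and> F' \<subseteq> hbases E \<longrightarrow> ?S F' 0 = 0)" by blast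
    then show ?case using z by blast
  next
    case (step k y s)
    obtain x c where xc: "x \<in> hcarrier H" "c \<in> hbases E" "y = ten H E x c" using step by (auto simp: ten_def)
    have s: "s \<in> tcar H E" using step(2) by (rule conjunct1)
    obtain F where F: "finite F" "F \<subseteq> hbases E" "\<forall>F'. finite F' \<and> F \<subseteq> F' \<and> F' \<subseteq> hbases E \<longrightarrow> ?S F' s = s"
      using step(2)[THEN conjunct2] by (elim exE conjE)
    have yC: "y \<in> tcar H E" unfolding xc(3) by (rule HE.ten_tcar[OF xc(1) E.hbases_C[OF xc(2)]])
    have kyC: "fscale k y \<in> tcar H E" by (rule fs.subspace_scale[OF subspace_tspan yC])
    have S: "?S F' (fscale k y + s) = fscale k y + s" if F': "finite F'" "insert c F \<subseteq> F'" "F' \<subseteq> hbases E" for F'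
    proof -
      have "?S F' s = s" by (rule F(3)[rule_format]) (use F' in blast)
      moreover have "?S F' y = y" unfolding xc(3) by (rule pure[OF xc(1) _ F'(1,3)]) (use F'(2) in blast)
      ultimately show ?thesis unfolding linear_on_add[OF Sl kyC s] linear_on_scale[OF Sl yC] by (simp only:)
    qed
    show ?case
    proof (intro conjI exI[of _ "insert c F"] allI impI)
      show "fscale k y + s \<in> tcar H E" by (rule fs.subspace_add[OF subspace_tspan kyC s])
      show "finite (insert c F)" "insert c F \<subseteq> hbases E" using F xc by auto
      fix F' assume "finite F' \<and> insert c F \<subseteq> F' \<and> F' \<subseteq> hbases E"
      then show "?S F' (fscale k y + s) = fscale k y + s" by (elim conjE) (rule S)
    qed
  qed
  then obtain F where F: "finite F" "F \<subseteq> hbases E"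
    "\<forall>F'. finite F' \<and> F \<subseteq> F' \<and> F' \<subseteq> hbases E \<longrightarrow> ?S F' t = t"
    by (elim exE conjE)
  show ?thesis
  proof (intro exI[of _ F] conjI allI impI F(1,2))
    fix F' assume "finite F' \<and> F \<subseteq> F' \<and> F' \<subseteq> hbases E"
    then show "t = ?S F' t" by (rule F(3)[rule_format, symmetric])
  qed
qed

text \<open>The coefficient of \<open>b\<close> in the coaction on \<open>h\<close>.\<close>

definition Tb :: "'e \<Rightarrow> 'h \<Rightarrow> 'h" where "Tb b h = eval2 (coord b) (rho h)"

lemma Tb_lin: "linear_on (scl H) (scl H) (hcarrier H) (Tb b)"
  unfolding Tb_def[abs_def] by (rule linear_on_comp[OF rho_lin eval2(1)[OF coord_lin]]) (use rho_tcar in blast)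

lemma Tb_C: "h \<in> hcarrier H \<Longrightarrow> Tb b h \<in> hcarrier H"
  unfolding Tb_def by (rule eval2_C[OF coord_lin rho_tcar])

lemma Tb_gr:
  assumes b: "b \<in> hbases E" and h: "h \<in> gr H n"
  shows "hdeg E b \<le> n \<Longrightarrow> Tb b h \<in> gr H (n - hdeg E b)" "n < hdeg E b \<Longrightarrow> Tb b h = 0"
proof -
  let ?W = "if hdeg E b \<le> n then gr H (n - hdeg E b) else {0}"
  have r: "rho h \<in> gr (talg H E) n" by (rule alg_homD(2)[OF rho_alg_hom h])
  have "Tb b h \<in> ?W" unfolding Tb_def
  proof (rule HE.talg_gr_image[OF eval2(1)[OF coord_lin] H.vs _ _ r])
    show "H.subspace ?W" using H.sub_gr H.subspace_single_0 by simp
    fix i j x z assume xz: "x \<in> gr H i" "z \<in> gr E j" and ij: "i + j = n"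
    show "eval2 (coord b) (ten H E x z) \<in> ?W"
      unfolding eval2(2)[OF coord_lin H.gr_C[OF xz(1)] E.gr_C[OF xz(2)]]
      using coord_gr[OF b xz(2)] H.scale_gr[OF xz(1)] ij H.subspace_0[OF H.sub_gr] by (cases "j = hdeg E b") auto
  qed
  then show "hdeg E b \<le> n \<Longrightarrow> Tb b h \<in> gr H (n - hdeg E b)" "n < hdeg E b \<Longrightarrow> Tb b h = 0" by auto
qed

lemma coord_q: "linear_on (scl H) (*) (hcarrier H) (\<lambda>x. coord b (q x))"
  by (rule linear_on_comp[OF q'(1) coord_lin]) (use q_C in blast)

text \<open>The coefficient has degree \<open>0\<close>, so it is a multiple of the unit, and the counit determines which.\<close>

lemma Tb_top:
  assumes b: "b \<in> hbases E" and h: "h \<in> gr H (hdeg E b)"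
  shows "Tb b h = scl H (coord b (q h)) (unit H)"
proof -
  have "Tb b h \<in> gr H 0" using Tb_gr(1)[OF b h] by simp
  then obtain c where c: "Tb b h = scl H c (unit H)" unfolding H.gr0 by blast
  note hC = H.gr_C[OF h]
  have "counit H (contr_r H (\<lambda>x. coord b (q x)) t) = coord b (q (contr_l H (counit H) t))" if t: "t \<in> tcar H H" for t
  proof (rule H.AA.tcar_eqI[OF _ _ vector_space_times _ t])
    note cr = contr[OF H.ga coord_q[of b]] and cl = contr[OF H.ga H.counit_lin]
    have crC: "contr_r H (\<lambda>x. coord b (q x)) t \<in> hcarrier H" if "t \<in> tcar H H" for t
      by (rule H.AA.tcar_image[OF cr(2) H.vs H.sub_C _ that]) (simp add: cr(4) H.gr_C H.scale_C)
    have clC: "contr_l H (counit H) t \<in> hcarrier H" if "t \<in> tcar H H" for t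
      by (rule H.AA.tcar_image[OF cl(1) H.vs H.sub_C _ that]) (simp add: cl(3) H.gr_C H.scale_C)
    show "linear_on fscale (*) (tcar H H) (\<lambda>t. counit H (contr_r H (\<lambda>x. coord b (q x)) t))"
      by (rule linear_on_comp[OF cr(2) H.counit_lin]) (use crC in blast)
    show "linear_on fscale (*) (tcar H H) (\<lambda>t. coord b (q (contr_l H (counit H) t)))"
      by (rule linear_on_comp[OF cl(1) coord_q]) (use clC in blast)
    fix i j x y assume "x \<in> gr H i" "y \<in> gr H j"
    then have xy: "x \<in> hcarrier H" "y \<in> hcarrier H" using H.gr_C by auto
    show "counit H (contr_r H (\<lambda>x. coord b (q x)) (ten H H x y)) = coord b (q (contr_l H (counit H) (ten H H x y)))"
      unfolding cr(4)[OF xy] cl(3)[OF xy] linear_on_scale[OF H.counit_lin xy(1)] linear_on_scale[OF coord_q xy(2)]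
      by (rule mult.commute)
  qed
  from this[OF H.comult_tcar[OF hC]]
  have "counit H (Tb b h) = coord b (q h)"
    unfolding Tb_def eval2_contr[OF coord_lin hC] using H.counit_l[OF hC] by (simp add: contr_l_def)
  then have "c = coord b (q h)" unfolding c linear_on_scale[OF H.counit_lin H.unit_C] H.counit_unit by simp
  then show ?thesis using c by simp
qed

text \<open>On \<open>H\<close>, the coordinate at the unit of \<open>E\<close> is the counit.\<close>

lemma Tb_unit: 
  assumes h: "h \<in> hcarrier H" shows "Tb (unit E) h = h"
proof -
  have eq: "coord (unit E) (q x) = counit H x" if "x \<in> hcarrier H" for x
  proof (rule H.C_eqI[OF coord_q H.counit_lin vector_space_times _ that])
    fix n a assume a: "a \<in> gr H n"
    show "coord (unit E) (q a) = counit H a"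
    proof (cases "n = 0")
      case True
      then obtain c where c: "a = scl H c (unit H)" using a unfolding H.gr0[symmetric] by (auto simp: H.gr0)
      show ?thesis unfolding c linear_on_scale[OF coord_q H.unit_C] linear_on_scale[OF H.counit_lin H.unit_C] q'(3) H.counit_unit
        using coord_basis[OF E.unit_hbases, of "unit E"] by simp
    next
      case False
      then show ?thesis using coord_gr[OF E.unit_hbases q'(2)[OF a]] H.counit_pos[OF _ a] by (simp add: E.hdeg_unit)
    qed
  qed
  have "contr_r H (\<lambda>x. coord (unit E) (q x)) (comult H h) = contr_r H (counit H) (comult H h)"
  proof (rule H.AA.tcar_eqI[OF contr(2)[OF H.ga coord_q] contr(2)[OF H.ga H.counit_lin] H.vs _ H.comult_tcar[OF h]])
    fix i j x y assume "x \<in> gr H i" "y \<in> gr H j"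
    then have xy: "x \<in> hcarrier H" "y \<in> hcarrier H" using H.gr_C by auto
    show "contr_r H (\<lambda>x. coord (unit E) (q x)) (ten H H x y) = contr_r H (counit H) (ten H H x y)"
      unfolding contr(4)[OF H.ga coord_q xy] contr(4)[OF H.ga H.counit_lin xy] eq[OF xy(2)] ..
  qed
  then show ?thesis unfolding Tb_def eval2_contr[OF coord_lin h] using H.counit_r[OF h] by (simp add: contr_r_def)
qed

text \<open>Membership means that the coaction on \<open>a\<close> is \<open>a \<otimes> 1\<close>. The coefficient at the unit is \<open>a\<close> for every
  element, by \<open>Tb_unit\<close>.\<close>

lemma cotensor_iff:
  assumes a: "a \<in> hcarrier H"
  shows "a \<in> cotensor H E q \<longleftrightarrow> (\<forall>b\<in>hbases E. b \<noteq> unit E \<longrightarrow> Tb b a = 0)"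
proof
  have id: "tensor_map (scl H) (scl H) (scl H) (scl E) (hcarrier H) (hcarrier H) id q (comult H a) = rho a"
    by (simp add: rho_def id_def)
  {
    assume "a \<in> cotensor H E q"
    then have r: "rho a = ten H E a (unit E)" by (simp only: cotensor_def mem_Collect_eq id)
    show "\<forall>b\<in>hbases E. b \<noteq> unit E \<longrightarrow> Tb b a = 0"
      unfolding Tb_def r eval2(2)[OF coord_lin a E.unit_C] using coord_basis[OF E.unit_hbases] by auto
  next
    assume z: "\<forall>b\<in>hbases E. b \<noteq> unit E \<longrightarrow> Tb b a = 0"
    obtain F where F: "finite F" "F \<subseteq> hbases E" "\<forall>F'. finite F' \<and> F \<subseteq> F' \<and> F' \<subseteq> hbases E \<longrightarrow>
        rho a = (\<Sum>b\<in>F'. ten H E (eval2 (coord b) (rho a)) b)"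
      using tcar_expand[OF rho_tcar[OF a]] by blast
    let ?F = "insert (unit E) F"
    have "rho a = (\<Sum>b\<in>?F. ten H E (Tb b a) b)"
      unfolding Tb_def by (rule F(3)[rule_format]) (use F E.unit_hbases in auto)
    also have "\<dots> = (\<Sum>b\<in>?F. if b = unit E then ten H E a (unit E) else 0)"
    proof (rule sum.cong[OF refl])
      fix b assume "b \<in> ?F"
      then have b: "b \<in> hbases E" using F E.unit_hbases by auto
      show "ten H E (Tb b a) b = (if b = unit E then ten H E a (unit E) else 0)"
      proof (cases "b = unit E")
        case False
        then have "Tb b a = 0" using z b by blast
        then show ?thesis using False HE.ten_zero(1) by (simp only: if_False)
      qed (simp add: Tb_unit[OF a])
    qed
    also have "\<dots> = ten H E a (unit E)"
      using F(1) by (subst sum.delta) (simp_all only: finite_insert insertI1 if_True)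
    finally show "a \<in> cotensor H E q" using a by (simp only: cotensor_def mem_Collect_eq id)
  }
qed

text \<open>The coaction is multiplicative, and on \<open>a\<close> it is \<open>a \<otimes> 1\<close>.\<close>

lemma Tb_mult:
  assumes a: "a \<in> cotensor H E q" "a \<in> gr H i" and h: "h \<in> hcarrier H"
  shows "Tb b (mult H a h) = mult H a (Tb b h)"
proof -
  note aC = H.gr_C[OF a(2)]
  have r: "rho a = ten H E a (unit E)" using a(1) by (simp add: cotensor_def rho_def id_def)
  have au: "ten H E a (unit E) \<in> tcar H E" by (rule HE.ten_tcar[OF aC E.unit_C])
  have "eval2 (coord b) (tmult H E (ten H E a (unit E)) t) = mult H a (eval2 (coord b) t)" if t: "t \<in> tcar H E" for t
  proof (rule HE.tcar_eqI[OF _ _ H.vs _ t])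
    show "linear_on fscale (scl H) (tcar H E) (\<lambda>t. eval2 (coord b) (tmult H E (ten H E a (unit E)) t))"
      by (rule linear_on_comp[OF HE.tmult_lin2[OF au] eval2(1)[OF coord_lin]]) (use HE.tmult_tcar[OF au] in blast)
    show "linear_on fscale (scl H) (tcar H E) (\<lambda>t. mult H a (eval2 (coord b) t))"
      by (rule linear_on_comp[OF eval2(1)[OF coord_lin] H.mult_lin2[OF aC]]) (use eval2_C[OF coord_lin] in blast)
    fix l j x z assume xz: "x \<in> gr H l" "z \<in> gr E j"
    note C = H.gr_C[OF xz(1)] E.gr_C[OF xz(2)]
    have m: "tmult H E (ten H E a (unit E)) (ten H E x z) = ten H E (mult H a x) z"
      using HE.tmult_ten[OF a(2) E.unit_gr xz] unfolding E.unit_l[OF C(2)] by (simp only: mult_zero_left power_0 fs.scale_one)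
    show "eval2 (coord b) (tmult H E (ten H E a (unit E)) (ten H E x z)) = mult H a (eval2 (coord b) (ten H E x z))"
      unfolding m eval2(2)[OF coord_lin C] eval2(2)[OF coord_lin H.mult_C[OF aC C(1)] C(2)] H.mult_scale2[OF aC C(1)] ..
  qed
  from this[OF rho_tcar[OF h]] show ?thesis
    unfolding Tb_def alg_homD(4)[OF rho_alg_hom aC h] talg_simps r .
qed

text \<open>By coassociativity the composite is the contraction of the coaction with the convolution of two
  coordinate functionals. The convolution is homogeneous of degree \<open>hdeg E b + hdeg E b'\<close>, hence a
  combination of coordinate functionals of that degree.\<close>

lemma Tb_Tb:
  assumes b: "b \<in> hbases E" and b': "b' \<in> hbases E" and h: "h \<in> hcarrier H"
    and z: "\<And>c. c \<in> hbases E \<Longrightarrow> hdeg E c = hdeg E b + hdeg E b' \<Longrightarrow> Tb c h = 0"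
  shows "Tb b' (Tb b h) = 0"
proof -
  let ?g = "\<lambda>x. coord b (q x)" and ?g' = "\<lambda>x. coord b' (q x)"
  note vk = vector_space_times and vf = vector_space_fscale
  have bil: "\<exists>k0. linear_on fscale (*) (tcar X X) k0 \<and> (\<forall>x\<in>hcarrier X. \<forall>y\<in>hcarrier X. k0 (ten X X x y) = f x * g y)"
    if X: "graded_algebra X" and f: "linear_on (scl X) (*) (hcarrier X) f" and g: "linear_on (scl X) (*) (hcarrier X) g"
    for X :: "('k, 'x::ab_group_add) hopf" and f g
  proof -
    interpret X: galg X by unfold_locales (rule X)
    have 1: "linear_on (scl X) (*) (hcarrier X) (\<lambda>y. f x * g y)" for x
      using g by (simp add: linear_on_def algebra_simps)
    have 2: "linear_on (scl X) (*) (hcarrier X) (\<lambda>x. f x * g y)" for y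
      using f by (simp add: linear_on_def algebra_simps)
    show ?thesis by (rule tensor_lift[OF X.vs X.vs vk X.sub_C X.sub_C 1 2]) (auto simp: ten_def)
  qed
  obtain k0 where k0: "linear_on fscale (*) (tcar H H) k0"
    "\<And>x y. x \<in> hcarrier H \<Longrightarrow> y \<in> hcarrier H \<Longrightarrow> k0 (ten H H x y) = ?g' x * ?g y"
    using bil[OF H.ga coord_q[of b'] coord_q[of b]] by blast
  obtain kE where kE: "linear_on fscale (*) (tcar E E) kE"
    "\<And>x y. x \<in> hcarrier E \<Longrightarrow> y \<in> hcarrier E \<Longrightarrow> kE (ten E E x y) = coord b' x * coord b y"
    using bil[OF E.ga coord_lin[of b'] coord_lin[of b]] by blast
  \<comment> \<open>The convolution of the two coordinate functionals.\<close>
  define kap where "kap z = kE (comult E z)" for z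
  have kap: "linear_on (scl E) (*) (hcarrier E) kap" unfolding kap_def[abs_def]
    by (rule linear_on_comp[OF E.comult_lin kE(1)]) (use E.comult_tcar in blast)
  have k0_kE: "k0 t = kE (tmap H H E E q q t)" if t: "t \<in> tcar H H" for t
  proof (rule H.AA.tcar_eqI[OF k0(1) _ vk _ t])
    note Q = tmap_lin[OF H.ga H.ga E.ga E.ga q_alg q_alg]
    have "tmap H H E E q q ` tcar H H \<subseteq> tcar E E"
      by (rule image_subsetI, rule tensor_map_into[OF H.vs H.vs E.vs E.vs H.sub_C H.sub_C q'(1) _ q'(1)])
        (use q_C in blast)+
    then show "linear_on fscale (*) (tcar H H) (\<lambda>t. kE (tmap H H E E q q t))" by (rule linear_on_comp[OF Q(1) kE(1)])
    fix i j x y assume "x \<in> gr H i" "y \<in> gr H j"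
    then have xy: "x \<in> hcarrier H" "y \<in> hcarrier H" using H.gr_C by auto
    show "k0 (ten H H x y) = kE (tmap H H E E q q (ten H H x y))"
      unfolding Q(2)[OF xy] k0(2)[OF xy] kE(2)[OF q_C[OF xy(1)] q_C[OF xy(2)]] ..
  qed
  have kapq: "kap (q y) = k0 (comult H y)" if "y \<in> hcarrier H" for y
    unfolding kap_def q'(6)[OF that] k0_kE[OF H.comult_tcar[OF that]] ..
  have t1: "linear_on (scl H) (scl H) (hcarrier H) (\<lambda>x. scl H (k0 s) x)" for s by (rule linear_on_scale_map[OF H.vs])
  have t2: "linear_on fscale (scl H) (tcar H H) (\<lambda>s. scl H (k0 s) x)" for x
    using k0(1) by (simp add: linear_on_def H.scale_left_distrib)
  obtain Th where Th: "linear_on fscale (scl H) (tspan (scl H) fscale (hcarrier H) (tcar H H)) Th"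
    "\<And>x s. x \<in> hcarrier H \<Longrightarrow> s \<in> tcar H H \<Longrightarrow> Th (tensor (scl H) fscale x s) = scl H (k0 s) x"
    by (rule tensor_lift[where h = "\<lambda>x s. scl H (k0 s) x", OF H.vs vf H.vs H.sub_C subspace_tspan t2 t1]) (rule that)
  have Th': "linear_on fscale (scl H) (tcar H (talg H H)) Th"
    "\<And>x s. x \<in> hcarrier H \<Longrightarrow> s \<in> tcar H H \<Longrightarrow> Th (ten H (talg H H) x s) = scl H (k0 s) x"
    using Th by (simp_all add: H.AA.hcarrier_talg ten_def)
  interpret TH: galg2 "talg H H" H by unfold_locales
  interpret HT: galg2 H "talg H H" by unfold_locales
  note crg = contr[OF H.ga coord_q[of b]] and crg' = contr[OF H.ga coord_q[of b']]
  have crgC: "contr_r H ?g t \<in> hcarrier H" if "t \<in> tcar H H" for t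
    by (rule H.AA.tcar_image[OF crg(2) H.vs H.sub_C _ that]) (simp add: crg(4) H.gr_C H.scale_C)
  have ta: "linear_on fscale fscale (tcar (talg H H) H) (tassoc H)" using tassoc(1)[OF H.ga] by simp
  interpret TT: galg2 "talg (talg H H) H" "talg H (talg H H)" by unfold_locales
  have taC: "tassoc H t \<in> tcar H (talg H H)" if "t \<in> tcar (talg H H) H" for t
    using TT.alg_hom_C[OF alg_hom_tassoc[OF H.ga], of t] that by (simp add: TH.hcarrier_talg HT.hcarrier_talg)
  have tenC: "ten (talg H H) H u y \<in> tcar (talg H H) H" if "u \<in> tcar H H" "y \<in> hcarrier H" for u y
    using TH.ten_tcar that by (simp add: H.AA.hcarrier_talg)
  have tenl: "linear_on fscale fscale (tcar H H) (\<lambda>u. ten (talg H H) H u y)" for y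
    unfolding ten_def talg_simps by (rule tensor_lin1)
  have A1: "Th (tassoc H (ten (talg H H) H u y)) = scl H (?g y) (contr_r H ?g' u)" if u: "u \<in> tcar H H" and y: "y \<in> hcarrier H" for u y
  proof (rule H.AA.tcar_eqI[OF _ _ H.vs _ u])
    have "linear_on fscale fscale (tcar H H) (\<lambda>u. tassoc H (ten (talg H H) H u y))"
      by (rule linear_on_comp[OF tenl ta]) (use tenC[OF _ y] in blast)
    then show "linear_on fscale (scl H) (tcar H H) (\<lambda>u. Th (tassoc H (ten (talg H H) H u y)))"
      by (rule linear_on_comp[OF _ Th'(1)]) (use taC tenC[OF _ y] in blast)
    show "linear_on fscale (scl H) (tcar H H) (\<lambda>u. scl H (?g y) (contr_r H ?g' u))"
      by (rule linear_on_scaled[OF crg'(2) H.vs])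
    fix i j x x' assume "x \<in> gr H i" "x' \<in> gr H j"
    then have xC: "x \<in> hcarrier H" "x' \<in> hcarrier H" using H.gr_C by auto
    show "Th (tassoc H (ten (talg H H) H (ten H H x x') y)) = scl H (?g y) (contr_r H ?g' (ten H H x x'))"
      unfolding tassoc(2)[OF H.ga xC y] Th'(2)[OF xC(1) H.AA.ten_tcar[OF xC(2) y]] k0(2)[OF xC(2) y] crg'(4)[OF xC]
      by (simp add: mult.commute)
  qed
  note id = alg_hom_ident[of H] and co = H.alg_hom_comult
  note D1 = tmap_lin[OF H.ga H.ga H.AA.T.ga H.ga co id] and D2 = tmap_lin[OF H.ga H.ga H.ga H.AA.T.ga id co]
  interpret T2: galg2 "talg H H" "talg (talg H H) H" by unfold_locales
  interpret T3: galg2 "talg H H" "talg H (talg H H)" by unfold_locales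
  have D1C: "tmap H H (talg H H) H (comult H) (\<lambda>x. x) t \<in> tcar (talg H H) H" if "t \<in> tcar H H" for t
    using T2.alg_hom_C[OF alg_hom_tmap[OF H.ga H.ga H.AA.T.ga H.ga co id], of t] that
    by (simp add: TH.hcarrier_talg H.AA.hcarrier_talg)
  have D2C: "tmap H H H (talg H H) (\<lambda>x. x) (comult H) t \<in> tcar H (talg H H)" if "t \<in> tcar H H" for t
    using T3.alg_hom_C[OF alg_hom_tmap[OF H.ga H.ga H.ga H.AA.T.ga id co], of t] that
    by (simp add: HT.hcarrier_talg H.AA.hcarrier_talg)
  have L: "contr_r H ?g' (comult H (contr_r H ?g t)) = Th (tassoc H (tmap H H (talg H H) H (comult H) (\<lambda>x. x) t))"
    if t: "t \<in> tcar H H" for t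
  proof (rule H.AA.tcar_eqI[OF _ _ H.vs _ t])
    have "linear_on fscale fscale (tcar H H) (\<lambda>t. comult H (contr_r H ?g t))"
      by (rule linear_on_comp[OF crg(2) H.comult_lin]) (use crgC in blast)
    then show "linear_on fscale (scl H) (tcar H H) (\<lambda>t. contr_r H ?g' (comult H (contr_r H ?g t)))"
      by (rule linear_on_comp[OF _ crg'(2)]) (use H.comult_tcar crgC in blast)
    have "linear_on fscale fscale (tcar H H) (\<lambda>t. tassoc H (tmap H H (talg H H) H (comult H) (\<lambda>x. x) t))"
      by (rule linear_on_comp[OF D1(1) ta]) (use D1C in blast)
    then show "linear_on fscale (scl H) (tcar H H) (\<lambda>t. Th (tassoc H (tmap H H (talg H H) H (comult H) (\<lambda>x. x) t)))"
      by (rule linear_on_comp[OF _ Th'(1)]) (use taC D1C in blast)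
    fix i j x y assume "x \<in> gr H i" "y \<in> gr H j"
    then have xy: "x \<in> hcarrier H" "y \<in> hcarrier H" using H.gr_C by auto
    note cx = H.comult_tcar[OF xy(1)]
    show "contr_r H ?g' (comult H (contr_r H ?g (ten H H x y))) =
        Th (tassoc H (tmap H H (talg H H) H (comult H) (\<lambda>x. x) (ten H H x y)))"
      unfolding D1(2)[OF xy] A1[OF cx xy(2)] crg(4)[OF xy] linear_on_scale[OF H.comult_lin xy(1)]
        linear_on_scale[OF crg'(2) cx] ..
  qed
  have R: "Th (tmap H H H (talg H H) (\<lambda>x. x) (comult H) t) = contr_r H (\<lambda>x. kap (q x)) t" if t: "t \<in> tcar H H" for t
  proof (rule H.AA.tcar_eqI[OF _ _ H.vs _ t])
    have kq: "linear_on (scl H) (*) (hcarrier H) (\<lambda>x. kap (q x))"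
      by (rule linear_on_comp[OF q'(1) kap]) (use q_C in blast)
    show "linear_on fscale (scl H) (tcar H H) (\<lambda>t. Th (tmap H H H (talg H H) (\<lambda>x. x) (comult H) t))"
      by (rule linear_on_comp[OF D2(1) Th'(1)]) (use D2C in blast)
    show "linear_on fscale (scl H) (tcar H H) (contr_r H (\<lambda>x. kap (q x)))" by (rule contr(2)[OF H.ga kq])
    fix i j x y assume "x \<in> gr H i" "y \<in> gr H j"
    then have xy: "x \<in> hcarrier H" "y \<in> hcarrier H" using H.gr_C by auto
    show "Th (tmap H H H (talg H H) (\<lambda>x. x) (comult H) (ten H H x y)) = contr_r H (\<lambda>x. kap (q x)) (ten H H x y)"
      unfolding D2(2)[OF xy] Th'(2)[OF xy(1) H.comult_tcar[OF xy(2)]] contr(4)[OF H.ga kq xy] kapq[OF xy(2)] ..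
  qed
  have "Tb b' (Tb b h) = contr_r H ?g' (comult H (contr_r H ?g (comult H h)))"
  proof -
    have "Tb b' (Tb b h) = contr_r H ?g' (comult H (Tb b h))"
      unfolding Tb_def[of b' "Tb b h"] by (rule eval2_contr[OF coord_lin Tb_C[OF h]])
    moreover have "Tb b h = contr_r H ?g (comult H h)" unfolding Tb_def by (rule eval2_contr[OF coord_lin h])
    ultimately show ?thesis by simp
  qed
  also have "\<dots> = Th (tmap H H H (talg H H) (\<lambda>x. x) (comult H) (comult H h))"
    unfolding L[OF H.comult_tcar[OF h]] using H.coassoc[OF h] by (simp add: id_def)
  also have "\<dots> = eval2 kap (rho h)" unfolding R[OF H.comult_tcar[OF h]] eval2_contr[OF kap h] ..
  also have "\<dots> = 0"
  proof -
    obtain F where F: "finite F" "F \<subseteq> hbases E" "rho h = (\<Sum>c\<in>F. ten H E (Tb c h) c)"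
      using tcar_expand[OF rho_tcar[OF h]] unfolding Tb_def by blast
    have kz: "kap c = 0" if c: "c \<in> hbases E" and d: "hdeg E c \<noteq> hdeg E b + hdeg E b'" for c
      unfolding kap_def
    proof (rule E.AA.talg_gr_eqI[OF kE(1) linear_on_null[OF vk] vk _ E.comult_gr[OF E.hbases_gr[OF c]]])
      fix i j x y assume xy: "x \<in> gr E i" "y \<in> gr E j" and ij: "i + j = hdeg E c"
      have "i \<noteq> hdeg E b' \<or> j \<noteq> hdeg E b" using ij d by auto
      then show "kE (ten E E x y) = 0"
        unfolding kE(2)[OF E.gr_C[OF xy(1)] E.gr_C[OF xy(2)]] using coord_gr[OF b' xy(1)] coord_gr[OF b xy(2)] by auto
    qed
    have "eval2 kap (\<Sum>c\<in>F'. ten H E (Tb c h) c) = 0" if "finite F'" "F' \<subseteq> hbases E" for F'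
      using that
    proof (induction F' rule: finite_induct)
      case empty
      show ?case unfolding sum.empty
        by (rule linear_on_zero[OF eval2(1)[OF kap] vf H.vs fs.subspace_0[OF subspace_tspan]])
    next
      case (insert c F')
      have c: "c \<in> hbases E" using insert by simp
      note m = HE.ten_tcar[OF Tb_C[OF h] E.hbases_C]
      have s: "(\<Sum>c\<in>F'. ten H E (Tb c h) c) \<in> tcar H E"
        by (rule fs.subspace_sum[OF subspace_tspan]) (use m insert in blast)
      have "scl H (kap c) (Tb c h) = 0" using kz[OF c] z[OF c] by (cases "hdeg E c = hdeg E b + hdeg E b'") auto
      then show ?case
        unfolding sum.insert[OF insert.hyps] linear_on_add[OF eval2(1)[OF kap] m[OF c] s]
          eval2(2)[OF kap Tb_C[OF h] E.hbases_C[OF c]] using insert by simp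
    qed
    then show ?thesis using F by simp
  qed
  finally show ?thesis .
qed

end


lemma linear_on_sum_fun:
  assumes f: "linear_on s1 s2 V f" and s: "vector_space s1" "vector_space s2" and V: "module.subspace s1 V"
    and I: "finite I" and g: "\<And>i. i \<in> I \<Longrightarrow> g i \<in> V"
  shows "f (\<Sum>i\<in>I. g i) = (\<Sum>i\<in>I. f (g i))"
proof -
  interpret a: vector_space s1 by fact
  show ?thesis using I g
  proof (induction I rule: finite_induct)
    case empty then show ?case using linear_on_zero[OF f s a.subspace_0[OF V]] by simp
  next
    case (insert i I)
    have "(\<Sum>i\<in>I. g i) \<in> V" by (rule a.subspace_sum[OF V]) (use insert in blast)
    then show ?case using insert linear_on_add[OF f insert.prems[OF insertI1]] by simp
  qed
qed

context chopf begin

lemma finite_type_basis: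
  assumes "finite_type (scl A) (gr A)"
  shows "finite (hbasis A n)" "dim (gr A n) = card (hbasis A n)"
proof -
  obtain B where B: "finite B" "gr A n \<subseteq> span B" using assms by (auto simp: finite_type_def)
  then show "finite (hbasis A n)" using independent_span_bound[OF B(1) hbasis(2)] hbasis(1) by blast
  show "dim (gr A n) = card (hbasis A n)"
    using dim_unique[OF hbasis(1) _ hbasis(2) refl] hbasis(3) by blast
qed

end

context hopf_surj begin

definition lift :: "'e \<Rightarrow> 'h" where "lift b = (SOME h. h \<in> gr H (hdeg E b) \<and> q h = b)"

lemma lift: "b \<in> hbases E \<Longrightarrow> lift b \<in> gr H (hdeg E b)" "b \<in> hbases E \<Longrightarrow> q (lift b) = b"
proof -
  have "b \<in> hbases E \<Longrightarrow> \<exists>h. h \<in> gr H (hdeg E b) \<and> q h = b"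
    using subsetD[OF surj E.hbases_gr] by blast
  then have "b \<in> hbases E \<Longrightarrow> lift b \<in> gr H (hdeg E b) \<and> q (lift b) = b"
    unfolding lift_def by (rule someI_ex)
  then show "b \<in> hbases E \<Longrightarrow> lift b \<in> gr H (hdeg E b)" "b \<in> hbases E \<Longrightarrow> q (lift b) = b" by blast+
qed

lemma Tb_lift:
  assumes b: "b \<in> hbases E" and b': "b' \<in> hbases E" and d: "hdeg E b \<le> hdeg E b'"
  shows "Tb b' (lift b) = (if b' = b then unit H else 0)"
proof (cases "hdeg E b = hdeg E b'")
  case True
  show ?thesis using Tb_top[OF b' lift(1)[OF b, unfolded True]] lift(2)[OF b] coord_basis[OF b, of b'] by simp
next
  case False
  then have "hdeg E b < hdeg E b'" using d by simp
  then show ?thesis using Tb_gr(2)[OF b' lift(1)[OF b]] by auto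
qed

abbreviation "Z \<equiv> cotensor_gr H E q"

lemma Z_iff: "a \<in> Z n \<longleftrightarrow> a \<in> gr H n \<and> (\<forall>b\<in>hbases E. b \<noteq> unit E \<longrightarrow> Tb b a = 0)"
  using cotensor_iff[OF H.gr_C] by (auto simp: cotensor_gr_def)

lemma sub_Z: "H.subspace (Z n)"
proof -
  have z: "Tb b 0 = 0" for b by (rule linear_on_zero[OF Tb_lin H.vs H.vs H.subspace_0[OF H.sub_C]])
  have a: "Tb b (x + y) = Tb b x + Tb b y" if "x \<in> gr H n" "y \<in> gr H n" for b x y
    by (rule linear_on_add[OF Tb_lin H.gr_C[OF that(1)] H.gr_C[OF that(2)]])
  have c: "Tb b (scl H c x) = scl H c (Tb b x)" if "x \<in> gr H n" for b x c
    by (rule linear_on_scale[OF Tb_lin H.gr_C[OF that]])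
  have Z: "Z n = {a \<in> gr H n. \<forall>b\<in>hbases E. b \<noteq> unit E \<longrightarrow> Tb b a = 0}" by (auto simp: Z_iff)
  show ?thesis
    unfolding H.subspace_def Z
    using H.subspace_0[OF H.sub_gr] H.subspace_add[OF H.sub_gr] H.scale_gr by (simp add: z a c)
qed

lemma mult_Z_lift:
  assumes a: "a \<in> Z (n - hdeg E b)" and b: "b \<in> hbases E" "hdeg E b \<le> n"
  shows "mult H a (lift b) \<in> gr H n"
proof -
  have "a \<in> gr H (n - hdeg E b)" using a by (simp add: Z_iff)
  from H.mult_gr[OF this lift(1)[OF b(1)]] show ?thesis using b(2) by simp
qed

text \<open>If \<open>l\<close> is the highest degree of a coefficient of \<open>h\<close>, then the coefficients of degree \<open>l\<close> lie in the
  cotensor product, and after subtracting their products with the lifts only coefficients of smaller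
  degree remain.\<close>

lemma span_products:
  assumes W: "\<And>b a. b \<in> hbases E \<Longrightarrow> hdeg E b \<le> n \<Longrightarrow> a \<in> Z (n - hdeg E b) \<Longrightarrow> mult H a (lift b) \<in> W"
    and subW: "H.subspace W" and h: "h \<in> gr H n"
  shows "h \<in> W"
proof -
  have "\<forall>h\<in>gr H n. (\<forall>b\<in>hbases E. l \<le> hdeg E b \<longrightarrow> Tb b h = 0) \<longrightarrow> h \<in> W" for l
  proof (induction l)
    case 0
    show ?case
    proof (intro ballI impI)
      fix h assume h: "h \<in> gr H n" "\<forall>b\<in>hbases E. 0 \<le> hdeg E b \<longrightarrow> Tb b h = 0"
      have "h = 0" using h(2) E.unit_hbases Tb_unit[OF H.gr_C[OF h(1)]] by simp
      then show "h \<in> W" using H.subspace_0[OF subW] by simp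
    qed
  next
    case (Suc l)
    show ?case
    proof (intro ballI impI)
      fix h assume h: "h \<in> gr H n" and v: "\<forall>b\<in>hbases E. Suc l \<le> hdeg E b \<longrightarrow> Tb b h = 0"
      note hC = H.gr_C[OF h]
      show "h \<in> W"
      proof (cases "l \<le> n")
        case False
        then have "\<forall>b\<in>hbases E. l \<le> hdeg E b \<longrightarrow> Tb b h = 0" using Tb_gr(2)[OF _ h] by simp
        then show ?thesis using Suc.IH h by blast
      next
        case True
        have finD: "finite (hbasis E l)" by (rule E.finite_type_basis(1)[OF fin_E])
        have D: "b \<in> hbases E" "hdeg E b = l" if "b \<in> hbasis E l" for b
          using that E.hdeg by (auto simp: hbases_def)
        have aZ: "Tb b h \<in> Z (n - hdeg E b)" if "b \<in> hbasis E l" for b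
          unfolding Z_iff
        proof (intro conjI ballI impI)
          show "Tb b h \<in> gr H (n - hdeg E b)" by (rule Tb_gr(1)[OF D(1)[OF that] h]) (simp add: D(2)[OF that] True)
          fix b' assume b': "b' \<in> hbases E" "b' \<noteq> unit E"
          show "Tb b' (Tb b h) = 0"
          proof (rule Tb_Tb[OF D(1)[OF that] b'(1) hC])
            fix c assume "c \<in> hbases E" "hdeg E c = hdeg E b + hdeg E b'"
            then show "Tb c h = 0" using v D(2)[OF that] E.hdeg_zero_iff[OF b'(1)] b'(2) by (metis Suc_leI less_add_same_cancel1 neq0_conv)
          qed
        qed
        let ?p = "\<lambda>b. mult H (Tb b h) (lift b)"
        have pg: "?p b \<in> gr H n" and pW: "?p b \<in> W" if "b \<in> hbasis E l" for b
          using mult_Z_lift[OF aZ[OF that] D(1)[OF that]] W[OF D(1)[OF that] _ aZ[OF that]] D(2)[OF that] True by simp_all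
        let ?s = "\<Sum>b\<in>hbasis E l. ?p b"
        have sg: "?s \<in> gr H n" by (rule H.subspace_sum[OF H.sub_gr pg])
        have sW: "?s \<in> W" by (rule H.subspace_sum[OF subW pW])
        have "h - ?s \<in> W"
        proof (rule Suc.IH[rule_format])
          show "h - ?s \<in> gr H n" by (rule H.subspace_diff[OF H.sub_gr h sg])
          fix b' assume b': "b' \<in> hbases E" "l \<le> hdeg E b'"
          have "Tb b' ?s = (\<Sum>b\<in>hbasis E l. Tb b' (?p b))"
            by (rule linear_on_sum_fun[OF Tb_lin H.vs H.vs H.sub_C finD]) (use pg H.gr_C in blast)
          also have "\<dots> = (\<Sum>b\<in>hbasis E l. if b = b' then Tb b' h else 0)"
          proof (rule sum.cong[OF refl])
            fix b assume b: "b \<in> hbasis E l"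
            have Zb: "Tb b h \<in> cotensor H E q" "Tb b h \<in> gr H (n - hdeg E b)" using aZ[OF b] by (auto simp: cotensor_gr_def)
            have "Tb b' (?p b) = mult H (Tb b h) (Tb b' (lift b))"
              by (rule Tb_mult[OF Zb H.gr_C[OF lift(1)[OF D(1)[OF b]]]])
            also have "Tb b' (lift b) = (if b' = b then unit H else 0)"
              by (rule Tb_lift[OF D(1)[OF b] b'(1)]) (simp add: D(2)[OF b] b'(2))
            finally show "Tb b' (?p b) = (if b = b' then Tb b' h else 0)"
              using H.unit_r[OF H.gr_C[OF Zb(2)]] linear_on_zero[OF H.mult_lin2[OF H.gr_C[OF Zb(2)]] H.vs H.vs H.subspace_0[OF H.sub_C]]
              by auto
          qed
          also have "\<dots> = Tb b' h"
          proof (cases "b' \<in> hbasis E l")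
            case False
            then have "hdeg E b' \<noteq> l" using b'(1) E.hbases_deg[of l] by blast
            then have "Tb b' h = 0" using v b' by simp
            then show ?thesis using False by (simp add: sum.delta[OF finD])
          qed (simp add: sum.delta[OF finD])
          finally show "Tb b' (h - ?s) = 0"
            unfolding linear_on_diff[OF Tb_lin H.vs H.vs H.sub_C hC H.gr_C[OF sg]] by simp
        qed
        from H.subspace_add[OF subW this sW] show ?thesis by simp
      qed
    qed
  qed
  from this[of "Suc n"] show ?thesis using h Tb_gr(2)[OF _ h] by simp
qed

text \<open>The products of lifts with bases of the homogeneous parts of the cotensor product are independent:
  in a nontrivial relation, \<open>Tb b\<close> for a basis element \<open>b\<close> of highest degree annihilates all products
  except those with the lift of \<open>b\<close>.\<close>

lemma dim_products: "H.dim (gr H n) = (\<Sum>d\<le>n. card (hbasis E d) * H.dim (Z (n - d)))"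
  and finite_type_Z: "finite_type (scl H) Z"
proof -
  have fin: "\<exists>B. finite B \<and> Z k \<subseteq> H.span B" for k
  proof -
    obtain B where B: "finite B" "gr H k \<subseteq> H.span B" using fin_H unfolding finite_type_def by meson
    have "Z k \<subseteq> gr H k" by (simp add: cotensor_gr_def)
    then show ?thesis using B by (intro exI[of _ B] conjI) (assumption | rule subset_trans)+
  qed
  then show "finite_type (scl H) Z" by (simp add: finite_type_def)
  have "\<forall>k. \<exists>C. finite C \<and> C \<subseteq> Z k \<and> H.independent C \<and> Z k = H.span C \<and> card C = H.dim (Z k)"
  proof
    fix k
    obtain B where "finite B" "Z k \<subseteq> H.span B" using fin by blast
    from H.finite_basis[OF this sub_Z] show "\<exists>C. finite C \<and> C \<subseteq> Z k \<and> H.independent C \<and> Z k = H.span C \<and> card C = H.dim (Z k)"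
      by metis
  qed
  then obtain C where C: "\<And>k. finite (C k)" "\<And>k. C k \<subseteq> Z k" "\<And>k. H.independent (C k)"
    "\<And>k. Z k = H.span (C k)" "\<And>k. card (C k) = H.dim (Z k)" by metis
  define X where "X = (SIGMA b:(\<Union>d\<le>n. hbasis E d). C (n - hdeg E b))"
  have finE: "finite (hbasis E d)" for d by (rule E.finite_type_basis(1)[OF fin_E])
  have X: "b \<in> hbases E" "hdeg E b \<le> n" "c \<in> C (n - hdeg E b)" if "(b, c) \<in> X" for b c
    using that E.hdeg by (auto simp: X_def hbases_def)
  have XI: "(b, c) \<in> X" if "b \<in> hbases E" "hdeg E b \<le> n" "c \<in> C (n - hdeg E b)" for b c
    using that E.hbases_deg by (auto simp: X_def)
  have finX: "finite X" unfolding X_def using finE C(1) by (intro finite_SigmaI finite_UN_I) auto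
  let ?v = "\<lambda>(b, c). mult H c (lift b)"
  have cg: "c \<in> gr H (n - hdeg E b)" "c \<in> cotensor H E q" if "(b, c) \<in> X" for b c
    using C(2) X(3)[OF that] by (auto simp: cotensor_gr_def)
  have vg: "?v x \<in> gr H n" if "x \<in> X" for x
  proof (cases x)
    case (Pair b c)
    then have bc: "(b, c) \<in> X" using that by simp
    show ?thesis using mult_Z_lift[OF subsetD[OF C(2) X(3)[OF bc]] X(1,2)[OF bc]] Pair by simp
  qed
  have "H.dim (gr H n) = card X"
  proof (rule H.dim_family[OF finX, where v = ?v])
    show "?v ` X \<subseteq> gr H n" using vg by blast
    show "gr H n \<subseteq> H.span (?v ` X)"
    proof
      fix h assume h: "h \<in> gr H n"
      show "h \<in> H.span (?v ` X)"
      proof (rule span_products[OF _ _ h])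
        fix b a assume b: "b \<in> hbases E" "hdeg E b \<le> n" and a: "a \<in> Z (n - hdeg E b)"
        have l: "lift b \<in> hcarrier H" by (rule H.gr_C[OF lift(1)[OF b(1)]])
        have sub: "H.span (C (n - hdeg E b)) \<subseteq> hcarrier H"
          unfolding C(4)[symmetric] using H.gr_C by (auto simp: cotensor_gr_def)
        show "mult H a (lift b) \<in> H.span (?v ` X)"
        proof (rule linear_on_image_span[where f = "\<lambda>a. mult H a (lift b)", OF linear_on_subset[OF H.mult_lin1[OF l] sub] H.vs H.vs])
          show "a \<in> H.span (C (n - hdeg E b))" using a unfolding C(4)[symmetric] .
          show "mult H c (lift b) \<in> H.span (?v ` X)" if "c \<in> C (n - hdeg E b)" for c
            by (rule H.span_base) (use XI[OF b that] in force)
        qed simp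
      qed simp
    qed
    fix u assume s: "(\<Sum>x\<in>X. scl H (u x) (?v x)) = 0"
    show "\<forall>x\<in>X. u x = 0"
    proof (rule ccontr)
      assume "\<not> (\<forall>x\<in>X. u x = 0)"
      define S where "S = {x \<in> X. u x \<noteq> 0}"
      define l where "l = Max ((\<lambda>x. hdeg E (fst x)) ` S)"
      have S: "finite S" "S \<noteq> {}" using finX \<open>\<not> (\<forall>x\<in>X. u x = 0)\<close> by (auto simp: S_def)
      have "l \<in> (\<lambda>x. hdeg E (fst x)) ` S" unfolding l_def using S by (intro Max_in) auto
      then obtain b0 c0 where b0: "(b0, c0) \<in> S" "hdeg E b0 = l" by fastforce
      have max: "hdeg E b \<le> l" if "(b, c) \<in> S" for b c
        unfolding l_def using S that by (intro Max_ge) (auto intro!: image_eqI[where x = "(b, c)"])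
      have bX: "(b0, c0) \<in> X" using b0 by (simp add: S_def)
      note b0E = X(1)[OF bX]
      have "(\<Sum>x\<in>X. scl H (u x) (if fst x = b0 then snd x else 0)) = (\<Sum>x\<in>X. Tb b0 (scl H (u x) (?v x)))"
      proof (rule sum.cong[OF refl])
        fix x assume x: "x \<in> X"
        obtain b c where bc: "x = (b, c)" by (cases x)
        have bcX: "(b, c) \<in> X" using x bc by simp
        show "scl H (u x) (if fst x = b0 then snd x else 0) = Tb b0 (scl H (u x) (?v x))"
        proof (cases "u x = 0")
          case True
          have "Tb b0 0 = 0" by (rule linear_on_zero[OF Tb_lin H.vs H.vs H.subspace_0[OF H.sub_C]])
          then show ?thesis using True by simp
        next
          case False
          then have "hdeg E b \<le> hdeg E b0" using max[of b c] bcX bc b0(2) by (simp add: S_def)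
          then have L: "Tb b0 (lift b) = (if b0 = b then unit H else 0)" by (rule Tb_lift[OF X(1)[OF bcX] b0E])
          note cC = H.gr_C[OF cg(1)[OF bcX]]
          have "Tb b0 (scl H (u x) (?v x)) = scl H (u x) (Tb b0 (mult H c (lift b)))"
            using linear_on_scale[OF Tb_lin H.gr_C[OF vg[OF x]]] bc by simp
          also have "Tb b0 (mult H c (lift b)) = mult H c (Tb b0 (lift b))"
            by (rule Tb_mult[OF cg(2,1)[OF bcX] H.gr_C[OF lift(1)[OF X(1)[OF bcX]]]])
          finally show ?thesis
            unfolding L using bc H.unit_r[OF cC] linear_on_zero[OF H.mult_lin2[OF cC] H.vs H.vs H.subspace_0[OF H.sub_C]] by auto
        qed
      qed
      also have "\<dots> = Tb b0 (\<Sum>x\<in>X. scl H (u x) (?v x))"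
        by (rule linear_on_sum_fun[OF Tb_lin H.vs H.vs H.sub_C finX, symmetric]) (rule H.scale_C[OF H.gr_C[OF vg]])
      also have "\<dots> = 0" unfolding s by (rule linear_on_zero[OF Tb_lin H.vs H.vs H.subspace_0[OF H.sub_C]])
      finally have z: "(\<Sum>x\<in>X. scl H (u x) (if fst x = b0 then snd x else 0)) = 0" .
      have "(\<Sum>c\<in>C (n - l). scl H (u (b0, c)) c) = (\<Sum>x\<in>Pair b0 ` C (n - l). scl H (u x) (if fst x = b0 then snd x else 0))"
        by (subst sum.reindex) (auto simp: inj_on_def)
      also have "\<dots> = (\<Sum>x\<in>X. scl H (u x) (if fst x = b0 then snd x else 0))"
        by (rule sum.mono_neutral_left[OF finX]) (use XI[OF b0E X(2)[OF bX]] X(3) b0(2) in auto)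
      finally have "(\<Sum>c\<in>C (n - l). scl H (u (b0, c)) c) = 0" using z by simp
      from H.independentD[OF C(3) C(1) order_refl this, of c0] X(3)[OF bX] b0 show False by (simp add: S_def)
    qed
  qed
  also have "\<dots> = (\<Sum>b\<in>(\<Union>d\<le>n. hbasis E d). card (C (n - hdeg E b)))"
    unfolding X_def using finE C(1) by (subst card_SigmaI) auto
  also have "\<dots> = (\<Sum>d\<le>n. \<Sum>b\<in>hbasis E d. card (C (n - hdeg E b)))"
    by (rule sum.UNION_disjoint) (use finE E.hbasis_disjoint in auto)
  also have "\<dots> = (\<Sum>d\<le>n. card (hbasis E d) * H.dim (Z (n - d)))"
    by (rule sum.cong[OF refl]) (simp add: E.hdeg C(5))
  finally show "H.dim (gr H n) = (\<Sum>d\<le>n. card (hbasis E d) * H.dim (Z (n - d)))" .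
qed

theorem poincare_cotensor:
  "poincare_series (scl H) (gr H) = poincare_series (scl H) (cotensor_gr H E q) * poincare_series (scl E) (gr E)"
proof (rule fps_ext)
  fix n
  have "fps_nth (poincare_series (scl H) (gr H)) n = (\<Sum>d\<le>n. of_nat (E.dim (gr E d)) * of_nat (H.dim (Z (n - d))))"
    by (simp add: poincare_series_def dim_products E.finite_type_basis(2)[OF fin_E])
  also have "\<dots> = fps_nth (poincare_series (scl E) (gr E) * poincare_series (scl H) Z) n"
    by (simp add: fps_mult_nth poincare_series_def atMost_atLeast0)
  finally show "fps_nth (poincare_series (scl H) (gr H)) n = fps_nth (poincare_series (scl H) Z * poincare_series (scl E) (gr E)) n"
    by (simp only: mult.commute)
qed

end


section \<open>Counting reduced traces\<close>

definition gfs :: "'x set \<Rightarrow> ('x \<Rightarrow> nat) \<Rightarrow> rat fps" where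
  "gfs S w = Abs_fps (\<lambda>n. of_nat (card {x \<in> S. w x = n}))"

lemma gfs_disjoint:
  assumes "\<And>n. finite {x \<in> S. w x = n}" "\<And>n. finite {x \<in> S'. w x = n}" "S \<inter> S' = {}"
  shows "gfs (S \<union> S') w = gfs S w + gfs S' w"
proof (rule fps_ext)
  fix n
  have "{x \<in> S \<union> S'. w x = n} = {x \<in> S. w x = n} \<union> {x \<in> S'. w x = n}" by auto
  moreover have "{x \<in> S. w x = n} \<inter> {x \<in> S'. w x = n} = {}" using assms(3) by blast
  ultimately show "fps_nth (gfs (S \<union> S') w) n = fps_nth (gfs S w + gfs S' w) n"
    by (simp add: gfs_def card_Un_disjoint assms(1,2))
qed

lemma gfs_bij:
  assumes f: "bij_betw f S S'" and w: "\<And>x. x \<in> S \<Longrightarrow> w' (f x) = w x"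
  shows "gfs S w = gfs S' w'"
proof (rule fps_ext)
  fix n
  have "bij_betw f {x \<in> S. w x = n} {x \<in> S'. w' x = n}"
    unfolding bij_betw_def
  proof
    show "inj_on f {x \<in> S. w x = n}" using f by (auto simp: bij_betw_def intro: inj_on_subset)
    have "S' = f ` S" using f by (simp add: bij_betw_def)
    then show "f ` {x \<in> S. w x = n} = {x \<in> S'. w' x = n}" using w by auto
  qed
  then show "fps_nth (gfs S w) n = fps_nth (gfs S' w') n" by (simp add: gfs_def bij_betw_same_card)
qed

lemma gfs_times:
  assumes "\<And>n. finite {x \<in> S. w x = n}" "\<And>n. finite {x \<in> S'. w' x = n}"
  shows "gfs (S \<times> S') (\<lambda>(x, y). w x + w' y) = gfs S w * gfs S' w'"
proof (rule fps_ext)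
  fix n
  let ?F = "\<lambda>i. {x \<in> S. w x = i} \<times> {y \<in> S'. w' y = n - i}"
  have "{p \<in> S \<times> S'. (case p of (x, y) \<Rightarrow> w x + w' y) = n} = (\<Union>i\<in>{0..n}. ?F i)" by auto
  moreover have "card (\<Union>i\<in>{0..n}. ?F i) = (\<Sum>i\<in>{0..n}. card (?F i))"
    by (rule card_UN_disjoint) (use assms in auto)
  ultimately show "fps_nth (gfs (S \<times> S') (\<lambda>(x, y). w x + w' y)) n = fps_nth (gfs S w * gfs S' w') n"
    by (simp add: gfs_def fps_mult_nth card_cartesian_product)
qed

lemma alternating_sum_subsets:
  assumes "finite F" shows "(\<Sum>X\<in>Pow F. (-1) ^ card X) = (if F = {} then 1 else 0 :: 'r::comm_ring_1)"
  using assms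
proof (induction F)
  case (insert x F)
  have "(\<Sum>X\<in>Pow (insert x F). (-1) ^ card X) = (\<Sum>X\<in>Pow F. (-1) ^ card X) + (\<Sum>X\<in>insert x ` Pow F. (-1) ^ card X :: 'r)"
    unfolding Pow_insert by (rule sum.union_disjoint) (use insert.hyps in auto)
  also have "(\<Sum>X\<in>insert x ` Pow F. (-1) ^ card X :: 'r) = (\<Sum>X\<in>Pow F. (-1) ^ card (insert x X))"
    by (rule sum.reindex_cong[OF _ refl refl]) (use insert.hyps in \<open>auto simp: inj_on_def\<close>)
  also have "\<dots> = (\<Sum>X\<in>Pow F. - ((-1) ^ card X))"
  proof (rule sum.cong[OF refl])
    fix X assume "X \<in> Pow F"
    then have "x \<notin> X" "finite X" using insert.hyps finite_subset[of X F] by auto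
    then show "(-1) ^ card (insert x X) = - ((-1 :: 'r) ^ card X)" by simp
  qed
  finally show ?case by (simp add: sum_negf)
qed simp

locale gprod_fin = gprod +
  assumes fin: "\<And>i. i \<in> {1..m} \<Longrightarrow> finite_type (scl (A i)) (gr (A i))"
begin

definition J :: "nat \<Rightarrow> rat fps" where "J i = gfs (Bp i) (hdeg (A i))"

lemma Bp_fin: "finite {b \<in> Bp i. hdeg (A i) b = n}"
proof (cases "i \<in> {1..m}")
  case True
  then interpret Ai: chopf "A i" by (rule chi)
  have "{b \<in> Bp i. hdeg (A i) b = n} \<subseteq> hbasis (A i) n" using Ai.hbases_deg[of n] True by (auto simp: Bp_def)
  then show ?thesis by (rule finite_subset[OF _ Ai.finite_type_basis(1)[OF fin[OF True]]])
next
  case False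
  then have "Bp i = {}" by (simp only: Bp_def if_False)
  then show ?thesis by simp
qed

lemma poincare_A:
  assumes i: "i \<in> {1..m}"
  shows "poincare_series (scl (A i)) (aug_ideal (A i)) = J i"
    "poincare_series (scl (A i)) (gr (A i)) = 1 + J i"
proof -
  interpret Ai: chopf "A i" by (rule chi[OF i])
  note fb = Ai.finite_type_basis[OF fin[OF i]]
  have Bn: "{b \<in> Bp i. hdeg (A i) b = n} = (if n = 0 then {} else hbasis (A i) n)" for n
  proof -
    have "{b \<in> Bp i. hdeg (A i) b = n} = hbasis (A i) n - {unit (A i)}"
      unfolding Ai.hbases_deg[symmetric] using i by (auto simp: Bp_def)
    moreover have "n = 0" if "unit (A i) \<in> hbasis (A i) n" using Ai.hdeg[OF that] Ai.hdeg_unit by simp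
    ultimately show ?thesis using Ai.hbasis_0 by auto
  qed
  have aug: "aug_ideal (A i) n = (if n = 0 then {0} else gr (A i) n)" for n
  proof (cases "n = 0")
    case True
    have "counit (A i) (scl (A i) c (unit (A i))) = c" for c
      using linear_on_scale[OF Ai.counit_lin Ai.unit_C] Ai.counit_unit by simp
    moreover have "counit (A i) 0 = 0"
      by (rule linear_on_zero[OF Ai.counit_lin Ai.vs vector_space_times Ai.subspace_0[OF Ai.sub_C]])
    ultimately show ?thesis using True by (auto simp: aug_ideal_def Ai.gr0 intro: image_eqI[where x = 0])
  next
    case False
    then show ?thesis using Ai.counit_pos by (auto simp: aug_ideal_def)
  qed
  have d0: "Ai.dim {0} = 0" using Ai.dim_span_eq_card_independent[OF Ai.independent_empty] by (simp add: Ai.span_empty)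
  show "poincare_series (scl (A i)) (aug_ideal (A i)) = J i"
    by (rule fps_ext) (simp add: poincare_series_def J_def gfs_def Bn aug d0 fb)
  show "poincare_series (scl (A i)) (gr (A i)) = 1 + J i"
    by (rule fps_ext) (simp add: poincare_series_def J_def gfs_def Bn fb Ai.hbasis_0)
qed

lemma T_letter:
  assumes "t \<in> T" "(i, b) \<in> set t" shows "i \<in> {1..m}" "b \<in> Bp i" "0 < hdeg (A i) b"
proof -
  show b: "b \<in> Bp i" by (rule tset_letters[OF assms(1)[unfolded T_def] assms(2)])
  then show i: "i \<in> {1..m}" by (simp add: Bp_def split: if_splits)
  show "0 < hdeg (A i) b" using b i chopf.hdeg_zero_iff[OF chi[OF i], of b] by (auto simp: Bp_def)
qed

lemma T_fin: "finite {t \<in> T. tdeg t = n}"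
proof -
  let ?\<Lambda> = "SIGMA i:{1..m}. (\<Union>d\<le>n. {b \<in> Bp i. hdeg (A i) b = d})"
  have "finite ?\<Lambda>" using Bp_fin by (intro finite_SigmaI finite_UN_I) auto
  moreover have "{t \<in> T. tdeg t = n} \<subseteq> {t. set t \<subseteq> ?\<Lambda> \<and> length t \<le> n}"
  proof safe
    fix t assume t: "t \<in> T" and n: "n = tdeg t"
    have "length w \<le> tdeg w" if "\<And>i b. (i, b) \<in> set w \<Longrightarrow> 0 < hdeg (A i) b" for w
      using that
    proof (induction w)
      case (Cons l w)
      then have "0 < hdeg (A (fst l)) (snd l)" "length w \<le> tdeg w" by auto
      then show ?case by (simp add: tdeg_def)
    qed simp
    then show "length t \<le> tdeg t" using T_letter(3)[OF t] by blast
    fix i b assume ib: "(i, b) \<in> set t"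
    show "i \<in> {1..m}" "b \<in> (\<Union>d\<le>tdeg t. {b \<in> Bp i. hdeg (A i) b = d})"
    proof -
      show "i \<in> {1..m}" by (rule T_letter(1)[OF t ib])
      have "hdeg (A (fst l)) (snd l) \<le> tdeg t" if "l \<in> set t" for l
        unfolding tdeg_def by (rule member_le_sum_list) (use that in auto)
      from this[OF ib] show "b \<in> (\<Union>d\<le>tdeg t. {b \<in> Bp i. hdeg (A i) b = d})" using T_letter(2)[OF t ib] by auto
    qed
  qed
  ultimately show ?thesis by (rule finite_subset[OF _ finite_lists_length_le, rotated])
qed

lemma finite_type_M: "finite_type fscale ngr" "fs.dim (ngr n) = card {t \<in> T. tdeg t = n}"
proof -
  show "finite_type fscale ngr" unfolding finite_type_def ngr_def
  proof
    fix n show "\<exists>B. finite B \<and> fs.span (e ` {t \<in> T. tdeg t = n}) \<subseteq> fs.span B"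
      by (intro exI[of _ "e ` {t \<in> T. tdeg t = n}"] conjI finite_imageI T_fin order_refl)
  qed
  show "fs.dim (ngr n) = card {t \<in> T. tdeg t = n}"
    unfolding ngr_def using fs.dim_span_eq_card_independent[OF independent_e] card_image[OF inj_on_subset[OF e_inj subset_UNIV]] by simp
qed

lemma poincare_M: "poincare_series fscale ngr = gfs T tdeg"
  by (rule fps_ext) (simp add: poincare_series_def gfs_def finite_type_M)

definition Tsub where "Tsub \<sigma> = {t \<in> T. \<sigma> \<subseteq> tinit t}"

lemma Tsub_fin: "finite {t \<in> {t \<in> T. Q t}. tdeg t = n}"
  by (rule finite_subset[OF _ T_fin[of n]]) auto

text \<open>A trace that can start with \<open>\<sigma>\<close> and with \<open>i\<close> arises uniquely by putting a letter with index \<open>i\<close> in front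
  of a trace that can start with \<open>\<sigma>\<close> but not with \<open>i\<close>. If \<open>X\<close> counts the former and \<open>R\<close> the latter, then
  \<open>X = J i * R\<close>, while \<open>X + R\<close> counts all traces that can start with \<open>\<sigma>\<close>.\<close>

lemma gfs_Tsub_insert:
  assumes K: "insert i \<sigma> \<in> K" and i: "i \<notin> \<sigma>"
  shows "(1 + J i) * gfs (Tsub (insert i \<sigma>)) tdeg = J i * gfs (Tsub \<sigma>) tdeg"
proof -
  interpret S: gprod_simplex m K A "insert i \<sigma>" by (rule simplexI[OF K])
  have im: "i \<in> {1..m}" using S.\<sigma>_m by blast
  let ?R = "{t \<in> T. \<sigma> \<subseteq> tinit t \<and> i \<notin> tinit t}"
  have c: "comm i j" if "j \<in> \<sigma>" for j using S.\<sigma>_comm[of i j] that i by blast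
  have "bij_betw (\<lambda>(b, t). tcons (i, b) t) (Bp i \<times> ?R) (Tsub (insert i \<sigma>))"
    unfolding bij_betw_def
  proof
    show "inj_on (\<lambda>(b, t). tcons (i, b) t) (Bp i \<times> ?R)"
    proof (rule inj_onI, clarify)
      fix b t c s assume "t \<in> T" "s \<in> T" "tcons (i, b) t = tcons (i, c) s"
      then show "b = c \<and> t = s" using tcons_inject[OF T_trep T_trep] by blast
    qed
    show "(\<lambda>(b, t). tcons (i, b) t) ` (Bp i \<times> ?R) = Tsub (insert i \<sigma>)"
    proof (intro set_eqI iffI)
      fix t assume "t \<in> (\<lambda>(b, t). tcons (i, b) t) ` (Bp i \<times> ?R)"
      then obtain b r where h: "b \<in> Bp i" "r \<in> T" "\<sigma> \<subseteq> tinit r" "i \<notin> tinit r" "t = tcons (i, b) r" by auto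
      have "t \<in> T" unfolding h(5) T_def by (rule tset.cons[OF h(2)[unfolded T_def] h(4,1)])
      moreover have "insert i \<sigma> \<subseteq> tinit t" unfolding h(5) tinit_tcons using h(3) c by blast
      ultimately show "t \<in> Tsub (insert i \<sigma>)" by (simp add: Tsub_def)
    next
      fix t assume t: "t \<in> Tsub (insert i \<sigma>)"
      then obtain b r where h: "b \<in> Bp i" "r \<in> T" "i \<notin> tinit r" "t = tcons (i, b) r"
        using tset_split[of t Bp i] unfolding Tsub_def T_def by blast
      have "\<sigma> \<subseteq> tinit (tcons (i, b) r)" using t unfolding h(4) Tsub_def by simp
      then have s: "\<sigma> \<subseteq> tinit r" unfolding tinit_tcons using i by blast
      show "t \<in> (\<lambda>(b, t). tcons (i, b) t) ` (Bp i \<times> ?R)"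
        by (rule image_eqI[of _ _ "(b, r)"]) (simp add: h(4), use h(1-3) s in simp)
    qed
  qed
  from gfs_bij[OF this, of tdeg "\<lambda>(b, t). hdeg (A i) b + tdeg t"]
  have "gfs (Bp i \<times> ?R) (\<lambda>(b, t). hdeg (A i) b + tdeg t) = gfs (Tsub (insert i \<sigma>)) tdeg"
    by (auto simp: tdeg_def sum_tcons)
  moreover have "gfs (Bp i \<times> ?R) (\<lambda>(b, t). hdeg (A i) b + tdeg t) = J i * gfs ?R tdeg"
    unfolding J_def by (rule gfs_times[OF Bp_fin Tsub_fin])
  ultimately have 1: "gfs (Tsub (insert i \<sigma>)) tdeg = J i * gfs ?R tdeg" by simp
  have "Tsub \<sigma> = Tsub (insert i \<sigma>) \<union> ?R" by (auto simp: Tsub_def)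
  moreover have "gfs (Tsub (insert i \<sigma>) \<union> ?R) tdeg = gfs (Tsub (insert i \<sigma>)) tdeg + gfs ?R tdeg"
    by (rule gfs_disjoint[OF Tsub_fin[of "\<lambda>t. insert i \<sigma> \<subseteq> tinit t", folded Tsub_def] Tsub_fin]) (auto simp: Tsub_def)
  ultimately have "gfs (Tsub \<sigma>) tdeg = gfs (Tsub (insert i \<sigma>)) tdeg + gfs ?R tdeg" by simp
  then show ?thesis unfolding 1 by (simp add: algebra_simps)
qed

lemma gfs_Tsub:
  assumes "\<sigma> \<in> K" shows "(\<Prod>i\<in>\<sigma>. 1 + J i) * gfs (Tsub \<sigma>) tdeg = (\<Prod>i\<in>\<sigma>. J i) * gfs T tdeg"
proof -
  interpret S: gprod_simplex m K A \<sigma> by (rule simplexI[OF assms])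
  show ?thesis using S.finite_\<sigma> assms
  proof (induction \<sigma> rule: finite_induct)
    case empty then show ?case by (simp add: Tsub_def)
  next
    case (insert i \<sigma>)
    have \<sigma>: "\<sigma> \<in> K" by (rule K_facts(2)[OF insert.prems]) blast
    have "(\<Prod>i\<in>insert i \<sigma>. 1 + J i) * gfs (Tsub (insert i \<sigma>)) tdeg =
        (\<Prod>i\<in>\<sigma>. 1 + J i) * ((1 + J i) * gfs (Tsub (insert i \<sigma>)) tdeg)"
      using insert.hyps by (simp add: mult_ac)
    also have "\<dots> = J i * ((\<Prod>i\<in>\<sigma>. 1 + J i) * gfs (Tsub \<sigma>) tdeg)"
      unfolding gfs_Tsub_insert[OF insert.prems insert.hyps(2)] by (simp add: mult_ac)
    also have "\<dots> = (\<Prod>i\<in>insert i \<sigma>. J i) * gfs T tdeg"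
      unfolding insert.IH[OF \<sigma>] using insert.hyps by (simp add: mult_ac)
    finally show ?case .
  qed
qed

lemma finite_K: "finite K"
  by (rule finite_subset[of _ "Pow {1..m}"]) (use K_facts(3) in auto)

text \<open>Initial letters commute pairwise, so by flagness their indices span a simplex.\<close>

lemma tinit_K: assumes "t \<in> T" shows "tinit t \<in> K" "finite (tinit t)"
proof -
  have m: "i \<in> {1..m}" if i: "i \<in> tinit t" for i
  proof -
    obtain b where "(i, b) \<in> set t" using tinit_letters[OF i] by auto
    then show ?thesis by (rule T_letter(1)[OF assms])
  qed
  then show "finite (tinit t)" using finite_subset[of "tinit t" "{1..m}"] by blast
  have "{i, j} \<in> K" if "i \<in> tinit t" "j \<in> tinit t" for i j
  proof (cases "i = j")
    case True then show ?thesis using K_facts(1)[OF m[OF that(1)]] by simp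
  next
    case False then show ?thesis using tinit_clique[OF that] by (simp add: comm_def)
  qed
  moreover have "\<forall>\<sigma>. \<sigma> \<subseteq> {1..m} \<and> (\<forall>i\<in>\<sigma>. \<forall>j\<in>\<sigma>. {i, j} \<in> K) \<longrightarrow> \<sigma> \<in> K"
    using flag unfolding flag_complex_def by (rule conjunct2)
  ultimately show "tinit t \<in> K" using m by blast
qed

text \<open>For a fixed trace the sum runs over all subsets of its set of initial indices, a simplex. It vanishes
  unless this set is empty, that is, unless the trace is empty.\<close>

lemma alternating_gfs: "(\<Sum>\<sigma>\<in>K. (-1) ^ card \<sigma> * gfs (Tsub \<sigma>) tdeg) = 1"
proof (rule fps_ext)
  fix n
  let ?T = "{t \<in> T. tdeg t = n}"
  have cnst: "fps_nth ((-1) ^ k * f) n = (-1) ^ k * fps_nth f n" for k and f :: "rat fps"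
    by (cases "even k") auto
  have "fps_nth (\<Sum>\<sigma>\<in>K. (-1) ^ card \<sigma> * gfs (Tsub \<sigma>) tdeg) n = (\<Sum>\<sigma>\<in>K. (-1) ^ card \<sigma> * of_nat (card {t \<in> ?T. \<sigma> \<subseteq> tinit t}))"
    unfolding fps_sum_nth cnst
    by (intro sum.cong refl) (auto simp: gfs_def Tsub_def intro!: arg_cong[where f = card])
  also have "\<dots> = (\<Sum>\<sigma>\<in>K. \<Sum>t\<in>?T. if \<sigma> \<subseteq> tinit t then (-1) ^ card \<sigma> else 0)"
    using T_fin[of n] by (intro sum.cong refl) (simp add: sum.If_cases Int_def mult.commute)
  also have "\<dots> = (\<Sum>t\<in>?T. \<Sum>\<sigma>\<in>K. if \<sigma> \<subseteq> tinit t then (-1) ^ card \<sigma> else 0)" by (rule sum.swap)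
  also have "\<dots> = (\<Sum>t\<in>?T. if t = [] then 1 else 0)"
  proof (rule sum.cong[OF refl])
    fix t assume "t \<in> ?T"
    then have t: "t \<in> T" by simp
    have "{\<sigma> \<in> K. \<sigma> \<subseteq> tinit t} = Pow (tinit t)" using K_facts(2)[OF tinit_K(1)[OF t]] by blast
    then have "(\<Sum>\<sigma>\<in>K. if \<sigma> \<subseteq> tinit t then (-1) ^ card \<sigma> else 0 :: rat) = (\<Sum>\<sigma>\<in>Pow (tinit t). (-1) ^ card \<sigma>)"
      using finite_K by (simp add: sum.inter_filter[symmetric])
    also have "\<dots> = (if tinit t = {} then 1 else 0)" by (rule alternating_sum_subsets[OF tinit_K(2)[OF t]])
    also have "tinit t = {} \<longleftrightarrow> t = []" using tset_tinit_empty[OF t[unfolded T_def]] by auto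
    finally show "(\<Sum>\<sigma>\<in>K. if \<sigma> \<subseteq> tinit t then (-1) ^ card \<sigma> else 0 :: rat) = (if t = [] then 1 else 0)" .
  qed
  also have "\<dots> = fps_nth 1 n" using T_fin[of n] nil_T tdeg_nil by (auto simp: sum.delta')
  finally show "fps_nth (\<Sum>\<sigma>\<in>K. (-1) ^ card \<sigma> * gfs (Tsub \<sigma>) tdeg) n = fps_nth 1 n" .
qed

text \<open>The factors \<open>1 + J i\<close> with \<open>i\<close> outside \<open>\<sigma>\<close> remain after multiplication. Their product is expanded over
  sets \<open>X\<close> of such indices, and \<open>I\<close> is the union of \<open>\<sigma>\<close> and \<open>X\<close>.\<close>

lemma poincare_M_eq:
  "(\<Prod>i\<in>{1..m}. 1 + J i) =
     gfs T tdeg * (\<Sum>I\<in>Pow {1..m}. (\<Sum>\<sigma>\<in>full_subcomplex K I. (-1) ^ card \<sigma>) * (\<Prod>i\<in>I. J i))"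
proof -
  let ?V = "{1..m}"
  let ?P = "\<lambda>S. \<Prod>i\<in>S. 1 + J i" and ?J = "\<lambda>S. \<Prod>i\<in>S. J i"
  have "?P ?V = (\<Sum>\<sigma>\<in>K. (-1) ^ card \<sigma> * (?P ?V * gfs (Tsub \<sigma>) tdeg))"
    using arg_cong[OF alternating_gfs, of "(*) (?P ?V)"] by (simp add: sum_distrib_left mult_ac)
  also have "\<dots> = (\<Sum>\<sigma>\<in>K. gfs T tdeg * ((-1) ^ card \<sigma> * (?P (?V - \<sigma>) * ?J \<sigma>)))"
  proof (rule sum.cong[OF refl])
    fix \<sigma> assume \<sigma>: "\<sigma> \<in> K"
    have "?P ?V = ?P (?V - \<sigma>) * ?P \<sigma>" by (rule prod.subset_diff[OF K_facts(3)[OF \<sigma>]]) simp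
    then have "?P ?V * gfs (Tsub \<sigma>) tdeg = ?P (?V - \<sigma>) * (?J \<sigma> * gfs T tdeg)"
      using gfs_Tsub[OF \<sigma>] by (simp add: mult.assoc)
    then show "(-1) ^ card \<sigma> * (?P ?V * gfs (Tsub \<sigma>) tdeg) = gfs T tdeg * ((-1) ^ card \<sigma> * (?P (?V - \<sigma>) * ?J \<sigma>))"
      by (simp add: mult_ac)
  qed
  also have "\<dots> = gfs T tdeg * (\<Sum>\<sigma>\<in>K. (-1) ^ card \<sigma> * (?P (?V - \<sigma>) * ?J \<sigma>))"
    by (simp add: sum_distrib_left)
  also have "(\<Sum>\<sigma>\<in>K. (-1) ^ card \<sigma> * (?P (?V - \<sigma>) * ?J \<sigma>)) =
      (\<Sum>\<sigma>\<in>K. \<Sum>I\<in>Pow ?V. if \<sigma> \<subseteq> I then (-1) ^ card \<sigma> * ?J I else 0)"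
  proof (rule sum.cong[OF refl])
    fix \<sigma> assume \<sigma>: "\<sigma> \<in> K"
    note s = K_facts(3)[OF \<sigma>]
    have "?P (?V - \<sigma>) = (\<Sum>X\<in>Pow (?V - \<sigma>). ?J X)"
      using prod_add[of "?V - \<sigma>" J "\<lambda>_. 1"] by (simp add: add.commute)
    then have "?P (?V - \<sigma>) * ?J \<sigma> = (\<Sum>X\<in>Pow (?V - \<sigma>). ?J X * ?J \<sigma>)" by (simp add: sum_distrib_right)
    also have "\<dots> = (\<Sum>I\<in>{I \<in> Pow ?V. \<sigma> \<subseteq> I}. ?J I)"
    proof (rule sum.reindex_bij_witness[where i = "\<lambda>I. I - \<sigma>" and j = "\<lambda>X. X \<union> \<sigma>"])
      fix X assume X: "X \<in> Pow (?V - \<sigma>)"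
      then have "finite X" "finite \<sigma>" "X \<inter> \<sigma> = {}" using s finite_subset[of _ ?V] by auto
      then show "?J (X \<union> \<sigma>) = ?J X * ?J \<sigma>" by (simp add: prod.union_disjoint)
    qed (use s in auto)
    finally have "(-1) ^ card \<sigma> * (?P (?V - \<sigma>) * ?J \<sigma>) = (\<Sum>I\<in>{I \<in> Pow ?V. \<sigma> \<subseteq> I}. (-1) ^ card \<sigma> * ?J I)"
      by (simp add: sum_distrib_left)
    also have "\<dots> = (\<Sum>I\<in>Pow ?V. if \<sigma> \<subseteq> I then (-1) ^ card \<sigma> * ?J I else 0)"
      by (rule sum.inter_filter) simp
    finally show "(-1) ^ card \<sigma> * (?P (?V - \<sigma>) * ?J \<sigma>) = (\<Sum>I\<in>Pow ?V. if \<sigma> \<subseteq> I then (-1) ^ card \<sigma> * ?J I else 0)" .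
  qed
  also have "\<dots> = (\<Sum>I\<in>Pow ?V. \<Sum>\<sigma>\<in>K. if \<sigma> \<subseteq> I then (-1) ^ card \<sigma> * ?J I else 0)" by (rule sum.swap)
  also have "\<dots> = (\<Sum>I\<in>Pow ?V. (\<Sum>\<sigma>\<in>full_subcomplex K I. (-1) ^ card \<sigma>) * ?J I)"
    using finite_K by (intro sum.cong refl) (simp add: full_subcomplex_def sum.inter_filter[symmetric] sum_distrib_right)
  finally show ?thesis .
qed

end

section \<open>The projection onto the tensor product of all factors\<close>

lemma poincare_iso:
  assumes f: "\<And>n. linear_on s1 s2 (V n) f" "\<And>n. inj_on f (V n)" "\<And>n. f ` V n = W n"
    and s: "vector_space s1" "vector_space s2" and V: "\<And>n. module.subspace s1 (V n)"
    and fin: "finite_type s1 V"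
  shows "poincare_series s2 W = poincare_series s1 V" "finite_type s2 W"
proof -
  interpret a: vector_space s1 by fact
  interpret b: vector_space s2 by fact
  have *: "b.dim (W n) = a.dim (V n) \<and> (\<exists>B. finite B \<and> W n \<subseteq> b.span B)" for n
  proof -
    obtain B where "finite B" "V n \<subseteq> a.span B" using fin unfolding finite_type_def by meson
    from a.finite_basis[OF this V] obtain C where C: "finite C" "C \<subseteq> V n" "a.independent C" "V n = a.span C" "card C = a.dim (V n)"
      by metis
    have W: "W n = b.span (f ` C)"
      using linear_on_from_span_image[of s1 s2 C f] f(1,3)[of n] s unfolding C(4) by simp
    have "b.dim (W n) = card C"
    proof (rule b.dim_family[OF C(1), where v = f])
      show "f ` C \<subseteq> W n" "W n \<subseteq> b.span (f ` C)" unfolding W using b.span_superset by auto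
      fix u assume z: "(\<Sum>x\<in>C. s2 (u x) (f x)) = 0"
      have m: "(\<Sum>x\<in>C. s1 (u x) x) \<in> V n" by (rule a.subspace_sum[OF V a.subspace_scale[OF V]]) (use C(2) in blast)
      have "f (\<Sum>x\<in>C. s1 (u x) x) = (\<Sum>x\<in>C. s2 (u x) (f x))" by (rule linear_on_sum[OF V s f(1) C(1,2)])
      also have "\<dots> = f 0" unfolding z by (rule linear_on_zero[OF f(1) s a.subspace_0[OF V], symmetric])
      finally have "(\<Sum>x\<in>C. s1 (u x) x) = 0" using inj_onD[OF f(2) _ m a.subspace_0[OF V]] by blast
      then show "\<forall>x\<in>C. u x = 0" using a.independentD[OF C(3) C(1) order_refl] by blast
    qed
    then show ?thesis using C(1,5) W by auto
  qed
  show "poincare_series s2 W = poincare_series s1 V" by (simp add: poincare_series_def *)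
  show "finite_type s2 W" using * by (simp add: finite_type_def)
qed

lemma hom_gproj:
  assumes H: "graded_algebra H" and E: "graded_algebra E" and q: "alg_hom H E q" and h: "h \<in> hcarrier H"
  shows "gproj H n h \<in> gr H n" "q (gproj H n h) = gproj E n (q h)"
proof -
  interpret galg2 H E by unfold_locales (rule H E)+
  have g: "gproj H n h \<in> gr H n" if "h \<in> hcarrier H" for h
    by (rule A.C_image[OF A.gproj_lin A.vs A.sub_gr _ that]) (auto simp: A.gproj_gr A.subspace_0[OF A.sub_gr])
  then show "gproj H n h \<in> gr H n" using h .
  show "q (gproj H n h) = gproj E n (q h)"
  proof (rule A.C_eqI[OF _ _ B.vs _ h])
    show "linear_on (scl H) (scl E) (hcarrier H) (\<lambda>h. q (gproj H n h))"
      by (rule linear_on_comp[OF A.gproj_lin alg_homD(1)[OF q]]) (use g A.gr_C in blast)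
    show "linear_on (scl H) (scl E) (hcarrier H) (\<lambda>h. gproj E n (q h))"
      by (rule linear_on_comp[OF alg_homD(1)[OF q] B.gproj_lin]) (use alg_hom_C[OF q] in blast)
    fix k a assume a: "a \<in> gr H k"
    show "q (gproj H n a) = gproj E n (q a)"
      unfolding A.gproj_gr[OF a] B.gproj_gr[OF alg_homD(2)[OF q a]]
      using linear_on_zero[OF alg_homD(1)[OF q] A.vs B.vs A.subspace_0[OF A.sub_C]] by simp
  qed
qed

lemma flag_simplex: "flag_complex m (Pow {1..m})"
  by (auto simp: flag_complex_def simplicial_complex_def)

text \<open>Tensor products of injective maps are injective, so the equation that defines the cotensor product may
  be tested after applying \<open>f\<close>.\<close>

lemma cotensor_factor:
  assumes H: "connected_hopf H" and p: "linear_on (scl H) (scl D) (hcarrier H) p" "p ` hcarrier H \<subseteq> DC"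
    and D: "vector_space (scl D)" "vector_space (scl E)" "module.subspace (scl D) DC"
    and f: "linear_on (scl D) (scl E) DC f" "inj_on f DC" and u: "unit D \<in> DC" "f (unit D) = unit E"
  shows "cotensor H D p = cotensor H E (\<lambda>x. f (p x))"
proof -
  interpret H: chopf H by unfold_locales (rule H)
  note vs = H.vs
  let ?P = "tensor_map (scl H) (scl H) (scl H) (scl D) (hcarrier H) (hcarrier H) id p"
  let ?Q = "tensor_map (scl H) (scl H) (scl H) (scl E) (hcarrier H) (hcarrier H) id (\<lambda>x. f (p x))"
  let ?F = "tensor_map (scl H) (scl D) (scl H) (scl E) (hcarrier H) DC id f"
  have id: "(id :: 'b \<Rightarrow> 'b) ` hcarrier H \<subseteq> hcarrier H" by simp
  have FP: "?F (?P t) = ?Q t" if t: "t \<in> tcar H H" for t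
    using tensor_map_comp[OF vs vs vs D(1) vs D(2) H.sub_C H.sub_C H.sub_C D(3) linear_on_ident(2) id p(1) p(2) linear_on_ident(2) f(1) t]
    by (simp add: id_def)
  have P: "?P t \<in> tspan (scl H) (scl D) (hcarrier H) DC" if t: "t \<in> tcar H H" for t
    by (rule tensor_map_into[OF vs vs vs D(1) H.sub_C H.sub_C linear_on_ident(2) id p t])
  have inj: "inj_on ?F (tspan (scl H) (scl D) (hcarrier H) DC)"
    by (rule tensor_map_inj[OF vs D(1) vs D(2) H.sub_C D(3) linear_on_ident(2) inj_on_id f])
  have "?P (comult H a) = ten H D a (unit D) \<longleftrightarrow> ?Q (comult H a) = ten H E a (unit E)" if a: "a \<in> hcarrier H" for a
  proof -
    note t = H.comult_tcar[OF a]
    have F1: "?F (ten H D a (unit D)) = ten H E a (unit E)"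
      using tensor_map_linear(2)[OF vs D(1) vs D(2) H.sub_C D(3) linear_on_ident(2) f(1) a u(1)] by (simp add: ten_def u(2))
    have m: "ten H D a (unit D) \<in> tspan (scl H) (scl D) (hcarrier H) DC" unfolding ten_def by (rule tspan_base[OF a u(1)])
    show ?thesis using inj_on_eq_iff[OF inj P[OF t] m] unfolding FP[OF t] F1 by simp
  qed
  then show ?thesis unfolding cotensor_def by blast
qed

text \<open>The tensor product of all factors is compared with the graph product over the full simplex. The
  composite of \<open>p\<close> with this comparison is onto because the graph product is generated by the factors, and
  the counting formula for the full simplex computes the series of the target.\<close>

theorem poincare_polyhedral:
  fixes A :: "nat \<Rightarrow> ('k::field, 'a::ab_group_add) hopf"
  assumes G: "gprod_fin m K A" and AK: "is_polyhedral_product K A AK \<phi>"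
    and p: "is_induced_projection m K A AK \<phi> p"
  shows "finite_type (scl AK) (gr AK)"
    "finite_type (scl AK) (cotensor_gr AK (hopf_tensor A {1..m}) p)"
    "poincare_series (scl AK) (gr AK) = gfs (gprod.T m K A) (gprod.tdeg A)"
    "poincare_series (scl AK) (gr AK) =
      poincare_series (scl AK) (cotensor_gr AK (hopf_tensor A {1..m}) p) * (\<Prod>i\<in>{1..m}. poincare_series (scl (A i)) (gr (A i)))"
proof -
  interpret G: gprod_fin m K A by (rule G)
  interpret D: gprod_fin m "Pow {1..m}" A by unfold_locales (rule flag_simplex G.hopf G.fin; assumption)+
  have fI: "{1..m} \<in> Pow {1..m}" by simp
  interpret S: gprod_simplex m "Pow {1..m}" A "{1..m}" by unfold_locales (rule fI)
  have H: "connected_hopf AK" using AK by (simp add: is_polyhedral_product_def)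
  interpret H: chopf AK by unfold_locales (rule H)
  interpret E: chopf D.M by unfold_locales (rule D.connected_hopf_M)
  obtain u v where uv: "hopf_hom AK G.M u" "hopf_hom G.M AK v" "\<And>h. h \<in> hcarrier AK \<Longrightarrow> v (u h) = h"
    "\<And>x. x \<in> G.N \<Longrightarrow> u (v x) = x" "\<And>i a. i \<in> {1..m} \<Longrightarrow> a \<in> hcarrier (A i) \<Longrightarrow> v (G.iota i a) = \<phi> {i} (G.vtx i a)"
    by (rule G.polyhedral_product_iso[OF AK]) blast
  note v' = hopf_homD[OF uv(2), unfolded G.M_simps G.hcarrier_M]
  note u' = hopf_homD[OF uv(1), unfolded G.M_simps G.hcarrier_M]
  have vim: "v ` G.ngr n = gr AK n" for n
  proof
    show "v ` G.ngr n \<subseteq> gr AK n" using v'(2) by blast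
    show "gr AK n \<subseteq> v ` G.ngr n" using uv(3)[OF H.gr_C] u'(2) by force
  qed
  have vinj: "inj_on v (G.ngr n)" for n
    by (rule inj_on_inverseI[where g = u]) (use uv(4) G.ngr_N in blast)
  note iso = poincare_iso[OF linear_on_subset[OF v'(1) G.ngr_N] vinj vim vector_space_fscale H.vs G.subspace_ngr G.finite_type_M(1)]
  show fin: "finite_type (scl AK) (gr AK)" by (rule iso(2))
  show PM: "poincare_series (scl AK) (gr AK) = gfs G.T G.tdeg" unfolding iso(1) by (rule G.poincare_M)
  have p1: "hopf_hom AK (hopf_tensor A {1..m}) p"
    and p2: "\<And>\<sigma> x. \<sigma> \<in> K \<Longrightarrow> x \<in> hcarrier (hopf_tensor A \<sigma>) \<Longrightarrow> p (\<phi> \<sigma> x) = hopf_incl A \<sigma> {1..m} x"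
    using p unfolding is_induced_projection_def by blast+
  define q where "q x = S.psi (p x)" for x
  have vD: "vector_space (scl (hopf_tensor A {1..m}))" "vector_space (scl D.M)"
    unfolding S.D_simps D.M_simps by (rule vector_space_fscale)+
  have q: "hopf_hom AK D.M q" unfolding q_def
    by (rule hopf_hom_comp[OF p1 S.hopf_hom_psi H.vs vD H.comult_tcar])
  note q' = hopf_homD[OF q, unfolded D.M_simps D.hcarrier_M]
  have qalg: "alg_hom AK D.M q" by (rule hopf_hom_alg_hom[OF q])
  have qC: "q h \<in> D.N" if "h \<in> hcarrier AK" for h
    using hopf_hom_C[OF q H.vs vD(2) that] by (simp only: D.hcarrier_M)
  have subW: "module.subspace fscale (q ` hcarrier AK)"
    by (rule linear_on_image_subspace[OF q'(1) H.vs vector_space_fscale H.sub_C])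
  have onto: "D.N \<subseteq> q ` hcarrier AK"
  proof (rule D.N_gen_subset[OF subW])
    show "D.e [] \<in> q ` hcarrier AK" unfolding q'(3)[symmetric] by (rule imageI[OF H.unit_C])
    fix i b x assume i: "i \<in> {1..m}" and b: "b \<in> hcarrier (A i)" and x: "x \<in> D.N" "x \<in> q ` hcarrier AK"
    obtain h where h: "h \<in> hcarrier AK" "x = q h" using x(2) by blast
    interpret V: gprod_simplex m K A "{i}" by (rule G.simplexI[OF G.K_facts(1)[OF i]])
    interpret VD: gprod_simplex m "Pow {1..m}" A "{i}" by (rule D.simplexI[OF D.K_facts(1)[OF i]])
    have vt: "G.vtx i b \<in> hcarrier (hopf_tensor A {i})" unfolding V.D_simps by (rule G.vtx_DC[OF i b])
    have vt': "D.vtx i b \<in> VD.DC" by (rule D.vtx_DC[OF i b])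
    have io: "G.iota i b \<in> hcarrier G.M" unfolding G.hcarrier_M by (rule G.iota_N[OF i b])
    have fC: "v (G.iota i b) \<in> hcarrier AK"
      by (rule hopf_hom_C[OF uv(2) _ H.vs io]) (simp add: G.M_simps vector_space_fscale)
    have "q (v (G.iota i b)) = S.psi (hopf_incl A {i} {1..m} (G.vtx i b))"
      unfolding q_def uv(5)[OF i b] p2[OF G.K_facts(1)[OF i] vt] ..
    also have "S.psi (hopf_incl A {i} {1..m} (D.vtx i b)) = VD.psi (D.vtx i b)"
      by (rule D.psi_incl[OF D.K_facts(1)[OF i] fI _ vt']) (use i in simp)
    also have "\<dots> = D.iota i b" by (rule D.vtx_psi[OF i b])
    finally have "D.iota i b = q (v (G.iota i b))" by simp
    then have "D.L i b x = q (mult AK (v (G.iota i b)) h)"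
      using D.iota_mult[OF i b x(1)] unfolding h(2) q'(4)[OF fC h(1)] by simp
    then show "D.L i b x \<in> q ` hcarrier AK" using H.mult_C[OF fC h(1)] by blast
  qed
  have surj: "gr D.M n \<subseteq> q ` gr AK n" for n
  proof
    fix x assume x: "x \<in> gr D.M n"
    then have "x \<in> D.N" unfolding D.M_simps using D.ngr_N by blast
    then obtain h where h: "h \<in> hcarrier AK" "x = q h" using onto by blast
    have "q (gproj AK n h) = gproj D.M n x" unfolding h(2) by (rule hom_gproj(2)[OF H.ga E.ga qalg h(1)])
    also have "\<dots> = x" using E.gproj_gr[OF x, of n] by simp
    finally show "x \<in> q ` gr AK n" using hom_gproj(1)[OF H.ga E.ga qalg h(1), of n] by force
  qed
  interpret Q: hopf_surj AK D.M q
    by unfold_locales (rule q surj fin D.finite_type_M(1)[folded D.M_simps] | (unfold D.M_simps, rule D.finite_type_M(1)))+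
  have pC: "p ` hcarrier AK \<subseteq> S.DC"
    using hopf_hom_C[OF p1 H.vs vD(1)] unfolding S.D_simps by blast
  have "cotensor AK (hopf_tensor A {1..m}) p = cotensor AK D.M q"
    unfolding q_def
    by (rule cotensor_factor[OF H hopf_homD(1)[OF p1] pC vD])
      (simp_all only: S.D_simps D.M_simps S.sub_DC S.psi_lin S.psi_inj S.psi_unit S.mten_DC S.unit_X)
  then have Z: "cotensor_gr AK (hopf_tensor A {1..m}) p = cotensor_gr AK D.M q"
    by (simp add: cotensor_gr_def fun_eq_iff)
  show "finite_type (scl AK) (cotensor_gr AK (hopf_tensor A {1..m}) p)" unfolding Z by (rule Q.finite_type_Z)
  \<comment> \<open>Full subcomplexes of a simplex are simplices, so only the empty set of indices contributes.\<close>
  have "(\<Sum>\<sigma>\<in>full_subcomplex (Pow {1..m}) I. (-1) ^ card \<sigma>) = (if I = {} then 1 else 0 :: rat fps)" if I: "I \<in> Pow {1..m}" for I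
  proof -
    have "full_subcomplex (Pow {1..m}) I = Pow I" using I by (auto simp: full_subcomplex_def)
    then show ?thesis using alternating_sum_subsets[of I] I finite_subset[of I "{1..m}"] by auto
  qed
  then have "(\<Sum>I\<in>Pow {1..m}. (\<Sum>\<sigma>\<in>full_subcomplex (Pow {1..m}) I. (-1) ^ card \<sigma>) * (\<Prod>i\<in>I. D.J i)) =
      (\<Sum>I\<in>Pow {1..m}. if I = {} then 1 else 0)"
    by (intro sum.cong refl) auto
  then have "(\<Prod>i\<in>{1..m}. 1 + D.J i) = gfs D.T D.tdeg" using D.poincare_M_eq by (simp add: sum.delta)
  then have "poincare_series (scl D.M) (gr D.M) = (\<Prod>i\<in>{1..m}. poincare_series (scl (A i)) (gr (A i)))"
    unfolding D.M_simps D.poincare_M using D.poincare_A(2) by simp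
  then show "poincare_series (scl AK) (gr AK) =
      poincare_series (scl AK) (cotensor_gr AK (hopf_tensor A {1..m}) p) * (\<Prod>i\<in>{1..m}. poincare_series (scl (A i)) (gr (A i)))"
    using Q.poincare_cotensor unfolding Z by simp
qed


section \<open>The Euler characteristic of a simplicial complex\<close>

text \<open>A basis of the kernel is extended to a basis of \<open>V\<close>; the added vectors are mapped to a basis of the
  image.\<close>

lemma rank_nullity:
  assumes s: "vector_space s1" "vector_space s2" and V: "module.subspace s1 V"
    and f: "linear_on s1 s2 V f" and fin: "finite B" "V \<subseteq> module.span s1 B"
  shows "vector_space.dim s1 V = vector_space.dim s1 {x \<in> V. f x = 0} + vector_space.dim s2 (f ` V)"
proof -
  interpret a: vector_space s1 by fact
  interpret b: vector_space s2 by fact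
  let ?K = "{x \<in> V. f x = 0}"
  have "a.subspace {x \<in> V. f x \<in> {0}}"
    by (rule linear_on_into_preimage[OF f s V b.subspace_single_0])
  then have subK: "a.subspace ?K" by simp
  have "?K \<subseteq> a.span B" using fin(2) by blast
  from a.finite_basis[OF fin(1) this subK]
  obtain C where C: "finite C" "C \<subseteq> ?K" "a.independent C" "?K = a.span C" "card C = a.dim ?K" .
  have "C \<subseteq> V" using C(2) by blast
  from a.maximal_independent_subset_extend[OF this C(3)]
  obtain D where D: "C \<subseteq> D" "D \<subseteq> V" "a.independent D" "V \<subseteq> a.span D" .
  have finD: "finite D" using a.independent_span_bound[OF fin(1) D(3)] D(2) fin(2) by blast
  have VD: "V = a.span D" using D(4) a.span_minimal[OF D(2) V] by blast
  have dimV: "a.dim V = card D" by (rule a.dim_unique[OF D(2,4,3) refl])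
  have "b.dim (f ` V) = card (D - C)"
  proof (rule b.dim_family[where v = f])
    show "finite (D - C)" using finD by simp
    show "f ` (D - C) \<subseteq> f ` V" using D(2) by blast
    show "f ` V \<subseteq> b.span (f ` (D - C))"
    proof
      fix y assume "y \<in> f ` V"
      then obtain x where x: "x \<in> V" "y = f x" by blast
      show "y \<in> b.span (f ` (D - C))"
        unfolding x(2)
      proof (rule linear_on_image_span[OF f[unfolded VD] s _ b.subspace_span x(1)[unfolded VD]])
        fix d assume "d \<in> D"
        then show "f d \<in> b.span (f ` (D - C))"
        proof (cases "d \<in> C")
          case True
          then have "f d = 0" using C(2) by blast
          then show ?thesis using b.span_zero by simp
        next
          case False
          show ?thesis by (rule b.span_base, rule imageI) (use False \<open>d \<in> D\<close> in simp)
        qed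
      qed
    qed
    fix u assume z: "(\<Sum>x\<in>D - C. s2 (u x) (f x)) = 0"
    have sub: "D - C \<subseteq> V" using D(2) by blast
    have m: "(\<Sum>x\<in>D - C. s1 (u x) x) \<in> V"
      by (rule a.subspace_sum[OF V a.subspace_scale[OF V]]) (use sub in blast)
    have "f (\<Sum>x\<in>D - C. s1 (u x) x) = (\<Sum>x\<in>D - C. s2 (u x) (f x))"
      by (rule linear_on_sum[OF V s f _ sub]) (use finD in simp)
    then have "(\<Sum>x\<in>D - C. s1 (u x) x) \<in> a.span C" using z m unfolding C(4)[symmetric] by simp
    then obtain w where w: "(\<Sum>x\<in>D - C. s1 (u x) x) = (\<Sum>x\<in>C. s1 (w x) x)"
      unfolding a.span_finite[OF C(1)] by blast
    let ?v = "\<lambda>x. if x \<in> C then - w x else u x"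
    have "(\<Sum>x\<in>D. s1 (?v x) x) = (\<Sum>x\<in>D - C. s1 (?v x) x) + (\<Sum>x\<in>C. s1 (?v x) x)"
      by (rule sum.subset_diff[OF D(1) finD])
    also have "\<dots> = (\<Sum>x\<in>D - C. s1 (u x) x) - (\<Sum>x\<in>C. s1 (w x) x)"
      by (simp add: sum_negf)
    finally have "(\<Sum>x\<in>D. s1 (?v x) x) = 0" using w by simp
    from a.independentD[OF D(3) finD order_refl this] show "\<forall>x\<in>D - C. u x = 0" by fastforce
  qed
  then show ?thesis
    unfolding dimV C(5)[symmetric] using card_Diff_subset[OF C(1) D(1)] card_mono[OF finD D(1)] by simp
qed

text \<open>The pairs with \<open>i < j\<close> cancel those with \<open>j < i\<close>. No division by \<open>2\<close> is involved, as the result is needed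
  in every characteristic.\<close>

lemma antisymmetric_sum:
  fixes F :: "nat \<Rightarrow> nat \<Rightarrow> 'r::ab_group_add"
  assumes S: "finite S" and F: "\<And>i j. i \<in> S \<Longrightarrow> j \<in> S \<Longrightarrow> i < j \<Longrightarrow> F i j = - F j i"
  shows "(\<Sum>i\<in>S. \<Sum>j\<in>S - {i}. F i j) = 0"
proof -
  have "(\<Sum>j\<in>S - {i}. F i j) = (\<Sum>j\<in>S. if i < j then F i j else 0) + (\<Sum>j\<in>S. if j < i then F i j else 0)"
    if i: "i \<in> S" for i
  proof -
    have "(\<Sum>j\<in>S. if i < j then F i j else 0) + (\<Sum>j\<in>S. if j < i then F i j else 0) = (\<Sum>j\<in>S. if j = i then 0 else F i j)"
      unfolding sum.distrib[symmetric] by (rule sum.cong) auto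
    also have "\<dots> = (\<Sum>j\<in>S - {i}. if j = i then 0 else F i j)"
      using sum.remove[OF S i, of "\<lambda>j. if j = i then 0 else F i j"] by simp
    also have "\<dots> = (\<Sum>j\<in>S - {i}. F i j)" by (rule sum.cong) auto
    finally show ?thesis ..
  qed
  then have "(\<Sum>i\<in>S. \<Sum>j\<in>S - {i}. F i j) =
      (\<Sum>i\<in>S. \<Sum>j\<in>S. if i < j then F i j else 0) + (\<Sum>i\<in>S. \<Sum>j\<in>S. if j < i then F i j else 0)"
    by (simp add: sum.distrib)
  also have "(\<Sum>i\<in>S. \<Sum>j\<in>S. if j < i then F i j else 0) = (\<Sum>j\<in>S. \<Sum>i\<in>S. if j < i then F i j else 0)"
    by (rule sum.swap)
  also have "\<dots> = (\<Sum>j\<in>S. \<Sum>i\<in>S. - (if j < i then F j i else 0))"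
    by (intro sum.cong refl) (use F in auto)
  finally show ?thesis by (simp add: sum_negf)
qed

locale finite_complex =
  fixes L :: "nat set set"
  assumes finL: "finite L" and finite_simplex: "\<And>\<sigma>. \<sigma> \<in> L \<Longrightarrow> finite \<sigma>"
    and down: "\<And>\<sigma> \<tau>. \<sigma> \<in> L \<Longrightarrow> \<tau> \<subseteq> \<sigma> \<Longrightarrow> \<tau> \<in> L" and vertex: "\<exists>i. {i} \<in> L"
begin

lemma empty_L: "{} \<in> L" using vertex down by blast

definition sgn_face :: "nat set \<Rightarrow> nat \<Rightarrow> 'k::field" where
  "sgn_face \<sigma> i = (-1) ^ card {j \<in> \<sigma>. j < i}"

lemma boundary_pairing:
  "(\<Sum>\<tau>\<in>L. g \<tau> * boundary L c \<tau>) = (\<Sum>\<sigma>\<in>L. \<Sum>i\<in>\<sigma>. g (\<sigma> - {i}) * (sgn_face \<sigma> i * c \<sigma>))"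
proof -
  have "(\<Sum>\<tau>\<in>L. g \<tau> * boundary L c \<tau>) =
      (\<Sum>\<tau>\<in>L. \<Sum>\<sigma>\<in>L. \<Sum>i\<in>\<sigma>. if \<sigma> - {i} = \<tau> then g \<tau> * (sgn_face \<sigma> i * c \<sigma>) else 0)"
    unfolding boundary_def sum_distrib_left sgn_face_def by (intro sum.cong refl) simp
  also have "\<dots> = (\<Sum>\<sigma>\<in>L. \<Sum>\<tau>\<in>L. \<Sum>i\<in>\<sigma>. if \<sigma> - {i} = \<tau> then g \<tau> * (sgn_face \<sigma> i * c \<sigma>) else 0)"
    by (rule sum.swap)
  also have "\<dots> = (\<Sum>\<sigma>\<in>L. \<Sum>i\<in>\<sigma>. \<Sum>\<tau>\<in>L. if \<sigma> - {i} = \<tau> then g \<tau> * (sgn_face \<sigma> i * c \<sigma>) else 0)"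
    by (intro sum.cong refl sum.swap)
  also have "\<dots> = (\<Sum>\<sigma>\<in>L. \<Sum>i\<in>\<sigma>. g (\<sigma> - {i}) * (sgn_face \<sigma> i * c \<sigma>))"
  proof (intro sum.cong refl)
    fix \<sigma> i assume "\<sigma> \<in> L" "i \<in> \<sigma>"
    then have "\<sigma> - {i} \<in> L" using down by blast
    then show "(\<Sum>\<tau>\<in>L. if \<sigma> - {i} = \<tau> then g \<tau> * (sgn_face \<sigma> i * c \<sigma>) else 0) = g (\<sigma> - {i}) * (sgn_face \<sigma> i * c \<sigma>)"
      using finL by (simp add: sum.delta')
  qed
  finally show ?thesis .
qed

lemma sgn_face_swap:
  assumes "finite \<sigma>" "i \<in> \<sigma>" "i < j"
  shows "sgn_face (\<sigma> - {i}) j * sgn_face \<sigma> i = - (sgn_face (\<sigma> - {j}) i * sgn_face \<sigma> j :: 'k::field)"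
proof -
  have "{k \<in> \<sigma>. k < j} = insert i {k \<in> \<sigma> - {i}. k < j}" using assms by auto
  then have "card {k \<in> \<sigma>. k < j} = Suc (card {k \<in> \<sigma> - {i}. k < j})" using assms by simp
  moreover have "{k \<in> \<sigma> - {j}. k < i} = {k \<in> \<sigma>. k < i}" using assms by auto
  ultimately show ?thesis by (simp add: sgn_face_def)
qed

text \<open>Removing two vertices in the two possible orders gives opposite signs.\<close>

lemma boundary_boundary: "boundary L (boundary L c) = 0"
proof
  fix \<rho>
  let ?g = "\<lambda>\<tau>. \<Sum>j\<in>\<tau>. if \<tau> - {j} = \<rho> then sgn_face \<tau> j else 0"
  have "boundary L (boundary L c) \<rho> = (\<Sum>\<tau>\<in>L. ?g \<tau> * boundary L c \<tau>)"
    unfolding boundary_def[of L "boundary L c"] sum_distrib_right sgn_face_def by (intro sum.cong refl) simp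
  also have "\<dots> = (\<Sum>\<sigma>\<in>L. 0)"
    unfolding boundary_pairing
  proof (rule sum.cong[OF refl])
    fix \<sigma> assume \<sigma>: "\<sigma> \<in> L"
    let ?F = "\<lambda>i j. if \<sigma> - {i} - {j} = \<rho> then sgn_face (\<sigma> - {i}) j * sgn_face \<sigma> i * c \<sigma> else 0"
    have "(\<Sum>i\<in>\<sigma>. ?g (\<sigma> - {i}) * (sgn_face \<sigma> i * c \<sigma>)) = (\<Sum>i\<in>\<sigma>. \<Sum>j\<in>\<sigma> - {i}. ?F i j)"
      unfolding sum_distrib_right by (intro sum.cong refl) simp
    also have "\<dots> = 0"
    proof (rule antisymmetric_sum[OF finite_simplex[OF \<sigma>]])
      fix i j assume ij: "i \<in> \<sigma>" "j \<in> \<sigma>" "i < j"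
      have "\<sigma> - {i} - {j} = \<sigma> - {j} - {i}" by blast
      then show "?F i j = - ?F j i"
        unfolding sgn_face_swap[OF finite_simplex[OF \<sigma>] ij(1,3)] by simp
    qed
    finally show "(\<Sum>i\<in>\<sigma>. ?g (\<sigma> - {i}) * (sgn_face \<sigma> i * c \<sigma>)) = 0" .
  qed
  finally show "boundary L (boundary L c) \<rho> = 0 \<rho>" by simp
qed

lemma boundary_linear: "linear_on fscale fscale S (boundary L)"
  by (auto simp: linear_on_def boundary_def fscale_def fun_eq_iff sum.distrib[symmetric] sum_distrib_left
    algebra_simps intro!: sum.cong)

text \<open>Chains indexed by the number of vertices, so that the augmentation is included.\<close>

definition ch :: "nat \<Rightarrow> (nat set \<Rightarrow> 'k::field) set" where
  "ch n = {c. \<forall>\<sigma>. c \<sigma> \<noteq> 0 \<longrightarrow> \<sigma> \<in> L \<and> card \<sigma> = n}"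

lemma chains_ch: "chains L q = ch (q + 1)" by (simp add: chains_def ch_def)

lemma subspace_ch: "fs.subspace (ch n)"
  unfolding fs.subspace_def
proof (intro conjI ballI allI)
  fix x y :: "nat set \<Rightarrow> 'k::field" and c assume x: "x \<in> ch n" and y: "y \<in> ch n"
  have "\<sigma> \<in> L \<and> card \<sigma> = n" if "(x + y) \<sigma> \<noteq> 0" for \<sigma>
  proof -
    have "x \<sigma> \<noteq> 0 \<or> y \<sigma> \<noteq> 0" using that by auto
    then show ?thesis using x y unfolding ch_def by blast
  qed
  then show "x + y \<in> ch n" unfolding ch_def by blast
  have "\<sigma> \<in> L \<and> card \<sigma> = n" if "fscale c x \<sigma> \<noteq> 0" for \<sigma>
  proof -
    have "x \<sigma> \<noteq> 0" using that by (auto simp: fscale_def)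
    then show ?thesis using x unfolding ch_def by blast
  qed
  then show "fscale c x \<in> ch n" unfolding ch_def by blast
qed (simp add: ch_def)

definition simp_vec :: "nat set \<Rightarrow> nat set \<Rightarrow> 'k::field" where
  "simp_vec \<sigma> = (\<lambda>\<tau>. if \<tau> = \<sigma> then 1 else 0)"

lemma sum_simp_vec: "finite S \<Longrightarrow> (\<Sum>\<sigma>\<in>S. fscale (u \<sigma>) (simp_vec \<sigma>)) \<tau> = (if \<tau> \<in> S then u \<tau> else 0)"
  by (induction S rule: finite_induct) (auto simp: fscale_def simp_vec_def)

lemma ch_span: "ch n \<subseteq> fs.span (simp_vec ` {\<sigma> \<in> L. card \<sigma> = n})"
proof
  fix c :: "nat set \<Rightarrow> 'k::field" assume c: "c \<in> ch n"
  have "c = (\<Sum>\<sigma>\<in>{\<sigma> \<in> L. card \<sigma> = n}. fscale (c \<sigma>) (simp_vec \<sigma>))"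
    by (rule ext, subst sum_simp_vec) (use finL c in \<open>auto simp: ch_def\<close>)
  also have "\<dots> \<in> fs.span (simp_vec ` {\<sigma> \<in> L. card \<sigma> = n})"
    by (intro fs.span_sum fs.span_scale fs.span_base) blast
  finally show "c \<in> fs.span (simp_vec ` {\<sigma> \<in> L. card \<sigma> = n})" .
qed

lemma dim_ch: "fs.dim (ch n :: (nat set \<Rightarrow> 'k::field) set) = card {\<sigma> \<in> L. card \<sigma> = n}"
proof (rule fs.dim_family[OF _ _ ch_span])
  show fin: "finite {\<sigma> \<in> L. card \<sigma> = n}" using finL by simp
  show "simp_vec ` {\<sigma> \<in> L. card \<sigma> = n} \<subseteq> ch n" by (auto simp: ch_def simp_vec_def split: if_splits)
  fix u :: "nat set \<Rightarrow> 'k" assume z: "(\<Sum>\<sigma>\<in>{\<sigma> \<in> L. card \<sigma> = n}. fscale (u \<sigma>) (simp_vec \<sigma>)) = 0"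
  show "\<forall>\<sigma>\<in>{\<sigma> \<in> L. card \<sigma> = n}. u \<sigma> = 0"
  proof
    fix \<sigma> assume "\<sigma> \<in> {\<sigma> \<in> L. card \<sigma> = n}"
    then show "u \<sigma> = 0" using sum_simp_vec[OF fin, of u \<sigma>] unfolding z by simp
  qed
qed

lemma boundary_ch: "c \<in> ch (Suc n) \<Longrightarrow> boundary L c \<in> ch n"
proof -
  assume c: "c \<in> ch (Suc n)"
  have "\<tau> \<in> L \<and> card \<tau> = n" if t: "boundary L c \<tau> \<noteq> 0" for \<tau>
  proof (rule ccontr)
    assume no: "\<not> (\<tau> \<in> L \<and> card \<tau> = n)"
    have "boundary L c \<tau> = 0"
      unfolding boundary_def
    proof (intro sum.neutral ballI)
      fix \<sigma> i assume \<sigma>: "\<sigma> \<in> L" "i \<in> \<sigma>"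
      show "(if \<sigma> - {i} = \<tau> then (-1) ^ card {j \<in> \<sigma>. j < i} * c \<sigma> else 0) = 0"
      proof (cases "c \<sigma> = 0")
        case False
        then have "card \<sigma> = Suc n" using c by (simp add: ch_def)
        then have "card (\<sigma> - {i}) = n" using \<sigma> finite_simplex by simp
        moreover have "\<sigma> - {i} \<in> L" using \<sigma> down by blast
        ultimately show ?thesis using no by auto
      qed simp
    qed
    then show False using t by simp
  qed
  then show ?thesis unfolding ch_def by blast
qed

lemma boundary_ch_1: "boundary L ` ch 1 = ch 0"
proof
  show "boundary L ` ch 1 \<subseteq> ch 0" using boundary_ch[of _ 0] by auto
  show "ch 0 \<subseteq> boundary L ` ch 1"
  proof
    fix c assume c: "c \<in> ch 0"
    obtain i where i: "{i} \<in> L" using vertex by blast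
    let ?d = "\<lambda>\<sigma>. if \<sigma> = {i} then c {} else 0"
    have "boundary L ?d \<tau> = c \<tau>" for \<tau>
    proof -
      have "boundary L ?d \<tau> = (\<Sum>\<sigma>\<in>L. if \<sigma> = {i} then (if {} = \<tau> then c {} else 0) else 0)"
        unfolding boundary_def
      proof (rule sum.cong[OF refl])
        fix \<sigma>
        have e: "{j. j = i \<and> j < i} = {}" by auto
        show "(\<Sum>l\<in>\<sigma>. if \<sigma> - {l} = \<tau> then (-1) ^ card {j \<in> \<sigma>. j < l} * ?d \<sigma> else 0) =
            (if \<sigma> = {i} then (if {} = \<tau> then c {} else 0) else 0)"
          by (cases "\<sigma> = {i}") (simp_all add: e cong: if_cong)
      qed
      also have "\<dots> = (if {} = \<tau> then c {} else 0)" using i finL by (simp add: sum.delta)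
      also have "\<dots> = c \<tau>" using c finite_simplex by (auto simp: ch_def)
      finally show ?thesis .
    qed
    then have "c = boundary L ?d" by (simp add: fun_eq_iff)
    moreover have "?d \<in> ch 1" using i by (simp add: ch_def)
    ultimately show "c \<in> boundary L ` ch 1" by blast
  qed
qed

context
  fixes k :: "'k::field itself"
begin

definition cyc :: "nat \<Rightarrow> nat" where "cyc n = fs.dim {c \<in> ch n :: (nat set \<Rightarrow> 'k) set. boundary L c = 0}"
definition bnd :: "nat \<Rightarrow> nat" where "bnd n = fs.dim (boundary L ` (ch n :: (nat set \<Rightarrow> 'k) set))"

lemma card_cyc_bnd: "card {\<sigma> \<in> L. card \<sigma> = n} = cyc n + bnd n"
  unfolding dim_ch[symmetric, where 'k = 'k] cyc_def bnd_def
  by (rule rank_nullity[OF vector_space_fscale vector_space_fscale subspace_ch boundary_linear _ ch_span])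
    (use finL in simp)

text \<open>As there is a vertex, the augmentation is onto, so the complex is exact at the empty simplex.\<close>

lemma bnd_1: "bnd 1 = 1"
proof -
  have "{\<sigma> \<in> L. card \<sigma> = 0} = {{}}" using empty_L finite_simplex by auto
  then show ?thesis unfolding bnd_def boundary_ch_1 dim_ch by simp
qed

lemma homology_dim: "cyc (q + 1) = bnd (q + 2) + reduced_homology_dim k L q"
proof -
  let ?Z = "{c \<in> ch (q + 1) :: (nat set \<Rightarrow> 'k) set. boundary L c = 0}"
  let ?B = "boundary L ` (ch (q + 2) :: (nat set \<Rightarrow> 'k) set)"
  let ?Q = "quot_class fscale ?B"
  have subB: "fs.subspace ?B"
    by (rule linear_on_image_subspace[OF boundary_linear vector_space_fscale vector_space_fscale subspace_ch])
  have BZ: "?B \<subseteq> ?Z" using boundary_boundary boundary_ch[of _ "q + 1"] by auto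
  have lin: "linear_on fscale fscale ?Z ?Q"
    unfolding linear_on_def
    by (intro conjI ballI allI vs_linear_add[OF quot_class_linear[OF vector_space_fscale]]
      vs_linear_scale[OF quot_class_linear[OF vector_space_fscale]])
  have "fs.subspace {c \<in> ch (q + 1) :: (nat set \<Rightarrow> 'k) set. boundary L c \<in> {0}}"
    by (rule linear_on_into_preimage[OF boundary_linear vector_space_fscale vector_space_fscale subspace_ch fs.subspace_single_0])
  then have subZ: "fs.subspace ?Z" by simp
  have "?Q c = 0 \<longleftrightarrow> c \<in> ?B" for c
    using quot_class_eq_iff[OF vector_space_fscale subB, of c 0]
    unfolding vs_linear_0[OF quot_class_linear[OF vector_space_fscale, of ?B]] diff_0_right .
  then have ker: "{c \<in> ?Z. ?Q c = 0} = ?B" using BZ by blast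
  have "fs.dim ?Z = fs.dim {c \<in> ?Z. ?Q c = 0} + fs.dim (?Q ` ?Z)"
    by (rule rank_nullity[OF vector_space_fscale vector_space_fscale subZ lin, of "simp_vec ` {\<sigma> \<in> L. card \<sigma> = q + 1}"])
      (use finL ch_span in auto)
  then show ?thesis
    unfolding ker cyc_def bnd_def reduced_homology_dim_def reduced_homology_def chains_ch by (simp add: add.assoc)
qed

lemma reduced_homology_zero:
  assumes "\<And>\<sigma>. \<sigma> \<in> L \<Longrightarrow> card \<sigma> \<noteq> q + 1" shows "reduced_homology_dim k L q = 0"
proof -
  have e: "{\<sigma> \<in> L. card \<sigma> = q + 1} = {}" using assms by blast
  show ?thesis using card_cyc_bnd[of "q + 1"] homology_dim[of q] unfolding e by simp
qed

text \<open>Chains decompose into cycles and boundaries. In the alternating sum the dimensions of the boundaries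
  cancel, except for the augmentation at one end, which accounts for the empty simplex.\<close>

theorem euler_characteristic:
  assumes N: "\<And>\<sigma>. \<sigma> \<in> L \<Longrightarrow> card \<sigma> \<le> N"
  shows "(\<Sum>q<N. (-1) ^ (q + 1) * of_nat (reduced_homology_dim k L q)) = (\<Sum>\<sigma>\<in>L. (-1) ^ card \<sigma> :: 'r::comm_ring_1)"
proof -
  let ?c = "\<lambda>n. of_nat (card {\<sigma> \<in> L. card \<sigma> = n}) :: 'r"
  have "(\<Sum>q<M. (-1) ^ (q + 1) * of_nat (reduced_homology_dim k L q)) =
      1 + (\<Sum>q<M. (-1) ^ (q + 1) * ?c (q + 1)) - (-1) ^ M * of_nat (bnd (M + 1))" for M
  proof (induction M)
    case 0 then show ?case using bnd_1 by simp
  next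
    case (Suc M)
    have "?c (M + 1) = of_nat (bnd (M + 2)) + of_nat (reduced_homology_dim k L M) + of_nat (bnd (M + 1))"
      unfolding card_cyc_bnd homology_dim by simp
    with Suc show ?case by (simp add: algebra_simps)
  qed
  moreover have "bnd (N + 1) = 0"
  proof -
    have e: "{\<sigma> \<in> L. card \<sigma> = N + 1} = {}" using N by fastforce
    show ?thesis using card_cyc_bnd[of "N + 1"] unfolding e by simp
  qed
  moreover have "(\<Sum>\<sigma>\<in>L. (-1) ^ card \<sigma>) = (\<Sum>n\<le>N. (-1) ^ n * ?c n)"
  proof -
    have "(\<Sum>\<sigma>\<in>L. (-1) ^ card \<sigma> :: 'r) = (\<Sum>n\<le>N. \<Sum>\<sigma>\<in>{\<sigma> \<in> L. card \<sigma> = n}. (-1) ^ card \<sigma>)"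
      by (rule sum.group[symmetric]) (use finL N in auto)
    then show ?thesis by (simp add: mult.commute)
  qed
  moreover have "{\<sigma> \<in> L. card \<sigma> = 0} = {{}}" using empty_L finite_simplex by auto
  then have "(\<Sum>n\<le>N. (-1) ^ n * ?c n) = 1 + (\<Sum>q<N. (-1) ^ (q + 1) * ?c (q + 1))"
    by (simp add: lessThan_Suc_atMost[symmetric] sum.lessThan_Suc_shift del: sum.lessThan_Suc)
  ultimately show ?thesis by simp
qed

end

end

section \<open>The Euler--Poincare series\<close>

theorem corollary5p11:
  fixes m :: nat
    and K :: "nat set set"
    and A :: "nat \<Rightarrow> ('k::field, 'a::ab_group_add) hopf"
    and AK :: "('k, ('k, 'a) word_space) hopf"
    and \<phi> :: "nat set \<Rightarrow> ('k, 'a) mtensor \<Rightarrow> ('k, 'a) word_space"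
    and p :: "('k, 'a) word_space \<Rightarrow> ('k, 'a) mtensor"
    and A' :: "nat \<Rightarrow> ('k, 'a) word_space set"
  assumes flag: "flag_complex m K"
    and hopf: "\<And>i. i \<in> {1..m} \<Longrightarrow> connected_hopf (A i)"
    and fin: "\<And>i. i \<in> {1..m} \<Longrightarrow> finite_type (scl (A i)) (gr (A i))"
    and AK: "is_polyhedral_product K A AK \<phi>"
    and p: "is_induced_projection m K A AK \<phi> p"
    and A': "A' = cotensor_gr AK (hopf_tensor A {1..m}) p"
  shows "finite_type (scl AK) A' \<and> finite_type (scl AK) (gr AK) \<and>
    1 / poincare_series (scl AK) A' =
      1 + (\<Sum>I | I \<subseteq> {1..m} \<and> I \<noteq> {}. \<Sum>n.
             (-1) ^ (n + 1) * of_nat (reduced_homology_dim TYPE('k) (full_subcomplex K I) n) *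
             (\<Prod>i\<in>I. poincare_series (scl (A i)) (aug_ideal (A i)))) \<and>
    poincare_series (scl AK) (gr AK) =
      poincare_series (scl AK) A' * (\<Prod>i\<in>{1..m}. poincare_series (scl (A i)) (gr (A i)))"
proof -
  interpret G: gprod_fin m K A by unfold_locales (rule flag hopf fin; assumption)+
  note main = poincare_polyhedral[OF G.gprod_fin_axioms AK p, folded A']
  let ?P = "\<lambda>i. poincare_series (scl (A i)) (gr (A i))"
  let ?J = "\<lambda>I. \<Prod>i\<in>I. poincare_series (scl (A i)) (aug_ideal (A i))"
  let ?\<chi> = "\<lambda>I. \<Sum>\<sigma>\<in>full_subcomplex K I. (-1) ^ card \<sigma> :: rat fps"
  define R where "R = (\<Sum>I\<in>Pow {1..m}. ?\<chi> I * ?J I)"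
  have J: "?J I = (\<Prod>i\<in>I. G.J i)" if "I \<subseteq> {1..m}" for I
    by (rule prod.cong[OF refl]) (use G.poincare_A(1) that in blast)
  have R: "R = (\<Sum>I\<in>Pow {1..m}. ?\<chi> I * (\<Prod>i\<in>I. G.J i))"
    unfolding R_def by (rule sum.cong[OF refl]) (simp only: Pow_iff J)
  have PP: "(\<Prod>i\<in>{1..m}. ?P i) = (\<Prod>i\<in>{1..m}. 1 + G.J i)"
    by (rule prod.cong[OF refl]) (rule G.poincare_A(2))
  \<comment> \<open>The series of the factors have constant term 1, so their product can be cancelled.\<close>
  have c0: "fps_nth (1 + G.J i) 0 = 1" for i
  proof -
    have e: "{b \<in> G.Bp i. hdeg (A i) b = 0} = {}"
      using chopf.hdeg_zero_iff[OF G.chi[of i]] by (auto simp: G.Bp_def)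
    show ?thesis by (simp add: G.J_def gfs_def e)
  qed
  have c1: "fps_nth (\<Prod>i\<in>S. 1 + G.J i) 0 = 1" if "finite S" for S
    using that
  proof (induction S rule: finite_induct)
    case (insert i S)
    then show ?case by (simp only: prod.insert[OF insert.hyps] fps_mult_nth_0 c0 mult_1)
  qed simp
  have "fps_nth (\<Prod>i\<in>{1..m}. ?P i) 0 = 1" unfolding PP by (rule c1) simp
  then have nz: "(\<Prod>i\<in>{1..m}. ?P i) \<noteq> 0" by (metis fps_zero_nth zero_neq_one)
  have "(\<Prod>i\<in>{1..m}. ?P i) = (\<Prod>i\<in>{1..m}. ?P i) * (poincare_series (scl AK) A' * R)"
    using G.poincare_M_eq unfolding R[symmetric] PP[symmetric] main(3)[symmetric] main(4) by (simp only: mult_ac)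
  then have PR: "poincare_series (scl AK) A' * R = 1"
    unfolding mult_cancel_left1[of "\<Prod>i\<in>{1..m}. ?P i"] using nz by blast
  have "fps_nth (poincare_series (scl AK) A') 0 * fps_nth R 0 = 1" using arg_cong[OF PR, of "\<lambda>f. fps_nth f 0"] by simp
  then have n0: "fps_nth (poincare_series (scl AK) A') 0 \<noteq> 0" by auto
  have inv: "1 / poincare_series (scl AK) A' = R"
  proof -
    have nz': "poincare_series (scl AK) A' \<noteq> 0" using PR by auto
    have "1 / poincare_series (scl AK) A' = (R * poincare_series (scl AK) A') / poincare_series (scl AK) A'"
      using PR by (simp add: mult.commute)
    also have "\<dots> = R" by (rule nonzero_mult_div_cancel_right[OF nz'])
    finally show ?thesis .
  qed
  have hom: "(\<Sum>n. (-1) ^ (n + 1) * of_nat (reduced_homology_dim TYPE('k) (full_subcomplex K I) n) * ?J I) = ?\<chi> I * ?J I"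
    if I: "I \<subseteq> {1..m}" "I \<noteq> {}" for I
  proof -
    let ?L = "full_subcomplex K I"
    have sub: "?L \<subseteq> Pow {1..m}" using G.K_facts(3) by (auto simp: full_subcomplex_def)
    interpret L: finite_complex ?L
    proof
      show "finite ?L" by (rule finite_subset[OF sub]) simp
      show "finite \<sigma>" if "\<sigma> \<in> ?L" for \<sigma> using sub that finite_subset[of \<sigma> "{1..m}"] by blast
      show "\<tau> \<in> ?L" if "\<sigma> \<in> ?L" "\<tau> \<subseteq> \<sigma>" for \<sigma> \<tau>
        using that G.K_facts(2)[of \<sigma> \<tau>] by (auto simp: full_subcomplex_def)
      obtain i where "i \<in> I" using I by blast
      then have "{i} \<in> ?L" using G.K_facts(1)[of i] I by (auto simp: full_subcomplex_def)
      then show "\<exists>i. {i} \<in> ?L" ..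
    qed
    have N: "card \<sigma> \<le> m" if "\<sigma> \<in> ?L" for \<sigma> using card_mono[of "{1..m}" \<sigma>] sub that by auto
    have "(\<Sum>n. (-1) ^ (n + 1) * of_nat (reduced_homology_dim TYPE('k) ?L n) * ?J I) =
        (\<Sum>n<m. (-1) ^ (n + 1) * of_nat (reduced_homology_dim TYPE('k) ?L n) * ?J I)"
    proof (rule suminf_finite)
      fix n assume "n \<notin> {..<m}"
      then have "reduced_homology_dim TYPE('k) ?L n = 0" by (intro L.reduced_homology_zero) (use N in fastforce)
      then show "(-1) ^ (n + 1) * of_nat (reduced_homology_dim TYPE('k) ?L n) * ?J I = 0" by simp
    qed simp
    also have "\<dots> = ?\<chi> I * ?J I"
      unfolding sum_distrib_right[symmetric] by (rule arg_cong[where f = "\<lambda>x. x * ?J I", OF L.euler_characteristic, OF N])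
    finally show ?thesis .
  qed
  have "{} \<in> K" using flag unfolding flag_complex_def simplicial_complex_def by (elim conjE)
  then have e: "full_subcomplex K {} = {{}}" unfolding full_subcomplex_def subset_empty by blast
  have "R = ?\<chi> {} * ?J {} + (\<Sum>I\<in>Pow {1..m} - {{}}. ?\<chi> I * ?J I)"
    unfolding R_def by (rule sum.remove) auto
  also note e
  also have "Pow {1..m} - {{}} = {I. I \<subseteq> {1..m} \<and> I \<noteq> {}}" by blast
  also have "(\<Sum>I | I \<subseteq> {1..m} \<and> I \<noteq> {}. ?\<chi> I * ?J I) =
      (\<Sum>I | I \<subseteq> {1..m} \<and> I \<noteq> {}. \<Sum>n. (-1) ^ (n + 1) *
        of_nat (reduced_homology_dim TYPE('k) (full_subcomplex K I) n) * ?J I)"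
    by (rule sum.cong[OF refl], rule hom[symmetric]) blast+
  finally have "R = 1 + (\<Sum>I | I \<subseteq> {1..m} \<and> I \<noteq> {}. \<Sum>n. (-1) ^ (n + 1) *
        of_nat (reduced_homology_dim TYPE('k) (full_subcomplex K I) n) * ?J I)"
    by (simp only: sum.insert finite.emptyI empty_iff not_False_eq_True sum.empty prod.empty card.empty
      power_0 add_0_right mult_1)
  from trans[OF inv this] show ?thesis by (intro conjI main(2,1,4))
qed

end
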